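(* Let $(t_0,p_0)\in[0,T)\times\Delta(I)$ and let $\bar{\mathbf P}\in\mathbf M(t_0,p_0)$ be optimal, i.e. $\mathbf E_{\bar{\mathbf P}}[\int_{t_0}^TH(s,\mathbf p(s))ds]=\inf_{\mathbf P\in\mathbf M(t_0,p_0)}\mathbf E_{\mathbf P}[\int_{t_0}^TH(s,\mathbf p(s))ds]$ (this infimum equals $\mathbf V(t_0,p_0)$). Then $$(s,\mathbf p(s))\in\mathcal H\qquad\forall s\in[t_0,T),\quad\bar{\mathbf P}\text{-a.s.},$$ and, for any $s\in(t_0,T]$, there is a measurable selection $\xi$ of $\partial\mathbf V(s,\mathbf p(s^-))$ such that $$\mathbf V(s,\mathbf p(s))-\mathbf V(s,\mathbf p(s^-))-\langle\xi,\mathbf p(s)-\mathbf p(s^-)\rangle=0\qquad\bar{\mathbf P}\text{-a.s.}$$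
   Context: Data. $I\ge 2$ is an integer, $T>0$, $U$ and $V$ are compact subsets of finite-dimensional spaces, and $\ell_i:[0,T]\times U\times V\to\mathbb R$ ($i=1,\dots,I$) are continuous. $\Delta(I)=\{p\in\mathbb R^I: p_i\ge 0,\ \sum_i p_i=1\}$, and $e_1,\dots,e_I$ is the canonical basis of $\mathbb R^I$. Isaacs' condition is assumed: for all $(t,p)\in[0,T]\times\Delta(I)$, $$H(t,p):=\min_{u\in U}\max_{v\in V}\sum_{i=1}^I p_i\ell_i(t,u,v)=\max_{v\in V}\min_{u\in U}\sum_{i=1}^I p_i\ell_i(t,u,v).$$ The game and its value. For $t_0<T$, $\mathcal U(t_0)$ (resp. $\mathcal V(t_0)$) is the set of Lebesgue measurable maps $[t_0,T]\to U$ (resp. $[t_0,T]\to V$), with the $L^1$-distance and its Borel $\sigma$-field. Fix a non-trivial set $\mathcal E$ of probability spaces, stable by product. A random strategy for Player 1 is a pair $((\Omega_\alpha,\mathcal F_\alpha,\mathbf P_\alpha),\alpha)$ with $(\Omega_\alpha,\mathcal F_\alpha,\mathbf P_\alpha)\in\mathcal E$ and $\alpha:\Omega_\alpha\times\mathcal V(t_0)\to\mathcal U(t_0)$ measurable, such that there is a partition $t_0<t_1<\dots<t_k=T$ with: for all $\omega$, all $v_1,v_2$ and all $i\in\{0,\dots,k-1\}$, if $v_1=v_2$ a.e. on $[t_0,t_i]$ then $\alpha(\omega,v_1)=\alpha(\omega,v_2)$ a.e. on $[t_0,t_{i+1}]$. The set of these is $\mathcal A_r(t_0)$. Random strategies $\beta:\Omega_\beta\times\mathcal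 U(t_0)\to\mathcal V(t_0)$ of Player 2 are defined symmetrically; their set is $\mathcal B_r(t_0)$. For $(\alpha,\beta)\in\mathcal A_r(t_0)\times\mathcal B_r(t_0)$ and $\omega=(\omega_1,\omega_2)$ there is a unique pair $(u_\omega,v_\omega)\in\mathcal U(t_0)\times\mathcal V(t_0)$ with $\alpha(\omega_1,v_\omega)=u_\omega$, $\beta(\omega_2,u_\omega)=v_\omega$, depending measurably on $\omega$; one sets $\mathbf E_{\alpha\beta}\big[\int_{t_0}^T\ell_i(s,\alpha(s),\beta(s))ds\big]=\int_{\Omega_\alpha\times\Omega_\beta}\int_{t_0}^T\ell_i(s,u_\omega(s),v_\omega(s))\,ds\,d(\mathbf P_\alpha\otimes\mathbf P_\beta)(\omega)$. The value is $$\mathbf V(t_0,p)=\inf_{(\alpha_i)\in\mathcal A_r(t_0)^I}\sup_{\beta\in\mathcal B_r(t_0)}\sum_{i=1}^I p_i\mathbf E_{\alpha_i\beta}\Big[\int_{t_0}^T\ell_i(s,\alpha_i(s),\beta(s))ds\Big],$$ which is known to equal the corresponding $\sup_\beta\inf_{(\alpha_i)}$ and not to depend on $\mathcal E$; $\mathbf V(T,p)=0$. $\mathbf V$ is known to be Lipschitz continuous on $[0,T]\times\Delta(I)$ and convex in $p$. Martingale measures. $\mathbf D(t_0)$ is the set of càdlàg functions $\mathbb R\to\Delta(I)$ that are constant on $(-\infty,t_0)$ and on $[T,+\infty)$; $t\mapsto\mathbf p(t)$ is the coordinate process and $(\mathcal G_t)$ the filtration it generates. $\mathbf M(t_0,p_0)$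 is the set of probability measures $\mathbf P$ on $\mathbf D(t_0)$ under which $(\mathbf p(t))_{t\in\mathbb R}$ is a martingale and, $\mathbf P$-a.s., $\mathbf p(t)=p_0$ for $t<t_0$ and $\mathbf p(t)\in\{e_1,\dots,e_I\}$ for $t\ge T$. $\mathbf E_{\mathbf P}$ is expectation under $\mathbf P$. Further notation. $\partial\mathbf V(t,p)=\{\hat p\in\mathbb R^I:\mathbf V(t,q)\ge\mathbf V(t,p)+\langle\hat p,q-p\rangle\ \forall q\in\Delta(I)\}$. A measurable selection of $\partial\mathbf V(s,\mathbf p(s^-))$ is a measurable map $\xi:\mathbf D(t_0)\to\mathbb R^I$ with $\xi\in\partial\mathbf V(s,\mathbf p(s^-))$ $\bar{\mathbf P}$-a.s. Finally $$\mathcal H=\Big\{(t,p)\in[0,T)\times\Delta(I):\ \liminf_{h\to0^+,\,p'\to p}\frac{\mathbf V(t+h,p')-\mathbf V(t,p')}{h}=-H(t,p)\Big\}$$ (with $p'\in\Delta(I)$). *)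

theory Defs
  imports "HOL-Probability.Probability"
begin

section \<open>Simplex and Hamiltonian\<close>

definition prob_simplex :: "(real^'i::finite) set" where
  "prob_simplex = {p. (\<forall>i. 0 \<le> p $ i) \<and> (\<Sum>i\<in>UNIV. p $ i) = 1}"

text \<open>For compact nonempty \<open>U\<close>, \<open>V\<close> and continuous \<open>l\<close>, the infima and suprema below are attained,
  so they are the min-max and the max-min of the Isaacs condition.\<close>

definition hamiltonian ::
  "'u set \<Rightarrow> 'v set \<Rightarrow> ('i::finite \<Rightarrow> real \<Rightarrow> 'u \<Rightarrow> 'v \<Rightarrow> real) \<Rightarrow> real \<Rightarrow> real^'i \<Rightarrow> real" where
  "hamiltonian U V l t p = (INF u\<in>U. SUP v\<in>V. \<Sum>i\<in>UNIV. p $ i * l i t u v)"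

definition isaacs ::
  "real \<Rightarrow> 'u set \<Rightarrow> 'v set \<Rightarrow> ('i::finite \<Rightarrow> real \<Rightarrow> 'u \<Rightarrow> 'v \<Rightarrow> real) \<Rightarrow> bool" where
  "isaacs T U V l \<longleftrightarrow> (\<forall>t\<in>{0..T}. \<forall>p\<in>prob_simplex.
     (INF u\<in>U. SUP v\<in>V. \<Sum>i\<in>UNIV. p $ i * l i t u v) =
     (SUP v\<in>V. INF u\<in>U. \<Sum>i\<in>UNIV. p $ i * l i t u v))"

section \<open>Controls\<close>

definition controls :: "real \<Rightarrow> real \<Rightarrow> 'u::euclidean_space set \<Rightarrow> (real \<Rightarrow> 'u) set" where
  "controls t0 T U = {u \<in> borel_measurable (lebesgue_on {t0..T}). u \<in> {t0..T} \<rightarrow>\<^sub>E U}"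

definition L1_dist :: "real \<Rightarrow> real \<Rightarrow> (real \<Rightarrow> 'u::euclidean_space) \<Rightarrow> (real \<Rightarrow> 'u) \<Rightarrow> real" where
  "L1_dist t0 T u w = (LINT s:{t0..T}|lebesgue. norm (u s - w s))"

text \<open>Controls are functions rather than classes modulo a.e. equality, so the L1 distance is only a
  pseudo-distance; its open sets, hence all members of the Borel field, are saturated with respect
  to a.e. equality.\<close>

definition control_space :: "real \<Rightarrow> real \<Rightarrow> 'u::euclidean_space set \<Rightarrow> (real \<Rightarrow> 'u) measure" where
  "control_space t0 T U = sigma (controls t0 T U)
     {G. G \<subseteq> controls t0 T U \<and>
         (\<forall>u\<in>G. \<exists>e>0. \<forall>w\<in>controls t0 T U. L1_dist t0 T u w < e \<longrightarrow> w \<in> G)}"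

section \<open>Random strategies\<close>

definition isomorphic_measures :: "'a measure \<Rightarrow> 'b measure \<Rightarrow> bool" where
  "isomorphic_measures M N \<longleftrightarrow> (\<exists>f g. f \<in> M \<rightarrow>\<^sub>M N \<and> g \<in> N \<rightarrow>\<^sub>M M \<and>
     (\<forall>x\<in>space M. g (f x) = x) \<and> (\<forall>y\<in>space N. f (g y) = y) \<and> distr M N f = N)"

text \<open>The product of two spaces over \<open>'w\<close> lives over \<open>'w \<times> 'w\<close>, so stability by product is
  understood up to isomorphism. Non-triviality asks for one space carrying actual randomness.\<close>

definition randomization_class :: "'w measure set \<Rightarrow> bool" where
  "randomization_class \<E> \<longleftrightarrow>
     (\<forall>M\<in>\<E>. prob_space M) \<and>
     (\<exists>M\<in>\<E>. \<exists>A\<in>sets M. 0 < measure M A \<and> measure M A < 1) \<and>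
     (\<forall>M\<in>\<E>. \<forall>N\<in>\<E>. \<exists>K\<in>\<E>. isomorphic_measures K (M \<Otimes>\<^sub>M N))"

text \<open>Strategies map the opponent's controls (values in \<open>B\<close>) to own controls (values in \<open>A\<close>).\<close>

definition random_strategies ::
  "'w measure set \<Rightarrow> real \<Rightarrow> real \<Rightarrow> 'b::euclidean_space set \<Rightarrow> 'a::euclidean_space set \<Rightarrow>
   ('w measure \<times> ('w \<Rightarrow> (real \<Rightarrow> 'b) \<Rightarrow> (real \<Rightarrow> 'a))) set" where
  "random_strategies \<E> t0 T B A = {(M, \<alpha>). M \<in> \<E> \<and>
     (\<lambda>(\<omega>, b). \<alpha> \<omega> b) \<in> M \<Otimes>\<^sub>M control_space t0 T B \<rightarrow>\<^sub>M control_space t0 T A \<and>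
     (\<exists>(k::nat) \<tau>. \<tau> 0 = t0 \<and> \<tau> k = T \<and> (\<forall>j<k. \<tau> j < \<tau> (Suc j)) \<and>
        (\<forall>\<omega>\<in>space M. \<forall>b1\<in>controls t0 T B. \<forall>b2\<in>controls t0 T B. \<forall>j<k.
           (AE s in lebesgue_on {t0..\<tau> j}. b1 s = b2 s) \<longrightarrow>
           (AE s in lebesgue_on {t0..\<tau> (Suc j)}. \<alpha> \<omega> b1 s = \<alpha> \<omega> b2 s)))}"

text \<open>The pair of controls generated by two non-anticipative maps with delay; it is unique up to
  a.e. equality, which does not affect the integral payoff.\<close>

definition play ::
  "real \<Rightarrow> real \<Rightarrow> 'u::euclidean_space set \<Rightarrow> 'v::euclidean_space set \<Rightarrow>
   ((real \<Rightarrow> 'v) \<Rightarrow> (real \<Rightarrow> 'u)) \<Rightarrow> ((real \<Rightarrow> 'u) \<Rightarrow> (real \<Rightarrow> 'v)) \<Rightarrow> (real \<Rightarrow> 'u) \<times> (real \<Rightarrow> 'v)" where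
  "play t0 T U V a b = (SOME (u, v). u \<in> controls t0 T U \<and> v \<in> controls t0 T V \<and>
     (AE s in lebesgue_on {t0..T}. a v s = u s) \<and> (AE s in lebesgue_on {t0..T}. b u s = v s))"

definition expected_payoff ::
  "real \<Rightarrow> real \<Rightarrow> 'u::euclidean_space set \<Rightarrow> 'v::euclidean_space set \<Rightarrow> (real \<Rightarrow> 'u \<Rightarrow> 'v \<Rightarrow> real) \<Rightarrow>
   'w measure \<times> ('w \<Rightarrow> (real \<Rightarrow> 'v) \<Rightarrow> (real \<Rightarrow> 'u)) \<Rightarrow>
   'w measure \<times> ('w \<Rightarrow> (real \<Rightarrow> 'u) \<Rightarrow> (real \<Rightarrow> 'v)) \<Rightarrow> real" where
  "expected_payoff t0 T U V l \<alpha> \<beta> =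
     (LINT \<omega>|(fst \<alpha> \<Otimes>\<^sub>M fst \<beta>).
        (let (u, v) = play t0 T U V (snd \<alpha> (fst \<omega>)) (snd \<beta> (snd \<omega>))
         in LINT s:{t0..T}|lebesgue. l s (u s) (v s)))"

definition game_value ::
  "'w measure set \<Rightarrow> real \<Rightarrow> 'u::euclidean_space set \<Rightarrow> 'v::euclidean_space set \<Rightarrow>
   ('i::finite \<Rightarrow> real \<Rightarrow> 'u \<Rightarrow> 'v \<Rightarrow> real) \<Rightarrow> real \<Rightarrow> real^'i \<Rightarrow> real" where
  "game_value \<E> T U V l t p =
     (if t < T then
        INF \<alpha>\<in>{\<alpha>. \<forall>i. \<alpha> i \<in> random_strategies \<E> t T V U}.
        SUP \<beta>\<in>random_strategies \<E> t T U V.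
          \<Sum>i\<in>UNIV. p $ i * expected_payoff t T U V (l i) (\<alpha> i) \<beta>
      else 0)"

section \<open>Martingale measures on the path space\<close>

definition cadlag :: "(real \<Rightarrow> 'a::topological_space) \<Rightarrow> bool" where
  "cadlag f \<longleftrightarrow> (\<forall>t. (f \<longlongrightarrow> f t) (at_right t) \<and> (\<exists>l. (f \<longlongrightarrow> l) (at_left t)))"

definition paths :: "real \<Rightarrow> real \<Rightarrow> (real \<Rightarrow> real^'i::finite) set" where
  "paths t0 T = {\<omega>. cadlag \<omega> \<and> range \<omega> \<subseteq> prob_simplex \<and>
     \<omega> constant_on {..<t0} \<and> \<omega> constant_on {T..}}"

definition path_filtration :: "real \<Rightarrow> real \<Rightarrow> real \<Rightarrow> (real \<Rightarrow> real^'i::finite) measure" where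
  "path_filtration t0 T t = sigma (paths t0 T)
     {{\<omega> \<in> paths t0 T. \<omega> s \<in> A} |s A. s \<le> t \<and> A \<in> sets borel}"

definition path_space :: "real \<Rightarrow> real \<Rightarrow> (real \<Rightarrow> real^'i::finite) measure" where
  "path_space t0 T = sigma (paths t0 T)
     {{\<omega> \<in> paths t0 T. \<omega> s \<in> A} |s A. A \<in> sets borel}"

definition vector_martingale ::
  "'a measure \<Rightarrow> (real \<Rightarrow> 'a measure) \<Rightarrow> (real \<Rightarrow> 'a \<Rightarrow> real^'i::finite) \<Rightarrow> bool" where
  "vector_martingale M F X \<longleftrightarrow>
     (\<forall>t. subalgebra M (F t)) \<and> (\<forall>s t. s \<le> t \<longrightarrow> sets (F s) \<subseteq> sets (F t)) \<and>
     (\<forall>t. X t \<in> borel_measurable (F t)) \<and> (\<forall>t. integrable M (X t)) \<and>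
     (\<forall>s t i. s \<le> t \<longrightarrow>
        (AE \<omega> in M. real_cond_exp M (F s) (\<lambda>\<omega>'. X t \<omega>' $ i) \<omega> = X s \<omega> $ i))"

definition martingale_measures ::
  "real \<Rightarrow> real \<Rightarrow> real^'i::finite \<Rightarrow> (real \<Rightarrow> real^'i) measure set" where
  "martingale_measures T t0 p0 = {P. prob_space P \<and> sets P = sets (path_space t0 T) \<and>
     vector_martingale P (path_filtration t0 T) (\<lambda>t \<omega>. \<omega> t) \<and>
     (AE \<omega> in P. \<forall>t<t0. \<omega> t = p0) \<and>
     (AE \<omega> in P. \<forall>t\<ge>T. \<omega> t \<in> range (\<lambda>i. axis i 1))}"

definition martingale_cost ::
  "real \<Rightarrow> 'u set \<Rightarrow> 'v set \<Rightarrow> ('i::finite \<Rightarrow> real \<Rightarrow> 'u \<Rightarrow> 'v \<Rightarrow> real) \<Rightarrow> real \<Rightarrow>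
   (real \<Rightarrow> real^'i) measure \<Rightarrow> real" where
  "martingale_cost T U V l t0 P =
     (LINT \<omega>|P. (LINT s:{t0..T}|lborel. hamiltonian U V l s (\<omega> s)))"

definition optimal_measure ::
  "real \<Rightarrow> 'u set \<Rightarrow> 'v set \<Rightarrow> ('i::finite \<Rightarrow> real \<Rightarrow> 'u \<Rightarrow> 'v \<Rightarrow> real) \<Rightarrow> real \<Rightarrow> real^'i \<Rightarrow>
   (real \<Rightarrow> real^'i) measure \<Rightarrow> bool" where
  "optimal_measure T U V l t0 p0 P \<longleftrightarrow> P \<in> martingale_measures T t0 p0 \<and>
     martingale_cost T U V l t0 P =
       (INF Q\<in>martingale_measures T t0 p0. martingale_cost T U V l t0 Q)"

section \<open>Subdifferential and the set of non-revealing points\<close>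

definition simplex_subdifferential ::
  "(real^'i::finite \<Rightarrow> real) \<Rightarrow> real^'i \<Rightarrow> (real^'i) set" where
  "simplex_subdifferential W p = {x. \<forall>q\<in>prob_simplex. W q \<ge> W p + x \<bullet> (q - p)}"

text \<open>The lower limit is over \<open>h \<rightarrow> 0+\<close> and \<open>p' \<rightarrow> p\<close> jointly with \<open>p'\<close> in the simplex;
  \<open>p' = p\<close> is allowed.\<close>

definition nonrevealing_set ::
  "'w measure set \<Rightarrow> real \<Rightarrow> 'u::euclidean_space set \<Rightarrow> 'v::euclidean_space set \<Rightarrow>
   ('i::finite \<Rightarrow> real \<Rightarrow> 'u \<Rightarrow> 'v \<Rightarrow> real) \<Rightarrow> (real \<times> (real^'i)) set" where
  "nonrevealing_set \<E> T U V l = {(t, p). t \<in> {0..<T} \<and> p \<in> prob_simplex \<and>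
     Liminf (at_right 0 \<times>\<^sub>F inf (nhds p) (principal prob_simplex))
       (\<lambda>(h, p'). ereal ((game_value \<E> T U V l (t + h) p' - game_value \<E> T U V l t p') / h))
     = ereal (- hamiltonian U V l t p)}"

end

theory Submission
  imports Defs
begin

text \<open>The value is the infimum, over martingales \<open>p\<close> that start at the prior and end at a vertex, of
  \<open>\<integral> H(s, p(s)) ds\<close>. For the upper bound, the informed player randomises over finitely many
  open-loop plans whose posteriors follow the nodes of a martingale tree. For the lower bound, the
  uninformed player replies optimally to his current belief; replying with delay costs an amount
  governed by the increments of the energy \<open>\<Sum> p\<^sub>i\<^sup>2\<close>, which telescope along the tree. The same
  comparison gives convexity of the value in \<open>p\<close> and \<open>V(t, p) \<le> V(t', p) + \<integral> H(s, p) ds\<close> over \<open>[t, t']\<close>.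

  Under an optimal measure, \<open>V(s, p(s))\<close> plus the cost accumulated before \<open>s\<close> is therefore a martingale.
  Around a point outside the non-revealing set the value grows in time faster than \<open>- H\<close>. Jensen's
  inequality over a short interval shows that the process is almost surely not there at a given time,
  and right-continuity of the paths and hereditary separability of the Sorgenfrey line extend this to
  all times. Letting \<open>r\<close> increase to \<open>s\<close> gives \<open>E V(s, p(s)) = E V(s, p(s-))\<close>, so that every bounded
  measurable selection of the subdifferential at \<open>p(s-)\<close>, for which the subgradient inequality holds
  pointwise and its linear term has mean zero, turns that inequality into an equality.\<close>

text \<open>All estimates live on finite trees, so that no limit of strategies is ever taken: a tree
  extracted from a near-optimal strategy is at once a plan for the informed player and a martingale
  measure with finitely many paths. Nodes carry unnormalised weights, the joint law of type and
  history. Since \<open>H\<close> is positively homogeneous, costs add up over nodes and null nodes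
  require no conditional law. The obstacle of the lower bound is circular: the belief of the
  uninformed player depends on how the informed player answers his own replies, while his strategy
  may react to observed controls only with delay. Rounding the payoffs of each interval to finitely
  many labels makes histories finite, and the reply rule is then defined by recursion on their
  length. For the upper bound, randomness starts from a single event of probability strictly between
  0 and 1, so the laws of the plan are approximated on products. The times of too fast growth near a
  given point are treated as an arbitrary set of reals, whence the reduction to countably many of
  them.\<close>

definition nonneg :: "real^'i::finite \<Rightarrow> bool" where
  "nonneg p \<longleftrightarrow> (\<forall>i. 0 \<le> p $ i)"

definition mass :: "real^'i::finite \<Rightarrow> real" where
  "mass p = (\<Sum>i\<in>UNIV. p $ i)"

lemma prob_simplex_iff: "p \<in> prob_simplex \<longleftrightarrow> nonneg p \<and> mass p = 1"
  by (simp add: prob_simplex_def nonneg_def mass_def)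

lemma mass_add: "mass (p + q) = mass p + mass q"
  by (simp add: mass_def sum.distrib)

lemma mass_scaleR: "mass (c *\<^sub>R p) = c * mass p"
  by (simp add: mass_def sum_distrib_left)

lemma mass_zero [simp]: "mass 0 = 0"
  by (simp add: mass_def)

lemma mass_sum: "mass (\<Sum>x\<in>A. f x) = (\<Sum>x\<in>A. mass (f x))"
  unfolding mass_def by (simp add: sum.swap[of _ A])

lemma mass_nonneg: "nonneg p \<Longrightarrow> 0 \<le> mass p"
  by (simp add: mass_def nonneg_def sum_nonneg)

lemma mass_eq_0: "nonneg p \<Longrightarrow> mass p = 0 \<longleftrightarrow> p = 0"
  by (auto simp: mass_def nonneg_def sum_nonneg_eq_0_iff vec_eq_iff)

lemma nonneg_le_mass: "nonneg p \<Longrightarrow> p $ i \<le> mass p"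
  unfolding mass_def nonneg_def by (rule member_le_sum) auto

lemma nonneg_add: "nonneg p \<Longrightarrow> nonneg q \<Longrightarrow> nonneg (p + q)"
  by (simp add: nonneg_def)

lemma nonneg_scaleR: "nonneg p \<Longrightarrow> 0 \<le> c \<Longrightarrow> nonneg (c *\<^sub>R p)"
  by (simp add: nonneg_def)

lemma nonneg_zero [simp]: "nonneg 0"
  by (simp add: nonneg_def)

section \<open>Scaling and perturbation of infima and suprema, and a modulus of continuity\<close>

lemma cSUP_mult_left:
  fixes f :: "'a \<Rightarrow> real"
  assumes "A \<noteq> {}" "bdd_above (f ` A)" "0 \<le> c"
  shows "(SUP x\<in>A. c * f x) = c * (SUP x\<in>A. f x)"
  using continuous_at_Sup_mono[of "\<lambda>x. c * x" "f ` A"] assms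
  by (simp add: image_image mono_def mult_left_mono continuous_intros)

lemma cINF_mult_left:
  fixes f :: "'a \<Rightarrow> real"
  assumes "A \<noteq> {}" "bdd_below (f ` A)" "0 \<le> c"
  shows "(INF x\<in>A. c * f x) = c * (INF x\<in>A. f x)"
  using continuous_at_Inf_mono[of "\<lambda>x. c * x" "f ` A"] assms
  by (simp add: image_image mono_def mult_left_mono continuous_intros)

lemma cSUP_diff_le:
  fixes f g :: "'a \<Rightarrow> real"
  assumes "A \<noteq> {}" "bdd_above (g ` A)" "\<And>x. x \<in> A \<Longrightarrow> f x \<le> g x + d"
  shows "(SUP x\<in>A. f x) \<le> (SUP x\<in>A. g x) + d"
  using assms by (intro cSUP_least) (auto intro: order_trans[OF _ add_right_mono] cSUP_upper)

lemma cINF_diff_le: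
  fixes f g :: "'a \<Rightarrow> real"
  assumes "A \<noteq> {}" "bdd_below (f ` A)" "\<And>x. x \<in> A \<Longrightarrow> f x \<le> g x + d"
  shows "(INF x\<in>A. f x) \<le> (INF x\<in>A. g x) + d"
proof -
  have "(INF x\<in>A. f x) - d \<le> (INF x\<in>A. g x)"
  proof (rule cINF_greatest[OF assms(1)])
    fix x assume "x \<in> A"
    then have "(INF x\<in>A. f x) \<le> f x" using assms(2) by (auto intro: cINF_lower)
    with assms(3)[OF \<open>x \<in> A\<close>] show "(INF x\<in>A. f x) - d \<le> g x" by simp
  qed
  then show ?thesis by simp
qed

text \<open>Distances below the \<open>d\<close> of uniform continuity cost at most
  \<open>\<rho>\<close>; larger ones are absorbed by the slope \<open>2 * \<bar>B\<bar> / d\<close>.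
  Unlike an epsilon-delta statement this affine bound can be integrated in time, which yields
  estimates in the L1 distance of controls.\<close>

lemma uniform_modulus:
  fixes f :: "'a::metric_space \<Rightarrow> real"
  assumes "compact K" "continuous_on K f" "0 < \<rho>"
  obtains L where "0 \<le> L" "\<And>x y. x \<in> K \<Longrightarrow> y \<in> K \<Longrightarrow> \<bar>f x - f y\<bar> \<le> \<rho> + L * dist x y"
proof -
  obtain d where d: "0 < d" "\<And>x y. x \<in> K \<Longrightarrow> y \<in> K \<Longrightarrow> dist y x < d \<Longrightarrow> dist (f y) (f x) < \<rho>"
    using compact_uniformly_continuous[OF assms(2,1)] assms(3)
    unfolding uniformly_continuous_on_def by blast
  obtain B where B: "\<And>x. x \<in> K \<Longrightarrow> \<bar>f x\<bar> \<le> B"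
    using compact_imp_bounded[OF compact_continuous_image[OF assms(2,1)]]
    unfolding bounded_iff by auto
  show ?thesis
  proof
    show "0 \<le> 2 * \<bar>B\<bar> / d" using d by simp
    fix x y assume xy: "x \<in> K" "y \<in> K"
    show "\<bar>f x - f y\<bar> \<le> \<rho> + 2 * \<bar>B\<bar> / d * dist x y"
    proof (cases "dist x y < d")
      case True
      then have "\<bar>f x - f y\<bar> < \<rho>" using d(2)[OF xy(2,1)] by (simp add: dist_real_def)
      moreover have "0 \<le> 2 * \<bar>B\<bar> / d * dist x y" using d by simp
      ultimately show ?thesis by linarith
    next
      case False
      then have "2 * \<bar>B\<bar> * 1 \<le> 2 * \<bar>B\<bar> * (dist x y / d)"
        using d by (intro mult_left_mono) auto
      moreover have "\<bar>f x - f y\<bar> \<le> 2 * \<bar>B\<bar>" using B[OF xy(1)] B[OF xy(2)] by linarith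
      ultimately show ?thesis using assms(3) by (simp add: field_simps)
    qed
  qed
qed

section \<open>The Hamiltonian: bounds, continuity, homogeneity and near-optimal actions\<close>

locale game =
  fixes T :: real and U :: "'u::euclidean_space set" and V :: "'v::euclidean_space set"
    and l :: "'i::finite \<Rightarrow> real \<Rightarrow> 'u \<Rightarrow> 'v \<Rightarrow> real"
  assumes T_pos: "0 < T"
    and compact_U: "compact U" and U_ne: "U \<noteq> {}"
    and compact_V: "compact V" and V_ne: "V \<noteq> {}"
    and cont_l: "\<And>i. continuous_on ({0..T} \<times> U \<times> V) (\<lambda>(t, u, v). l i t u v)"
    and isaacs: "isaacs T U V l"
begin

abbreviation H :: "real \<Rightarrow> real^'i \<Rightarrow> real" where
  "H \<equiv> hamiltonian U V l"

definition F :: "real \<Rightarrow> real^'i \<Rightarrow> 'u \<Rightarrow> 'v \<Rightarrow> real" where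
  "F t m u v = (\<Sum>i\<in>UNIV. m $ i * l i t u v)"

lemma H_def: "H t m = (INF u\<in>U. SUP v\<in>V. F t m u v)"
  by (simp add: hamiltonian_def F_def)

lemma bound_ex: "\<exists>C>0. \<forall>i. \<forall>t\<in>{0..T}. \<forall>u\<in>U. \<forall>v\<in>V. \<bar>l i t u v\<bar> \<le> C"
proof -
  have "\<exists>C. \<forall>t\<in>{0..T}. \<forall>u\<in>U. \<forall>v\<in>V. \<bar>l i t u v\<bar> \<le> C" for i
  proof -
    have "bounded ((\<lambda>(t, u, v). l i t u v) ` ({0..T} \<times> U \<times> V))"
      by (intro compact_imp_bounded compact_continuous_image cont_l compact_Times compact_U compact_V) auto
    then obtain C where "\<forall>x\<in>(\<lambda>(t, u, v). l i t u v) ` ({0..T} \<times> U \<times> V). norm x \<le> C"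
      by (auto simp: bounded_iff)
    then show ?thesis by (intro exI[of _ C]) force
  qed
  then obtain c where c: "\<And>i t u v. t \<in> {0..T} \<Longrightarrow> u \<in> U \<Longrightarrow> v \<in> V \<Longrightarrow> \<bar>l i t u v\<bar> \<le> c i"
    by metis
  have "c i \<le> 1 + (\<Sum>i\<in>UNIV. \<bar>c i\<bar>)" for i
    using member_le_sum[of i UNIV "\<lambda>i. \<bar>c i\<bar>"] by simp
  then show ?thesis
    using order_trans[OF c] by (intro exI[of _ "1 + (\<Sum>i\<in>UNIV. \<bar>c i\<bar>)"])
      (auto simp: add_pos_nonneg sum_nonneg)
qed

text \<open>A strictly positive bound is chosen so that \<open>C\<close> may stand in denominators
  of error budgets.\<close>

definition C :: real where
  "C = (SOME C. 0 < C \<and> (\<forall>i. \<forall>t\<in>{0..T}. \<forall>u\<in>U. \<forall>v\<in>V. \<bar>l i t u v\<bar> \<le> C))"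

lemma C_pos: "0 < C"
  and l_bound: "t \<in> {0..T} \<Longrightarrow> u \<in> U \<Longrightarrow> v \<in> V \<Longrightarrow> \<bar>l i t u v\<bar> \<le> C"
proof -
  have "0 < C \<and> (\<forall>i. \<forall>t\<in>{0..T}. \<forall>u\<in>U. \<forall>v\<in>V. \<bar>l i t u v\<bar> \<le> C)"
    unfolding C_def using someI_ex[OF bound_ex] by simp
  then show "0 < C" "t \<in> {0..T} \<Longrightarrow> u \<in> U \<Longrightarrow> v \<in> V \<Longrightarrow> \<bar>l i t u v\<bar> \<le> C" by auto
qed

lemma l_modulus:
  assumes "0 < \<rho>"
  obtains L where "0 \<le> L"
    "\<And>i s s' u u' v v'. s \<in> {0..T} \<Longrightarrow> s' \<in> {0..T} \<Longrightarrow> u \<in> U \<Longrightarrow> u' \<in> U \<Longrightarrow> v \<in> V \<Longrightarrow> v' \<in> V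
      \<Longrightarrow> \<bar>l i s u v - l i s' u' v'\<bar> \<le> \<rho> + L * (\<bar>s - s'\<bar> + norm (u - u') + norm (v - v'))"
proof -
  have "\<exists>L\<ge>0. \<forall>x\<in>{0..T} \<times> U \<times> V. \<forall>y\<in>{0..T} \<times> U \<times> V.
      \<bar>(\<lambda>(t, u, v). l i t u v) x - (\<lambda>(t, u, v). l i t u v) y\<bar> \<le> \<rho> + L * dist x y" for i
    by (rule uniform_modulus[OF _ cont_l assms, of i]) 
      (auto intro!: compact_Times compact_U compact_V)
  then obtain L where L: "\<And>i. 0 \<le> L i" "\<And>i. \<forall>x\<in>{0..T} \<times> U \<times> V. \<forall>y\<in>{0..T} \<times> U \<times> V.
      \<bar>(\<lambda>(t, u, v). l i t u v) x - (\<lambda>(t, u, v). l i t u v) y\<bar> \<le> \<rho> + L i * dist x y"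
    by metis
  have Li: "L i \<le> sum L UNIV" for i
    using L(1) by (intro member_le_sum) auto
  show ?thesis
  proof
    show "0 \<le> sum L UNIV" using L(1) by (simp add: sum_nonneg)
    fix i s s' u u' v v'
    assume a: "s \<in> {0..T}" "s' \<in> {0..T}" "u \<in> U" "u' \<in> U" "v \<in> V" "v' \<in> V"
    have "\<bar>l i s u v - l i s' u' v'\<bar> \<le> \<rho> + L i * dist (s, u, v) (s', u', v')"
      using L(2)[of i, rule_format, of "(s, u, v)" "(s', u', v')"] a by simp
    also have "L i * dist (s, u, v) (s', u', v') \<le> sum L UNIV * (\<bar>s - s'\<bar> + norm (u - u') + norm (v - v'))"
    proof (rule mult_mono[OF Li])
      have "dist (s, u, v) (s', u', v') \<le> dist s s' + dist (u, v) (u', v')"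
        unfolding dist_Pair_Pair[of s] by (rule sqrt_sum_squares_le_sum) auto
      also have "dist (u, v) (u', v') \<le> dist u u' + dist v v'"
        unfolding dist_Pair_Pair by (rule sqrt_sum_squares_le_sum) auto
      finally show "dist (s, u, v) (s', u', v') \<le> \<bar>s - s'\<bar> + norm (u - u') + norm (v - v')"
        by (simp add: dist_norm)
    qed (use L(1) in \<open>auto simp: sum_nonneg\<close>)
    finally show "\<bar>l i s u v - l i s' u' v'\<bar> \<le> \<rho> + sum L UNIV * (\<bar>s - s'\<bar> + norm (u - u') + norm (v - v'))"
      by simp
  qed
qed

text \<open>Each product difference splits as \<open>m (l - l') + (m - m') l'\<close>. The time
  variation is weighed by \<open>m\<close> alone, so the case \<open>m = 0\<close> of this estimate
  already bounds \<open>F\<close> at an arbitrary \<open>m'\<close>.\<close>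

lemma F_diff:
  assumes "nonneg m" "s \<in> {0..T}" "s' \<in> {0..T}" "u \<in> U" "v \<in> V"
    and d: "\<And>i. \<bar>l i s u v - l i s' u v\<bar> \<le> d"
  shows "\<bar>F s m u v - F s' m' u v\<bar> \<le> d * mass m + C * (\<Sum>i\<in>UNIV. \<bar>m $ i - m' $ i\<bar>)"
proof -
  have "F s m u v - F s' m' u v =
      (\<Sum>i\<in>UNIV. m $ i * (l i s u v - l i s' u v) + (m $ i - m' $ i) * l i s' u v)"
    unfolding F_def sum_subtractf[symmetric] by (rule sum.cong) (auto simp: algebra_simps)
  also have "\<bar>\<dots>\<bar> \<le> (\<Sum>i\<in>UNIV. m $ i * d + \<bar>m $ i - m' $ i\<bar> * C)"
  proof (rule sum_abs[THEN order_trans], rule sum_mono, rule abs_triangle_ineq[THEN order_trans], rule add_mono)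
    fix i
    show "\<bar>m $ i * (l i s u v - l i s' u v)\<bar> \<le> m $ i * d"
      using assms(1) d[of i] by (auto simp: nonneg_def abs_mult intro!: mult_left_mono)
    show "\<bar>(m $ i - m' $ i) * l i s' u v\<bar> \<le> \<bar>m $ i - m' $ i\<bar> * C"
      using l_bound[OF assms(3-5)] by (auto simp: abs_mult intro!: mult_left_mono)
  qed
  also have "\<dots> = d * mass m + C * (\<Sum>i\<in>UNIV. \<bar>m $ i - m' $ i\<bar>)"
    by (simp add: sum.distrib mass_def sum_distrib_left mult.commute)
  finally show ?thesis .
qed

lemma F_bound:
  assumes "s \<in> {0..T}" "u \<in> U" "v \<in> V"
  shows "\<bar>F s m u v\<bar> \<le> C * (\<Sum>i\<in>UNIV. \<bar>m $ i\<bar>)"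
  using F_diff[OF nonneg_zero assms(1) assms(1) assms(2,3), of 0 m] by (simp add: F_def)

lemma F_bdd:
  assumes "s \<in> {0..T}"
  shows "u \<in> U \<Longrightarrow> bdd_above (F s m u ` V)" "v \<in> V \<Longrightarrow> bdd_below ((\<lambda>u. F s m u v) ` U)"
    "bdd_below ((\<lambda>u. SUP v\<in>V. F s m u v) ` U)" "bdd_above ((\<lambda>v. INF u\<in>U. F s m u v) ` V)"
proof -
  define B where "B = C * (\<Sum>i\<in>UNIV. \<bar>m $ i\<bar>)"
  have B: "- B \<le> F s m u v" "F s m u v \<le> B" if "u \<in> U" "v \<in> V" for u v
    using F_bound[OF assms that, of m] by (auto simp: B_def)
  obtain u0 v0 where uv0: "u0 \<in> U" "v0 \<in> V" using U_ne V_ne by auto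
  show 1: "bdd_above (F s m u ` V)" if "u \<in> U" for u
    using B that by (intro bdd_aboveI2[where M=B]) auto
  show 2: "bdd_below ((\<lambda>u. F s m u v) ` U)" if "v \<in> V" for v
    using B that by (intro bdd_belowI2[where m="-B"]) auto
  show "bdd_below ((\<lambda>u. SUP v\<in>V. F s m u v) ` U)"
  proof (intro bdd_belowI2[where m="-B"])
    fix u assume "u \<in> U"
    then show "- B \<le> (SUP v\<in>V. F s m u v)"
      using B[of u v0] 1 uv0 by (intro cSUP_upper2[where x=v0]) auto
  qed
  show "bdd_above ((\<lambda>v. INF u\<in>U. F s m u v) ` V)"
  proof (intro bdd_aboveI2[where M=B])
    fix v assume "v \<in> V"
    then show "(INF u\<in>U. F s m u v) \<le> B"
      using B[of u0 v] 2 uv0 by (intro cINF_lower2[where x=u0]) auto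
  qed
qed

lemma H_diff:
  assumes "nonneg m" "s \<in> {0..T}" "s' \<in> {0..T}"
    and d: "\<And>i u v. u \<in> U \<Longrightarrow> v \<in> V \<Longrightarrow> \<bar>l i s u v - l i s' u v\<bar> \<le> d"
  shows "\<bar>H s m - H s' m'\<bar> \<le> d * mass m + C * (\<Sum>i\<in>UNIV. \<bar>m $ i - m' $ i\<bar>)"
proof -
  define D where "D = d * mass m + C * (\<Sum>i\<in>UNIV. \<bar>m $ i - m' $ i\<bar>)"
  have *: "F s m u v \<le> F s' m' u v + D" "F s' m' u v \<le> F s m u v + D" if "u \<in> U" "v \<in> V" for u v
    using F_diff[OF assms(1-3) that d[OF that]] by (auto simp: D_def abs_le_iff algebra_simps)
  have "H s m \<le> H s' m' + D"
    unfolding H_def using F_bdd[OF assms(2)] F_bdd[OF assms(3)] *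
    by (intro cINF_diff_le cSUP_diff_le U_ne V_ne) auto
  moreover have "H s' m' \<le> H s m + D"
    unfolding H_def using F_bdd[OF assms(2)] F_bdd[OF assms(3)] *
    by (intro cINF_diff_le cSUP_diff_le U_ne V_ne) auto
  ultimately show ?thesis by (simp add: D_def)
qed

lemma H_zero: "H s 0 = 0"
  using U_ne V_ne by (simp add: H_def F_def)

lemma H_bound: 
  assumes "s \<in> {0..T}" shows "\<bar>H s m\<bar> \<le> C * (\<Sum>i\<in>UNIV. \<bar>m $ i\<bar>)"
  using H_diff[OF nonneg_zero assms assms, of 0 m] H_zero by simp

lemma H_bound_nonneg: 
  assumes "s \<in> {0..T}" "nonneg m" shows "\<bar>H s m\<bar> \<le> C * mass m"
  using H_bound[OF assms(1), of m] assms(2) by (simp add: mass_def nonneg_def)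

lemma F_scaleR: "F s (c *\<^sub>R m) u v = c * F s m u v"
  by (simp add: F_def sum_distrib_left mult.assoc)

text \<open>Positive homogeneity identifies the mass of a node times \<open>H\<close> at its belief
  with \<open>H\<close> at its weight, so unnormalised trees charge the correct expected
  cost.\<close>

lemma H_scaleR:
  assumes "0 \<le> c" "s \<in> {0..T}" shows "H s (c *\<^sub>R m) = c * H s m"
proof -
  have "H s (c *\<^sub>R m) = (INF u\<in>U. c * (SUP v\<in>V. F s m u v))"
    unfolding H_def F_scaleR using F_bdd(1)[OF assms(2)] assms V_ne
    by (intro INF_cong refl cSUP_mult_left) auto
  also have "\<dots> = c * H s m"
    unfolding H_def using F_bdd(3)[OF assms(2)] assms U_ne by (intro cINF_mult_left) auto
  finally show ?thesis .
qed

lemma near_optimal_u: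
  assumes "s \<in> {0..T}" "0 < e"
  obtains u where "u \<in> U" "\<And>v. v \<in> V \<Longrightarrow> F s m u v \<le> H s m + e"
proof -
  have "(INF u\<in>U. SUP v\<in>V. F s m u v) < H s m + e" using assms by (simp add: H_def)
  then obtain u where u: "u \<in> U" "(SUP v\<in>V. F s m u v) < H s m + e"
    using cINF_less_iff[OF U_ne F_bdd(3)[OF assms(1)]] by blast
  moreover have "F s m u v \<le> (SUP v\<in>V. F s m u v)" if "v \<in> V" for v
    using F_bdd(1)[OF assms(1) u(1)] that by (intro cSUP_upper) auto
  ultimately show ?thesis using that[of u] by force
qed

text \<open>Isaacs' condition is only needed for the normalised weights, which is why the error scales
  with the mass.\<close>

lemma near_optimal_v:
  assumes s: "s \<in> {0..T}" and e: "0 < e" and m: "nonneg m"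
  obtains v where "v \<in> V" "\<And>u. u \<in> U \<Longrightarrow> H s m - e * mass m \<le> F s m u v"
proof (cases "m = 0")
  case True
  obtain v where "v \<in> V" using V_ne by auto
  then show ?thesis using that[of v] True by (simp add: H_zero F_def)
next
  case False
  define p where "p = (1 / mass m) *\<^sub>R m"
  have pos: "0 < mass m" using mass_nonneg[OF m] mass_eq_0[OF m] False by linarith
  have p: "p \<in> prob_simplex" using pos m
    by (auto simp: prob_simplex_iff p_def mass_scaleR nonneg_scaleR)
  have mp: "m = mass m *\<^sub>R p" using pos by (simp add: p_def)
  have "H s p = (SUP v\<in>V. INF u\<in>U. F s p u v)"
    using isaacs s p by (simp add: isaacs_def H_def F_def)
  then have "H s p - e < (SUP v\<in>V. INF u\<in>U. F s p u v)" using e by simp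
  then obtain v where v: "v \<in> V" "H s p - e < (INF u\<in>U. F s p u v)"
    using less_cSUP_iff[OF V_ne F_bdd(4)[OF s]] by blast
  show ?thesis
  proof (rule that[OF v(1)])
    fix u assume u: "u \<in> U"
    have "(INF u\<in>U. F s p u v) \<le> F s p u v"
      using F_bdd(2)[OF s v(1)] u by (intro cINF_lower) auto
    then have "H s p - e \<le> F s p u v" using v(2) by simp
    then have "mass m * (H s p - e) \<le> mass m * F s p u v" using pos by (intro mult_left_mono) auto
    moreover have "H s m = mass m * H s p" "F s m u v = mass m * F s p u v"
      using mp H_scaleR[of "mass m" s p] F_scaleR[of s "mass m" p u v] s pos by auto
    ultimately show "H s m - e * mass m \<le> F s m u v" by (simp add: algebra_simps)
  qed
qed

end

section \<open>Martingale trees and open-loop plans\<close>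

context game
begin

text \<open>Costs of finite martingale trees with unnormalised weights: at grid time \<open>r k\<close> the weight
  vector may split, then the Hamiltonian is paid until \<open>r (Suc k)\<close>.\<close>

inductive tree_cost :: "(nat \<Rightarrow> real) \<Rightarrow> nat \<Rightarrow> real^'i \<Rightarrow> real \<Rightarrow> bool" where
  leaf: "nonneg m \<Longrightarrow> tree_cost r 0 m 0"
| split: "tree_cost r n m1 x1 \<Longrightarrow> tree_cost r n m2 x2 \<Longrightarrow> tree_cost r n (m1 + m2) (x1 + x2)"
| play: "tree_cost (r \<circ> Suc) n m x \<Longrightarrow> tree_cost r (Suc n) m ((r 1 - r 0) * H (r 0) m + x)"

lemma tree_cost_nonneg: "tree_cost r n m x \<Longrightarrow> nonneg m"
  by (induction rule: tree_cost.induct) (auto intro: nonneg_add)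

lemma tree_cost_zero: "tree_cost r n 0 0"
proof (induction n arbitrary: r)
  case 0
  show ?case by (rule leaf) simp
next
  case (Suc n)
  then show ?case using play[OF Suc[of "r \<circ> Suc"]] by (simp add: H_zero)
qed

lemma tree_cost_sum:
  assumes "finite A" "\<And>a. a \<in> A \<Longrightarrow> tree_cost r n (f a) (x a)"
  shows "tree_cost r n (\<Sum>a\<in>A. f a) (\<Sum>a\<in>A. x a)"
  using assms by (induction A rule: finite_induct) (auto intro: tree_cost_zero split)

lemma tree_cost_scaleR:
  assumes "tree_cost r n m x" "0 \<le> c" "\<And>k. k < n \<Longrightarrow> r k \<in> {0..T}"
  shows "tree_cost r n (c *\<^sub>R m) (c * x)"
  using assms
proof (induction rule: tree_cost.induct)
  case (leaf m r)
  then show ?case by (simp add: tree_cost.leaf nonneg_scaleR)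
next
  case (split r n m1 x1 m2 x2)
  then show ?case by (simp add: tree_cost.split algebra_simps)
next
  case (play r n m x)
  have "tree_cost (r \<circ> Suc) n (c *\<^sub>R m) (c * x)"
    using play by (intro play.IH) auto
  from tree_cost.play[OF this] show ?case
    using play by (simp add: H_scaleR algebra_simps)
qed

text \<open>Delaying a tree by \<open>k\<close> steps without splitting models an informed player
  who reveals nothing until \<open>r k\<close>; this is the tree behind the dynamic programming
  inequality \<open>Val_step\<close>.\<close>

lemma tree_cost_constant_steps:
  assumes "tree_cost (\<lambda>j. r (k + j)) n m x"
  shows "tree_cost r (k + n) m ((\<Sum>j<k. (r (Suc j) - r j) * H (r j) m) + x)"
  using assms
proof (induction k arbitrary: r)
  case 0
  then show ?case by simp
next
  case (Suc k)
  have "tree_cost (r \<circ> Suc) (k + n) m ((\<Sum>j<k. (r (Suc (Suc j)) - r (Suc j)) * H (r (Suc j)) m) + x)"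
    using Suc.IH[of "r \<circ> Suc"] Suc.prems by (simp add: comp_def)
  from play[OF this] show ?case by (simp add: sum.lessThan_Suc_shift add.assoc del: sum.lessThan_Suc)
qed

text \<open>An open-loop plan is a finite list of action sequences weighted by the joint law of type and
  sequence. The argument \<open>y\<close> of a guarantee lists, for every history of own actions, the payoff
  vector which the opponent's reaction produces on the current interval.\<close>

definition responses :: "real \<Rightarrow> (nat \<Rightarrow> real) \<Rightarrow> nat \<Rightarrow> ('u list \<Rightarrow> real^'i) \<Rightarrow> bool" where
  "responses \<rho> r n y \<longleftrightarrow> (\<forall>k<n. \<forall>us. length us = Suc k \<longrightarrow> set us \<subseteq> U \<longrightarrow>
     (\<forall>m. nonneg m \<longrightarrow> (\<forall>b. (\<forall>v\<in>V. F (r k) m (last us) v \<le> b) \<longrightarrow>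
        m \<bullet> y us \<le> (r (Suc k) - r k) * (b + \<rho> * mass m))))"

definition plan :: "nat \<Rightarrow> real^'i \<Rightarrow> ((real^'i) \<times> 'u list) list \<Rightarrow> bool" where
  "plan n m ps \<longleftrightarrow> (\<forall>(q, us)\<in>set ps. nonneg q \<and> length us = n \<and> set us \<subseteq> U) \<and>
     (\<Sum>(q, us)\<leftarrow>ps. q) = m"

definition plan_payoff :: "nat \<Rightarrow> ((real^'i) \<times> 'u list) list \<Rightarrow> ('u list \<Rightarrow> real^'i) \<Rightarrow> real" where
  "plan_payoff n ps y = (\<Sum>(q, us)\<leftarrow>ps. \<Sum>k<n. q \<bullet> y (take (Suc k) us))"

lemma plan_payoff_append: "plan_payoff n (ps @ qs) y = plan_payoff n ps y + plan_payoff n qs y"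
  by (simp add: plan_payoff_def)

lemma plan_payoff_Cons:
  "plan_payoff (Suc n) (map (\<lambda>(q, us). (q, u # us)) ps) y =
    (\<Sum>(q, us)\<leftarrow>ps. q) \<bullet> y [u] + plan_payoff n ps (\<lambda>us. y (u # us))"
  by (induction ps)
    (auto simp: plan_payoff_def sum.lessThan_Suc_shift inner_add_left simp del: sum.lessThan_Suc)

text \<open>Induction on the tree: a leaf is the empty action sequence, a split concatenates two
  plans, and a played step prefixes all sequences with one near-optimal action for the current
  weight. As that action is common to all of them, the opponent's first reaction is a single payoff
  vector and is bounded against the total weight \<open>m\<close>.\<close>

lemma plan_exists:
  assumes "tree_cost r n m x" "0 \<le> \<rho>" "0 < e" 
    "\<And>k. k \<le> n \<Longrightarrow> r k \<in> {0..T}" "\<And>k. k < n \<Longrightarrow> r k \<le> r (Suc k)"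
  shows "\<exists>ps. plan n m ps \<and>
    (\<forall>y. responses \<rho> r n y \<longrightarrow> plan_payoff n ps y \<le> x + e + \<rho> * (r n - r 0) * mass m)"
  using assms
proof (induction arbitrary: e rule: tree_cost.induct)
  case (leaf m r)
  then show ?case by (intro exI[of _ "[(m, [])]"]) (auto simp: plan_def plan_payoff_def)
next
  case (split r n m1 x1 m2 x2)
  obtain ps1 where 1: "plan n m1 ps1"
    "\<And>y. responses \<rho> r n y \<Longrightarrow> plan_payoff n ps1 y \<le> x1 + e/2 + \<rho> * (r n - r 0) * mass m1"
    using split.IH(1)[of "e/2"] split.prems by auto
  obtain ps2 where 2: "plan n m2 ps2"
    "\<And>y. responses \<rho> r n y \<Longrightarrow> plan_payoff n ps2 y \<le> x2 + e/2 + \<rho> * (r n - r 0) * mass m2"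
    using split.IH(2)[of "e/2"] split.prems by auto
  show ?case
  proof (intro exI[of _ "ps1 @ ps2"] conjI allI impI)
    show "plan n (m1 + m2) (ps1 @ ps2)" using 1(1) 2(1) by (auto simp: plan_def)
    fix y assume "responses \<rho> r n y"
    from 1(2)[OF this] 2(2)[OF this]
    show "plan_payoff n (ps1 @ ps2) y \<le> x1 + x2 + e + \<rho> * (r n - r 0) * mass (m1 + m2)"
      by (simp add: plan_payoff_append mass_add algebra_simps)
  qed
next
  case (play r n m x)
  define D where "D = r 1 - r 0"
  have D: "0 \<le> D" using play.prems(4)[of 0] by (simp add: D_def)
  have m: "nonneg m" using play.hyps tree_cost_nonneg by blast
  obtain ps where ps: "plan n m ps"
    "\<And>y. responses \<rho> (r \<circ> Suc) n y \<Longrightarrow> plan_payoff n ps y \<le> x + e/2 + \<rho> * (r (Suc n) - r 1) * mass m"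
    using play.IH[of "e/2"] play.prems by (auto simp: comp_def)
  \<comment> \<open>Adding 1 keeps the quotient meaningful for an interval of length zero and still
    gives \<open>D * d \<le> e / 2\<close>.\<close>
  define d where "d = e / (2 * (D + 1))"
  have d: "0 < d" "D * d \<le> e / 2" using D play.prems(2) by (auto simp: d_def field_simps)
  obtain u where u: "u \<in> U" "\<And>v. v \<in> V \<Longrightarrow> F (r 0) m u v \<le> H (r 0) m + d"
    using near_optimal_u[of "r 0" d m] play.prems(3)[of 0] d by auto
  show ?case
  proof (intro exI[of _ "map (\<lambda>(q, us). (q, u # us)) ps"] conjI allI impI)
    have "(\<Sum>(q, us)\<leftarrow>map (\<lambda>(q, us). (q, u # us)) ps. q) = (\<Sum>(q, us)\<leftarrow>ps. q)"
      by (induction ps) auto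
    then show "plan (Suc n) m (map (\<lambda>(q, us). (q, u # us)) ps)"
      using ps(1) u(1) unfolding plan_def by (fastforce simp del: map_map)
    fix y assume y: "responses \<rho> r (Suc n) y"
    \<comment> \<open>With the first action fixed, reactions to longer histories are reactions on
      the shifted grid, to which the induction hypothesis applies.\<close>
    have "responses \<rho> (r \<circ> Suc) n (\<lambda>us. y (u # us))"
      unfolding responses_def
    proof (intro allI impI)
      fix k us m' b
      assume a: "k < n" "length us = Suc k" "set us \<subseteq> U" "nonneg m'"
        "\<forall>v\<in>V. F ((r \<circ> Suc) k) m' (last us) v \<le> b"
      have "us \<noteq> []" using a by auto
      then show "m' \<bullet> y (u # us) \<le> ((r \<circ> Suc) (Suc k) - (r \<circ> Suc) k) * (b + \<rho> * mass m')"
        using y[unfolded responses_def, rule_format, of "Suc k" "u # us" m' b] a u(1) by simp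
    qed
    from ps(2)[OF this]
    have "plan_payoff n ps (\<lambda>us. y (u # us)) \<le> x + e/2 + \<rho> * (r (Suc n) - r 1) * mass m" .
    moreover have "m \<bullet> y [u] \<le> D * ((H (r 0) m + d) + \<rho> * mass m)"
      using y[unfolded responses_def, rule_format, of 0 "[u]" m "H (r 0) m + d"] u m
      by (simp add: D_def)
    then have "m \<bullet> y [u] \<le> D * H (r 0) m + e / 2 + \<rho> * (r 1 - r 0) * mass m"
      using d(2) by (simp add: D_def algebra_simps)
    moreover have "(\<Sum>(q, us)\<leftarrow>ps. q) = m" using ps(1) by (simp add: plan_def)
    ultimately show "plan_payoff (Suc n) (map (\<lambda>(q, us). (q, u # us)) ps) y
        \<le> (r 1 - r 0) * H (r 0) m + x + e + \<rho> * (r (Suc n) - r 0) * mass m"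
      by (simp add: plan_payoff_Cons D_def[symmetric]) (simp add: D_def algebra_simps)
  qed
qed

section \<open>Weight trees indexed by words\<close>

definition words :: "'c set \<Rightarrow> nat \<Rightarrow> 'c list set" where
  "words A n = {h. set h \<subseteq> A \<and> length h = n}"

lemma finite_words: "finite A \<Longrightarrow> finite (words A n)"
  unfolding words_def by (rule finite_lists_length_eq)

lemma words_0 [simp]: "words A 0 = {[]}"
  by (auto simp: words_def)

lemma sum_words_Suc:
  assumes "finite A"
  shows "(\<Sum>h\<in>words A (Suc n). f h) = (\<Sum>h\<in>words A n. \<Sum>c\<in>A. f (h @ [c]))"
proof -
  have "(\<Sum>h\<in>words A (Suc n). f h) = (\<Sum>(h, c)\<in>words A n \<times> A. f (h @ [c]))"
  proof (rule sum.reindex_bij_witness[where i="\<lambda>(h, c). h @ [c]" and j="\<lambda>h. (butlast h, last h)"])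
    fix h assume "h \<in> words A (Suc n)"
    then have "h \<noteq> []" "set h \<subseteq> A" "length h = Suc n" by (auto simp: words_def)
    then show "(case (butlast h, last h) of (h, c) \<Rightarrow> h @ [c]) = h"
      "(butlast h, last h) \<in> words A n \<times> A"
      "(case (butlast h, last h) of (h, c) \<Rightarrow> f (h @ [c])) = f h"
      by (auto simp: words_def dest: in_set_butlastD)
  qed (auto simp: words_def)
  also have "\<dots> = (\<Sum>h\<in>words A n. \<Sum>c\<in>A. f (h @ [c]))"
    by (simp add: sum.cartesian_product)
  finally show ?thesis .
qed

text \<open>A word is a history of public signals and \<open>m h $ i\<close> the joint mass of type
  \<open>i\<close> and history \<open>h\<close>; the last condition is consistency of marginals. In
  contrast to \<open>tree_cost\<close> the nodes have names, which energies and path measures refer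
  to.\<close>

definition weight_tree :: "'c set \<Rightarrow> nat \<Rightarrow> ('c list \<Rightarrow> real^'i) \<Rightarrow> bool" where
  "weight_tree A n m \<longleftrightarrow> finite A \<and> (\<forall>k\<le>n. \<forall>h\<in>words A k. nonneg (m h)) \<and>
     (\<forall>k<n. \<forall>h\<in>words A k. m h = (\<Sum>c\<in>A. m (h @ [c])))"

definition weight_tree_cost :: "(nat \<Rightarrow> real) \<Rightarrow> 'c set \<Rightarrow> nat \<Rightarrow> ('c list \<Rightarrow> real^'i) \<Rightarrow> real" where
  "weight_tree_cost r A n m = (\<Sum>k<n. (r (Suc k) - r k) * (\<Sum>h\<in>words A k. H (r k) (m h)))"

lemma weight_tree_sum:
  assumes "weight_tree A n m" "k \<le> n"
  shows "(\<Sum>h\<in>words A k. m h) = m []"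
  using assms(2)
proof (induction k)
  case (Suc k)
  have "(\<Sum>h\<in>words A (Suc k). m h) = (\<Sum>h\<in>words A k. \<Sum>c\<in>A. m (h @ [c]))"
    using assms(1) by (intro sum_words_Suc) (simp add: weight_tree_def)
  also have "\<dots> = (\<Sum>h\<in>words A k. m h)"
    using assms(1) Suc.prems by (intro sum.cong refl) (simp add: weight_tree_def Suc_le_eq)
  finally show ?case using Suc by simp
qed simp

text \<open>Backward induction on the level: the trees below the children of a node are summed at
  the next grid time, and one played step is put in front. This feeds the trees found in the lower
  bound into the upper bound.\<close>

lemma weight_tree_imp_tree_cost:
  assumes "weight_tree A n m"
  shows "tree_cost r n (m []) (weight_tree_cost r A n m)"
proof -
  have fin: "finite A" using assms by (simp add: weight_tree_def)
  have "h \<in> words A k \<Longrightarrow> k \<le> n \<Longrightarrow> tree_cost (\<lambda>j. r (k + j)) (n - k) (m h)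
      (\<Sum>j<n-k. (r (Suc (k + j)) - r (k + j)) * (\<Sum>g\<in>words A j. H (r (k + j)) (m (h @ g))))" for h k
  proof (induction "n - k" arbitrary: h k)
    case 0
    then have "n = k" by simp
    then show ?case using 0 assms by (auto simp: weight_tree_def intro!: leaf)
  next
    case (Suc d)
    then have k: "k < n" by simp
    define x where "x c = (\<Sum>j<d. (r (Suc (Suc k + j)) - r (Suc k + j)) *
      (\<Sum>g\<in>words A j. H (r (Suc k + j)) (m ((h @ [c]) @ g))))" for c
    have "tree_cost (\<lambda>j. r (Suc k + j)) d (m (h @ [c])) (x c)" if "c \<in> A" for c
    proof -
      have d: "d = n - Suc k" using Suc.hyps(2) by simp
      have "h @ [c] \<in> words A (Suc k)" using Suc.prems that by (simp add: words_def)
      from Suc.hyps(1)[OF d this] k show ?thesis unfolding x_def d by simp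
    qed
    from tree_cost_sum[OF fin this]
    have "tree_cost (\<lambda>j. r (Suc k + j)) d (\<Sum>c\<in>A. m (h @ [c])) (\<Sum>c\<in>A. x c)" by simp
    moreover have "(\<Sum>c\<in>A. m (h @ [c])) = m h"
      using assms k Suc.prems by (auto simp: weight_tree_def)
    ultimately have "tree_cost ((\<lambda>j. r (k + j)) \<circ> Suc) d (m h) (\<Sum>c\<in>A. x c)"
      by (simp add: comp_def)
    from play[OF this] have "tree_cost (\<lambda>j. r (k + j)) (Suc d) (m h)
        ((r (Suc k) - r k) * H (r k) (m h) + (\<Sum>c\<in>A. x c))" by simp
    moreover have "(\<Sum>c\<in>A. x c) = (\<Sum>j<d. (r (Suc (Suc k + j)) - r (Suc k + j)) *
      (\<Sum>g\<in>words A (Suc j). H (r (Suc k + j)) (m (h @ g))))"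
    proof -
      have "(\<Sum>g\<in>words A (Suc j). f g) = (\<Sum>c\<in>A. \<Sum>g\<in>words A j. f (c # g))" for j and f :: "_ \<Rightarrow> real"
      proof -
        have "(\<Sum>g\<in>words A (Suc j). f g) = (\<Sum>(c, g)\<in>A \<times> words A j. f (c # g))"
          by (rule sum.reindex_bij_witness[where i="\<lambda>(c, g). c # g" and j="\<lambda>g. (hd g, tl g)"])
            (auto simp: words_def length_Suc_conv)
        then show ?thesis by (simp add: sum.cartesian_product)
      qed
      then show ?thesis unfolding x_def
        by (subst sum.swap) (simp add: sum_distrib_left)
    qed
    ultimately show ?case using Suc.hyps(2)[symmetric]
      by (simp add: sum.lessThan_Suc_shift del: sum.lessThan_Suc)
  qed
  from this[of "[]" 0] show ?thesis by (simp add: weight_tree_cost_def)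
qed

end

section \<open>Controls and plays\<close>

lemma space_control_space [simp]: "space (control_space t0 T U) = controls t0 T U"
  unfolding control_space_def by (rule space_measure_of) auto

text \<open>The interval is a guard inside one almost-everywhere statement on the line, so shrinking
  it and chaining equalities never change the measure.\<close>

definition ae_eq :: "real \<Rightarrow> real \<Rightarrow> (real \<Rightarrow> 'a) \<Rightarrow> (real \<Rightarrow> 'a) \<Rightarrow> bool" where
  "ae_eq a b f g \<longleftrightarrow> (AE s in lebesgue. s \<in> {a..b} \<longrightarrow> f s = g s)"

lemma ae_eq_iff: "(AE s in lebesgue_on {a..b}. f s = g s) \<longleftrightarrow> ae_eq a b f g"
  unfolding ae_eq_def by (rule AE_restrict_space_iff) auto

lemma ae_eq_refl [simp]: "ae_eq a b f f"
  by (simp add: ae_eq_def)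

lemma ae_eq_sym: "ae_eq a b f g \<Longrightarrow> ae_eq a b g f"
  unfolding ae_eq_def by (auto elim: AE_mp)

lemma ae_eq_trans: "ae_eq a b f g \<Longrightarrow> ae_eq a b g h \<Longrightarrow> ae_eq a b f h"
  unfolding ae_eq_def by (auto elim: AE_mp)

lemma ae_eq_mono: "ae_eq a b f g \<Longrightarrow> a \<le> a' \<Longrightarrow> b' \<le> b \<Longrightarrow> ae_eq a' b' f g"
  unfolding ae_eq_def by (auto elim: AE_mp)

lemma AE_lebesgue_neq: "AE s in lebesgue. s \<noteq> (a::real)"
  by (rule AE_completion) (rule AE_lborel_singleton)

lemma ae_eqI_open: "(\<And>s. a < s \<Longrightarrow> s < b \<Longrightarrow> f s = g s) \<Longrightarrow> ae_eq a b f g"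
  unfolding ae_eq_def using AE_lebesgue_neq[of a] AE_lebesgue_neq[of b]
  by eventually_elim force

lemma ae_eq_point [simp]: "ae_eq a a f g"
  by (rule ae_eqI_open) simp

lemma set_lebesgue_integral_ae_eq:
  fixes f g :: "real \<Rightarrow> real"
  assumes "ae_eq a b f g"
    "f \<in> borel_measurable (lebesgue_on {a..b})" "g \<in> borel_measurable (lebesgue_on {a..b})"
  shows "(LINT s:{a..b}|lebesgue. f s) = (LINT s:{a..b}|lebesgue. g s)"
  unfolding set_lebesgue_integral_def using assms
  by (intro integral_cong_AE)
    (auto simp: ae_eq_def borel_measurable_restrict_space_iff split: split_indicator elim!: AE_mp)

text \<open>A single realisation of a random strategy: the game between two realisations is solved
  deterministically, apart from measurability.\<close>

definition delayed ::
  "real \<Rightarrow> real \<Rightarrow> 'b::euclidean_space set \<Rightarrow> 'a::euclidean_space set \<Rightarrow> ((real \<Rightarrow> 'b) \<Rightarrow> (real \<Rightarrow> 'a)) \<Rightarrow> bool" where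
  "delayed t0 T B A f \<longleftrightarrow> f \<in> controls t0 T B \<rightarrow> controls t0 T A \<and>
     (\<exists>(k::nat) \<tau>. \<tau> 0 = t0 \<and> \<tau> k = T \<and> (\<forall>j<k. \<tau> j < \<tau> (Suc j)) \<and>
        (\<forall>b1\<in>controls t0 T B. \<forall>b2\<in>controls t0 T B. \<forall>j<k.
           ae_eq t0 (\<tau> j) b1 b2 \<longrightarrow> ae_eq t0 (\<tau> (Suc j)) (f b1) (f b2)))"

lemma random_strategy_delayed:
  assumes "\<alpha> \<in> random_strategies \<E> t0 T B A" "\<omega> \<in> space (fst \<alpha>)"
  shows "delayed t0 T B A (snd \<alpha> \<omega>)"
proof -
  obtain M f where \<alpha>: "\<alpha> = (M, f)" by fastforce
  have m: "(\<lambda>(\<omega>, b). f \<omega> b) \<in> M \<Otimes>\<^sub>M control_space t0 T B \<rightarrow>\<^sub>M control_space t0 T A"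
    using assms(1) by (auto simp: random_strategies_def \<alpha>)
  have "f \<omega> b \<in> controls t0 T A" if "b \<in> controls t0 T B" for b
    using measurable_space[OF m, of "(\<omega>, b)"] assms(2) that by (simp add: \<alpha> space_pair_measure)
  moreover have "\<exists>(k::nat) \<tau>. \<tau> 0 = t0 \<and> \<tau> k = T \<and> (\<forall>j<k. \<tau> j < \<tau> (Suc j)) \<and>
        (\<forall>\<omega>\<in>space M. \<forall>b1\<in>controls t0 T B. \<forall>b2\<in>controls t0 T B. \<forall>j<k.
           ae_eq t0 (\<tau> j) b1 b2 \<longrightarrow> ae_eq t0 (\<tau> (Suc j)) (f \<omega> b1) (f \<omega> b2))"
    using assms(1) unfolding random_strategies_def \<alpha> ae_eq_iff by simp
  ultimately show ?thesis
    using assms(2) unfolding delayed_def \<alpha> fst_conv snd_conv by blast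
qed

lemma random_strategy_section:
  assumes "\<alpha> \<in> random_strategies \<E> t0 T B A" "b \<in> controls t0 T B"
  shows "(\<lambda>\<omega>. snd \<alpha> \<omega> b) \<in> fst \<alpha> \<rightarrow>\<^sub>M control_space t0 T A"
proof -
  obtain M f where \<alpha>: "\<alpha> = (M, f)" by fastforce
  have m: "(\<lambda>(\<omega>, b). f \<omega> b) \<in> M \<Otimes>\<^sub>M control_space t0 T B \<rightarrow>\<^sub>M control_space t0 T A"
    using assms(1) by (auto simp: random_strategies_def \<alpha>)
  have "(\<lambda>\<omega>. (\<omega>, b)) \<in> M \<rightarrow>\<^sub>M M \<Otimes>\<^sub>M control_space t0 T B"
    using assms(2) by simp
  from measurable_compose[OF this m] show ?thesis by (simp add: \<alpha>)
qed

lemma random_strategiesI: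
  assumes "M \<in> \<E>" "(\<lambda>(\<omega>, b). f \<omega> b) \<in> M \<Otimes>\<^sub>M control_space t0 T B \<rightarrow>\<^sub>M control_space t0 T A"
    "\<tau> 0 = t0" "\<tau> k = T" "\<And>j. j < k \<Longrightarrow> \<tau> j < \<tau> (Suc j)"
    "\<And>\<omega> b1 b2 j. \<omega> \<in> space M \<Longrightarrow> b1 \<in> controls t0 T B \<Longrightarrow> b2 \<in> controls t0 T B \<Longrightarrow> j < k \<Longrightarrow>
      ae_eq t0 (\<tau> j) b1 b2 \<Longrightarrow> ae_eq t0 (\<tau> (Suc j)) (f \<omega> b1) (f \<omega> b2)"
  shows "(M, f) \<in> random_strategies \<E> t0 T B A"
proof -
  have "\<exists>(k::nat) \<tau>. \<tau> 0 = t0 \<and> \<tau> k = T \<and> (\<forall>j<k. \<tau> j < \<tau> (Suc j)) \<and>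
        (\<forall>\<omega>\<in>space M. \<forall>b1\<in>controls t0 T B. \<forall>b2\<in>controls t0 T B. \<forall>j<k.
           ae_eq t0 (\<tau> j) b1 b2 \<longrightarrow> ae_eq t0 (\<tau> (Suc j)) (f \<omega> b1) (f \<omega> b2))"
    using assms(3-6) by (intro exI[of _ k] exI[of _ \<tau>]) blast
  then show ?thesis using assms(1,2) unfolding random_strategies_def ae_eq_iff by simp
qed

text \<open>Take the first partition point at or beyond \<open>x\<close>. The one before it lies
  strictly before \<open>x\<close>, so agreement up to \<open>x\<close> covers it, and the delay
  carries equality of the outputs past \<open>x\<close>.\<close>

lemma delayed_nonanticipative:
  assumes "delayed t0 T B A f" "b1 \<in> controls t0 T B" "b2 \<in> controls t0 T B" "x \<le> T"
    "ae_eq t0 x b1 b2"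
  shows "ae_eq t0 x (f b1) (f b2)"
proof -
  obtain k :: nat and \<tau> where \<tau>: "\<tau> 0 = t0" "\<tau> k = T" "\<And>j. j < k \<Longrightarrow> \<tau> j < \<tau> (Suc j)"
    "\<And>j. j < k \<Longrightarrow> ae_eq t0 (\<tau> j) b1 b2 \<Longrightarrow> ae_eq t0 (\<tau> (Suc j)) (f b1) (f b2)"
    using assms(1-3) unfolding delayed_def by blast
  define j where "j = (LEAST j. x \<le> \<tau> j)"
  have xj: "x \<le> \<tau> j" "j \<le> k" unfolding j_def using \<tau>(2) assms(4)
    by (auto intro: LeastI[of _ k] Least_le)
  show ?thesis
  proof (cases j)
    case 0
    then have "ae_eq t0 t0 (f b1) (f b2)" "x \<le> t0" using xj \<tau> by auto
    then show ?thesis using ae_eq_mono[of t0 t0] by blast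
  next
    case (Suc i)
    then have "\<not> x \<le> \<tau> i" unfolding j_def by (metis lessI not_less_Least)
    then have "ae_eq t0 (\<tau> i) b1 b2" using assms(5) ae_eq_mono by fastforce
    with \<tau>(4)[of i] xj Suc have "ae_eq t0 (\<tau> j) (f b1) (f b2)" by simp
    then show ?thesis using xj ae_eq_mono by blast
  qed
qed

text \<open>Iterate \<open>b\<close> after \<open>a\<close> from any control. The delay of
  \<open>a\<close> settles one more of its partition intervals in every round and the
  nonanticipativity of \<open>b\<close> preserves this gain, so after \<open>k\<close> rounds the
  iterates agree almost everywhere on the whole interval.\<close>

lemma delayed_contraction_fixpoint:
  assumes a: "delayed t0 T B A a" and b: "delayed t0 T A B b" and "controls t0 T B \<noteq> {}"
  shows "\<exists>u\<in>controls t0 T A. \<exists>v\<in>controls t0 T B. ae_eq t0 T (a v) u \<and> ae_eq t0 T (b u) v"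
proof -
  obtain v0 where v0: "v0 \<in> controls t0 T B" using assms(3) by auto
  obtain k :: nat and \<tau> where \<tau>: "\<tau> 0 = t0" "\<tau> k = T" "\<And>j. j < k \<Longrightarrow> \<tau> j < \<tau> (Suc j)"
    "\<And>j b1 b2. j < k \<Longrightarrow> b1 \<in> controls t0 T B \<Longrightarrow> b2 \<in> controls t0 T B \<Longrightarrow>
      ae_eq t0 (\<tau> j) b1 b2 \<Longrightarrow> ae_eq t0 (\<tau> (Suc j)) (a b1) (a b2)"
    using a unfolding delayed_def by blast
  have \<tau>T: "\<tau> j \<le> T" if "j \<le> k" for j
    using that
  proof (induction rule: inc_induct)
    case base
    then show ?case using \<tau> by simp
  next
    case (step j)
    then show ?case using \<tau>(3)[of j] by simp
  qed
  have ac: "a v \<in> controls t0 T A" if "v \<in> controls t0 T B" for v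
    using a that by (auto simp: delayed_def)
  have bc: "b v \<in> controls t0 T B" if "v \<in> controls t0 T A" for v
    using b that by (auto simp: delayed_def)
  define w where "w n = ((\<lambda>v. b (a v)) ^^ n) v0" for n
  have w: "w n \<in> controls t0 T B" for n
    by (induction n) (auto simp: w_def v0 ac bc)
  have wS: "w (Suc n) = b (a (w n))" for n by (simp add: w_def)
  have "n \<le> k \<Longrightarrow> ae_eq t0 (\<tau> n) (w (Suc n)) (w n)" for n
  proof (induction n)
    case 0
    then show ?case by (simp add: \<tau>)
  next
    case (Suc n)
    then have "ae_eq t0 (\<tau> (Suc n)) (a (w (Suc n))) (a (w n))"
      using \<tau>(4)[of n] w by simp
    then show ?case unfolding wS[of "Suc n"] wS[of n]
      using delayed_nonanticipative[OF b] ac w \<tau>T Suc.prems bc by blast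
  qed
  from this[of k] have *: "ae_eq t0 T (w (Suc k)) (w k)" by (simp add: \<tau>)
  have "ae_eq t0 T (a (w (Suc k))) (a (w k))"
    using delayed_nonanticipative[OF a w w order_refl *] .
  \<comment> \<open>With these witnesses \<open>b u = v\<close> holds by definition of the
    iteration, and \<open>a v = u\<close> almost everywhere by the stationarity just proved.\<close>
  then show ?thesis
    using ac w bc by (intro bexI[of _ "a (w k)"] bexI[of _ "w (Suc k)"]) (auto simp: wS)
qed

lemma play_props:
  assumes "delayed t0 T V U a" "delayed t0 T U V b" "controls t0 T V \<noteq> {}"
  obtains u v where "play t0 T U V a b = (u, v)" "u \<in> controls t0 T U" "v \<in> controls t0 T V"
    "ae_eq t0 T (a v) u" "ae_eq t0 T (b u) v"
proof -
  define P where "P = (\<lambda>(u, v). u \<in> controls t0 T U \<and> v \<in> controls t0 T V \<and>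
     (AE s in lebesgue_on {t0..T}. a v s = u s) \<and> (AE s in lebesgue_on {t0..T}. b u s = v s))"
  have "\<exists>x. P x"
    using delayed_contraction_fixpoint[OF assms] unfolding P_def ae_eq_iff by auto
  then have "P (SOME x. P x)" by (rule someI_ex)
  moreover have "play t0 T U V a b = (SOME x. P x)"
    by (simp add: play_def P_def)
  ultimately have "P (play t0 T U V a b)" by simp
  then show ?thesis using that unfolding P_def ae_eq_iff
    by (cases "play t0 T U V a b") auto
qed

text \<open>Continuity in the L1 pseudo-distance makes the preimage of an open set one of the
  generators of the Borel field.\<close>

lemma control_space_functional_measurable:
  fixes \<Phi> :: "(real \<Rightarrow> 'a::euclidean_space) \<Rightarrow> real"
  assumes "\<And>x e. x \<in> controls t0 T A \<Longrightarrow> 0 < e \<Longrightarrow>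
    \<exists>d>0. \<forall>w\<in>controls t0 T A. L1_dist t0 T x w < d \<longrightarrow> \<bar>\<Phi> x - \<Phi> w\<bar> < e"
  shows "\<Phi> \<in> borel_measurable (control_space t0 T A)"
proof (rule borel_measurableI)
  fix S :: "real set" assume S: "open S"
  have "\<Phi> -` S \<inter> controls t0 T A \<in> {G. G \<subseteq> controls t0 T A \<and>
         (\<forall>u\<in>G. \<exists>e>0. \<forall>w\<in>controls t0 T A. L1_dist t0 T u w < e \<longrightarrow> w \<in> G)}"
  proof (intro CollectI conjI ballI)
    fix x assume x: "x \<in> \<Phi> -` S \<inter> controls t0 T A"
    then obtain e where e: "0 < e" "ball (\<Phi> x) e \<subseteq> S" using S by (auto simp: open_contains_ball)
    obtain d where "d > 0" "\<forall>w\<in>controls t0 T A. L1_dist t0 T x w < d \<longrightarrow> \<bar>\<Phi> x - \<Phi> w\<bar> < e"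
      using assms[of x e] x e by auto
    then show "\<exists>e>0. \<forall>w\<in>controls t0 T A. L1_dist t0 T x w < e \<longrightarrow> w \<in> \<Phi> -` S \<inter> controls t0 T A"
      using e(2) by (intro exI[of _ d]) (auto simp: subset_iff dist_real_def)
  qed auto
  then have "\<Phi> -` S \<inter> controls t0 T A \<in> sets (control_space t0 T A)"
    unfolding control_space_def by (subst sets_measure_of) auto
  then show "\<Phi> -` S \<inter> space (control_space t0 T A) \<in> sets (control_space t0 T A)" by simp
qed

lemma set_integrable_lebesgue_bounded:
  fixes f :: "real \<Rightarrow> real"
  assumes "f \<in> borel_measurable (lebesgue_on {a..b})" "\<And>s. s \<in> {a..b} \<Longrightarrow> \<bar>f s\<bar> \<le> B"
  shows "set_integrable lebesgue {a..b} f"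
proof -
  interpret finite_measure "lebesgue_on {a..b}"
    by (rule finite_measure_lebesgue_on) simp
  have "integrable (lebesgue_on {a..b}) f"
    using assms by (intro integrable_const_bound[where B=B]) (auto intro!: AE_I2)
  then show ?thesis by (simp add: integrable_restrict_space set_integrable_def)
qed

lemma set_integral_lebesgue_le:
  fixes f :: "real \<Rightarrow> real"
  assumes "set_integrable lebesgue {a..b} f" "\<And>s. s \<in> {a..b} \<Longrightarrow> f s \<le> B" "a \<le> b"
  shows "(LINT s:{a..b}|lebesgue. f s) \<le> (b - a) * B"
proof -
  have "(LINT s:{a..b}|lebesgue. f s) \<le> (LINT s:{a..b}|lebesgue. B)"
    using assms by (intro set_integral_mono) (auto simp: set_integrable_def)
  also have "\<dots> = (b - a) * B"
    using assms(3) by (simp add: set_lebesgue_integral_def)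
  finally show ?thesis .
qed

text \<open>A function that is not integrable has integral 0 by convention, which respects the bound
  too. So expected payoffs are bounded without measurability of the pair chosen by
  \<open>play\<close>.\<close>

lemma prob_integral_abs_le:
  fixes f :: "'a \<Rightarrow> real"
  assumes "prob_space M" "\<And>x. x \<in> space M \<Longrightarrow> \<bar>f x\<bar> \<le> B" "0 \<le> B"
  shows "\<bar>integral\<^sup>L M f\<bar> \<le> B"
proof (cases "integrable M f")
  case True
  interpret prob_space M by fact
  have "integral\<^sup>L M f \<le> B" "- B \<le> integral\<^sup>L M f"
    using assms(2) True by (auto intro!: integral_le_const integral_ge_const AE_I2 simp: abs_le_iff minus_le_iff)
  then show ?thesis by simp
qed (simp add: not_integrable_integral_eq assms)

context game
begin

text \<open>The payoff is continuous only on a compact set; extending it by zero outside this closed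
  set gives a Borel function of all arguments, which can be composed with the controls.\<close>

lemma l_measurable:
  assumes u: "u \<in> controls t0 T U" and v: "v \<in> controls t0 T V" and "0 \<le> t0" "t0 \<le> a" "b \<le> T"
  shows "(\<lambda>s. l i s (u s) (v s)) \<in> borel_measurable (lebesgue_on {a..b})"
proof -
  have [measurable]: "u \<in> borel_measurable (lebesgue_on {a..b})" "v \<in> borel_measurable (lebesgue_on {a..b})"
    using u v assms(4,5) by (auto simp: controls_def intro: measurable_restrict_mono)
  have ran: "u s \<in> U" "v s \<in> V" if "s \<in> {a..b}" for s
    using u v that assms(4,5) by (auto simp: controls_def)
  define K where "K = {0..T} \<times> U \<times> V"
  have "closed K"
    unfolding K_def by (intro compact_imp_closed compact_Times compact_U compact_V) auto
  then have [measurable]: "(\<lambda>x. indicator K x *\<^sub>R (case x of (t, u, v) \<Rightarrow> l i t u v)) \<in> borel_measurable borel"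
    unfolding K_def by (intro borel_measurable_continuous_on_indicator cont_l) auto
  have [measurable]: "(\<lambda>s. s) \<in> borel_measurable (lebesgue_on {a..b})"
    by (intro measurable_restrict_space1 measurable_completion) auto
  have "(\<lambda>s. indicator K (s, u s, v s) *\<^sub>R (case (s, u s, v s) of (t, u, v) \<Rightarrow> l i t u v))
      \<in> borel_measurable (lebesgue_on {a..b})"
    by (rule measurable_compose[where N=borel]) measurable
  moreover have "l i s (u s) (v s) = indicator K (s, u s, v s) *\<^sub>R (case (s, u s, v s) of (t, u, v) \<Rightarrow> l i t u v)"
    if "s \<in> space (lebesgue_on {a..b})" for s
    using that ran[of s] assms(3-5) by (auto simp: K_def)
  ultimately show ?thesis by (subst measurable_cong)
qed

definition pay :: "'i \<Rightarrow> real \<Rightarrow> real \<Rightarrow> (real \<Rightarrow> 'u) \<Rightarrow> (real \<Rightarrow> 'v) \<Rightarrow> real" where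
  "pay i a b u v = (LINT s:{a..b}|lebesgue. l i s (u s) (v s))"

lemma l_integrable:
  assumes u: "u \<in> controls t0 T U" and v: "v \<in> controls t0 T V" and "0 \<le> t0" "t0 \<le> a" "b \<le> T"
  shows "set_integrable lebesgue {a..b} (\<lambda>s. l i s (u s) (v s))"
  using assms by (intro set_integrable_lebesgue_bounded[where B=C] l_measurable[OF assms] l_bound)
    (auto simp: controls_def)

lemma pay_bound:
  assumes u: "u \<in> controls t0 T U" and v: "v \<in> controls t0 T V" and "0 \<le> t0" "t0 \<le> a" "b \<le> T" "a \<le> b"
  shows "\<bar>pay i a b u v\<bar> \<le> (b - a) * C"
proof -
  have b: "\<bar>l i s (u s) (v s)\<bar> \<le> C" if "s \<in> {a..b}" for s
    using assms that by (intro l_bound) (auto simp: controls_def)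
  have i: "set_integrable lebesgue {a..b} (\<lambda>s. l i s (u s) (v s))"
    by (rule l_integrable[OF assms(1-5)])
  have "pay i a b u v \<le> (b - a) * C"
    unfolding pay_def using b assms by (intro set_integral_lebesgue_le i) (auto simp: abs_le_iff)
  moreover have "- pay i a b u v = (LINT s:{a..b}|lebesgue. - l i s (u s) (v s))"
    unfolding pay_def set_lebesgue_integral_def by simp
  moreover have "\<dots> \<le> (b - a) * C"
    using b assms i by (intro set_integral_lebesgue_le) (auto simp: abs_le_iff set_integrable_def)
  ultimately show ?thesis by linarith
qed

lemma pay_cong:
  assumes "u \<in> controls t0 T U" "v \<in> controls t0 T V" "u' \<in> controls t0 T U" "v' \<in> controls t0 T V"
    "0 \<le> t0" "t0 \<le> a" "b \<le> T" "ae_eq a b u u'" "ae_eq a b v v'"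
  shows "pay i a b u v = pay i a b u' v'"
  unfolding pay_def
proof (rule set_lebesgue_integral_ae_eq)
  show "ae_eq a b (\<lambda>s. l i s (u s) (v s)) (\<lambda>s. l i s (u' s) (v' s))"
    using assms(8,9) unfolding ae_eq_def by eventually_elim auto
qed (use assms in \<open>auto intro!: l_measurable\<close>)

lemma L1_integrable:
  assumes "compact A" "u \<in> controls t0 T A" "u' \<in> controls t0 T A"
  shows "set_integrable lebesgue {t0..T} (\<lambda>s. norm (u s - u' s))"
proof -
  obtain B where B: "\<And>x. x \<in> A \<Longrightarrow> norm x \<le> B"
    using compact_imp_bounded[OF assms(1)] by (auto simp: bounded_iff)
  show ?thesis
  proof (rule set_integrable_lebesgue_bounded[where B="B + B"])
    show "(\<lambda>s. norm (u s - u' s)) \<in> borel_measurable (lebesgue_on {t0..T})"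
      using assms(2,3) by (auto simp: controls_def)
    fix s assume "s \<in> {t0..T}"
    then have "u s \<in> A" "u' s \<in> A" using assms(2,3) by (auto simp: controls_def)
    then show "\<bar>norm (u s - u' s)\<bar> \<le> B + B" 
      using norm_triangle_ineq4[of "u s" "u' s"] B[of "u s"] B[of "u' s"] by simp
  qed
qed

text \<open>Integrates the affine modulus of the payoffs. The slope \<open>L\<close> depends on
  \<open>\<rho>\<close> only, neither on the interval nor on the controls, and the slack accumulates
  to at most \<open>\<rho> * T\<close>.\<close>

lemma pay_modulus:
  assumes "0 < \<rho>"
  obtains L where "0 \<le> L" "\<And>i t0 a b u u' v v'. u \<in> controls t0 T U \<Longrightarrow> u' \<in> controls t0 T U \<Longrightarrow>
    v \<in> controls t0 T V \<Longrightarrow> v' \<in> controls t0 T V \<Longrightarrow> 0 \<le> t0 \<Longrightarrow> t0 \<le> a \<Longrightarrow> a \<le> b \<Longrightarrow> b \<le> T \<Longrightarrow>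
    \<bar>pay i a b u v - pay i a b u' v'\<bar> \<le> \<rho> * T + L * (L1_dist t0 T u u' + L1_dist t0 T v v')"
proof -
  obtain L where L: "0 \<le> L"
    "\<And>i s s' u u' v v'. s \<in> {0..T} \<Longrightarrow> s' \<in> {0..T} \<Longrightarrow> u \<in> U \<Longrightarrow> u' \<in> U \<Longrightarrow> v \<in> V \<Longrightarrow> v' \<in> V
      \<Longrightarrow> \<bar>l i s u v - l i s' u' v'\<bar> \<le> \<rho> + L * (\<bar>s - s'\<bar> + norm (u - u') + norm (v - v'))"
    using l_modulus[OF assms] by blast
  show ?thesis
  proof (rule that[OF L(1)])
    fix i t0 a b u u' v v'
    assume c: "u \<in> controls t0 T U" "u' \<in> controls t0 T U" "v \<in> controls t0 T V" "v' \<in> controls t0 T V"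
      and t: "0 \<le> t0" "t0 \<le> a" "a \<le> b" "b \<le> T"
    have i1: "set_integrable lebesgue {a..b} (\<lambda>s. l i s (u s) (v s))"
      "set_integrable lebesgue {a..b} (\<lambda>s. l i s (u' s) (v' s))"
      using c t by (auto intro!: l_integrable)
    have iu: "set_integrable lebesgue {t0..T} (\<lambda>s. norm (u s - u' s))" 
      and iv: "set_integrable lebesgue {t0..T} (\<lambda>s. norm (v s - v' s))"
      using c by (auto intro!: L1_integrable compact_U compact_V)
    have iuv: "set_integrable lebesgue {t0..T} (\<lambda>s. L * (norm (u s - u' s) + norm (v s - v' s)))"
      using iu iv by (intro set_integrable_mult_right set_integral_add) auto
    have ic: "set_integrable lebesgue {t0..T} (\<lambda>s. \<rho>)"
      by (rule set_integrable_lebesgue_bounded[where B="\<bar>\<rho>\<bar>"]) auto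
    have "\<bar>pay i a b u v - pay i a b u' v'\<bar> =
        \<bar>LINT s:{a..b}|lebesgue. l i s (u s) (v s) - l i s (u' s) (v' s)\<bar>"
      unfolding pay_def using i1 by simp
    also have "\<dots> \<le> (LINT s:{a..b}|lebesgue. \<bar>l i s (u s) (v s) - l i s (u' s) (v' s)\<bar>)"
      using set_integral_norm_bound[of lebesgue "{a..b}" "\<lambda>s. l i s (u s) (v s) - l i s (u' s) (v' s)"] i1
      by simp
    also have "\<dots> \<le> (LINT s:{t0..T}|lebesgue. \<rho> + L * (norm (u s - u' s) + norm (v s - v' s)))"
      unfolding set_lebesgue_integral_def
    proof (rule integral_mono)
      show "integrable lebesgue (\<lambda>s. indicator {a..b} s *\<^sub>R \<bar>l i s (u s) (v s) - l i s (u' s) (v' s)\<bar>)"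
        using set_integrable_abs[OF set_integral_diff(1)[OF i1]] by (simp add: set_integrable_def)
      show "integrable lebesgue (\<lambda>s. indicator {t0..T} s *\<^sub>R (\<rho> + L * (norm (u s - u' s) + norm (v s - v' s))))"
        using set_integral_add(1)[OF ic iuv] by (simp add: set_integrable_def)
      fix s
      have "\<bar>l i s (u s) (v s) - l i s (u' s) (v' s)\<bar> \<le> \<rho> + L * (\<bar>s - s\<bar> + norm (u s - u' s) + norm (v s - v' s))"
        if "s \<in> {a..b}"
        using that c t by (intro L(2)) (auto simp: controls_def)
      then show "indicator {a..b} s *\<^sub>R \<bar>l i s (u s) (v s) - l i s (u' s) (v' s)\<bar>
          \<le> indicator {t0..T} s *\<^sub>R (\<rho> + L * (norm (u s - u' s) + norm (v s - v' s)))"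
        using t assms L(1) by (auto simp: indicator_def)
    qed
    also have "\<dots> = (LINT s:{t0..T}|lebesgue. \<rho>) + L * (L1_dist t0 T u u' + L1_dist t0 T v v')"
      unfolding L1_dist_def using ic iuv iu iv by (simp add: set_integral_add)
    also have "(LINT s:{t0..T}|lebesgue. \<rho>) \<le> \<rho> * T"
      using t assms by (simp add: set_lebesgue_integral_def mult.commute mult_left_mono)
    finally show "\<bar>pay i a b u v - pay i a b u' v'\<bar> \<le> \<rho> * T + L * (L1_dist t0 T u u' + L1_dist t0 T v v')"
      by simp
  qed
qed

lemma L1_dist_self [simp]: "L1_dist t0 T u u = 0"
  by (simp add: L1_dist_def)

lemma pay_measurable:
  assumes "0 \<le> t0" "t0 \<le> a" "a \<le> b" "b \<le> T"
  shows "v \<in> controls t0 T V \<Longrightarrow> (\<lambda>u. pay i a b u v) \<in> borel_measurable (control_space t0 T U)"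
    "u \<in> controls t0 T U \<Longrightarrow> (\<lambda>v. pay i a b u v) \<in> borel_measurable (control_space t0 T V)"
proof -
  have *: "\<exists>\<rho>>0. \<exists>L\<ge>0. \<exists>d>0. \<rho> * T + L * d \<le> e \<and> (\<forall>u u' v v'. u \<in> controls t0 T U \<longrightarrow> u' \<in> controls t0 T U \<longrightarrow>
    v \<in> controls t0 T V \<longrightarrow> v' \<in> controls t0 T V \<longrightarrow>
    \<bar>pay i a b u v - pay i a b u' v'\<bar> \<le> \<rho> * T + L * (L1_dist t0 T u u' + L1_dist t0 T v v'))"
    if "0 < e" for e
  proof -
    define \<rho> where "\<rho> = e / (2 * T)"
    have \<rho>: "0 < \<rho>" using that T_pos by (simp add: \<rho>_def)
    obtain L where L: "0 \<le> L" "\<And>i t0 a b u u' v v'. u \<in> controls t0 T U \<Longrightarrow> u' \<in> controls t0 T U \<Longrightarrow>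
      v \<in> controls t0 T V \<Longrightarrow> v' \<in> controls t0 T V \<Longrightarrow> 0 \<le> t0 \<Longrightarrow> t0 \<le> a \<Longrightarrow> a \<le> b \<Longrightarrow> b \<le> T \<Longrightarrow>
      \<bar>pay i a b u v - pay i a b u' v'\<bar> \<le> \<rho> * T + L * (L1_dist t0 T u u' + L1_dist t0 T v v')"
      using pay_modulus[OF \<rho>] by blast
    define d where "d = e / (2 * (L + 1))"
    have "0 < d" "L * d \<le> e / 2" using that L(1) by (auto simp: d_def field_simps)
    moreover have "\<rho> * T = e / 2" using T_pos by (simp add: \<rho>_def)
    ultimately show ?thesis using \<rho> L assms
      by (intro exI[of _ \<rho>] exI[of _ L] exI[of _ d] conjI) auto
  qed
  show "(\<lambda>u. pay i a b u v) \<in> borel_measurable (control_space t0 T U)" if v: "v \<in> controls t0 T V"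
  proof (rule control_space_functional_measurable)
    fix x :: "real \<Rightarrow> 'u" and e :: real assume x: "x \<in> controls t0 T U" and e: "0 < e"
    obtain \<rho> L d where 1: "0 < \<rho>" "0 \<le> L" "0 < d" "\<rho> * T + L * d \<le> e / 2"
      and 2: "\<forall>u u' v v'. u \<in> controls t0 T U \<longrightarrow> u' \<in> controls t0 T U \<longrightarrow>
    v \<in> controls t0 T V \<longrightarrow> v' \<in> controls t0 T V \<longrightarrow>
    \<bar>pay i a b u v - pay i a b u' v'\<bar> \<le> \<rho> * T + L * (L1_dist t0 T u u' + L1_dist t0 T v v')"
      using *[of "e/2"] e by auto
    show "\<exists>d>0. \<forall>w\<in>controls t0 T U. L1_dist t0 T x w < d \<longrightarrow> \<bar>pay i a b x v - pay i a b w v\<bar> < e"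
    proof (intro exI[of _ d] conjI ballI impI 1)
      fix w assume w: "w \<in> controls t0 T U" "L1_dist t0 T x w < d"
      have "\<bar>pay i a b x v - pay i a b w v\<bar> \<le> \<rho> * T + L * (L1_dist t0 T x w + L1_dist t0 T v v)"
        using 2 x w v by blast
      also have "\<dots> \<le> \<rho> * T + L * d" using w 1 by (auto intro: mult_left_mono)
      finally show "\<bar>pay i a b x v - pay i a b w v\<bar> < e" using 1 e by linarith
    qed
  qed
  show "(\<lambda>v. pay i a b u v) \<in> borel_measurable (control_space t0 T V)" if u: "u \<in> controls t0 T U"
  proof (rule control_space_functional_measurable)
    fix x :: "real \<Rightarrow> 'v" and e :: real assume x: "x \<in> controls t0 T V" and e: "0 < e"
    obtain \<rho> L d where 1: "0 < \<rho>" "0 \<le> L" "0 < d" "\<rho> * T + L * d \<le> e / 2"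
      and 2: "\<forall>u u' v v'. u \<in> controls t0 T U \<longrightarrow> u' \<in> controls t0 T U \<longrightarrow>
    v \<in> controls t0 T V \<longrightarrow> v' \<in> controls t0 T V \<longrightarrow>
    \<bar>pay i a b u v - pay i a b u' v'\<bar> \<le> \<rho> * T + L * (L1_dist t0 T u u' + L1_dist t0 T v v')"
      using *[of "e/2"] e by auto
    show "\<exists>d>0. \<forall>w\<in>controls t0 T V. L1_dist t0 T x w < d \<longrightarrow> \<bar>pay i a b u x - pay i a b u w\<bar> < e"
    proof (intro exI[of _ d] conjI ballI impI 1)
      fix w assume w: "w \<in> controls t0 T V" "L1_dist t0 T x w < d"
      have "\<bar>pay i a b u x - pay i a b u w\<bar> \<le> \<rho> * T + L * (L1_dist t0 T u u + L1_dist t0 T x w)"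
        using 2 x w u by blast
      also have "\<dots> \<le> \<rho> * T + L * d" using w 1 by (auto intro: mult_left_mono)
      finally show "\<bar>pay i a b u x - pay i a b u w\<bar> < e" using 1 e by linarith
    qed
  qed
qed

end

section \<open>Piecewise constant controls on a grid\<close>

text \<open>Counting the interior grid points passed gives a total, monotone and measurable index: 0
  before the grid starts, \<open>n - 1\<close> after it ends for nonempty grids, and
  \<open>k\<close> on the half-open interval from \<open>r k\<close> to
  \<open>r (Suc k)\<close>.\<close>

definition step_index :: "(nat \<Rightarrow> real) \<Rightarrow> nat \<Rightarrow> real \<Rightarrow> nat" where
  "step_index r n s = card {k\<in>{1..<n}. r k \<le> s}"

text \<open>Restricted to the closed interval because \<open>controls\<close> consists of
  extensional functions.\<close>

definition step_control :: "(nat \<Rightarrow> real) \<Rightarrow> nat \<Rightarrow> (nat \<Rightarrow> 'a) \<Rightarrow> real \<Rightarrow> 'a" where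
  "step_control r n f = (\<lambda>s\<in>{r 0..r n}. f (step_index r n s))"

definition grid :: "(nat \<Rightarrow> real) \<Rightarrow> nat \<Rightarrow> bool" where
  "grid r n \<longleftrightarrow> 0 < n \<and> (\<forall>k<n. r k < r (Suc k))"

lemma grid_less: "grid r n \<Longrightarrow> i < j \<Longrightarrow> j \<le> n \<Longrightarrow> r i < r j"
proof (induction j)
  case (Suc j)
  then have "r j < r (Suc j)" by (simp add: grid_def)
  with Suc show ?case by (cases "i = j") auto
qed simp

lemma grid_le: "grid r n \<Longrightarrow> i \<le> j \<Longrightarrow> j \<le> n \<Longrightarrow> r i \<le> r j"
  using grid_less[of r n i j] by (cases "i = j") auto

lemma step_index_eq:
  assumes g: "grid r n" and k: "k < n" "r k \<le> s" "s < r (Suc k)"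
  shows "step_index r n s = k"
proof -
  have "{j\<in>{1..<n}. r j \<le> s} = {1..k}"
  proof (intro set_eqI iffI)
    fix j assume j: "j \<in> {j\<in>{1..<n}. r j \<le> s}"
    then have "\<not> Suc k \<le> j" using grid_le[OF g, of "Suc k" j] k by auto
    then show "j \<in> {1..k}" using j by auto
  next
    fix j assume "j \<in> {1..k}"
    then show "j \<in> {j\<in>{1..<n}. r j \<le> s}" using grid_le[OF g, of j k] k by auto
  qed
  then show ?thesis by (simp add: step_index_def)
qed

lemma step_index_less:
  assumes g: "grid r n" and k: "k < n" "s < r (Suc k)"
  shows "step_index r n s \<le> k"
proof -
  have "{j\<in>{1..<n}. r j \<le> s} \<subseteq> {1..k}"
  proof
    fix j assume j: "j \<in> {j\<in>{1..<n}. r j \<le> s}"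
    then have "\<not> Suc k \<le> j" using grid_le[OF g, of "Suc k" j] k by auto
    then show "j \<in> {1..k}" using j by auto
  qed
  then have "card {j\<in>{1..<n}. r j \<le> s} \<le> card {1..k}" by (intro card_mono) auto
  then show ?thesis by (simp add: step_index_def)
qed

lemma step_index_bound: "0 < n \<Longrightarrow> step_index r n s < n"
proof -
  assume "0 < n"
  have "card {j\<in>{1..<n}. r j \<le> s} \<le> card {1..<n}" by (intro card_mono) auto
  with \<open>0 < n\<close> show ?thesis by (simp add: step_index_def)
qed

lemma step_index_measurable: "step_index r n \<in> borel \<rightarrow>\<^sub>M count_space UNIV"
proof -
  have "step_index r n = (\<lambda>s. \<Sum>k\<in>{1..<n}. if r k \<le> s then 1 else 0)"
    by (auto simp: step_index_def sum.If_cases Int_def)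
  also have "\<dots> \<in> borel \<rightarrow>\<^sub>M count_space UNIV" by measurable
  finally show ?thesis .
qed

lemma step_control_controls:
  assumes g: "grid r n" and f: "\<And>k. k < n \<Longrightarrow> f k \<in> A"
  shows "step_control r n f \<in> controls (r 0) (r n) A"
proof -
  have "step_index r n \<in> lebesgue_on {r 0..r n} \<rightarrow>\<^sub>M count_space UNIV"
    by (intro measurable_restrict_space1 measurable_completion)
      (use step_index_measurable in simp)
  then have "(\<lambda>s. f (step_index r n s)) \<in> borel_measurable (lebesgue_on {r 0..r n})"
    by (rule measurable_compose) simp
  then have "step_control r n f \<in> borel_measurable (lebesgue_on {r 0..r n})"
    unfolding step_control_def by (subst measurable_cong[where g="\<lambda>s. f (step_index r n s)"]) auto
  then show ?thesis
    using g f step_index_bound[of n r] by (auto simp: controls_def step_control_def grid_def)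
qed

lemma step_control_eq_interval:
  assumes g: "grid r n" and k: "k < n"
  shows "ae_eq (r k) (r (Suc k)) (step_control r n f) (\<lambda>_. f k)"
proof (rule ae_eqI_open)
  fix s assume "r k < s" "s < r (Suc k)"
  then show "step_control r n f s = f k"
    using step_index_eq[OF g k, of s] grid_le[OF g, of 0 k] grid_le[OF g, of "Suc k" n] k
    by (auto simp: step_control_def)
qed

text \<open>Instructions up to index \<open>k\<close> determine the control up to
  \<open>r (Suc k)\<close>. This gain of one interval is the delay of every strategy built from a
  grid.\<close>

lemma step_control_prefix:
  assumes g: "grid r n" and k: "k < n" and f: "\<And>j. j \<le> k \<Longrightarrow> f j = f' j"
  shows "ae_eq (r 0) (r (Suc k)) (step_control r n f) (step_control r n f')"
proof (rule ae_eqI_open)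
  fix s assume "r 0 < s" "s < r (Suc k)"
  then show "step_control r n f s = step_control r n f' s"
    using step_index_less[OF g k, of s] f by (auto simp: step_control_def)
qed

lemma constant_controls:
  assumes "x \<in> A" shows "(\<lambda>s\<in>{a..b}. x) \<in> controls a b A"
proof -
  have "(\<lambda>s\<in>{a..b}. x) \<in> borel_measurable (lebesgue_on {a..b})"
    by (subst measurable_cong[where g="\<lambda>s. x"]) auto
  then show ?thesis using assms by (auto simp: controls_def)
qed

context game
begin

lemma pay_combine:
  assumes "u \<in> controls t0 T U" "v \<in> controls t0 T V" "0 \<le> t0" "t0 \<le> a" "a \<le> b" "b \<le> c" "c \<le> T"
  shows "pay i a c u v = pay i a b u v + pay i b c u v"
proof -
  have "{a..c} = {a..b} \<union> {b..c}" using assms by auto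
  then show ?thesis unfolding pay_def using assms AE_lebesgue_neq[of b]
    by (simp only:, intro set_integral_Un_AE) (auto intro!: l_integrable elim!: AE_mp)
qed

lemma pay_grid:
  assumes "u \<in> controls (r 0) T U" "v \<in> controls (r 0) T V" "0 \<le> r 0" "grid r n" "r n \<le> T"
  shows "pay i (r 0) (r n) u v = (\<Sum>k<n. pay i (r k) (r (Suc k)) u v)"
proof -
  have "j \<le> n \<Longrightarrow> pay i (r 0) (r j) u v = (\<Sum>k<j. pay i (r k) (r (Suc k)) u v)" for j
  proof (induction j)
    case 0
    then show ?case using pay_bound[OF assms(1-3), of "r 0" "r 0" i] assms(5) grid_le[OF assms(4), of 0 n] by simp
  next
    case (Suc j)
    then show ?case 
      using pay_combine[OF assms(1-3), of "r 0" "r j" "r (Suc j)" i] assms(5)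
        grid_le[OF assms(4), of 0 j] grid_le[OF assms(4), of j "Suc j"] grid_le[OF assms(4), of "Suc j" n]
      by simp
  qed
  then show ?thesis by simp
qed

lemma controls_ne: "controls a b U \<noteq> {}" "controls a b V \<noteq> {}"
  using constant_controls U_ne V_ne by blast+

end

section \<open>Elementary properties of the value\<close>

locale random_game = game T U V l for T and U :: "'u::euclidean_space set" and V :: "'v::euclidean_space set"
    and l :: "'i::finite \<Rightarrow> real \<Rightarrow> 'u \<Rightarrow> 'v \<Rightarrow> real" +
  fixes \<E> :: "'w measure set"
  assumes randomization: "randomization_class \<E>"
begin

abbreviation Val :: "real \<Rightarrow> real^'i \<Rightarrow> real" where
  "Val \<equiv> game_value \<E> T U V l"

definition SU :: "real \<Rightarrow> ('w measure \<times> ('w \<Rightarrow> (real \<Rightarrow> 'v) \<Rightarrow> (real \<Rightarrow> 'u))) set" where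
  "SU t = random_strategies \<E> t T V U"

definition SV :: "real \<Rightarrow> ('w measure \<times> ('w \<Rightarrow> (real \<Rightarrow> 'u) \<Rightarrow> (real \<Rightarrow> 'v))) set" where
  "SV t = random_strategies \<E> t T U V"

definition J where
  "J t p \<alpha> \<beta> = (\<Sum>i\<in>UNIV. p $ i * expected_payoff t T U V (l i) (\<alpha> i) \<beta>)"

lemma prob_space_SU: "\<alpha> \<in> SU t \<Longrightarrow> prob_space (fst \<alpha>)"
  and prob_space_SV: "\<beta> \<in> SV t \<Longrightarrow> prob_space (fst \<beta>)"
  using randomization unfolding SU_def SV_def random_strategies_def randomization_class_def by auto

lemma SU_delayed: "\<alpha> \<in> SU t \<Longrightarrow> \<omega> \<in> space (fst \<alpha>) \<Longrightarrow> delayed t T V U (snd \<alpha> \<omega>)"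
  and SV_delayed: "\<beta> \<in> SV t \<Longrightarrow> \<omega> \<in> space (fst \<beta>) \<Longrightarrow> delayed t T U V (snd \<beta> \<omega>)"
  unfolding SU_def SV_def by (auto intro: random_strategy_delayed)

text \<open>\<open>play\<close> selects some solution of the two strategy equations, so the premise
  asks for the same payoff at every solution; the selected one is then covered.\<close>

lemma expected_payoff_eq:
  assumes "\<alpha> \<in> SU t" "\<beta> \<in> SV t"
    and "\<And>\<omega>1 \<omega>2 u v. \<omega>1 \<in> space (fst \<alpha>) \<Longrightarrow> \<omega>2 \<in> space (fst \<beta>) \<Longrightarrow>
      u \<in> controls t T U \<Longrightarrow> v \<in> controls t T V \<Longrightarrow>
      ae_eq t T (snd \<alpha> \<omega>1 v) u \<Longrightarrow> ae_eq t T (snd \<beta> \<omega>2 u) v \<Longrightarrow> pay i t T u v = X \<omega>1 \<omega>2"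
  shows "expected_payoff t T U V (l i) \<alpha> \<beta> = (LINT \<omega>|(fst \<alpha> \<Otimes>\<^sub>M fst \<beta>). X (fst \<omega>) (snd \<omega>))"
  unfolding expected_payoff_def
proof (rule Bochner_Integration.integral_cong[OF refl])
  fix \<omega> assume "\<omega> \<in> space (fst \<alpha> \<Otimes>\<^sub>M fst \<beta>)"
  then have \<omega>: "fst \<omega> \<in> space (fst \<alpha>)" "snd \<omega> \<in> space (fst \<beta>)" by (auto simp: space_pair_measure)
  obtain u v where "play t T U V (snd \<alpha> (fst \<omega>)) (snd \<beta> (snd \<omega>)) = (u, v)"
    "u \<in> controls t T U" "v \<in> controls t T V"
    "ae_eq t T (snd \<alpha> (fst \<omega>) v) u" "ae_eq t T (snd \<beta> (snd \<omega>) u) v"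
    using play_props[OF SU_delayed[OF assms(1) \<omega>(1)] SV_delayed[OF assms(2) \<omega>(2)] controls_ne(2)] by blast
  with assms(3)[OF \<omega>] show "(let (u, v) = play t T U V (snd \<alpha> (fst \<omega>)) (snd \<beta> (snd \<omega>))
         in LINT s:{t..T}|lebesgue. l i s (u s) (v s)) = X (fst \<omega>) (snd \<omega>)"
    by (simp add: pay_def)
qed

lemma prob_space_pair_strategies:
  assumes "\<alpha> \<in> SU t" "\<beta> \<in> SV t"
  shows "prob_space (fst \<alpha> \<Otimes>\<^sub>M fst \<beta>)"
proof -
  interpret a: prob_space "fst \<alpha>" using assms prob_space_SU by blast
  interpret b: prob_space "fst \<beta>" using assms prob_space_SV by blast
  interpret pair_prob_space "fst \<alpha>" "fst \<beta>" ..
  show ?thesis by (rule P.prob_space_axioms)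
qed

lemma expected_payoff_bound:
  assumes "\<alpha> \<in> SU t" "\<beta> \<in> SV t" "t \<in> {0..<T}"
  shows "\<bar>expected_payoff t T U V (l i) \<alpha> \<beta>\<bar> \<le> C * T"
  unfolding expected_payoff_def
proof (rule prob_integral_abs_le[OF prob_space_pair_strategies[OF assms(1,2)]])
  show "0 \<le> C * T" using C_pos T_pos by simp
  fix \<omega> assume "\<omega> \<in> space (fst \<alpha> \<Otimes>\<^sub>M fst \<beta>)"
  then have \<omega>: "fst \<omega> \<in> space (fst \<alpha>)" "snd \<omega> \<in> space (fst \<beta>)" by (auto simp: space_pair_measure)
  obtain u v where *: "play t T U V (snd \<alpha> (fst \<omega>)) (snd \<beta> (snd \<omega>)) = (u, v)"
    "u \<in> controls t T U" "v \<in> controls t T V"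
    using play_props[OF SU_delayed[OF assms(1) \<omega>(1)] SV_delayed[OF assms(2) \<omega>(2)] controls_ne(2)] by blast
  have "\<bar>pay i t T u v\<bar> \<le> (T - t) * C" using pay_bound[OF *(2,3), of t T i] assms(3) by simp
  also have "\<dots> \<le> C * T" using assms(3) C_pos by (simp add: algebra_simps)
  finally show "\<bar>let (u, v) = play t T U V (snd \<alpha> (fst \<omega>)) (snd \<beta> (snd \<omega>))
         in LINT s:{t..T}|lebesgue. l i s (u s) (v s)\<bar> \<le> C * T"
    using * by (simp add: pay_def)
qed

lemma J_diff:
  assumes "\<And>i. \<alpha> i \<in> SU t" "\<beta> \<in> SV t" "t \<in> {0..<T}"
  shows "\<bar>J t p \<alpha> \<beta> - J t q \<alpha> \<beta>\<bar> \<le> C * T * (\<Sum>i\<in>UNIV. \<bar>p $ i - q $ i\<bar>)"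
proof -
  have "J t p \<alpha> \<beta> - J t q \<alpha> \<beta> = (\<Sum>i\<in>UNIV. (p $ i - q $ i) * expected_payoff t T U V (l i) (\<alpha> i) \<beta>)"
    by (simp add: J_def sum_subtractf left_diff_distrib)
  also have "\<bar>\<dots>\<bar> \<le> (\<Sum>i\<in>UNIV. \<bar>p $ i - q $ i\<bar> * (C * T))"
    using expected_payoff_bound[OF assms(1) assms(2,3)]
    by (intro order_trans[OF sum_abs] sum_mono) (auto simp: abs_mult intro!: mult_left_mono)
  finally show ?thesis by (simp add: sum_distrib_left mult.commute)
qed

lemma strategies_ne: 
  assumes "t < T" shows "SU t \<noteq> {}" "SV t \<noteq> {}"
proof -
  obtain M where M: "M \<in> \<E>" using randomization by (auto simp: randomization_class_def)
  obtain u v where uv: "u \<in> U" "v \<in> V" using U_ne V_ne by auto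
  have "(M, \<lambda>_ _. \<lambda>s\<in>{t..T}. u) \<in> SU t" "(M, \<lambda>_ _. \<lambda>s\<in>{t..T}. v) \<in> SV t"
    unfolding SU_def SV_def using assms M constant_controls[OF uv(1)] constant_controls[OF uv(2)]
    by (auto intro!: random_strategiesI[where \<tau>="\<lambda>j. if j = 0 then t else T" and k=1])
  then show "SU t \<noteq> {}" "SV t \<noteq> {}" by auto
qed

lemma J_bdd:
  assumes "t \<in> {0..<T}"
  shows "\<forall>i. \<alpha> i \<in> SU t \<Longrightarrow> bdd_above (J t p \<alpha> ` SV t)"
    "bdd_below ((\<lambda>\<alpha>. SUP \<beta>\<in>SV t. J t p \<alpha> \<beta>) ` {\<alpha>. \<forall>i. \<alpha> i \<in> SU t})"
proof -
  define B where "B = C * T * (\<Sum>i\<in>UNIV. \<bar>p $ i\<bar>)"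
  have B: "- B \<le> J t p \<alpha> \<beta>" "J t p \<alpha> \<beta> \<le> B" if "\<forall>i. \<alpha> i \<in> SU t" "\<beta> \<in> SV t" for \<alpha> \<beta>
    using J_diff[where \<alpha>=\<alpha> and t=t and \<beta>=\<beta> and p=p and q=0] that assms by (auto simp: J_def B_def)
  show 1: "bdd_above (J t p \<alpha> ` SV t)" if "\<forall>i. \<alpha> i \<in> SU t" for \<alpha>
    using B that by (intro bdd_aboveI2[where M=B]) auto
  obtain \<beta> where \<beta>: "\<beta> \<in> SV t" using strategies_ne[of t] assms by fastforce
  show "bdd_below ((\<lambda>\<alpha>. SUP \<beta>\<in>SV t. J t p \<alpha> \<beta>) ` {\<alpha>. \<forall>i. \<alpha> i \<in> SU t})"
    using B \<beta> 1 by (intro bdd_belowI2[where m="- B"] cSUP_upper2[where x=\<beta>]) auto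
qed

lemma Val_eq: "t \<in> {0..<T} \<Longrightarrow> Val t p = (INF \<alpha>\<in>{\<alpha>. \<forall>i. \<alpha> i \<in> SU t}. SUP \<beta>\<in>SV t. J t p \<alpha> \<beta>)"
  by (simp add: game_value_def SU_def SV_def J_def)

lemma Val_leI:
  assumes "t \<in> {0..<T}" "\<And>i. \<alpha> i \<in> SU t" "\<And>\<beta>. \<beta> \<in> SV t \<Longrightarrow> J t p \<alpha> \<beta> \<le> x"
  shows "Val t p \<le> x"
  unfolding Val_eq[OF assms(1)] using assms strategies_ne[of t]
  by (intro cINF_lower2[OF J_bdd(2)[OF assms(1)], where x=\<alpha>] cSUP_least) auto

lemma Val_near_optimal:
  assumes "t \<in> {0..<T}" "0 < e"
  obtains \<alpha> where "\<And>i. \<alpha> i \<in> SU t" "\<And>\<beta>. \<beta> \<in> SV t \<Longrightarrow> J t p \<alpha> \<beta> \<le> Val t p + e"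
proof -
  obtain \<alpha>0 where "\<alpha>0 \<in> SU t" using strategies_ne[of t] assms by fastforce
  then have ne: "{\<alpha>. \<forall>i::'i. \<alpha> i \<in> SU t} \<noteq> {}" by (auto intro: exI[of _ "\<lambda>_. \<alpha>0"])
  have "(INF \<alpha>\<in>{\<alpha>. \<forall>i. \<alpha> i \<in> SU t}. SUP \<beta>\<in>SV t. J t p \<alpha> \<beta>) < Val t p + e"
    using assms by (simp add: Val_eq)
  then obtain \<alpha> where \<alpha>: "\<forall>i. \<alpha> i \<in> SU t" "(SUP \<beta>\<in>SV t. J t p \<alpha> \<beta>) < Val t p + e"
    using cINF_less_iff[OF ne J_bdd(2)[OF assms(1)], of p] by auto
  moreover have "J t p \<alpha> \<beta> \<le> (SUP \<beta>\<in>SV t. J t p \<alpha> \<beta>)" if "\<beta> \<in> SV t" for \<beta>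
    using J_bdd(1)[OF assms(1) \<alpha>(1)] that by (intro cSUP_upper) auto
  ultimately show ?thesis using that[of \<alpha>] by (meson less_imp_le order_trans)
qed

lemma Val_T [simp]: "Val T p = 0"
  by (simp add: game_value_def)

lemma Val_Lipschitz_le:
  assumes "t \<in> {0..T}"
  shows "Val t p \<le> Val t q + C * T * (\<Sum>i\<in>UNIV. \<bar>p $ i - q $ i\<bar>)"
proof (cases "t = T")
  case True
  then show ?thesis using C_pos T_pos by (simp add: sum_nonneg)
next
  case False
  then have t: "t \<in> {0..<T}" using assms by auto
  show ?thesis
  proof (rule field_le_epsilon)
    fix e :: real assume "0 < e"
    then obtain \<alpha> where \<alpha>: "\<And>i. \<alpha> i \<in> SU t" "\<And>\<beta>. \<beta> \<in> SV t \<Longrightarrow> J t q \<alpha> \<beta> \<le> Val t q + e"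
      using Val_near_optimal[OF t, of e q] by blast
    show "Val t p \<le> Val t q + C * T * (\<Sum>i\<in>UNIV. \<bar>p $ i - q $ i\<bar>) + e"
    proof (rule Val_leI[OF t \<alpha>(1)])
      fix \<beta> assume "\<beta> \<in> SV t"
      then show "J t p \<alpha> \<beta> \<le> Val t q + C * T * (\<Sum>i\<in>UNIV. \<bar>p $ i - q $ i\<bar>) + e"
        using J_diff[where \<alpha>=\<alpha>, OF \<alpha>(1) _ t, where \<beta>=\<beta> and p=p and q=q] \<alpha>(2)[of \<beta>] by (simp add: abs_le_iff)
    qed
  qed
qed

end

section \<open>Randomisation devices\<close>

lemma randomization_class_product:
  "randomization_class \<E> \<Longrightarrow> M \<in> \<E> \<Longrightarrow> N \<in> \<E> \<Longrightarrow> \<exists>K\<in>\<E>. isomorphic_measures K (M \<Otimes>\<^sub>M N)"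
  by (simp add: randomization_class_def)

lemma randomization_class_prob_space: "randomization_class \<E> \<Longrightarrow> M \<in> \<E> \<Longrightarrow> prob_space M"
  by (simp add: randomization_class_def)

text \<open>Two independent copies of a partition square the bound on the largest cell, which
  doubles the exponent of \<open>c\<close>. The product space belongs to the class only up to
  isomorphism, so its cells are pulled back along the measure-preserving map
  \<open>f\<close>.\<close>

lemma fine_partition:
  assumes "randomization_class \<E>" and biased: "\<exists>K\<in>\<E>. \<exists>A\<in>sets K. measure K A \<le> c \<and> 1 - measure K A \<le> c"
  shows "\<exists>K\<in>\<E>. \<exists>g::'w \<Rightarrow> nat. \<exists>N. g \<in> K \<rightarrow>\<^sub>M count_space UNIV \<and> (\<forall>\<omega>. g \<omega> < N) \<and>
    (\<forall>j. measure K {\<omega>\<in>space K. g \<omega> = j} \<le> c ^ (2 ^ n))"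
proof (induction n)
  case 0
  obtain K A where K: "K \<in> \<E>" "A \<in> sets K" "measure K A \<le> c" "1 - measure K A \<le> c"
    using biased by auto
  interpret prob_space K using K(1) assms(1) by (auto simp: randomization_class_def)
  have "measure K {\<omega>\<in>space K. of_bool (\<omega> \<in> A) = j} \<le> c" for j :: nat
  proof -
    consider "j = 0" | "j = 1" | "j > 1" by linarith
    then show ?thesis
    proof cases
      case 1
      then have "{\<omega>\<in>space K. of_bool (\<omega> \<in> A) = j} = space K - A" by auto
      then show ?thesis using prob_compl[OF K(2)] K by simp
    next
      case 2
      then have "{\<omega>\<in>space K. of_bool (\<omega> \<in> A) = j} = A" using sets.sets_into_space[OF K(2)] by auto
      then show ?thesis using K by simp
    next
      case 3
      then have e: "{\<omega>\<in>space K. of_bool (\<omega> \<in> A) = j} = {}" by (auto simp: of_bool_def split: if_splits)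
      show ?thesis unfolding e using order_trans[OF measure_nonneg K(3)] by simp
    qed
  qed
  moreover have "(\<lambda>\<omega>. of_bool (\<omega> \<in> A)) \<in> K \<rightarrow>\<^sub>M count_space (UNIV :: nat set)"
    using K(2) unfolding of_bool_def by measurable
  moreover have "\<forall>\<omega>. of_bool (\<omega> \<in> A) < (2::nat)" by auto
  ultimately show ?case using K(1) by (intro bexI[of _ K] exI[of _ "\<lambda>\<omega>. of_bool (\<omega> \<in> A)"] exI[of _ 2]) auto
next
  case (Suc n)
  then obtain M and g :: "'w \<Rightarrow> nat" and N where M: "M \<in> \<E>" "g \<in> M \<rightarrow>\<^sub>M count_space UNIV" "\<And>\<omega>. g \<omega> < N"
    "\<And>j. measure M {\<omega>\<in>space M. g \<omega> = j} \<le> c ^ (2 ^ n)" by auto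
  obtain K where K: "K \<in> \<E>" "isomorphic_measures K (M \<Otimes>\<^sub>M M)"
    by (rule bexE[OF randomization_class_product[OF assms(1) M(1) M(1)]])
  obtain f where f: "f \<in> K \<rightarrow>\<^sub>M M \<Otimes>\<^sub>M M" "distr K (M \<Otimes>\<^sub>M M) f = M \<Otimes>\<^sub>M M"
    using K(2) unfolding isomorphic_measures_def by (elim exE conjE)
  interpret prob_space M by (rule randomization_class_prob_space[OF assms(1) M(1)])
  have sf: "sigma_finite_measure M"
    by (rule prob_space_imp_sigma_finite[OF randomization_class_prob_space[OF assms(1) M(1)]])
  interpret pair_prob_space M M ..
  \<comment> \<open>Pairs of cell numbers below \<open>N\<close> are coded in base \<open>N\<close>;
    \<open>mod\<close> and \<open>div\<close> recover them.\<close>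
  define h where "h = (\<lambda>\<omega>. g (fst (f \<omega>)) + N * g (snd (f \<omega>)))"
  have [measurable]: "f \<in> K \<rightarrow>\<^sub>M M \<Otimes>\<^sub>M M" "g \<in> M \<rightarrow>\<^sub>M count_space UNIV" by fact+
  have "h \<in> K \<rightarrow>\<^sub>M count_space UNIV" unfolding h_def by measurable
  moreover have "h \<omega> < N + N * N" for \<omega>
    using M(3)[of "fst (f \<omega>)"] M(3)[of "snd (f \<omega>)"] unfolding h_def
    by (intro add_less_le_mono mult_le_mono) auto
  moreover have "measure K {\<omega>\<in>space K. h \<omega> = j} \<le> c ^ (2 ^ Suc n)" for j
  proof -
    define A where "A a = {\<omega>\<in>space M. g \<omega> = a}" for a
    have A: "A a \<in> sets M" for a unfolding A_def by measurable
    have N: "0 < N" using M(3)[of undefined] by simp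
    have sub: "{\<omega>\<in>space K. h \<omega> = j} \<subseteq> f -` (A (j mod N) \<times> A (j div N)) \<inter> space K"
    proof
      fix \<omega> assume \<omega>: "\<omega> \<in> {\<omega>\<in>space K. h \<omega> = j}"
      then have "f \<omega> \<in> space (M \<Otimes>\<^sub>M M)" using measurable_space[OF f(1)] by auto
      moreover have "g (fst (f \<omega>)) = j mod N" "g (snd (f \<omega>)) = j div N"
        using \<omega> M(3)[of "fst (f \<omega>)"] N by (auto simp: h_def)
      ultimately show "\<omega> \<in> f -` (A (j mod N) \<times> A (j div N)) \<inter> space K"
        using \<omega> by (cases "f \<omega>") (auto simp: A_def space_pair_measure)
    qed
    interpret K: prob_space K by (rule randomization_class_prob_space[OF assms(1) K(1)])
    have "measure K {\<omega>\<in>space K. h \<omega> = j} \<le> measure K (f -` (A (j mod N) \<times> A (j div N)) \<inter> space K)"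
      using A by (intro K.finite_measure_mono[OF sub] measurable_sets[OF f(1)]) auto
    also have "\<dots> = measure (distr K (M \<Otimes>\<^sub>M M) f) (A (j mod N) \<times> A (j div N))"
      using A by (subst measure_distr) auto
    also have "\<dots> = measure M (A (j mod N)) * measure M (A (j div N))"
      unfolding f(2) measure_def sigma_finite_measure.emeasure_pair_measure_Times[OF sf A A] enn2real_mult ..
    also have "\<dots> \<le> c ^ (2 ^ n) * c ^ (2 ^ n)"
      using M(4) measure_nonneg[of M] order_trans[OF measure_nonneg M(4)]
      by (intro mult_mono) (auto simp: A_def)
    finally show ?thesis by (simp add: power_add[symmetric] mult_2)
  qed
  ultimately show ?case using K(1) by blast
qed

text \<open>Thresholding the cumulative distribution function of a fine partition.\<close>

lemma approximate_distribution:
  assumes "randomization_class \<E>" "0 < \<eta>" "\<And>j. j < N \<Longrightarrow> 0 \<le> w j" "(\<Sum>j<N. w j) = 1"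
  obtains K and f :: "'w \<Rightarrow> nat" where "K \<in> \<E>" "f \<in> K \<rightarrow>\<^sub>M count_space {..<N}"
    "\<And>j. j < N \<Longrightarrow> \<bar>measure K {\<omega>\<in>space K. f \<omega> = j} - w j\<bar> \<le> \<eta>"
proof -
  have N: "0 < N" using assms(4) by (cases N) auto
  obtain K0 A where K0: "K0 \<in> \<E>" "A \<in> sets K0" "0 < measure K0 A" "measure K0 A < 1"
    using assms(1) by (auto simp: randomization_class_def)
  define c where "c = max (measure K0 A) (1 - measure K0 A)"
  have c: "0 \<le> c" "c < 1" using K0 by (auto simp: c_def)
  obtain n where n: "c ^ n < \<eta>" using real_arch_pow_inv[OF assms(2) c(2)] by blast
  have "n \<le> 2 ^ n" using less_exp[of n] by simp
  then have "c ^ (2 ^ n) \<le> c ^ n" using c by (intro power_decreasing) auto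
  moreover have "\<exists>K\<in>\<E>. \<exists>A\<in>sets K. measure K A \<le> c \<and> 1 - measure K A \<le> c"
    using K0 by (intro bexI[of _ K0] bexI[of _ A]) (auto simp: c_def)
  ultimately obtain K and g :: "'w \<Rightarrow> nat" and m where K: "K \<in> \<E>" "g \<in> K \<rightarrow>\<^sub>M count_space UNIV" 
    "\<And>\<omega>. g \<omega> < m" "\<And>j. measure K {\<omega>\<in>space K. g \<omega> = j} \<le> \<eta>"
    using fine_partition[OF assms(1), of c n] n by (meson less_imp_le order_trans)
  interpret prob_space K using K(1) assms(1) by (auto simp: randomization_class_def)
  have [measurable]: "g \<in> K \<rightarrow>\<^sub>M count_space UNIV" by fact
  define S where "S j = measure K {\<omega>\<in>space K. g \<omega> < j}" for j
  have S_Suc: "S (Suc j) = S j + measure K {\<omega>\<in>space K. g \<omega> = j}" for j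
  proof -
    have "{\<omega>\<in>space K. g \<omega> < Suc j} = {\<omega>\<in>space K. g \<omega> < j} \<union> {\<omega>\<in>space K. g \<omega> = j}" by auto
    then show ?thesis unfolding S_def by (subst finite_measure_Union[symmetric]) (auto simp: less_Suc_eq)
  qed
  have S_mono: "mono S" by (rule mono_iff_le_Suc[THEN iffD2]) (simp add: S_Suc)
  have Sm: "S m = 1" using K(3) by (simp add: S_def prob_space)
  define W where "W a = (\<Sum>b<a. w b)" for a
  have W_mono: "W a \<le> W b" if "a \<le> b" "b \<le> N" for a b
    unfolding W_def using that assms(3) by (intro sum_mono2) auto
  \<comment> \<open>The distribution function \<open>S\<close> of the cell number jumps by at most
    \<open>\<eta>\<close>, so the first value that reaches \<open>W a\<close> overshoots it by at
    most \<open>\<eta>\<close>.\<close>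
  have cum: "W a \<le> measure K {\<omega>\<in>space K. S (g \<omega>) < W a} \<and> measure K {\<omega>\<in>space K. S (g \<omega>) < W a} \<le> W a + \<eta>"
    if a: "a \<le> N" for a
  proof (cases "W a \<le> 0")
    case True
    have "W a = 0" using True W_mono[of 0 a] a by (simp add: W_def)
    moreover have "\<not> S j < 0" for j by (simp add: S_def not_less)
    ultimately show ?thesis using assms(2) by simp
  next
    case False
    have "W a \<le> 1" using W_mono[of a N] a assms(4) by (simp add: W_def)
    then have ex: "W a \<le> S m" by (simp add: Sm)
    define k where "k = (LEAST j. W a \<le> S j)"
    have k: "W a \<le> S k" unfolding k_def using ex by (rule LeastI)
    have less: "S j < W a \<longleftrightarrow> j < k" for j
    proof
      assume "S j < W a"
      then have "\<not> k \<le> j" using k monoD[OF S_mono, of k j] by auto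
      then show "j < k" by simp
    next
      assume "j < k"
      then show "S j < W a" unfolding k_def using not_less_Least by fastforce
    qed
    have "measure K {\<omega>\<in>space K. S (g \<omega>) < W a} = S k" unfolding less by (simp add: S_def)
    moreover have "S k \<le> W a + \<eta>"
    proof (cases k)
      case 0
      then show ?thesis using False k assms(2) by (simp add: S_def)
    next
      case (Suc j)
      then show ?thesis using S_Suc[of j] less[of j] K(4)[of j] by simp
    qed
    ultimately show ?thesis using k by simp
  qed
  \<comment> \<open>The number of thresholds passed is the generalised inverse of the target
    distribution function evaluated at \<open>S (g \<omega>)\<close>.\<close>
  define f where "f \<omega> = card {a\<in>{1..<N}. W a \<le> S (g \<omega>)}" for \<omega>
  have f_less: "f \<omega> < a \<longleftrightarrow> S (g \<omega>) < W a" if "1 \<le> a" "a < N" for \<omega> a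
  proof
    assume *: "S (g \<omega>) < W a"
    have "{b\<in>{1..<N}. W b \<le> S (g \<omega>)} \<subseteq> {1..<a}"
    proof
      fix b assume b: "b \<in> {b\<in>{1..<N}. W b \<le> S (g \<omega>)}"
      then have "\<not> a \<le> b" using W_mono[of a b] * that by auto
      then show "b \<in> {1..<a}" using b by auto
    qed
    then have "f \<omega> \<le> card {1..<a}" unfolding f_def by (intro card_mono) auto
    then show "f \<omega> < a" using that by simp
  next
    assume *: "f \<omega> < a"
    show "S (g \<omega>) < W a"
    proof (rule ccontr)
      assume n: "\<not> S (g \<omega>) < W a"
      have "{1..a} \<subseteq> {b\<in>{1..<N}. W b \<le> S (g \<omega>)}"
      proof
        fix b assume "b \<in> {1..a}"
        then show "b \<in> {b\<in>{1..<N}. W b \<le> S (g \<omega>)}" using W_mono[of b a] n that by auto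
      qed
      then have "card {1..a} \<le> f \<omega>" unfolding f_def by (intro card_mono) auto
      then show False using * by simp
    qed
  qed
  have f_N: "f \<omega> < N" for \<omega>
  proof -
    have "f \<omega> \<le> card {1..<N}" unfolding f_def by (intro card_mono) auto
    then show ?thesis using N by simp
  qed
  have fm: "f \<in> K \<rightarrow>\<^sub>M count_space UNIV"
    unfolding f_def by (rule measurable_compose[OF K(2)]) simp
  have f_cum: "W a \<le> measure K {\<omega>\<in>space K. f \<omega> < a} \<and> measure K {\<omega>\<in>space K. f \<omega> < a} \<le> W a + \<eta>"
    if aN: "a \<le> N" for a
  proof -
    consider "a = 0" | "1 \<le> a" "a < N" | "a = N" using aN by linarith
    then show ?thesis
    proof cases
      case 2
      then show ?thesis using cum[of a] f_less[of a] by simp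
    next
      case 3
      then have "{\<omega>\<in>space K. f \<omega> < a} = space K" using f_N by auto
      moreover have "W a = 1" using 3 assms(4) by (simp add: W_def)
      ultimately show ?thesis using assms(2) by (simp add: prob_space)
    qed (use assms(2) in \<open>simp add: W_def\<close>)
  qed
  show ?thesis
  proof (rule that[OF K(1)])
    show "f \<in> K \<rightarrow>\<^sub>M count_space {..<N}"
      using fm f_N by (auto intro!: measurableI dest: measurable_sets simp: measurable_count_space_eq2)
    fix j assume j: "j < N"
    have "{\<omega>\<in>space K. f \<omega> < Suc j} = {\<omega>\<in>space K. f \<omega> < j} \<union> {\<omega>\<in>space K. f \<omega> = j}" by auto
    moreover have "{\<omega>\<in>space K. f \<omega> < j} \<in> sets K" "{\<omega>\<in>space K. f \<omega> = j} \<in> sets K"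
      using fm by measurable
    ultimately have "measure K {\<omega>\<in>space K. f \<omega> < Suc j} =
        measure K {\<omega>\<in>space K. f \<omega> < j} + measure K {\<omega>\<in>space K. f \<omega> = j}"
      by (subst finite_measure_Union[symmetric]) auto
    moreover have "W (Suc j) = W j + w j" by (simp add: W_def)
    \<comment> \<open>Both cumulative errors lie between 0 and \<open>\<eta>\<close>, so their
      difference loses only one \<open>\<eta>\<close>.\<close>
    ultimately show "\<bar>measure K {\<omega>\<in>space K. f \<omega> = j} - w j\<bar> \<le> \<eta>"
      using f_cum[of j] f_cum[of "Suc j"] j by (simp add: abs_le_iff)
  qed
qed

section \<open>Upper bound: open-loop plans of the informed player\<close>

context game
begin

lemma pay_vector_integral:
  assumes u: "u \<in> controls t0 T U" and v: "v \<in> controls t0 T V" and "0 \<le> t0" "t0 \<le> a" "b \<le> T"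
  shows "m \<bullet> (\<chi> i. pay i a b u v) = (LINT s:{a..b}|lebesgue. F s m (u s) (v s))"
    "set_integrable lebesgue {a..b} (\<lambda>s. F s m (u s) (v s))"
proof -
  have i: "set_integrable lebesgue {a..b} (\<lambda>s. m $ i * l i s (u s) (v s))" for i
    using l_integrable[OF assms] by (rule set_integrable_mult_right)
  show "m \<bullet> (\<chi> i. pay i a b u v) = (LINT s:{a..b}|lebesgue. F s m (u s) (v s))"
    unfolding F_def inner_vec_def pay_def set_lebesgue_integral_def scaleR_sum_right using i
    by (subst Bochner_Integration.integral_sum)
      (auto simp: set_integrable_def mult.left_commute simp flip: Bochner_Integration.integral_mult_right_zero)
  show "set_integrable lebesgue {a..b} (\<lambda>s. F s m (u s) (v s))"
    unfolding F_def set_integrable_def scaleR_sum_right using i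
    by (intro Bochner_Integration.integrable_sum) (simp add: set_integrable_def)
qed

text \<open>Comparing with the left end point of each interval fits the players, who choose actions
  at grid times for the payoffs seen there.\<close>

definition fine_grid :: "real \<Rightarrow> (nat \<Rightarrow> real) \<Rightarrow> nat \<Rightarrow> bool" where
  "fine_grid \<rho> r n \<longleftrightarrow> grid r n \<and> 0 \<le> r 0 \<and> r n = T \<and> 0 \<le> \<rho> \<and>
     (\<forall>k<n. \<forall>s\<in>{r k..r (Suc k)}. \<forall>i. \<forall>u\<in>U. \<forall>v\<in>V. \<bar>l i s u v - l i (r k) u v\<bar> \<le> \<rho>)"

lemma fine_grid_range:
  assumes "fine_grid \<rho> r n" "k \<le> n" shows "r k \<in> {0..T}"
  using assms grid_le[of r n 0 k] grid_le[of r n k n] by (auto simp: fine_grid_def)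

lemma fine_grid_F:
  assumes "fine_grid \<rho> r n" "k < n" "s \<in> {r k..r (Suc k)}" "nonneg m" "u \<in> U" "v \<in> V"
  shows "\<bar>F s m u v - F (r k) m u v\<bar> \<le> \<rho> * mass m"
proof -
  have "r k \<in> {0..T}" "r (Suc k) \<in> {0..T}"
    using fine_grid_range[OF assms(1)] assms(2) by auto
  then have "\<bar>F s m u v - F (r k) m u v\<bar> \<le> \<rho> * mass m + C * (\<Sum>i\<in>UNIV. \<bar>m $ i - m $ i\<bar>)"
    using assms by (intro F_diff) (auto simp: fine_grid_def)
  then show ?thesis by simp
qed

lemma fine_grid_exists:
  assumes "0 < \<rho>"
  obtains \<delta> where "0 < \<delta>" "\<And>r n. grid r n \<Longrightarrow> 0 \<le> r 0 \<Longrightarrow> r n = T \<Longrightarrow>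
    (\<And>k. k < n \<Longrightarrow> r (Suc k) - r k \<le> \<delta>) \<Longrightarrow> fine_grid \<rho> r n"
proof -
  obtain L where L: "0 \<le> L"
    "\<And>i s s' u u' v v'. s \<in> {0..T} \<Longrightarrow> s' \<in> {0..T} \<Longrightarrow> u \<in> U \<Longrightarrow> u' \<in> U \<Longrightarrow> v \<in> V \<Longrightarrow> v' \<in> V
      \<Longrightarrow> \<bar>l i s u v - l i s' u' v'\<bar> \<le> \<rho> / 2 + L * (\<bar>s - s'\<bar> + norm (u - u') + norm (v - v'))"
    using l_modulus[of "\<rho> / 2"] assms by auto
  define \<delta> where "\<delta> = \<rho> / (2 * (L + 1))"
  have d: "0 < \<delta>" "L * \<delta> \<le> \<rho> / 2" using assms L(1) by (auto simp: \<delta>_def field_simps)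
  show ?thesis
  proof (rule that[OF d(1)])
    fix r :: "nat \<Rightarrow> real" and n
    assume g: "grid r n" "0 \<le> r 0" "r n = T" "\<And>k. k < n \<Longrightarrow> r (Suc k) - r k \<le> \<delta>"
    have "\<bar>l i s u v - l i (r k) u v\<bar> \<le> \<rho>"
      if k: "k < n" "s \<in> {r k..r (Suc k)}" "u \<in> U" "v \<in> V" for k s i u v
    proof -
      have "0 \<le> r k" "r (Suc k) \<le> T"
        using g(2,3) grid_le[OF g(1), of 0 k] grid_le[OF g(1), of "Suc k" n] k by auto
      then have "\<bar>l i s u v - l i (r k) u v\<bar> \<le> \<rho> / 2 + L * (\<bar>s - r k\<bar> + norm (u - u) + norm (v - v))"
        using k by (intro L(2)) auto
      moreover have "L * \<bar>s - r k\<bar> \<le> L * \<delta>" using k(2) g(4)[OF k(1)] L(1) by (intro mult_left_mono) auto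
      ultimately show ?thesis using d(2) by simp
    qed
    then show "fine_grid \<rho> r n" using g assms by (auto simp: fine_grid_def)
  qed
qed

text \<open>The control equals the action \<open>x\<close> only almost everywhere; replacing it by a
  constant control changes no payoff and makes the bound on \<open>F\<close> available at every
  time. This is what \<open>responses\<close> demands on one interval.\<close>

lemma pay_vector_le:
  assumes r: "fine_grid \<rho> r n" and k: "k < n" and u: "u \<in> controls (r 0) T U" and v: "v \<in> controls (r 0) T V"
    and m: "nonneg m" and x: "x \<in> U" and eq: "ae_eq (r k) (r (Suc k)) u (\<lambda>_. x)"
    and b: "\<And>y. y \<in> V \<Longrightarrow> F (r k) m x y \<le> b"
  shows "m \<bullet> (\<chi> i. pay i (r k) (r (Suc k)) u v) \<le> (r (Suc k) - r k) * (b + \<rho> * mass m)"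
proof -
  have g: "grid r n" "0 \<le> r 0" "r n = T" using r by (auto simp: fine_grid_def)
  have rk: "r 0 \<le> r k" "r k < r (Suc k)" "r (Suc k) \<le> T"
    using grid_le[OF g(1), of 0 k] grid_less[OF g(1), of k "Suc k"] grid_le[OF g(1), of "Suc k" n] k g by auto
  define c where "c = (\<lambda>s\<in>{r 0..T}. x)"
  have c: "c \<in> controls (r 0) T U" unfolding c_def using x by (rule constant_controls)
  have cv: "\<And>s. s \<in> {r k..r (Suc k)} \<Longrightarrow> c s = x \<and> v s \<in> V" using rk v by (auto simp: c_def controls_def)
  then have "ae_eq (r k) (r (Suc k)) c (\<lambda>_. x)" by (intro ae_eqI_open) auto
  then have "ae_eq (r k) (r (Suc k)) u c" using eq ae_eq_sym ae_eq_trans by blast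
  then have "pay i (r k) (r (Suc k)) u v = pay i (r k) (r (Suc k)) c v" for i
    using rk g by (intro pay_cong[OF u v c v]) auto
  then have "m \<bullet> (\<chi> i. pay i (r k) (r (Suc k)) u v) = m \<bullet> (\<chi> i. pay i (r k) (r (Suc k)) c v)" by simp
  also have "\<dots> = (LINT s:{r k..r (Suc k)}|lebesgue. F s m (c s) (v s))"
    using rk g by (intro pay_vector_integral[OF c v]) auto
  also have "\<dots> \<le> (r (Suc k) - r k) * (b + \<rho> * mass m)"
  proof (rule set_integral_lebesgue_le)
    show "set_integrable lebesgue {r k..r (Suc k)} (\<lambda>s. F s m (c s) (v s))"
      using rk g by (intro pay_vector_integral[OF c v]) auto
    fix s assume s: "s \<in> {r k..r (Suc k)}"
    then show "F s m (c s) (v s) \<le> b + \<rho> * mass m"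
      using fine_grid_F[OF r k s m x, of "v s"] b[of "v s"] cv[OF s] by (simp add: abs_le_iff)
  qed (use rk in simp)
  finally show ?thesis .
qed

end

context random_game
begin

text \<open>Type \<open>i\<close> draws the sequence \<open>us j\<close> with probability close to
  \<open>q j $ i / p $ i\<close>, so the joint law of type and sequence is approximately
  \<open>q\<close>. The sequences are open loop, hence the opponent's reaction on an interval
  depends only on the actions up to it, and the payoffs form one function \<open>y\<close> of such
  histories.\<close>

lemma Val_le_plan:
  assumes r: "fine_grid \<rho> r n" and p: "p \<in> prob_simplex" and ps: "plan n p ps" and e: "0 < e"
    and X: "\<And>y. responses \<rho> r n y \<Longrightarrow> plan_payoff n ps y \<le> X"
  shows "Val (r 0) p \<le> X + e"
proof -
  have g: "grid r n" "0 \<le> r 0" "r n = T" using r by (auto simp: fine_grid_def)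
  have n: "0 < n" using g by (simp add: grid_def)
  define t where "t = r 0"
  have t: "t \<in> {0..<T}" using grid_less[OF g(1), of 0 n] g n by (auto simp: t_def)
  define N where "N = length ps"
  define q where "q j = fst (ps ! j)" for j
  define us where "us j = snd (ps ! j)" for j
  have qus: "nonneg (q j)" "length (us j) = n" "set (us j) \<subseteq> U" if "j < N" for j
    using ps nth_mem[of j ps] that unfolding plan_def q_def us_def N_def by (auto simp: case_prod_unfold)
  have q_sum: "(\<Sum>j<N. q j) = p"
  proof -
    have "(\<Sum>(q, us)\<leftarrow>ps. q) = (\<Sum>j<N. q j)"
      by (simp add: sum_list_sum_nth N_def q_def lessThan_atLeast0 case_prod_unfold)
    then show ?thesis using ps by (simp add: plan_def)
  qed
  have q_sum_i: "(\<Sum>j<N. q j $ i) = p $ i" for i using q_sum by (metis sum_component)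
  have p_nn: "0 \<le> p $ i" for i using p by (simp add: prob_simplex_def)
  have N: "0 < N"
  proof (rule ccontr)
    assume "\<not> 0 < N"
    then have "p = 0" using q_sum by simp
    then show False using p by (simp add: prob_simplex_def)
  qed
  \<comment> \<open>Each of the \<open>N\<close> sequences is misweighted by at most
    \<open>\<eta>\<close> and pays at most \<open>C * T\<close>, so averaging over types the total
    error is \<open>e\<close>.\<close>
  define \<eta> where "\<eta> = e / (real N * (C * T))"
  have \<eta>: "0 < \<eta>" using e N C_pos T_pos by (simp add: \<eta>_def)
  \<comment> \<open>A type of zero prior still needs a law; it plays sequence 0, which exists
    because \<open>N\<close> is positive.\<close>
  define w where "w i j = (if p $ i = 0 then of_bool (j = 0) else q j $ i / p $ i)" for i j
  have "\<exists>x. fst x \<in> \<E> \<and> snd x \<in> fst x \<rightarrow>\<^sub>M count_space {..<N} \<and>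
    (\<forall>j<N. \<bar>measure (fst x) {\<omega>\<in>space (fst x). snd x \<omega> = j} - w i j\<bar> \<le> \<eta>)" for i
  proof -
    have w: "0 \<le> w i j" if "j < N" for j
      using qus(1)[OF that] p_nn[of i] by (auto simp: w_def nonneg_def)
    have w1: "(\<Sum>j<N. w i j) = 1"
    proof (cases "p $ i = 0")
      case True
      then show ?thesis using N by (simp add: w_def of_bool_def)
    next
      case False
      then show ?thesis using q_sum_i[of i] by (simp add: w_def sum_divide_distrib[symmetric])
    qed
    show ?thesis
    proof (rule approximate_distribution[OF randomization \<eta> w w1])
      fix K and f :: "'w \<Rightarrow> nat"
      assume "K \<in> \<E>" "f \<in> K \<rightarrow>\<^sub>M count_space {..<N}"
        "\<And>j. j < N \<Longrightarrow> \<bar>measure K {\<omega>\<in>space K. f \<omega> = j} - w i j\<bar> \<le> \<eta>"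
      then show ?thesis by (intro exI[of _ "(K, f)"]) simp
    qed
  qed
  then have "\<exists>x. \<forall>i. fst (x i) \<in> \<E> \<and> snd (x i) \<in> fst (x i) \<rightarrow>\<^sub>M count_space {..<N} \<and>
    (\<forall>j<N. \<bar>measure (fst (x i)) {\<omega>\<in>space (fst (x i)). snd (x i) \<omega> = j} - w i j\<bar> \<le> \<eta>)"
    by (intro choice allI)
  then obtain x where x: "\<And>i. fst (x i) \<in> \<E>"
    "\<And>i. snd (x i) \<in> fst (x i) \<rightarrow>\<^sub>M count_space {..<N}"
    "\<And>i j. j < N \<Longrightarrow> \<bar>measure (fst (x i)) {\<omega>\<in>space (fst (x i)). snd (x i) \<omega> = j} - w i j\<bar> \<le> \<eta>"
    by auto
  define K where "K i = fst (x i)" for i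
  define f where "f i = snd (x i)" for i
  note K = x[folded K_def f_def]
  have f_less: "f i \<omega> < N" if "\<omega> \<in> space (K i)" for i \<omega>
    using measurable_space[OF K(2) that] by simp
  \<comment> \<open>A prefix is continued by its last action, so every history yields a control on
    the whole interval and can be shown to the opponent.\<close>
  define ctl where "ctl w = step_control r n (\<lambda>j. if j < length w then w ! j else last w)" for w :: "'u list"
  have ctl: "ctl w \<in> controls t T U" if "w \<noteq> []" "set w \<subseteq> U" for w
    unfolding ctl_def t_def g(3)[symmetric]
    using that last_in_set[OF that(1)] nth_mem by (intro step_control_controls g(1)) fastforce
  have us_ne: "us j \<noteq> []" if "j < N" for j using qus[OF that] n by auto
  have ctl_us: "ctl (us j) \<in> controls t T U" if "j < N" for j using ctl us_ne qus that by blast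
  define \<alpha> where "\<alpha> i = (K i, \<lambda>\<omega> (v::real \<Rightarrow> 'v). ctl (us (f i \<omega>)))" for i
  have \<alpha>: "\<alpha> i \<in> SU t" for i
    unfolding SU_def \<alpha>_def
  \<comment> \<open>The control ignores the opponent, so the partition with the single interval from
    \<open>t\<close> to \<open>T\<close> witnesses the delay.\<close>
  proof (rule random_strategiesI[where \<tau>="\<lambda>j. if j = 0 then t else T" and k=1, OF K(1)])
    have "(\<lambda>j. ctl (us j)) \<in> count_space {..<N} \<rightarrow>\<^sub>M control_space t T U"
      using ctl_us by auto
    from measurable_compose[OF measurable_compose[OF measurable_fst K(2)] this]
    show "(\<lambda>(\<omega>, b). ctl (us (f i \<omega>))) \<in> K i \<Otimes>\<^sub>M control_space t T V \<rightarrow>\<^sub>M control_space t T U"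
      by (simp add: case_prod_unfold)
  qed (use t in auto)
  show ?thesis
    unfolding t_def[symmetric]
  proof (rule Val_leI[OF t \<alpha>])
    fix \<beta> assume \<beta>: "\<beta> \<in> SV t"
    define M2 where "M2 = fst \<beta>"
    define b where "b = snd \<beta>"
    interpret M2: prob_space M2 unfolding M2_def by (rule prob_space_SV[OF \<beta>])
    have b_del: "delayed t T U V (b \<omega>)" if "\<omega> \<in> space M2" for \<omega>
      using SV_delayed[OF \<beta>] that by (simp add: M2_def b_def)
    have b_ctl: "b \<omega> u \<in> controls t T V" if "\<omega> \<in> space M2" "u \<in> controls t T U" for \<omega> u
      using b_del[OF that(1)] that(2) by (auto simp: delayed_def)
    define Y where "Y i j \<omega> = pay i t T (ctl (us j)) (b \<omega> (ctl (us j)))" for i j \<omega>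
    have Y_meas: "Y i j \<in> borel_measurable M2" if "j < N" for i j
    proof -
      have 1: "(\<lambda>\<omega>. b \<omega> (ctl (us j))) \<in> M2 \<rightarrow>\<^sub>M control_space t T V"
        unfolding b_def M2_def using \<beta> ctl_us[OF that] by (intro random_strategy_section) (auto simp: SV_def)
      have 2: "(\<lambda>v. pay i t T (ctl (us j)) v) \<in> borel_measurable (control_space t T V)"
        using t ctl_us[OF that] by (intro pay_measurable) auto
      show ?thesis using measurable_compose[OF 1 2] by (simp add: Y_def[abs_def])
    qed
    have Y_bound: "\<bar>Y i j \<omega>\<bar> \<le> C * T" if "j < N" "\<omega> \<in> space M2" for i j \<omega>
    proof -
      have "\<bar>Y i j \<omega>\<bar> \<le> (T - t) * C"
        unfolding Y_def using t by (intro pay_bound[OF ctl_us[OF that(1)] b_ctl[OF that(2) ctl_us[OF that(1)]]]) auto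
      also have "\<dots> \<le> C * T" using t C_pos by (simp add: algebra_simps)
      finally show ?thesis .
    qed
    have Y_int: "integrable M2 (Y i j)" if "j < N" for i j
      using Y_meas Y_bound that by (intro M2.integrable_const_bound[where B="C * T"]) (auto intro!: AE_I2)
    define Z where "Z i j = integral\<^sup>L M2 (Y i j)" for i j
    have Z_bound: "\<bar>Z i j\<bar> \<le> C * T" if "j < N" for i j
      unfolding Z_def using Y_bound[OF that] C_pos T_pos
      by (intro prob_integral_abs_le M2.prob_space_axioms) auto
    have payoff: "expected_payoff t T U V (l i) (\<alpha> i) \<beta> =
        (\<Sum>j<N. measure (K i) {\<omega>\<in>space (K i). f i \<omega> = j} * Z i j)" for i
    proof -
      interpret Ki: prob_space "K i" using K(1) randomization by (auto simp: randomization_class_def)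
      interpret pair_prob_space "K i" M2 ..
      have "expected_payoff t T U V (l i) (\<alpha> i) \<beta> = (LINT \<omega>|(fst (\<alpha> i) \<Otimes>\<^sub>M fst \<beta>). Y i (f i (fst \<omega>)) (snd \<omega>))"
      proof (rule expected_payoff_eq[OF \<alpha> \<beta>])
        fix \<omega>1 \<omega>2 u v
        assume a: "\<omega>1 \<in> space (fst (\<alpha> i))" "\<omega>2 \<in> space (fst \<beta>)" "u \<in> controls t T U" "v \<in> controls t T V"
          "ae_eq t T (snd (\<alpha> i) \<omega>1 v) u" "ae_eq t T (snd \<beta> \<omega>2 u) v"
        define c where "c = ctl (us (f i \<omega>1))"
        have c: "c \<in> controls t T U" using a(1) f_less ctl_us by (auto simp: c_def \<alpha>_def)
        have cu: "ae_eq t T c u" using a(5) by (simp add: \<alpha>_def c_def)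
        have \<omega>2: "\<omega>2 \<in> space M2" using a by (simp add: M2_def)
        have "ae_eq t T (b \<omega>2 u) (b \<omega>2 c)"
          using delayed_nonanticipative[OF b_del[OF \<omega>2] a(3) c _ ae_eq_sym[OF cu]] by simp
        then have "ae_eq t T v (b \<omega>2 c)" using a(6) ae_eq_trans ae_eq_sym unfolding b_def by blast
        then have "pay i t T u v = pay i t T c (b \<omega>2 c)"
          using t ae_eq_sym[OF cu] by (intro pay_cong[OF a(3,4) c b_ctl[OF \<omega>2 c]]) auto
        then show "pay i t T u v = Y i (f i \<omega>1) \<omega>2" by (simp add: Y_def c_def)
      qed
      also have "\<dots> = (LINT \<omega>|(K i \<Otimes>\<^sub>M M2). (\<lambda>(x, y). Y i (f i x) y) \<omega>)"
        by (simp add: \<alpha>_def M2_def case_prod_unfold)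
      also have "\<dots> = (LINT x|K i. LINT y|M2. Y i (f i x) y)"
      proof -
        have "integrable (K i \<Otimes>\<^sub>M M2) (\<lambda>(x, y). Y i (f i x) y)"
        proof (rule P.integrable_const_bound[where B="C * T"])
        show "(\<lambda>(x, y). Y i (f i x) y) \<in> borel_measurable (K i \<Otimes>\<^sub>M M2)"
          unfolding case_prod_unfold
        proof (rule measurable_compose_countable'[where I="{..<N}"])
          fix j assume "j \<in> {..<N}"
          then show "(\<lambda>x. Y i j (snd x)) \<in> borel_measurable (K i \<Otimes>\<^sub>M M2)"
            using Y_meas[of j i] by (intro measurable_compose[OF measurable_snd]) auto
        qed (auto intro: measurable_compose[OF measurable_fst K(2)])
        show "AE x in K i \<Otimes>\<^sub>M M2. norm (case x of (x, y) \<Rightarrow> Y i (f i x) y) \<le> C * T"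
          using Y_bound f_less by (intro AE_I2) (auto simp: space_pair_measure)
        qed
        from integral_fst'[OF this] show ?thesis by simp
      qed
      also have "\<dots> = (LINT x|K i. (\<Sum>j<N. indicator {\<omega>\<in>space (K i). f i \<omega> = j} x * Z i j))"
      proof (rule Bochner_Integration.integral_cong[OF refl])
        fix x assume x: "x \<in> space (K i)"
        have "(\<Sum>j<N. indicator {\<omega>\<in>space (K i). f i \<omega> = j} x * Z i j) = (\<Sum>j<N. if f i x = j then Z i j else 0)"
          using x by (intro sum.cong) auto
        then show "(LINT y|M2. Y i (f i x) y) = (\<Sum>j<N. indicator {\<omega>\<in>space (K i). f i \<omega> = j} x * Z i j)"
          using f_less[OF x] by (simp add: Z_def)
      qed
      also have "\<dots> = (\<Sum>j<N. measure (K i) {\<omega>\<in>space (K i). f i \<omega> = j} * Z i j)"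
      proof -
        have m: "{\<omega>\<in>space (K i). f i \<omega> = j} \<in> sets (K i)" if "j < N" for j
        proof -
          have "{\<omega>\<in>space (K i). f i \<omega> = j} = f i -` {j} \<inter> space (K i)" by auto
          then show ?thesis using measurable_sets[OF K(2), of "{j}"] that by simp
        qed
        show ?thesis using m
          by (subst Bochner_Integration.integral_sum) 
            (auto intro!: integrable_mult_left integrable_real_indicator simp: Ki.emeasure_eq_measure)
      qed
      finally show ?thesis .
    qed
    have "J t p \<alpha> \<beta> = (\<Sum>i\<in>UNIV. \<Sum>j<N. p $ i * measure (K i) {\<omega>\<in>space (K i). f i \<omega> = j} * Z i j)"
      unfolding J_def payoff by (simp add: sum_distrib_left mult.assoc)
    also have "\<dots> \<le> (\<Sum>i\<in>UNIV. \<Sum>j<N. q j $ i * Z i j + p $ i * (\<eta> * (C * T)))"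
    proof (intro sum_mono)
      fix i j assume "j \<in> {..<N}"
      then have j: "j < N" by simp
      define P where "P = measure (K i) {\<omega>\<in>space (K i). f i \<omega> = j}"
      have pw: "p $ i * w i j = q j $ i"
      proof (cases "p $ i = 0")
        case True
        have "q j $ i \<le> (\<Sum>j<N. q j $ i)"
          using j qus(1) by (intro member_le_sum) (auto simp: nonneg_def)
        then have "q j $ i = 0" using q_sum_i[of i] True qus(1)[OF j] by (auto simp: nonneg_def intro: antisym)
        then show ?thesis using True by simp
      qed (simp add: w_def)
      have "(P - w i j) * Z i j \<le> \<bar>P - w i j\<bar> * \<bar>Z i j\<bar>" by (simp add: abs_mult[symmetric])
      also have "\<dots> \<le> \<eta> * (C * T)"
        using K(3)[OF j, of i] Z_bound[OF j, of i] \<eta> by (intro mult_mono) (auto simp: P_def)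
      finally have "p $ i * ((P - w i j) * Z i j) \<le> p $ i * (\<eta> * (C * T))"
        using p_nn[of i] by (intro mult_left_mono)
      moreover have "p $ i * ((P - w i j) * Z i j) = p $ i * P * Z i j - q j $ i * Z i j"
        unfolding pw[symmetric] by (simp add: algebra_simps)
      ultimately show "p $ i * measure (K i) {\<omega>\<in>space (K i). f i \<omega> = j} * Z i j
          \<le> q j $ i * Z i j + p $ i * (\<eta> * (C * T))" by (simp add: P_def)
    qed
    also have "\<dots> = (\<Sum>i\<in>UNIV. \<Sum>j<N. q j $ i * Z i j) + e"
    proof -
      have "(\<Sum>i\<in>UNIV. p $ i * (real N * (\<eta> * (C * T)))) = (\<Sum>i\<in>UNIV. p $ i) * e"
        unfolding sum_distrib_right using N C_pos T_pos by (simp add: \<eta>_def)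
      then show ?thesis using p by (simp add: sum.distrib prob_simplex_def mult.left_commute)
    qed
    also have "(\<Sum>i\<in>UNIV. \<Sum>j<N. q j $ i * Z i j) = (LINT \<omega>|M2. (\<Sum>i\<in>UNIV. \<Sum>j<N. q j $ i * Y i j \<omega>))"
      unfolding Z_def using Y_int by (subst Bochner_Integration.integral_sum) auto
    also have "\<dots> \<le> X"
    proof (rule M2.integral_le_const)
      show "integrable M2 (\<lambda>\<omega>. \<Sum>i\<in>UNIV. \<Sum>j<N. q j $ i * Y i j \<omega>)"
        by (intro Bochner_Integration.integrable_sum integrable_mult_right) (use Y_int in auto)
      show "AE \<omega> in M2. (\<Sum>i\<in>UNIV. \<Sum>j<N. q j $ i * Y i j \<omega>) \<le> X"
      proof (rule AE_I2)
        fix \<omega> assume \<omega>: "\<omega> \<in> space M2"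
        \<comment> \<open>A history of length \<open>k + 1\<close> is charged for interval
          \<open>k\<close>, the one on which its last action is played.\<close>
        define y where "y w = (\<chi> i. pay i (r (length w - 1)) (r (length w)) (ctl w) (b \<omega> (ctl w)))" for w
        have "responses \<rho> r n y"
          unfolding responses_def
        proof (intro allI impI)
          fix k w m c
          assume a: "k < n" "length w = Suc k" "set w \<subseteq> U" "nonneg m" "\<forall>v\<in>V. F (r k) m (last w) v \<le> c"
          have w: "w \<noteq> []" using a by auto
          have eq: "ae_eq (r k) (r (Suc k)) (ctl w) (\<lambda>_. last w)"
            using step_control_eq_interval[OF g(1) a(1), of "\<lambda>j. if j < length w then w ! j else last w"] a(2) w
            by (simp add: ctl_def last_conv_nth)
          show "m \<bullet> y w \<le> (r (Suc k) - r k) * (c + \<rho> * mass m)"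
            using pay_vector_le[OF r a(1) ctl[OF w a(3), unfolded t_def] b_ctl[OF \<omega> ctl[OF w a(3)], unfolded t_def]
                a(4) _ eq, of c] a last_in_set[OF w] by (auto simp: y_def)
        qed
        from X[OF this] have "plan_payoff n ps y \<le> X" .
        moreover have "plan_payoff n ps y = (\<Sum>j<N. \<Sum>k<n. q j \<bullet> y (take (Suc k) (us j)))"
          by (simp add: plan_payoff_def sum_list_sum_nth N_def q_def us_def lessThan_atLeast0 case_prod_unfold)
        moreover have "(\<Sum>k<n. q j \<bullet> y (take (Suc k) (us j))) = (\<Sum>i\<in>UNIV. q j $ i * Y i j \<omega>)" if j: "j < N" for j
        proof -
          define c where "c = ctl (us j)"
          have c: "c \<in> controls t T U" using ctl_us[OF j] by (simp add: c_def)
          have "y (take (Suc k) (us j)) $ i = pay i (r k) (r (Suc k)) c (b \<omega> c)" if k: "k < n" for k i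
          proof -
            define c' where "c' = ctl (take (Suc k) (us j))"
            have len: "length (take (Suc k) (us j)) = Suc k" using qus(2)[OF j] k by simp
            have c': "c' \<in> controls t T U"
              unfolding c'_def using qus[OF j] us_ne[OF j] set_take_subset[of "Suc k" "us j"] by (intro ctl) auto
            have rk: "r 0 \<le> r k" "r k \<le> r (Suc k)" "r (Suc k) \<le> T"
              using grid_le[OF g(1), of 0 k] grid_le[OF g(1), of k "Suc k"] grid_le[OF g(1), of "Suc k" n] k g by auto
            \<comment> \<open>The padded prefix and the full sequence agree up to
              \<open>r (Suc k)\<close>, and nonanticipativity transfers this to the reactions; so
              \<open>y\<close> at the prefix is the payoff in the actual play.\<close>
            have eq: "ae_eq t (r (Suc k)) c' c"
              unfolding c_def c'_def ctl_def t_def using qus(2)[OF j] k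
              by (intro step_control_prefix[OF g(1) k]) auto
            have "ae_eq t (r (Suc k)) (b \<omega> c') (b \<omega> c)"
              by (rule delayed_nonanticipative[OF b_del[OF \<omega>] c' c rk(3) eq])
            then have "pay i (r k) (r (Suc k)) c' (b \<omega> c') = pay i (r k) (r (Suc k)) c (b \<omega> c)"
              using t rk eq by (intro pay_cong[OF c' b_ctl[OF \<omega> c'] c b_ctl[OF \<omega> c]])
                (auto simp: t_def intro: ae_eq_mono)
            then show ?thesis by (simp add: y_def len c'_def del: length_take)
          qed
          then have "(\<Sum>k<n. q j \<bullet> y (take (Suc k) (us j))) =
              (\<Sum>k<n. \<Sum>i\<in>UNIV. q j $ i * pay i (r k) (r (Suc k)) c (b \<omega> c))"
            by (simp add: inner_vec_def)
          also have "\<dots> = (\<Sum>i\<in>UNIV. q j $ i * (\<Sum>k<n. pay i (r k) (r (Suc k)) c (b \<omega> c)))"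
            by (subst sum.swap) (simp add: sum_distrib_left)
          also have "\<dots> = (\<Sum>i\<in>UNIV. q j $ i * Y i j \<omega>)"
            using pay_grid[of c r "b \<omega> c" n] c b_ctl[OF \<omega> c] g by (simp add: Y_def c_def t_def)
          finally show ?thesis .
        qed
        ultimately have "(\<Sum>j<N. \<Sum>i\<in>UNIV. q j $ i * Y i j \<omega>) \<le> X" by simp
        then show "(\<Sum>i\<in>UNIV. \<Sum>j<N. q j $ i * Y i j \<omega>) \<le> X" by (subst sum.swap)
      qed
    qed
    finally show "J t p \<alpha> \<beta> \<le> X + e" by simp
  qed
qed

lemma Val_le_tree_cost:
  assumes r: "fine_grid \<rho> r n" and p: "p \<in> prob_simplex" and x: "tree_cost r n p x"
  shows "Val (r 0) p \<le> x + \<rho> * T"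
proof (rule field_le_epsilon)
  fix e :: real assume e: "0 < e"
  have g: "grid r n" "0 \<le> r 0" "r n = T" "0 \<le> \<rho>" using r by (auto simp: fine_grid_def)
  obtain ps where ps: "plan n p ps"
    "\<And>y. responses \<rho> r n y \<Longrightarrow> plan_payoff n ps y \<le> x + e / 2 + \<rho> * (r n - r 0) * mass p"
    using plan_exists[OF x g(4), of "e / 2"] fine_grid_range[OF r] g e by (auto simp: grid_def less_imp_le)
  have "\<rho> * (r n - r 0) * mass p \<le> \<rho> * T"
    using p g by (simp add: prob_simplex_iff mult_left_mono)
  then have "plan_payoff n ps y \<le> x + e / 2 + \<rho> * T" if "responses \<rho> r n y" for y
    using ps(2)[OF that] by simp
  from Val_le_plan[OF r p ps(1), of "e / 2", OF _ this] e
  show "Val (r 0) p \<le> x + \<rho> * T + e" by simp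
qed

end

section \<open>Lower bound: belief-based replies of the uninformed player\<close>

context game
begin

text \<open>The tower property: the summand is linear in the weight, and the weights of all
  extensions of a prefix add up to the weight of the prefix.\<close>

lemma weight_tree_marginal:
  assumes "weight_tree A n m" "k \<le> n"
  shows "(\<Sum>h\<in>words A n. m h \<bullet> f (take k h)) = (\<Sum>h\<in>words A k. m h \<bullet> f h)"
  using assms(2)
proof (induction "n - k" arbitrary: k f)
  case 0
  then show ?case by (intro sum.cong) (auto simp: words_def)
next
  case (Suc d)
  then have k: "k < n" by simp
  have "(\<Sum>h\<in>words A n. m h \<bullet> f (take k (take (Suc k) h))) = (\<Sum>h\<in>words A (Suc k). m h \<bullet> f (take k h))"
    using Suc.hyps(1)[of "Suc k" "\<lambda>h. f (take k h)"] Suc.hyps(2) k by simp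
  also have "\<dots> = (\<Sum>h\<in>words A k. \<Sum>c\<in>A. m (h @ [c]) \<bullet> f h)"
    using assms(1) by (subst sum_words_Suc) (auto simp: weight_tree_def words_def intro!: sum.cong)
  also have "\<dots> = (\<Sum>h\<in>words A k. m h \<bullet> f h)"
    using assms(1) k by (intro sum.cong refl) (simp add: weight_tree_def inner_sum_left)
  finally show ?case by (simp add: min_def)
qed

text \<open>The energy of a belief, weighted by its mass. Its growth along a tree controls how much the
  beliefs of the uninformed player move, which is what he loses by replying with delay.\<close>

definition energy :: "real^'i \<Rightarrow> real" where
  "energy x = (\<Sum>i\<in>UNIV. (x $ i)\<^sup>2 / mass x)"

text \<open>With total mass 1 this bounds the energy gained along the whole tree by 1, whatever the
  depth and the alphabet.\<close>

lemma energy_le_mass: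
  assumes "nonneg x" shows "0 \<le> energy x" "energy x \<le> mass x"
proof -
  show "0 \<le> energy x" unfolding energy_def using mass_nonneg[OF assms] by (intro sum_nonneg) auto
  have "(x $ i)\<^sup>2 / mass x \<le> x $ i" for i
  proof (cases "mass x = 0")
    case False
    then have "0 < mass x" using mass_nonneg[OF assms] by simp
    moreover have "x $ i * x $ i \<le> x $ i * mass x"
      using assms nonneg_le_mass[OF assms, of i] by (intro mult_left_mono) (auto simp: nonneg_def)
    ultimately show ?thesis by (simp add: field_simps power2_eq_square)
  qed (use assms in \<open>auto simp: nonneg_def\<close>)
  then show "energy x \<le> mass x" unfolding energy_def mass_def by (intro sum_mono) auto
qed

text \<open>Young's inequality; the free weight \<open>a\<close> is later balanced against the mesh
  of the grid.\<close>

lemma abs_le_square: "0 < a \<Longrightarrow> \<bar>x\<bar> \<le> a * x\<^sup>2 + 1 / (4 * a)" for a x :: real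
proof -
  assume a: "0 < a"
  have "0 \<le> (2 * a * \<bar>x\<bar> - 1)\<^sup>2 / (4 * a)" using a by simp
  also have "\<dots> = a * x\<^sup>2 + 1 / (4 * a) - \<bar>x\<bar>"
    using a by (simp add: power2_diff power_mult_distrib field_simps power2_eq_square)
  finally show ?thesis by simp
qed

text \<open>Expanding the squares shows that the variance of the posteriors around the parent belief
  is exactly the increase of energy; the cross term simplifies because the children sum to
  \<open>x\<close>. Nonnegativity of the variance gives the monotonicity, Young's inequality turns
  the l1 variation into variance. Null children contribute zero by the convention for
  division.\<close>

lemma belief_variation:
  assumes A: "finite A" and m: "\<And>c. c \<in> A \<Longrightarrow> nonneg (q c)" and x: "x = (\<Sum>c\<in>A. q c)" and a: "0 < a"
  shows "(\<Sum>c\<in>A. \<Sum>i\<in>UNIV. \<bar>q c $ i - mass (q c) / mass x * x $ i\<bar>)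
      \<le> a * ((\<Sum>c\<in>A. energy (q c)) - energy x) + CARD('i) * mass x / (4 * a)"
    "energy x \<le> (\<Sum>c\<in>A. energy (q c))"
proof -
  define M where "M = mass x"
  have xM: "M = (\<Sum>c\<in>A. mass (q c))" by (simp add: M_def x mass_sum)
  have q0: "mass (q c) = 0 \<Longrightarrow> q c = 0" if "c \<in> A" for c using m[OF that] mass_eq_0 by blast
  have M0: "x = 0" if "M = 0"
  proof -
    have "nonneg x" using m unfolding x nonneg_def by (simp add: sum_nonneg)
    then show ?thesis using that mass_eq_0[OF \<open>nonneg x\<close>] by (simp add: M_def)
  qed
  define D where "D c i = q c $ i - mass (q c) / M * x $ i" for c i
  have Di: "(\<Sum>c\<in>A. (D c i)\<^sup>2 / mass (q c)) = (\<Sum>c\<in>A. (q c $ i)\<^sup>2 / mass (q c)) - (x $ i)\<^sup>2 / M" for i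
  proof (cases "M = 0")
    case True
    then show ?thesis using M0 by (simp add: D_def)
  next
    case False
    then have M: "M \<noteq> 0" by simp
    have "(\<Sum>c\<in>A. (D c i)\<^sup>2 / mass (q c)) =
        (\<Sum>c\<in>A. (q c $ i)\<^sup>2 / mass (q c) - 2 * (x $ i / M) * q c $ i + (x $ i / M)\<^sup>2 * mass (q c))"
    proof (intro sum.cong refl)
      fix c assume c: "c \<in> A"
      show "(D c i)\<^sup>2 / mass (q c) = (q c $ i)\<^sup>2 / mass (q c) - 2 * (x $ i / M) * q c $ i + (x $ i / M)\<^sup>2 * mass (q c)"
      proof (cases "mass (q c) = 0")
        case True
        then show ?thesis using q0[OF c] by simp
      next
        case False
        then show ?thesis unfolding D_def using M by (simp add: power2_eq_square field_simps)
      qed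
    qed
    also have "\<dots> = (\<Sum>c\<in>A. (q c $ i)\<^sup>2 / mass (q c)) - 2 * (x $ i / M) * (\<Sum>c\<in>A. q c $ i) + (x $ i / M)\<^sup>2 * M"
      unfolding xM[symmetric] by (simp add: sum.distrib sum_subtractf sum_distrib_left xM)
    also have "(\<Sum>c\<in>A. q c $ i) = x $ i" by (simp add: x)
    finally show ?thesis using False by (simp add: power2_eq_square)
  qed
  have total: "(\<Sum>c\<in>A. \<Sum>i\<in>UNIV. (D c i)\<^sup>2 / mass (q c)) = (\<Sum>c\<in>A. energy (q c)) - energy x"
    unfolding energy_def M_def[symmetric] sum_subtractf[symmetric]
    by (subst (1 2) sum.swap) (simp add: Di sum_subtractf)
  have "0 \<le> (\<Sum>c\<in>A. \<Sum>i\<in>UNIV. (D c i)\<^sup>2 / mass (q c))"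
    using mass_nonneg[OF m] by (intro sum_nonneg divide_nonneg_nonneg) auto
  then show "energy x \<le> (\<Sum>c\<in>A. energy (q c))" using total by simp
  have "(\<Sum>c\<in>A. \<Sum>i\<in>UNIV. \<bar>D c i\<bar>) \<le> (\<Sum>c\<in>A. \<Sum>i\<in>(UNIV::'i set). a * ((D c i)\<^sup>2 / mass (q c)) + mass (q c) / (4 * a))"
  proof (intro sum_mono)
    fix c i assume c: "c \<in> A"
    show "\<bar>D c i\<bar> \<le> a * ((D c i)\<^sup>2 / mass (q c)) + mass (q c) / (4 * a)"
    proof (cases "mass (q c) = 0")
      case True
      then show ?thesis using q0[OF c] by (simp add: D_def)
    next
      case False
      then have pos: "0 < mass (q c)" using mass_nonneg[OF m[OF c]] by simp
      have "mass (q c) * \<bar>D c i / mass (q c)\<bar> \<le> mass (q c) * (a * (D c i / mass (q c))\<^sup>2 + 1 / (4 * a))"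
        using pos by (intro mult_left_mono abs_le_square[OF a]) auto
      then show ?thesis using pos by (simp add: power2_eq_square abs_divide algebra_simps)
    qed
  qed
  also have "\<dots> = a * ((\<Sum>c\<in>A. energy (q c)) - energy x) + CARD('i) * M / (4 * a)"
    unfolding total[symmetric] xM
    by (simp add: sum.distrib sum_distrib_left sum_divide_distrib)
  finally show "(\<Sum>c\<in>A. \<Sum>i\<in>UNIV. \<bar>q c $ i - mass (q c) / mass x * x $ i\<bar>)
      \<le> a * ((\<Sum>c\<in>A. energy (q c)) - energy x) + CARD('i) * mass x / (4 * a)"
    by (simp add: D_def M_def)
qed

text \<open>The reply was optimised for the weight \<open>x\<close> before the last label, while the
  payoff of label \<open>c\<close> is weighed by \<open>q c\<close>. Replacing \<open>q c\<close> by
  its share \<open>mass (q c) / mass x\<close> of \<open>x\<close> costs \<open>B\<close> times the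
  l1 variation, and the shares of \<open>b\<close> add up to \<open>b\<close>.\<close>

lemma node_payoff_ge:
  assumes A: "finite A" and q: "\<And>c. c \<in> A \<Longrightarrow> nonneg (q c)" and x: "x = (\<Sum>c\<in>A. q c)" and a: "0 < a"
    and y: "\<And>c i. c \<in> A \<Longrightarrow> q c \<noteq> 0 \<Longrightarrow> \<bar>y c $ i\<bar> \<le> B"
    and b: "\<And>c. c \<in> A \<Longrightarrow> q c \<noteq> 0 \<Longrightarrow> b \<le> x \<bullet> y c" and b0: "x = 0 \<Longrightarrow> b = 0" and B: "0 \<le> B"
  shows "b - B * (a * ((\<Sum>c\<in>A. energy (q c)) - energy x) + CARD('i) * mass x / (4 * a)) \<le> (\<Sum>c\<in>A. q c \<bullet> y c)"
proof -
  have nx: "nonneg x" using q unfolding x nonneg_def by (simp add: sum_nonneg)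
  have lb: "mass (q c) / mass x * b - B * (\<Sum>i\<in>UNIV. \<bar>q c $ i - mass (q c) / mass x * x $ i\<bar>) \<le> q c \<bullet> y c"
    if c: "c \<in> A" for c
  proof (cases "q c = 0")
    case False
    define w where "w = mass (q c) / mass x"
    have l: "0 \<le> w" using mass_nonneg[OF q[OF c]] mass_nonneg[OF nx] by (simp add: w_def)
    have "w * (x \<bullet> y c) - q c \<bullet> y c = (\<Sum>i\<in>UNIV. (w * x $ i - q c $ i) * y c $ i)"
      by (simp add: inner_vec_def sum_distrib_left sum_subtractf left_diff_distrib mult.assoc)
    also have "\<dots> \<le> (\<Sum>i\<in>UNIV. \<bar>q c $ i - w * x $ i\<bar> * B)"
    proof (rule sum_mono)
      fix i
      have "(w * x $ i - q c $ i) * y c $ i \<le> \<bar>w * x $ i - q c $ i\<bar> * \<bar>y c $ i\<bar>"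
        by (simp add: abs_mult[symmetric])
      also have "\<dots> \<le> \<bar>q c $ i - w * x $ i\<bar> * B"
        using y[OF c False, of i] by (subst abs_minus_commute) (intro mult_left_mono, auto)
      finally show "(w * x $ i - q c $ i) * y c $ i \<le> \<bar>q c $ i - w * x $ i\<bar> * B" .
    qed
    finally have "w * (x \<bullet> y c) - q c \<bullet> y c \<le> B * (\<Sum>i\<in>UNIV. \<bar>q c $ i - w * x $ i\<bar>)"
      by (simp add: sum_distrib_left mult.commute)
    moreover have "w * b \<le> w * (x \<bullet> y c)" using b[OF c False] l by (intro mult_left_mono)
    ultimately show ?thesis by (simp add: w_def)
  qed simp
  have "(\<Sum>c\<in>A. mass (q c) / mass x * b) = b"
  proof (cases "mass x = 0")
    case True
    then show ?thesis using b0 mass_eq_0[OF nx] by simp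
  next
    case False
    have "(\<Sum>c\<in>A. mass (q c) / mass x * b) = (\<Sum>c\<in>A. mass (q c)) / mass x * b"
      by (simp add: sum_distrib_right sum_divide_distrib)
    then show ?thesis using False by (simp add: x mass_sum)
  qed
  then have "b - B * (\<Sum>c\<in>A. \<Sum>i\<in>UNIV. \<bar>q c $ i - mass (q c) / mass x * x $ i\<bar>) =
      (\<Sum>c\<in>A. mass (q c) / mass x * b - B * (\<Sum>i\<in>UNIV. \<bar>q c $ i - mass (q c) / mass x * x $ i\<bar>))"
    by (simp add: sum_subtractf sum_distrib_left)
  also have "\<dots> \<le> (\<Sum>c\<in>A. q c \<bullet> y c)" using lb by (rule sum_mono)
  finally show ?thesis
    using mult_left_mono[OF belief_variation(1)[OF A q x a] B] by simp
qed

text \<open>Sums the node estimate over the tree. The energy increments telescope to at most 1 and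
  leave \<open>a * \<delta>\<close>; the linear terms of Young's inequality add up with the interval
  lengths to \<open>CARD('i) * T / (4 * a)\<close>.\<close>

lemma tree_payoff_ge:
  assumes m: "weight_tree A n m" and p: "mass (m []) = 1" and r: "grid r n" "0 \<le> r 0" "r n = T"
    and mesh: "\<And>k. k < n \<Longrightarrow> r (Suc k) - r k \<le> \<delta>" and a: "0 < a" and K: "0 \<le> K"
    and y: "\<And>k h c i. k < n \<Longrightarrow> h \<in> words A k \<Longrightarrow> c \<in> A \<Longrightarrow> m (h @ [c]) \<noteq> 0 \<Longrightarrow>
      \<bar>y c $ i\<bar> \<le> K * (r (Suc k) - r k)"
    and b: "\<And>k h c. k < n \<Longrightarrow> h \<in> words A k \<Longrightarrow> c \<in> A \<Longrightarrow> m (h @ [c]) \<noteq> 0 \<Longrightarrow>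
      (r (Suc k) - r k) * (H (r k) (m h) - \<kappa> * mass (m h)) \<le> m h \<bullet> y c" and \<kappa>: "0 \<le> \<kappa>"
  shows "weight_tree_cost r A n m - \<kappa> * T - K * (a * \<delta> + CARD('i) * T / (4 * a))
    \<le> (\<Sum>k<n. \<Sum>h\<in>words A k. \<Sum>c\<in>A. m (h @ [c]) \<bullet> y c)"
proof -
  define \<Delta> where "\<Delta> k = r (Suc k) - r k" for k
  have \<Delta>: "0 \<le> \<Delta> k" "\<Delta> k \<le> \<delta>" if "k < n" for k
    using grid_less[OF r(1), of k "Suc k"] mesh[OF that] that by (auto simp: \<Delta>_def)
  have A: "finite A" using m by (simp add: weight_tree_def)
  define Q where "Q k = (\<Sum>h\<in>words A k. energy (m h))" for k
  have nn: "nonneg (m h)" if "h \<in> words A k" "k \<le> n" for h k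
    using m that by (auto simp: weight_tree_def)
  have child: "h @ [c] \<in> words A (Suc k)" if "h \<in> words A k" "c \<in> A" for h c k
    using that by (auto simp: words_def)
  have split: "m h = (\<Sum>c\<in>A. m (h @ [c]))" if "h \<in> words A k" "k < n" for h k
    using m that by (auto simp: weight_tree_def)
  have mass1: "(\<Sum>h\<in>words A k. mass (m h)) = 1" if "k \<le> n" for k
    using weight_tree_sum[OF m that] p by (simp add: mass_sum[symmetric])
  have QS: "Q (Suc k) = (\<Sum>h\<in>words A k. \<Sum>c\<in>A. energy (m (h @ [c])))" for k
    unfolding Q_def by (rule sum_words_Suc[OF A])
  have Q_mono: "Q k \<le> Q (Suc k)" if "k < n" for k
    unfolding QS unfolding Q_def
  proof (rule sum_mono)
    fix h assume h: "h \<in> words A k"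
    show "energy (m h) \<le> (\<Sum>c\<in>A. energy (m (h @ [c])))"
      using belief_variation(2)[OF A _ split[OF h that], of 1] nn[OF child[OF h]] that by auto
  qed
  \<comment> \<open>In front of the energy increment the length of the interval is replaced by the
    common bound \<open>\<delta>\<close>; only with a constant factor do the increments
    telescope.\<close>
  have step: "\<Delta> k * (\<Sum>h\<in>words A k. H (r k) (m h)) - \<kappa> * \<Delta> k - K * (a * \<delta> * (Q (Suc k) - Q k) + CARD('i) * \<Delta> k / (4 * a))
      \<le> (\<Sum>h\<in>words A k. \<Sum>c\<in>A. m (h @ [c]) \<bullet> y c)" if k: "k < n" for k
  proof -
    have "(\<Sum>h\<in>words A k. \<Delta> k * (H (r k) (m h) - \<kappa> * mass (m h)) - K * \<Delta> k *
        (a * ((\<Sum>c\<in>A. energy (m (h @ [c]))) - energy (m h)) + CARD('i) * mass (m h) / (4 * a)))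
        \<le> (\<Sum>h\<in>words A k. \<Sum>c\<in>A. m (h @ [c]) \<bullet> y c)"
    proof (rule sum_mono)
      fix h assume h: "h \<in> words A k"
      show "\<Delta> k * (H (r k) (m h) - \<kappa> * mass (m h)) - K * \<Delta> k *
        (a * ((\<Sum>c\<in>A. energy (m (h @ [c]))) - energy (m h)) + CARD('i) * mass (m h) / (4 * a))
        \<le> (\<Sum>c\<in>A. m (h @ [c]) \<bullet> y c)"
        using nn[OF child[OF h]] y[OF k h] b[OF k h] k \<Delta>[OF k] K H_zero
        by (intro node_payoff_ge[OF A _ split[OF h k] a]) (auto simp: \<Delta>_def)
    qed
    also have "(\<Sum>h\<in>words A k. \<Delta> k * (H (r k) (m h) - \<kappa> * mass (m h)) - K * \<Delta> k *
        (a * ((\<Sum>c\<in>A. energy (m (h @ [c]))) - energy (m h)) + CARD('i) * mass (m h) / (4 * a))) =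
      \<Delta> k * ((\<Sum>h\<in>words A k. H (r k) (m h)) - \<kappa> * (\<Sum>h\<in>words A k. mass (m h))) -
      K * \<Delta> k * (a * (Q (Suc k) - Q k) + CARD('i) * (\<Sum>h\<in>words A k. mass (m h)) / (4 * a))"
      unfolding QS unfolding Q_def
      by (simp add: sum_subtractf sum.distrib flip: sum_distrib_left sum_divide_distrib)
    also have "\<dots> = \<Delta> k * (\<Sum>h\<in>words A k. H (r k) (m h)) - \<kappa> * \<Delta> k -
        K * (a * (\<Delta> k * (Q (Suc k) - Q k)) + CARD('i) * \<Delta> k / (4 * a))"
      using mass1[of k] k by (simp add: algebra_simps)
    finally show ?thesis
      using mult_left_mono[OF mult_left_mono[OF mult_right_mono[OF \<Delta>(2)[OF k], of "Q (Suc k) - Q k"], of a] K]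
        Q_mono[OF k] a by (simp add: algebra_simps)
  qed
  have "(\<Sum>k<n. \<Delta> k * (\<Sum>h\<in>words A k. H (r k) (m h)) - \<kappa> * \<Delta> k - K * (a * \<delta> * (Q (Suc k) - Q k) + CARD('i) * \<Delta> k / (4 * a)))
      \<le> (\<Sum>k<n. \<Sum>h\<in>words A k. \<Sum>c\<in>A. m (h @ [c]) \<bullet> y c)"
    using step by (intro sum_mono) auto
  moreover have e1: "(\<Sum>k<n. \<Delta> k * (\<Sum>h\<in>words A k. H (r k) (m h)) - \<kappa> * \<Delta> k - K * (a * \<delta> * (Q (Suc k) - Q k) + CARD('i) * \<Delta> k / (4 * a)))
    = weight_tree_cost r A n m - \<kappa> * (\<Sum>k<n. \<Delta> k) - K * (a * \<delta> * (\<Sum>k<n. Q (Suc k) - Q k) + CARD('i) * (\<Sum>k<n. \<Delta> k) / (4 * a))"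
    by (simp add: weight_tree_cost_def \<Delta>_def[symmetric] sum_subtractf sum.distrib flip: sum_distrib_left sum_divide_distrib)
  moreover have e2: "(\<Sum>k<n. Q (Suc k) - Q k) = Q n - Q 0" by (rule sum_lessThan_telescope)
  moreover have e3: "(\<Sum>k<n. \<Delta> k) = T - r 0" unfolding \<Delta>_def using sum_lessThan_telescope[of r n] r by simp
  moreover have "\<kappa> * (T - r 0) \<le> \<kappa> * T" using \<kappa> r by (intro mult_left_mono) auto
  moreover have "K * (a * \<delta> * (Q n - Q 0) + CARD('i) * (T - r 0) / (4 * a)) \<le> K * (a * \<delta> + CARD('i) * T / (4 * a))"
  proof (intro mult_left_mono[OF _ K] add_mono)
    have "Q n \<le> (\<Sum>h\<in>words A n. mass (m h))"
      unfolding Q_def using nn by (intro sum_mono energy_le_mass) auto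
    moreover have "0 \<le> Q 0" unfolding Q_def using nn[of _ 0] by (intro sum_nonneg energy_le_mass) auto
    ultimately have "Q n - Q 0 \<le> 1" using mass1[of n] by simp
    moreover have "0 \<le> a * \<delta>" using a \<Delta>[of 0] r(1) by (auto simp: grid_def)
    ultimately show "a * \<delta> * (Q n - Q 0) \<le> a * \<delta>" using mult_left_mono by fastforce
    show "CARD('i) * (T - r 0) / (4 * a) \<le> CARD('i) * T / (4 * a)"
      using a r(2) by (intro divide_right_mono mult_left_mono) auto
  qed
  ultimately show ?thesis unfolding e1 unfolding e2 e3 by linarith
qed

end

section \<open>Label histories and replies of the uninformed player\<close>

context game
begin

text \<open>What the uninformed player remembers of an interval: for every type, the payoff of the
  opponent's control against the constant reply \<open>x\<close>, rounded down to a multiple of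
  \<open>\<eta>\<close>. This is all that enters expected payoffs and takes finitely many
  values.\<close>

definition label :: "real \<Rightarrow> (nat \<Rightarrow> real) \<Rightarrow> nat \<Rightarrow> 'v \<Rightarrow> (real \<Rightarrow> 'u) \<Rightarrow> int^'i" where
  "label \<eta> r k x u = (\<chi> i. \<lfloor>pay i (r k) (r (Suc k)) u (\<lambda>s\<in>{r 0..T}. x) / \<eta>\<rfloor>)"

text \<open>Since \<open>take j h = h\<close> beyond the length of \<open>h\<close>, an incomplete
  history is continued by its last reply. The control is the intended one up to the end of the
  interval following \<open>h\<close>.\<close>

definition policy_control :: "(nat \<Rightarrow> real) \<Rightarrow> nat \<Rightarrow> ('c list \<Rightarrow> 'v) \<Rightarrow> 'c list \<Rightarrow> real \<Rightarrow> 'v" where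
  "policy_control r n \<sigma> h = step_control r n (\<lambda>j. \<sigma> (take j h))"

text \<open>Simulates the play against a given strategy without solving a fixed point: the control
  for the labels so far is already right on the next interval, so nonanticipativity gives the
  opponent's true answer there.\<close>

primrec play_history :: "real \<Rightarrow> (nat \<Rightarrow> real) \<Rightarrow> nat \<Rightarrow> ((int^'i) list \<Rightarrow> 'v) \<Rightarrow>
    ((real \<Rightarrow> 'v) \<Rightarrow> (real \<Rightarrow> 'u)) \<Rightarrow> nat \<Rightarrow> (int^'i) list" where
  "play_history \<eta> r n \<sigma> a 0 = []"
| "play_history \<eta> r n \<sigma> a (Suc k) = play_history \<eta> r n \<sigma> a k @
    [label \<eta> r k (\<sigma> (play_history \<eta> r n \<sigma> a k)) (a (policy_control r n \<sigma> (play_history \<eta> r n \<sigma> a k)))]"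

text \<open>Reads the labels off an observed control, as the uninformed player must do; against a
  strategy it agrees with \<open>play_history\<close> along every solution of the play.\<close>

primrec observed_history :: "real \<Rightarrow> (nat \<Rightarrow> real) \<Rightarrow> ((int^'i) list \<Rightarrow> 'v) \<Rightarrow>
    (real \<Rightarrow> 'u) \<Rightarrow> nat \<Rightarrow> (int^'i) list" where
  "observed_history \<eta> r \<sigma> u 0 = []"
| "observed_history \<eta> r \<sigma> u (Suc k) = observed_history \<eta> r \<sigma> u k @
    [label \<eta> r k (\<sigma> (observed_history \<eta> r \<sigma> u k)) u]"

lemma length_histories [simp]:
  "length (play_history \<eta> r n \<sigma> a k) = k" "length (observed_history \<eta> r \<sigma> u k) = k"
  by (induction k) auto

lemma take_play_history: "j \<le> k \<Longrightarrow> take j (play_history \<eta> r n \<sigma> a k) = play_history \<eta> r n \<sigma> a j"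
  by (induction k) (auto simp: le_Suc_eq)

lemma take_observed_history: "j \<le> k \<Longrightarrow> take j (observed_history \<eta> r \<sigma> u k) = observed_history \<eta> r \<sigma> u j"
  by (induction k) (auto simp: le_Suc_eq)

text \<open>A history of length \<open>k\<close> involves only replies to shorter histories; the
  policy can therefore be fixed level by level.\<close>

lemma play_history_cong:
  assumes "\<And>h. length h < k \<Longrightarrow> \<sigma> h = \<sigma>' h"
  shows "play_history \<eta> r n \<sigma> a k = play_history \<eta> r n \<sigma>' a k"
  using assms
proof (induction k)
  case (Suc k)
  have eq: "play_history \<eta> r n \<sigma> a k = play_history \<eta> r n \<sigma>' a k" using Suc by simp
  have "policy_control r n \<sigma> (play_history \<eta> r n \<sigma>' a k) = policy_control r n \<sigma>' (play_history \<eta> r n \<sigma>' a k)"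
    unfolding policy_control_def using Suc.prems by simp
  then show ?case using Suc.prems by (simp add: eq)
qed simp

lemma play_history_nth: "j < k \<Longrightarrow> play_history \<eta> r n \<sigma> a k ! j =
   label \<eta> r j (\<sigma> (play_history \<eta> r n \<sigma> a j)) (a (policy_control r n \<sigma> (play_history \<eta> r n \<sigma> a j)))"
  by (induction k) (auto simp: nth_append less_Suc_eq)

lemma finite_bounded_labels: "finite {c::int^'i. \<forall>i. \<bar>c $ i\<bar> \<le> B}"
proof -
  have "finite (vec_lambda ` (UNIV \<rightarrow>\<^sub>E {-B..B}) :: (int^'i) set)"
    by (intro finite_imageI finite_PiE) auto
  moreover have "{c::int^'i. \<forall>i. \<bar>c $ i\<bar> \<le> B} \<subseteq> vec_lambda ` (UNIV \<rightarrow>\<^sub>E {-B..B})"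
  proof
    fix c :: "int^'i" assume "c \<in> {c. \<forall>i. \<bar>c $ i\<bar> \<le> B}"
    then have "vec_nth c \<in> UNIV \<rightarrow>\<^sub>E {-B..B}" by (auto simp: abs_le_iff minus_le_iff)
    then show "c \<in> vec_lambda ` (UNIV \<rightarrow>\<^sub>E {-B..B})" by (intro image_eqI[of _ _ "vec_nth c"]) auto
  qed
  ultimately show ?thesis by (rule finite_subset[rotated])
qed

context
  fixes \<rho> \<eta> :: real and r :: "nat \<Rightarrow> real" and n :: nat and \<sigma> :: "(int^'i) list \<Rightarrow> 'v"
  assumes r: "fine_grid \<rho> r n" and \<sigma>: "\<And>h. \<sigma> h \<in> V" and \<eta>: "0 < \<eta>"
begin

lemma r_grid: "grid r n" "0 \<le> r 0" "r n = T"
  using r by (auto simp: fine_grid_def)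

lemma r_step: "k < n \<Longrightarrow> r 0 \<le> r k \<and> r k < r (Suc k) \<and> r (Suc k) \<le> T"
  using grid_le[OF r_grid(1), of 0 k] grid_less[OF r_grid(1), of k "Suc k"]
    grid_le[OF r_grid(1), of "Suc k" n] r_grid by auto

lemma const_control: "x \<in> V \<Longrightarrow> (\<lambda>s\<in>{r 0..T}. x) \<in> controls (r 0) T V"
  by (rule constant_controls)

lemma policy_control_controls: "policy_control r n \<sigma> h \<in> controls (r 0) T V"
  unfolding policy_control_def r_grid(3)[symmetric] by (intro step_control_controls r_grid \<sigma>)

lemma policy_control_interval:
  assumes "k < n"
  shows "ae_eq (r k) (r (Suc k)) (policy_control r n \<sigma> h) (\<lambda>s\<in>{r 0..T}. \<sigma> (take k h))"
proof (rule ae_eq_trans)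
  show "ae_eq (r k) (r (Suc k)) (policy_control r n \<sigma> h) (\<lambda>_. \<sigma> (take k h))"
    unfolding policy_control_def by (rule step_control_eq_interval[OF r_grid(1) assms])
  show "ae_eq (r k) (r (Suc k)) (\<lambda>_. \<sigma> (take k h)) (\<lambda>s\<in>{r 0..T}. \<sigma> (take k h))"
    using r_step[OF assms] by (intro ae_eqI_open) auto
qed

lemma policy_control_prefix:
  assumes "k < n" "take k h = take k h'"
  shows "ae_eq (r 0) (r (Suc k)) (policy_control r n \<sigma> h) (policy_control r n \<sigma> h')"
  unfolding policy_control_def
proof (rule step_control_prefix[OF r_grid(1) assms(1)])
  fix j assume "j \<le> k"
  then have "take j h = take j (take k h)" "take j h' = take j (take k h')" by (auto simp: min_def)
  then show "\<sigma> (take j h) = \<sigma> (take j h')" using assms(2) by simp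
qed

lemma label_cong:
  assumes "k < n" "u \<in> controls (r 0) T U" "u' \<in> controls (r 0) T U" "ae_eq (r k) (r (Suc k)) u u'"
  shows "label \<eta> r k (\<sigma> h) u = label \<eta> r k (\<sigma> h) u'"
  unfolding label_def using r_step[OF assms(1)] r_grid assms const_control[OF \<sigma>]
  by (intro vec_eq_iff[THEN iffD2] allI) (simp, subst pay_cong[of u "r 0" _ u'], auto)

lemma label_measurable:
  assumes "k < n" 
  shows "label \<eta> r k (\<sigma> h) -` {c} \<inter> controls (r 0) T U \<in> sets (control_space (r 0) T U)"
proof -
  have [measurable]: "(\<lambda>u. pay i (r k) (r (Suc k)) u (\<lambda>s\<in>{r 0..T}. \<sigma> h)) \<in> borel_measurable (control_space (r 0) T U)" for i
    using r_step[OF assms] r_grid const_control[OF \<sigma>] by (intro pay_measurable) auto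
  have "label \<eta> r k (\<sigma> h) -` {c} \<inter> controls (r 0) T U = {u\<in>space (control_space (r 0) T U).
      \<forall>i\<in>UNIV. \<lfloor>pay i (r k) (r (Suc k)) u (\<lambda>s\<in>{r 0..T}. \<sigma> h) / \<eta>\<rfloor> = c $ i}"
    by (auto simp: label_def vec_eq_iff)
  also have "\<dots> \<in> sets (control_space (r 0) T U)" by measurable
  finally show ?thesis .
qed

lemma observed_history_measurable:
  assumes "k \<le> n"
  shows "(\<lambda>u. observed_history \<eta> r \<sigma> u k) \<in> control_space (r 0) T U \<rightarrow>\<^sub>M count_space UNIV"
proof -
  have "(\<lambda>u. observed_history \<eta> r \<sigma> u k) -` {h} \<inter> controls (r 0) T U \<in> sets (control_space (r 0) T U)" for h
    using assms
  proof (induction k arbitrary: h)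
    case 0
    have "(\<lambda>u. observed_history \<eta> r \<sigma> u 0) -` {h} \<inter> controls (r 0) T U =
        (if h = [] then space (control_space (r 0) T U) else {})" by auto
    then show ?case by (metis sets.top sets.empty_sets)
  next
    case (Suc k)
    show ?case
    proof (cases "h = []")
      case False
      then have "(\<lambda>u. observed_history \<eta> r \<sigma> u (Suc k)) -` {h} \<inter> controls (r 0) T U =
        ((\<lambda>u. observed_history \<eta> r \<sigma> u k) -` {butlast h} \<inter> controls (r 0) T U) \<inter>
        (label \<eta> r k (\<sigma> (butlast h)) -` {last h} \<inter> controls (r 0) T U)"
        by (auto simp: append_eq_conv_conj snoc_eq_iff_butlast)
      then show ?thesis using Suc label_measurable[of k "butlast h" "last h"] by auto
    next
      case True
      then have "(\<lambda>u. observed_history \<eta> r \<sigma> u (Suc k)) -` {h} = {}" by auto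
      then show ?thesis by (simp only: Int_empty_left sets.empty_sets)
    qed
  qed
  then show ?thesis by (subst measurable_count_space_eq2_countable) auto
qed

lemma observed_history_cong:
  assumes "k \<le> n" "u \<in> controls (r 0) T U" "u' \<in> controls (r 0) T U" "ae_eq (r 0) (r k) u u'"
  shows "observed_history \<eta> r \<sigma> u k = observed_history \<eta> r \<sigma> u' k"
  using assms(1,4)
proof (induction k)
  case (Suc k)
  have "ae_eq (r 0) (r k) u u'" "ae_eq (r k) (r (Suc k)) u u'"
    using Suc.prems r_step[of k] ae_eq_mono[OF Suc.prems(2)] by auto
  then show ?case using Suc assms label_cong[of k u u'] by simp
qed simp

text \<open>The reply on interval \<open>j\<close> uses the labels of the earlier intervals only, so
  the grid itself is the partition witnessing the delay. Measurability follows because histories are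
  countably many.\<close>

lemma policy_strategy:
  assumes "M \<in> \<E>"
  shows "(M, \<lambda>\<omega> u. policy_control r n \<sigma> (observed_history \<eta> r \<sigma> u n)) \<in> random_strategies \<E> (r 0) T U V"
proof (rule random_strategiesI[where \<tau>=r and k=n, OF assms])
  have "(\<lambda>h. policy_control r n \<sigma> h) \<in> count_space UNIV \<rightarrow>\<^sub>M control_space (r 0) T V"
    using policy_control_controls by auto
  from measurable_compose[OF measurable_compose[OF measurable_snd observed_history_measurable[OF order_refl]] this]
  show "(\<lambda>(\<omega>, b). policy_control r n \<sigma> (observed_history \<eta> r \<sigma> b n))
    \<in> M \<Otimes>\<^sub>M control_space (r 0) T U \<rightarrow>\<^sub>M control_space (r 0) T V"
    by (simp add: case_prod_unfold)
  fix u u' j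
  assume "u \<in> controls (r 0) T U" "u' \<in> controls (r 0) T U" "j < n" "ae_eq (r 0) (r j) u u'"
  then show "ae_eq (r 0) (r (Suc j)) (policy_control r n \<sigma> (observed_history \<eta> r \<sigma> u n))
      (policy_control r n \<sigma> (observed_history \<eta> r \<sigma> u' n))"
    by (intro policy_control_prefix) (auto simp: take_observed_history intro: observed_history_cong)
qed (use r_grid in \<open>auto simp: grid_def\<close>)

context
  fixes a
  assumes a: "delayed (r 0) T V U a"
begin

lemma a_controls: "v \<in> controls (r 0) T V \<Longrightarrow> a v \<in> controls (r 0) T U"
  using a by (auto simp: delayed_def)

abbreviation "hist \<equiv> play_history \<eta> r n \<sigma> a"

text \<open>Induction along the grid: equal histories before interval \<open>k\<close> fix the reply
  on it, and the nonanticipativity of \<open>a\<close> then forces the same control, hence the same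
  label.\<close>

lemma observed_eq_play_history:
  assumes u: "u \<in> controls (r 0) T U" and v: "v \<in> controls (r 0) T V" and au: "ae_eq (r 0) T (a v) u"
    and bv: "ae_eq (r 0) T (policy_control r n \<sigma> (observed_history \<eta> r \<sigma> u n)) v"
  shows "k \<le> n \<Longrightarrow> observed_history \<eta> r \<sigma> u k = hist k"
proof (induction k)
  case (Suc k)
  then have k: "k < n" and IH: "observed_history \<eta> r \<sigma> u k = hist k" by auto
  have "ae_eq (r 0) (r (Suc k)) (policy_control r n \<sigma> (hist k)) (policy_control r n \<sigma> (observed_history \<eta> r \<sigma> u n))"
    using k IH by (intro policy_control_prefix) (auto simp: take_observed_history)
  then have "ae_eq (r 0) (r (Suc k)) (policy_control r n \<sigma> (hist k)) v"
    using ae_eq_trans ae_eq_mono[OF bv order_refl] r_step[OF k] by blast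
  then have "ae_eq (r 0) (r (Suc k)) (a (policy_control r n \<sigma> (hist k))) (a v)"
    using r_step[OF k] by (intro delayed_nonanticipative[OF a policy_control_controls v]) auto
  then have "ae_eq (r k) (r (Suc k)) (a (policy_control r n \<sigma> (hist k))) u"
    using ae_eq_trans[OF ae_eq_mono ae_eq_mono[OF au]] r_step[OF k] by blast
  then have "label \<eta> r k (\<sigma> (hist k)) (a (policy_control r n \<sigma> (hist k))) = label \<eta> r k (\<sigma> (hist k)) u"
    by (intro label_cong k a_controls policy_control_controls u)
  then show ?case by (simp add: IH)
qed simp

lemma policy_play_pay:
  assumes u: "u \<in> controls (r 0) T U" and v: "v \<in> controls (r 0) T V" and au: "ae_eq (r 0) T (a v) u"
    and bv: "ae_eq (r 0) T (policy_control r n \<sigma> (observed_history \<eta> r \<sigma> u n)) v"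
  shows "pay i (r 0) T u v = pay i (r 0) T (a (policy_control r n \<sigma> (hist n))) (policy_control r n \<sigma> (hist n))"
proof -
  have v': "ae_eq (r 0) T (policy_control r n \<sigma> (hist n)) v"
    using bv observed_eq_play_history[OF assms order_refl] by simp
  then have "ae_eq (r 0) T (a (policy_control r n \<sigma> (hist n))) (a v)"
    by (intro delayed_nonanticipative[OF a policy_control_controls v]) auto
  then have "ae_eq (r 0) T u (a (policy_control r n \<sigma> (hist n)))"
    using au ae_eq_sym ae_eq_trans by blast
  then show ?thesis
    using r_grid v' by (intro pay_cong[OF u v a_controls[OF policy_control_controls] policy_control_controls])
      (auto intro: ae_eq_sym)
qed

lemma policy_pay_decomposition:
  "pay i (r 0) T (a (policy_control r n \<sigma> (hist n))) (policy_control r n \<sigma> (hist n)) =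
    (\<Sum>k<n. pay i (r k) (r (Suc k)) (a (policy_control r n \<sigma> (hist k))) (\<lambda>s\<in>{r 0..T}. \<sigma> (hist k)))"
proof -
  have "pay i (r 0) (r n) (a (policy_control r n \<sigma> (hist n))) (policy_control r n \<sigma> (hist n)) =
    (\<Sum>k<n. pay i (r k) (r (Suc k)) (a (policy_control r n \<sigma> (hist n))) (policy_control r n \<sigma> (hist n)))"
    using r_grid by (intro pay_grid a_controls policy_control_controls) auto
  also have "\<dots> = (\<Sum>k<n. pay i (r k) (r (Suc k)) (a (policy_control r n \<sigma> (hist k))) (\<lambda>s\<in>{r 0..T}. \<sigma> (hist k)))"
  proof (intro sum.cong refl)
    fix k assume "k \<in> {..<n}"
    then have k: "k < n" by simp
    have "ae_eq (r 0) (r (Suc k)) (policy_control r n \<sigma> (hist n)) (policy_control r n \<sigma> (hist k))"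
      using k by (intro policy_control_prefix) (auto simp: take_play_history)
    then have "ae_eq (r 0) (r (Suc k)) (a (policy_control r n \<sigma> (hist n))) (a (policy_control r n \<sigma> (hist k)))"
      using r_step[OF k] by (intro delayed_nonanticipative[OF a policy_control_controls policy_control_controls]) auto
    moreover have "ae_eq (r k) (r (Suc k)) (policy_control r n \<sigma> (hist n)) (\<lambda>s\<in>{r 0..T}. \<sigma> (hist k))"
      using policy_control_interval[OF k, of "hist n"] k by (simp add: take_play_history)
    ultimately show "pay i (r k) (r (Suc k)) (a (policy_control r n \<sigma> (hist n))) (policy_control r n \<sigma> (hist n)) =
        pay i (r k) (r (Suc k)) (a (policy_control r n \<sigma> (hist k))) (\<lambda>s\<in>{r 0..T}. \<sigma> (hist k))"
      using r_step[OF k] r_grid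
      by (intro pay_cong[OF a_controls[OF policy_control_controls] policy_control_controls
            a_controls[OF policy_control_controls] const_control[OF \<sigma>]]) (auto intro: ae_eq_mono)
  qed
  finally show ?thesis by (simp add: r_grid)
qed

text \<open>Rounding down errs on the safe side: the labels underestimate the payoff that is to be
  bounded from below.\<close>

lemma policy_pay_ge:
  "(\<Sum>k<n. \<eta> * of_int (hist n ! k $ i)) \<le>
    pay i (r 0) T (a (policy_control r n \<sigma> (hist n))) (policy_control r n \<sigma> (hist n))"
  unfolding policy_pay_decomposition
proof (rule sum_mono)
  fix k assume "k \<in> {..<n}"
  then have k: "k < n" by simp
  have "\<eta> * of_int \<lfloor>x / \<eta>\<rfloor> \<le> x" for x
    using floor_divide_lower[OF \<eta>, of x] by (simp add: mult.commute)
  then show "\<eta> * of_int (hist n ! k $ i) \<le>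
      pay i (r k) (r (Suc k)) (a (policy_control r n \<sigma> (hist k))) (\<lambda>s\<in>{r 0..T}. \<sigma> (hist k))"
    using play_history_nth[OF k, of \<eta> r n \<sigma> a] by (simp add: label_def)
qed

end

text \<open>The additional 1 in \<open>C + 1\<close> absorbs the rounding error, which is at most
  the length of the interval. The second bound makes the alphabet finite.\<close>

lemma label_bounds:
  assumes "k < n" "u \<in> controls (r 0) T U" "\<eta> \<le> r (Suc k) - r k"
  shows "\<bar>\<eta> * of_int (label \<eta> r k (\<sigma> h) u $ i)\<bar> \<le> (C + 1) * (r (Suc k) - r k)"
    "\<bar>label \<eta> r k (\<sigma> h) u $ i\<bar> \<le> \<lceil>(C + 1) * T / \<eta>\<rceil>"
proof -
  define x where "x = pay i (r k) (r (Suc k)) u (\<lambda>s\<in>{r 0..T}. \<sigma> h)"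
  have "\<bar>x\<bar> \<le> (r (Suc k) - r k) * C"
    unfolding x_def using r_step[OF assms(1)] r_grid
    by (intro pay_bound[OF assms(2) const_control[OF \<sigma>]]) auto
  moreover have "\<eta> * of_int \<lfloor>x / \<eta>\<rfloor> \<le> x" "x - \<eta> \<le> \<eta> * of_int \<lfloor>x / \<eta>\<rfloor>"
    using floor_divide_lower[OF \<eta>, of x] floor_divide_upper[OF \<eta>, of x] by (auto simp: algebra_simps)
  ultimately show *: "\<bar>\<eta> * of_int (label \<eta> r k (\<sigma> h) u $ i)\<bar> \<le> (C + 1) * (r (Suc k) - r k)"
    using assms(3) by (auto simp: label_def x_def[symmetric] abs_le_iff algebra_simps)
  also have "\<dots> \<le> (C + 1) * T"
    using r_step[OF assms(1)] r_grid C_pos by (intro mult_left_mono) auto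
  finally have "\<bar>of_int (label \<eta> r k (\<sigma> h) u $ i)\<bar> \<le> (C + 1) * T / \<eta>"
    using \<eta> by (simp add: abs_mult field_simps)
  then have "real_of_int \<bar>label \<eta> r k (\<sigma> h) u $ i\<bar> \<le> real_of_int \<lceil>(C + 1) * T / \<eta>\<rceil>"
    unfolding of_int_abs by (rule order_trans[OF _ le_of_int_ceiling])
  then show "\<bar>label \<eta> r k (\<sigma> h) u $ i\<bar> \<le> \<lceil>(C + 1) * T / \<eta>\<rceil>" by (simp only: of_int_le_iff)
qed

text \<open>One \<open>\<rho>\<close> pays for freezing the payoffs at \<open>r k\<close>, the other
  for rounding, since \<open>\<eta>\<close> is at most \<open>\<rho>\<close> times the length of the
  interval.\<close>

lemma label_vector_ge:
  assumes k: "k < n" and u: "u \<in> controls (r 0) T U" and m: "nonneg m" 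
    and b: "\<And>x. x \<in> U \<Longrightarrow> b \<le> F (r k) m x (\<sigma> h)" and e: "\<eta> \<le> \<rho> * (r (Suc k) - r k)"
  shows "(r (Suc k) - r k) * (b - 2 * \<rho> * mass m) \<le> m \<bullet> (\<chi> i. \<eta> * of_int (label \<eta> r k (\<sigma> h) u $ i))"
proof -
  define v where "v = (\<lambda>s\<in>{r 0..T}. \<sigma> h)"
  have v: "v \<in> controls (r 0) T V" unfolding v_def by (rule const_control[OF \<sigma>])
  have i: "set_integrable lebesgue {r k..r (Suc k)} (\<lambda>s. F s m (u s) (v s))"
    using r_step[OF k] r_grid by (intro pay_vector_integral[OF u v]) auto
  have "- (m \<bullet> (\<chi> i. pay i (r k) (r (Suc k)) u v)) = - (LINT s:{r k..r (Suc k)}|lebesgue. F s m (u s) (v s))"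
    using r_step[OF k] r_grid by (subst pay_vector_integral[OF u v]) auto
  also have "\<dots> = (LINT s:{r k..r (Suc k)}|lebesgue. - F s m (u s) (v s))"
    by (simp add: set_lebesgue_integral_def)
  also have "\<dots> \<le> (r (Suc k) - r k) * (- b + \<rho> * mass m)"
  proof (rule set_integral_lebesgue_le)
    show "set_integrable lebesgue {r k..r (Suc k)} (\<lambda>s. - F s m (u s) (v s))"
      using i by (simp add: set_integrable_def)
    fix s assume s: "s \<in> {r k..r (Suc k)}"
    then have "u s \<in> U" "v s = \<sigma> h" using u r_step[OF k] by (auto simp: controls_def v_def)
    then show "- F s m (u s) (v s) \<le> - b + \<rho> * mass m"
      using fine_grid_F[OF r k s m, of "u s" "v s"] b[of "u s"] \<sigma>[of h] by (simp add: abs_le_iff)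
  qed (use r_step[OF k] in simp)
  finally have 1: "(r (Suc k) - r k) * (b - \<rho> * mass m) \<le> m \<bullet> (\<chi> i. pay i (r k) (r (Suc k)) u v)"
    by (simp add: algebra_simps)
  have "pay i (r k) (r (Suc k)) u v - \<eta> \<le> \<eta> * of_int (label \<eta> r k (\<sigma> h) u $ i)" for i
    using floor_divide_upper[OF \<eta>, of "pay i (r k) (r (Suc k)) u v"]
    by (simp add: label_def v_def[symmetric] algebra_simps)
  then have "(\<Sum>i\<in>UNIV. m $ i * (pay i (r k) (r (Suc k)) u v - \<eta>)) \<le>
      m \<bullet> (\<chi> i. \<eta> * of_int (label \<eta> r k (\<sigma> h) u $ i))"
    using m unfolding inner_vec_def by (intro sum_mono) (auto simp: nonneg_def intro: mult_left_mono)
  moreover have "(\<Sum>i\<in>UNIV. m $ i * (pay i (r k) (r (Suc k)) u v - \<eta>)) =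
      m \<bullet> (\<chi> i. pay i (r k) (r (Suc k)) u v) - \<eta> * mass m"
    by (simp add: inner_vec_def mass_def right_diff_distrib sum_subtractf sum_distrib_left mult.commute)
  moreover have "\<eta> * mass m \<le> \<rho> * (r (Suc k) - r k) * mass m"
    using e mass_nonneg[OF m] by (intro mult_right_mono)
  ultimately show ?thesis using 1 by (simp add: algebra_simps)
qed

end

end

section \<open>Self-consistent beliefs and near-optimal trees\<close>

context random_game
begin

declare play_history.simps(2) [simp del]

context
  fixes \<rho> \<eta> :: real and r :: "nat \<Rightarrow> real" and n :: nat and p :: "real^'i"
    and \<alpha> :: "'i \<Rightarrow> 'w measure \<times> ('w \<Rightarrow> (real \<Rightarrow> 'v) \<Rightarrow> (real \<Rightarrow> 'u))"
  assumes r: "fine_grid \<rho> r n" and \<eta>: "0 < \<eta>" and p: "p \<in> prob_simplex" and \<rho>: "0 < \<rho>"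
    and \<alpha>: "\<And>i. \<alpha> i \<in> SU (r 0)"
begin

abbreviation hist_of :: "((int^'i) list \<Rightarrow> 'v) \<Rightarrow> 'i \<Rightarrow> 'w \<Rightarrow> nat \<Rightarrow> (int^'i) list" where
  "hist_of \<sigma> i \<omega> k \<equiv> play_history \<eta> r n \<sigma> (snd (\<alpha> i) \<omega>) k"

text \<open>The joint law of type and label history under the prior and the informed player's
  strategies, that is, the unnormalised posterior of the uninformed player.\<close>

definition history_weight :: "((int^'i) list \<Rightarrow> 'v) \<Rightarrow> (int^'i) list \<Rightarrow> real^'i" where
  "history_weight \<sigma> h = (\<chi> i. p $ i *
     measure (fst (\<alpha> i)) {\<omega>\<in>space (fst (\<alpha> i)). hist_of \<sigma> i \<omega> (length h) = h})"

lemma nonneg_history_weight: "nonneg (history_weight \<sigma> h)"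
  using p by (simp add: nonneg_def history_weight_def prob_simplex_def)

lemma history_weight_cong:
  assumes "\<And>g. length g < length h \<Longrightarrow> \<sigma> g = \<sigma>' g"
  shows "history_weight \<sigma> h = history_weight \<sigma>' h"
proof -
  have "hist_of \<sigma> i \<omega> (length h) = hist_of \<sigma>' i \<omega> (length h)" for i \<omega>
    by (rule play_history_cong) (rule assms)
  then show ?thesis unfolding history_weight_def by simp
qed

text \<open>The belief after a history depends only on the replies to shorter histories, so a policy
  that is optimal for its own beliefs can be built level by level.\<close>

lemma consistent_policy_exists:
  "\<exists>\<sigma>. (\<forall>h. \<sigma> h \<in> V) \<and> (\<forall>h. length h < n \<longrightarrow> (\<forall>u\<in>U.
     H (r (length h)) (history_weight \<sigma> h) - \<rho> * mass (history_weight \<sigma> h)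
       \<le> F (r (length h)) (history_weight \<sigma> h) u (\<sigma> h)))"
proof -
  have "k \<le> n \<Longrightarrow> \<exists>\<sigma>. (\<forall>h. \<sigma> h \<in> V) \<and> (\<forall>h. length h < k \<longrightarrow> (\<forall>u\<in>U.
     H (r (length h)) (history_weight \<sigma> h) - \<rho> * mass (history_weight \<sigma> h)
       \<le> F (r (length h)) (history_weight \<sigma> h) u (\<sigma> h)))" for k
  proof (induction k)
    case 0
    obtain v where "v \<in> V" using V_ne by auto
    then show ?case by (intro exI[of _ "\<lambda>_. v"]) auto
  next
    case (Suc k)
    then obtain \<sigma> where \<sigma>: "\<And>h. \<sigma> h \<in> V" and opt: "\<And>h u. length h < k \<Longrightarrow> u \<in> U \<Longrightarrow>
     H (r (length h)) (history_weight \<sigma> h) - \<rho> * mass (history_weight \<sigma> h)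
       \<le> F (r (length h)) (history_weight \<sigma> h) u (\<sigma> h)" by auto
    have "\<exists>v. v \<in> V \<and> (\<forall>u\<in>U. H (r k) (history_weight \<sigma> h) - \<rho> * mass (history_weight \<sigma> h)
       \<le> F (r k) (history_weight \<sigma> h) u v)" for h
      using near_optimal_v[OF fine_grid_range[OF r, of k] \<rho> nonneg_history_weight[of \<sigma> h]] Suc.prems
      by (metis Suc_leD)
    then obtain v where v: "\<And>h. v h \<in> V" "\<And>h u. u \<in> U \<Longrightarrow>
       H (r k) (history_weight \<sigma> h) - \<rho> * mass (history_weight \<sigma> h) \<le> F (r k) (history_weight \<sigma> h) u (v h)"
      by metis
    define \<sigma>' where "\<sigma>' h = (if length h = k then v h else \<sigma> h)" for h
    have eq: "history_weight \<sigma>' h = history_weight \<sigma> h" if "length h \<le> k" for h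
      using that by (intro history_weight_cong) (auto simp: \<sigma>'_def)
    show ?case
    proof (intro exI[of _ \<sigma>'] conjI allI impI ballI)
      show "\<sigma>' h \<in> V" for h using \<sigma> v by (simp add: \<sigma>'_def)
      fix h u assume h: "length (h :: (int^'i) list) < Suc k" and u: "u \<in> U"
      show "H (r (length h)) (history_weight \<sigma>' h) - \<rho> * mass (history_weight \<sigma>' h)
          \<le> F (r (length h)) (history_weight \<sigma>' h) u (\<sigma>' h)"
      proof (cases "length h = k")
        case True
        then show ?thesis using v(2)[OF u, of h] eq[of h] by (simp add: \<sigma>'_def)
      next
        case False
        then show ?thesis using opt[of h, OF _ u] eq[of h] h by (simp add: \<sigma>'_def)
      qed
    qed
  qed
  then show ?thesis by blast
qed

context
  fixes \<sigma> :: "(int^'i) list \<Rightarrow> 'v"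
  assumes \<sigma>: "\<And>h. \<sigma> h \<in> V"
begin

lemma strategy_delayed: "\<omega> \<in> space (fst (\<alpha> i)) \<Longrightarrow> delayed (r 0) T V U (snd (\<alpha> i) \<omega>)"
  by (rule SU_delayed[OF \<alpha>])

lemma strategy_controls:
  "\<omega> \<in> space (fst (\<alpha> i)) \<Longrightarrow> v \<in> controls (r 0) T V \<Longrightarrow> snd (\<alpha> i) \<omega> v \<in> controls (r 0) T U"
  using strategy_delayed[of \<omega> i] by (auto simp: delayed_def)

lemma reply_measurable:
  "(\<lambda>\<omega>. snd (\<alpha> i) \<omega> (policy_control r n \<sigma> h)) \<in> fst (\<alpha> i) \<rightarrow>\<^sub>M control_space (r 0) T U"
  using \<alpha> policy_control_controls[where \<sigma>=\<sigma>, OF r \<sigma> \<eta>] unfolding SU_def by (intro random_strategy_section)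

text \<open>Once the previous labels are prescribed the reply is a fixed control, so the next label
  depends on chance only through a measurable section of the strategy.\<close>

lemma play_history_sets:
  "k \<le> n \<Longrightarrow> {\<omega>\<in>space (fst (\<alpha> i)). hist_of \<sigma> i \<omega> k = h} \<in> sets (fst (\<alpha> i))"
proof (induction k arbitrary: h)
  case (Suc k)
  show ?case
  proof (cases "h = []")
    case False
    have "{\<omega>\<in>space (fst (\<alpha> i)). hist_of \<sigma> i \<omega> (Suc k) = h} =
      {\<omega>\<in>space (fst (\<alpha> i)). hist_of \<sigma> i \<omega> k = butlast h} \<inter>
      ((\<lambda>\<omega>. snd (\<alpha> i) \<omega> (policy_control r n \<sigma> (butlast h))) -`
        (label \<eta> r k (\<sigma> (butlast h)) -` {last h} \<inter> controls (r 0) T U) \<inter> space (fst (\<alpha> i)))"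
      using False measurable_space[OF reply_measurable, of _ i "butlast h"]
      by (auto simp: snoc_eq_iff_butlast play_history.simps(2))
    also have "\<dots> \<in> sets (fst (\<alpha> i))"
      using Suc by (intro sets.Int measurable_sets[OF reply_measurable] label_measurable[where \<sigma>=\<sigma>, OF r \<sigma> \<eta>]) auto
    finally show ?thesis .
  next
    case True
    then have "{\<omega>\<in>space (fst (\<alpha> i)). hist_of \<sigma> i \<omega> (Suc k) = h} = {}" by (auto simp: play_history.simps(2))
    then show ?thesis by (simp only: sets.empty_sets)
  qed
qed auto

lemma play_history_measurable:
  "k \<le> n \<Longrightarrow> (\<lambda>\<omega>. hist_of \<sigma> i \<omega> k) \<in> fst (\<alpha> i) \<rightarrow>\<^sub>M count_space UNIV"
  using play_history_sets[of k i]
  by (subst measurable_count_space_eq2_countable) (auto simp: vimage_def Int_def conj_commute)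

definition alphabet :: "(int^'i) set" where
  "alphabet = {c. \<forall>i. \<bar>c $ i\<bar> \<le> \<lceil>(C + 1) * T / \<eta>\<rceil>}"

context
  assumes \<eta>_le: "\<And>k. k < n \<Longrightarrow> \<eta> \<le> r (Suc k) - r k"
begin

lemma hist_words: "\<omega> \<in> space (fst (\<alpha> i)) \<Longrightarrow> k \<le> n \<Longrightarrow> hist_of \<sigma> i \<omega> k \<in> words alphabet k"
proof (induction k)
  case (Suc k)
  have "label \<eta> r k (\<sigma> h) (snd (\<alpha> i) \<omega> (policy_control r n \<sigma> g)) \<in> alphabet" for h g
    unfolding alphabet_def mem_Collect_eq
    using Suc.prems \<eta>_le[of k] strategy_controls[OF Suc.prems(1) policy_control_controls[where \<sigma>=\<sigma>, OF r \<sigma> \<eta>]]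
    by (intro allI label_bounds(2)[where \<sigma>=\<sigma>, OF r \<sigma> \<eta>]) auto
  then show ?case using Suc by (auto simp: words_def play_history.simps(2))
qed simp

lemma weight_tree_history: "weight_tree alphabet n (history_weight \<sigma>)"
  unfolding weight_tree_def
proof (intro conjI allI impI ballI)
  show "finite alphabet" unfolding alphabet_def by (rule finite_bounded_labels)
  show "nonneg (history_weight \<sigma> h)" for h by (rule nonneg_history_weight)
  fix k h assume k: "k < n" and h: "h \<in> words alphabet k"
  have "measure (fst (\<alpha> i)) {\<omega>\<in>space (fst (\<alpha> i)). hist_of \<sigma> i \<omega> k = h} =
    (\<Sum>c\<in>alphabet. measure (fst (\<alpha> i)) {\<omega>\<in>space (fst (\<alpha> i)). hist_of \<sigma> i \<omega> (Suc k) = h @ [c]})" for i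
  proof -
    interpret prob_space "fst (\<alpha> i)" by (rule prob_space_SU[OF \<alpha>])
    have "{\<omega>\<in>space (fst (\<alpha> i)). hist_of \<sigma> i \<omega> k = h} =
      (\<Union>c\<in>alphabet. {\<omega>\<in>space (fst (\<alpha> i)). hist_of \<sigma> i \<omega> (Suc k) = h @ [c]})"
      using hist_words[of _ i "Suc k"] k by (auto simp: words_def play_history.simps(2))
    then show ?thesis
      using \<open>finite alphabet\<close> play_history_sets[of "Suc k" i] k
      by (simp only:, subst finite_measure_finite_Union) (auto simp: disjoint_family_on_def)
  qed
  then show "history_weight \<sigma> h = (\<Sum>c\<in>alphabet. history_weight \<sigma> (h @ [c]))"
    using h by (simp add: history_weight_def vec_eq_iff words_def sum_distrib_left)
qed

lemma history_weight_Nil: "history_weight \<sigma> [] = p"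
proof -
  have "measure (fst (\<alpha> i)) (space (fst (\<alpha> i))) = 1" for i
    using prob_space_SU[OF \<alpha>] by (rule prob_space.prob_space)
  then show ?thesis by (simp add: history_weight_def vec_eq_iff)
qed

text \<open>The policy is deterministic, so the second factor of the product space integrates out,
  and what remains is a sum over the finitely many label histories.\<close>

lemma expected_payoff_policy_ge:
  assumes M: "M \<in> \<E>"
  shows "(\<Sum>h\<in>words alphabet n. measure (fst (\<alpha> i)) {\<omega>\<in>space (fst (\<alpha> i)). hist_of \<sigma> i \<omega> n = h} *
      (\<Sum>k<n. \<eta> * of_int (h ! k $ i)))
    \<le> expected_payoff (r 0) T U V (l i) (\<alpha> i) (M, \<lambda>\<omega> u. policy_control r n \<sigma> (observed_history \<eta> r \<sigma> u n))"
proof -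
  define \<beta> where "\<beta> = (M, \<lambda>(\<omega>::'w) u. policy_control r n \<sigma> (observed_history \<eta> r \<sigma> u n))"
  have \<beta>: "\<beta> \<in> SV (r 0)" unfolding SV_def \<beta>_def by (rule policy_strategy[where \<sigma>=\<sigma>, OF r \<sigma> \<eta> M])
  interpret M1: prob_space "fst (\<alpha> i)" by (rule prob_space_SU[OF \<alpha>])
  interpret M2: prob_space "fst \<beta>" by (rule prob_space_SV[OF \<beta>])
  define Y where "Y h \<omega> = pay i (r 0) T (snd (\<alpha> i) \<omega> (policy_control r n \<sigma> h)) (policy_control r n \<sigma> h)" for h \<omega>
  have fin: "finite (words alphabet n)"
    using weight_tree_history by (intro finite_words) (simp add: weight_tree_def)
  define X where "X \<omega> = Y (hist_of \<sigma> i \<omega> n) \<omega>" for \<omega>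
  have "expected_payoff (r 0) T U V (l i) (\<alpha> i) \<beta> = (LINT \<omega>|(fst (\<alpha> i) \<Otimes>\<^sub>M fst \<beta>). X (fst \<omega>))"
  proof (rule expected_payoff_eq[OF \<alpha> \<beta>, where X="\<lambda>\<omega> _. X \<omega>"])
    fix \<omega>1 \<omega>2 u v
    assume "\<omega>1 \<in> space (fst (\<alpha> i))" "u \<in> controls (r 0) T U" "v \<in> controls (r 0) T V"
      "ae_eq (r 0) T (snd (\<alpha> i) \<omega>1 v) u" "ae_eq (r 0) T (snd \<beta> \<omega>2 u) v"
    then show "pay i (r 0) T u v = X \<omega>1"
      unfolding X_def Y_def by (intro policy_play_pay[where \<sigma>=\<sigma>, OF r \<sigma> \<eta> strategy_delayed]) (auto simp: \<beta>_def)
  qed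
  also have "\<dots> = integral\<^sup>L (fst (\<alpha> i)) X"
  proof -
    have Xm: "X \<in> borel_measurable (fst (\<alpha> i))"
      unfolding X_def
    proof (rule measurable_compose_countable[OF _ play_history_measurable[OF order_refl]])
      fix h
      have "(\<lambda>u. pay i (r 0) T u (policy_control r n \<sigma> h)) \<in> borel_measurable (control_space (r 0) T U)"
        using r_grid[where \<sigma>=\<sigma>, OF r \<sigma> \<eta>] grid_le[of r n 0 n] policy_control_controls[where \<sigma>=\<sigma>, OF r \<sigma> \<eta>] by (intro pay_measurable) auto
      from measurable_compose[OF reply_measurable this] show "Y h \<in> borel_measurable (fst (\<alpha> i))"
        by (simp add: Y_def[abs_def])
    qed
    have "integral\<^sup>L (distr (fst (\<alpha> i) \<Otimes>\<^sub>M fst \<beta>) (fst (\<alpha> i)) fst) X = (LINT \<omega>|(fst (\<alpha> i) \<Otimes>\<^sub>M fst \<beta>). X (fst \<omega>))"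
      by (rule integral_distr[OF measurable_fst Xm])
    then show ?thesis unfolding M2.distr_pair_fst by simp
  qed
  also have "\<dots> \<ge> (LINT \<omega>|fst (\<alpha> i). (\<Sum>h\<in>words alphabet n.
      indicator {\<omega>\<in>space (fst (\<alpha> i)). hist_of \<sigma> i \<omega> n = h} \<omega> * (\<Sum>k<n. \<eta> * of_int (h ! k $ i))))"
  proof (rule integral_mono)
    have Xm: "X \<in> borel_measurable (fst (\<alpha> i))"
      unfolding X_def
    proof (rule measurable_compose_countable[OF _ play_history_measurable[OF order_refl]])
      fix h
      have "(\<lambda>u. pay i (r 0) T u (policy_control r n \<sigma> h)) \<in> borel_measurable (control_space (r 0) T U)"
        using r_grid[where \<sigma>=\<sigma>, OF r \<sigma> \<eta>] grid_le[of r n 0 n] policy_control_controls[where \<sigma>=\<sigma>, OF r \<sigma> \<eta>] by (intro pay_measurable) auto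
      from measurable_compose[OF reply_measurable this] show "Y h \<in> borel_measurable (fst (\<alpha> i))"
        by (simp add: Y_def[abs_def])
    qed
    show "integrable (fst (\<alpha> i)) X"
    proof (rule M1.integrable_const_bound[OF AE_I2 Xm])
      fix \<omega> assume "\<omega> \<in> space (fst (\<alpha> i))"
      then show "norm (X \<omega>) \<le> (T - r 0) * C"
        unfolding X_def Y_def real_norm_def using r_grid[where \<sigma>=\<sigma>, OF r \<sigma> \<eta>] grid_le[of r n 0 n]
        by (intro pay_bound[OF strategy_controls policy_control_controls[where \<sigma>=\<sigma>, OF r \<sigma> \<eta>]]
            policy_control_controls[where \<sigma>=\<sigma>, OF r \<sigma> \<eta>]) auto
    qed
    show "integrable (fst (\<alpha> i)) (\<lambda>\<omega>. (\<Sum>h\<in>words alphabet n.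
      indicator {\<omega>\<in>space (fst (\<alpha> i)). hist_of \<sigma> i \<omega> n = h} \<omega> * (\<Sum>k<n. \<eta> * of_int (h ! k $ i))))"
      using play_history_sets[of n i]
      by (intro Bochner_Integration.integrable_sum integrable_mult_left integrable_real_indicator)
        (auto simp: M1.emeasure_eq_measure)
    fix \<omega> assume \<omega>: "\<omega> \<in> space (fst (\<alpha> i))"
    have "(\<Sum>h\<in>words alphabet n.
      indicator {\<omega>\<in>space (fst (\<alpha> i)). hist_of \<sigma> i \<omega> n = h} \<omega> * (\<Sum>k<n. \<eta> * of_int (h ! k $ i))) =
      (\<Sum>h\<in>words alphabet n. if hist_of \<sigma> i \<omega> n = h then (\<Sum>k<n. \<eta> * of_int (h ! k $ i)) else 0)"
      using \<omega> by (intro sum.cong) auto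
    also have "\<dots> = (\<Sum>k<n. \<eta> * of_int (hist_of \<sigma> i \<omega> n ! k $ i))"
      using hist_words[OF \<omega> order_refl] by (subst sum.delta'[OF fin]) (simp only: if_True)
    also have "\<dots> \<le> X \<omega>"
      unfolding X_def Y_def by (rule policy_pay_ge[where \<sigma>=\<sigma>, OF r \<sigma> \<eta> strategy_delayed[OF \<omega>]])
    finally show "(\<Sum>h\<in>words alphabet n.
      indicator {\<omega>\<in>space (fst (\<alpha> i)). hist_of \<sigma> i \<omega> n = h} \<omega> * (\<Sum>k<n. \<eta> * of_int (h ! k $ i))) \<le> X \<omega>" .
  qed
  also have "(LINT \<omega>|fst (\<alpha> i). (\<Sum>h\<in>words alphabet n.
      indicator {\<omega>\<in>space (fst (\<alpha> i)). hist_of \<sigma> i \<omega> n = h} \<omega> * (\<Sum>k<n. \<eta> * of_int (h ! k $ i)))) =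
    (\<Sum>h\<in>words alphabet n. measure (fst (\<alpha> i)) {\<omega>\<in>space (fst (\<alpha> i)). hist_of \<sigma> i \<omega> n = h} *
      (\<Sum>k<n. \<eta> * of_int (h ! k $ i)))"
    using play_history_sets[of n i]
    by (subst Bochner_Integration.integral_sum)
      (auto intro!: integrable_mult_left integrable_real_indicator simp: M1.emeasure_eq_measure)
  finally show ?thesis by (simp add: \<beta>_def)
qed

text \<open>Charges each label at the level where it appears; the marginal property carries the sum
  from complete histories to their prefixes.\<close>

lemma J_policy_ge:
  assumes M: "M \<in> \<E>"
  shows "(\<Sum>k<n. \<Sum>h\<in>words alphabet k. \<Sum>c\<in>alphabet.
      history_weight \<sigma> (h @ [c]) \<bullet> (\<chi> i. \<eta> * of_int (c $ i)))
    \<le> J (r 0) p \<alpha> (M, \<lambda>\<omega> u. policy_control r n \<sigma> (observed_history \<eta> r \<sigma> u n))"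
proof -
  define y where "y c = (\<chi> i. \<eta> * of_int (c $ i))" for c :: "int^'i"
  have fin: "finite alphabet" using weight_tree_history by (simp add: weight_tree_def)
  have "(\<Sum>k<n. \<Sum>h\<in>words alphabet k. \<Sum>c\<in>alphabet. history_weight \<sigma> (h @ [c]) \<bullet> y c) =
      (\<Sum>k<n. \<Sum>h\<in>words alphabet (Suc k). history_weight \<sigma> h \<bullet> y (last h))"
    by (simp add: sum_words_Suc[OF fin])
  also have "\<dots> = (\<Sum>k<n. \<Sum>h\<in>words alphabet n. history_weight \<sigma> h \<bullet> y (h ! k))"
  proof (rule sum.cong[OF refl])
    fix k assume k: "k \<in> {..<n}"
    have "(\<Sum>h\<in>words alphabet (Suc k). history_weight \<sigma> h \<bullet> y (last h)) =
      (\<Sum>h\<in>words alphabet n. history_weight \<sigma> h \<bullet> y (last (take (Suc k) h)))"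
      using weight_tree_marginal[OF weight_tree_history, of "Suc k" "\<lambda>h. y (last h)"] k by simp
    also have "\<dots> = (\<Sum>h\<in>words alphabet n. history_weight \<sigma> h \<bullet> y (h ! k))"
      using k by (intro sum.cong refl) (auto simp: words_def take_Suc_conv_app_nth)
    finally show "(\<Sum>h\<in>words alphabet (Suc k). history_weight \<sigma> h \<bullet> y (last h)) =
      (\<Sum>h\<in>words alphabet n. history_weight \<sigma> h \<bullet> y (h ! k))" .
  qed
  also have "\<dots> = (\<Sum>h\<in>words alphabet n. \<Sum>k<n. history_weight \<sigma> h \<bullet> y (h ! k))"
    by (rule sum.swap)
  also have "\<dots> = (\<Sum>h\<in>words alphabet n. \<Sum>i\<in>UNIV. p $ i *
      (measure (fst (\<alpha> i)) {\<omega>\<in>space (fst (\<alpha> i)). hist_of \<sigma> i \<omega> n = h} * (\<Sum>k<n. \<eta> * of_int (h ! k $ i))))"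
  proof (rule sum.cong[OF refl])
    fix h assume "h \<in> words alphabet n"
    then have "length h = n" by (simp add: words_def)
    then show "(\<Sum>k<n. history_weight \<sigma> h \<bullet> y (h ! k)) = (\<Sum>i\<in>UNIV. p $ i *
      (measure (fst (\<alpha> i)) {\<omega>\<in>space (fst (\<alpha> i)). hist_of \<sigma> i \<omega> n = h} * (\<Sum>k<n. \<eta> * of_int (h ! k $ i))))"
      by (simp add: history_weight_def inner_vec_def y_def) (subst sum.swap, simp add: sum_distrib_left mult.assoc)
  qed
  also have "\<dots> = (\<Sum>i\<in>UNIV. p $ i * (\<Sum>h\<in>words alphabet n.
      measure (fst (\<alpha> i)) {\<omega>\<in>space (fst (\<alpha> i)). hist_of \<sigma> i \<omega> n = h} * (\<Sum>k<n. \<eta> * of_int (h ! k $ i))))"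
    by (subst sum.swap) (simp add: sum_distrib_left)
  also have "\<dots> \<le> J (r 0) p \<alpha> (M, \<lambda>\<omega> u. policy_control r n \<sigma> (observed_history \<eta> r \<sigma> u n))"
    unfolding J_def using p expected_payoff_policy_ge[OF M]
    by (intro sum_mono mult_left_mono) (auto simp: prob_simplex_def)
  finally show ?thesis unfolding y_def .
qed

text \<open>The bounds on labels hold for labels of actual controls; positive weight provides a
  scenario that produces one.\<close>

lemma history_weight_nonzero:
  assumes "history_weight \<sigma> (h @ [c]) \<noteq> 0" "length h = k" "k < n"
  obtains u where "u \<in> controls (r 0) T U" "c = label \<eta> r k (\<sigma> h) u"
proof -
  obtain i where "history_weight \<sigma> (h @ [c]) $ i \<noteq> 0" using assms by (auto simp: vec_eq_iff)
  then have "measure (fst (\<alpha> i)) {\<omega>\<in>space (fst (\<alpha> i)). hist_of \<sigma> i \<omega> (Suc k) = h @ [c]} \<noteq> 0"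
    using assms(2) by (simp add: history_weight_def)
  then have "{\<omega>\<in>space (fst (\<alpha> i)). hist_of \<sigma> i \<omega> (Suc k) = h @ [c]} \<noteq> {}"
    by (metis measure_empty)
  then obtain \<omega> where \<omega>: "\<omega> \<in> space (fst (\<alpha> i))" "hist_of \<sigma> i \<omega> (Suc k) = h @ [c]" by blast
  then show ?thesis
    using that[of "snd (\<alpha> i) \<omega> (policy_control r n \<sigma> h)"]
      strategy_controls[OF \<omega>(1) policy_control_controls[where \<sigma>=\<sigma>, OF r \<sigma> \<eta>]]
    by (auto simp: play_history.simps(2))
qed

end

end

text \<open>The posteriors under the self-consistent policy form the tree. Of the three
  \<open>\<rho>\<close>, one comes from the near-optimal replies and two from
  \<open>label_vector_ge\<close>.\<close>

lemma lower_tree: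
  assumes \<eta>_le: "\<And>k. k < n \<Longrightarrow> \<eta> \<le> r (Suc k) - r k" "\<And>k. k < n \<Longrightarrow> \<eta> \<le> \<rho> * (r (Suc k) - r k)"
    and mesh: "\<And>k. k < n \<Longrightarrow> r (Suc k) - r k \<le> \<delta>" and a: "0 < a"
    and val: "\<And>\<beta>. \<beta> \<in> SV (r 0) \<Longrightarrow> J (r 0) p \<alpha> \<beta> \<le> X"
  shows "\<exists>(A :: (int^'i) set) m. weight_tree A n m \<and> m [] = p \<and>
    weight_tree_cost r A n m \<le> X + 3 * \<rho> * T + (C + 1) * (a * \<delta> + CARD('i) * T / (4 * a))"
proof -
  obtain \<sigma> where \<sigma>: "\<And>h. \<sigma> h \<in> V" and opt: "\<And>h u. length h < n \<Longrightarrow> u \<in> U \<Longrightarrow>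
     H (r (length h)) (history_weight \<sigma> h) - \<rho> * mass (history_weight \<sigma> h)
       \<le> F (r (length h)) (history_weight \<sigma> h) u (\<sigma> h)"
    using consistent_policy_exists by blast
  obtain M where M: "M \<in> \<E>" using randomization by (auto simp: randomization_class_def)
  note ge = r \<sigma> \<eta>
  define y where "y c = (\<chi> i. \<eta> * of_int (c $ i))" for c :: "int^'i"
  have g: "grid r n" "0 \<le> r 0" "r n = T" using r by (auto simp: fine_grid_def)
  have "weight_tree_cost r alphabet n (history_weight \<sigma>) - 3 * \<rho> * T - (C + 1) * (a * \<delta> + CARD('i) * T / (4 * a))
    \<le> (\<Sum>k<n. \<Sum>h\<in>words alphabet k. \<Sum>c\<in>alphabet. history_weight \<sigma> (h @ [c]) \<bullet> y c)"
  proof (rule tree_payoff_ge[OF weight_tree_history[OF \<sigma> \<eta>_le(1)] _ g mesh a])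
    show "mass (history_weight \<sigma> []) = 1"
      using history_weight_Nil[OF \<sigma> \<eta>_le(1)] p by (simp add: prob_simplex_iff)
    show "0 \<le> C + 1" "0 \<le> 3 * \<rho>" using C_pos \<rho> by auto
    fix k h c
    assume k: "k < n" and h: "h \<in> words alphabet k" and nz: "history_weight \<sigma> (h @ [c]) \<noteq> 0"
    have len: "length h = k" using h by (simp add: words_def)
    obtain u where u: "u \<in> controls (r 0) T U" "c = label \<eta> r k (\<sigma> h) u"
      using history_weight_nonzero[OF \<sigma> \<eta>_le(1) nz len k] by blast
    show "\<bar>y c $ i\<bar> \<le> (C + 1) * (r (Suc k) - r k)" for i
      using label_bounds(1)[where \<sigma>=\<sigma>, OF r \<sigma> \<eta> k u(1) \<eta>_le(1)[OF k]] by (simp add: y_def u(2))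
    show "(r (Suc k) - r k) * (H (r k) (history_weight \<sigma> h) - 3 * \<rho> * mass (history_weight \<sigma> h)) \<le> history_weight \<sigma> h \<bullet> y c"
      using label_vector_ge[where \<sigma>=\<sigma>, OF r \<sigma> \<eta> k u(1) nonneg_history_weight[of \<sigma> h] _ \<eta>_le(2)[OF k],
          where b="H (r k) (history_weight \<sigma> h) - \<rho> * mass (history_weight \<sigma> h)" and h=h] opt[of h] k len
      by (simp add: y_def u(2) algebra_simps)
  qed
  also have "\<dots> \<le> X"
    using J_policy_ge[OF \<sigma> \<eta>_le(1) M] val policy_strategy[where \<sigma>=\<sigma>, OF r \<sigma> \<eta> M]
    unfolding y_def SV_def by (meson order_trans)
  finally show ?thesis
    using weight_tree_history[OF \<sigma> \<eta>_le(1)] history_weight_Nil[OF \<sigma> \<eta>_le(1)]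
    by (intro exI[of _ alphabet] exI[of _ "history_weight \<sigma>"]) (simp add: algebra_simps)
qed

end

text \<open>The admissible mesh is chosen before the grid and the prior, so one
  \<open>\<delta>\<close> serves all starting times and all priors. The error splits into four equal
  parts: the near-optimal strategy, \<open>3 * \<rho> * T\<close> and the two terms from Young's
  inequality.\<close>

lemma near_optimal_tree:
  assumes "0 < \<epsilon>"
  obtains \<delta> where "0 < \<delta>" "\<And>r n p. grid r n \<Longrightarrow> 0 \<le> r 0 \<Longrightarrow> r n = T \<Longrightarrow> (\<And>k. k < n \<Longrightarrow> r (Suc k) - r k \<le> \<delta>) \<Longrightarrow>
      p \<in> prob_simplex \<Longrightarrow> \<exists>(A :: (int^'i) set) m. weight_tree A n m \<and> m [] = p \<and>
        weight_tree_cost r A n m \<le> Val (r 0) p + \<epsilon>"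
proof -
  define \<rho> where "\<rho> = \<epsilon> / (12 * T)"
  have \<rho>: "0 < \<rho>" "3 * \<rho> * T = \<epsilon> / 4" using assms T_pos by (auto simp: \<rho>_def)
  \<comment> \<open>Solves \<open>(C + 1) * CARD('i) * T / (4 * a) = \<epsilon> / 4\<close>.\<close>
  define a where "a = (C + 1) * CARD('i) * T / \<epsilon>"
  have a: "0 < a" using C_pos T_pos assms by (simp add: a_def)
  have a1: "(C + 1) * (CARD('i) * T / (4 * a)) = \<epsilon> / 4"
  proof -
    have "a * \<epsilon> = (C + 1) * CARD('i) * T" using assms by (simp add: a_def)
    then show ?thesis using a by (simp add: field_simps)
  qed
  obtain \<delta>1 where \<delta>1: "0 < \<delta>1" "\<And>r n. grid r n \<Longrightarrow> 0 \<le> r 0 \<Longrightarrow> r n = T \<Longrightarrow>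
    (\<And>k. k < n \<Longrightarrow> r (Suc k) - r k \<le> \<delta>1) \<Longrightarrow> fine_grid \<rho> r n"
    using fine_grid_exists[OF \<rho>(1)] by blast
  \<comment> \<open>With \<open>a\<close> fixed, the second bound makes the energy term
    \<open>(C + 1) * a * \<delta>\<close> at most \<open>\<epsilon> / 4\<close>.\<close>
  define \<delta> where "\<delta> = min \<delta>1 (\<epsilon> / (4 * (C + 1) * a))"
  have \<delta>: "0 < \<delta>" "\<delta> \<le> \<delta>1" using \<delta>1 assms a C_pos by (auto simp: \<delta>_def)
  have "(C + 1) * (a * \<delta>) \<le> (C + 1) * (a * (\<epsilon> / (4 * (C + 1) * a)))"
    using a C_pos by (intro mult_left_mono) (auto simp: \<delta>_def)
  also have "\<dots> = \<epsilon> / 4"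
  proof -
    have "c * (a * (\<epsilon> / (4 * c * a))) = \<epsilon> / 4" if "c \<noteq> 0" for c using a that by simp
    then show ?thesis using C_pos by (metis add_pos_pos less_irrefl zero_less_one)
  qed
  finally have a2: "(C + 1) * (a * \<delta>) \<le> \<epsilon> / 4" .
  show ?thesis
  proof (rule that[OF \<delta>(1)])
    fix r :: "nat \<Rightarrow> real" and n p
    assume g: "grid r n" "0 \<le> r 0" "r n = T" and mesh: "\<And>k. k < n \<Longrightarrow> r (Suc k) - r k \<le> \<delta>"
      and p: "p \<in> (prob_simplex :: (real^'i) set)"
    have fg: "fine_grid \<rho> r n" using \<delta>1(2)[OF g] mesh \<delta>(2) by fastforce
    have t: "r 0 \<in> {0..<T}" using g grid_less[OF g(1), of 0 n] by (auto simp: grid_def)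
    have "\<epsilon> / 4 > 0" using assms by simp
    from Val_near_optimal[OF t this, of p] obtain \<alpha> where \<alpha>: "\<And>i. \<alpha> i \<in> SU (r 0)"
      "\<And>\<beta>. \<beta> \<in> SV (r 0) \<Longrightarrow> J (r 0) p \<alpha> \<beta> \<le> Val (r 0) p + \<epsilon> / 4" by blast
    \<comment> \<open>The rounding is chosen last, once the grid is known; the factor
      \<open>min 1 \<rho>\<close> serves both smallness conditions of
      \<open>lower_tree\<close>.\<close>
    define \<eta> where "\<eta> = Min ((\<lambda>k. min 1 \<rho> * (r (Suc k) - r k)) ` {..<n})"
    have n: "0 < n" using g by (simp add: grid_def)
    have pos: "0 < min 1 \<rho> * (r (Suc k) - r k)" if "k < n" for k
      using g(1) that \<rho> by (auto simp: grid_def)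
    have \<eta>: "0 < \<eta>" unfolding \<eta>_def using n pos by (subst Min_gr_iff) auto
    have \<eta>_le: "\<eta> \<le> min 1 \<rho> * (r (Suc k) - r k)" if "k < n" for k
      unfolding \<eta>_def using that by (intro Min_le) auto
    have le: "min 1 \<rho> * (r (Suc k) - r k) \<le> 1 * (r (Suc k) - r k)"
      "min 1 \<rho> * (r (Suc k) - r k) \<le> \<rho> * (r (Suc k) - r k)" if "k < n" for k
      using g(1) that by (auto intro!: mult_right_mono simp: grid_def less_imp_le)
    have \<eta>1: "\<eta> \<le> r (Suc k) - r k" if "k < n" for k
      using \<eta>_le[OF that] le(1)[OF that] by simp
    have \<eta>2: "\<eta> \<le> \<rho> * (r (Suc k) - r k)" if "k < n" for k
      using \<eta>_le[OF that] le(2)[OF that] by simp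
    have "\<exists>(A :: (int^'i) set) m. weight_tree A n m \<and> m [] = p \<and>
      weight_tree_cost r A n m \<le> Val (r 0) p + \<epsilon> / 4 + 3 * \<rho> * T + (C + 1) * (a * \<delta> + CARD('i) * T / (4 * a))"
      by (rule lower_tree[OF fg \<eta> p \<rho>(1) \<alpha>(1) \<eta>1 \<eta>2 mesh a \<alpha>(2)])
    then obtain A :: "(int^'i) set" and m where "weight_tree A n m" "m [] = p"
      "weight_tree_cost r A n m \<le> Val (r 0) p + \<epsilon> / 4 + 3 * \<rho> * T + (C + 1) * (a * \<delta> + CARD('i) * T / (4 * a))"
      by (elim exE conjE)
    moreover have "(C + 1) * (a * \<delta> + CARD('i) * T / (4 * a)) \<le> \<epsilon> / 2"
      using a1 a2 unfolding distrib_left[of "C + 1"] by linarith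
    ultimately show "\<exists>(A :: (int^'i) set) m. weight_tree A n m \<and> m [] = p \<and>
        weight_tree_cost r A n m \<le> Val (r 0) p + \<epsilon>"
      using \<rho>(2) by (intro exI[of _ A] exI[of _ m]) auto
  qed
qed

end

section \<open>Martingale measures with finitely many paths\<close>

lemma vec_nth_borel_measurable: "(\<lambda>x. x $ i) \<in> borel_measurable (borel :: (real^'i::finite) measure)"
  by (intro borel_measurable_continuous_onI continuous_intros)

lemma axis_simplex: "axis i 1 \<in> (prob_simplex :: (real^'i::finite) set)"
  by (auto simp: prob_simplex_def axis_def)

lemma space_path_space [simp]: "space (path_space t0 T) = paths t0 T"
  unfolding path_space_def by (rule space_measure_of) auto

lemma space_path_filtration [simp]: "space (path_filtration t0 T t) = paths t0 T"
  unfolding path_filtration_def by (rule space_measure_of) auto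

lemma sets_path_space: "sets (path_space t0 T) = sigma_sets (paths t0 T) {{\<omega> \<in> paths t0 T. \<omega> s \<in> A} |s A. A \<in> sets borel}"
  unfolding path_space_def by (rule sets_measure_of) auto

lemma sets_path_filtration: "sets (path_filtration t0 T t) =
    sigma_sets (paths t0 T) {{\<omega> \<in> paths t0 T. \<omega> s \<in> A} |s A. s \<le> t \<and> A \<in> sets borel}"
  unfolding path_filtration_def by (rule sets_measure_of) auto

lemma sets_path_filtration_mono: "s \<le> t \<Longrightarrow> sets (path_filtration t0 T s) \<subseteq> sets (path_filtration t0 T t)"
  unfolding sets_path_filtration by (rule sigma_sets_mono') force

lemma sets_path_filtration_subset: "sets (path_filtration t0 T s) \<subseteq> sets (path_space t0 T)"
  unfolding sets_path_filtration sets_path_space by (rule sigma_sets_mono') force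

lemma coordinate_measurable_filtration:
  "s \<le> t \<Longrightarrow> (\<lambda>\<omega>. \<omega> s) \<in> borel_measurable (path_filtration t0 T t)"
proof (rule measurableI)
  fix A :: "(real^'i) set" assume "s \<le> t" "A \<in> sets borel"
  then show "(\<lambda>\<omega>. \<omega> s) -` A \<inter> space (path_filtration t0 T t) \<in> sets (path_filtration t0 T t)"
    unfolding sets_path_filtration by (intro sigma_sets.Basic) (auto intro!: exI[of _ s] exI[of _ A])
qed auto

lemma coordinate_measurable: "(\<lambda>\<omega>. \<omega> s) \<in> borel_measurable (path_space t0 T)"
proof (rule measurableI)
  fix A :: "(real^'i) set" assume "A \<in> sets borel"
  then show "(\<lambda>\<omega>. \<omega> s) -` A \<inter> space (path_space t0 T) \<in> sets (path_space t0 T)"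
    unfolding sets_path_space by (intro sigma_sets.Basic) (auto intro!: exI[of _ s] exI[of _ A])
qed auto

text \<open>Events that cannot separate paths agreeing up to \<open>t\<close> form a sigma-algebra
  containing the generators. For tree measures this makes an event of the filtration a function of
  the labels seen so far.\<close>

lemma path_filtration_determined:
  assumes "A \<in> sets (path_filtration t0 T t)" "\<omega> \<in> paths t0 T" "\<omega>' \<in> paths t0 T"
    "\<And>s. s \<le> t \<Longrightarrow> \<omega> s = \<omega>' s"
  shows "\<omega> \<in> A \<longleftrightarrow> \<omega>' \<in> A"
  using assms(1) unfolding sets_path_filtration
proof (induction rule: sigma_sets.induct)
  case (Compl a)
  then show ?case using assms(2,3) by auto
qed (use assms in auto)

text \<open>Before the grid the index is 0, so the path starts at \<open>f 0\<close>; from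
  \<open>r n\<close> on it stays at \<open>z\<close>.\<close>

definition step_path :: "(nat \<Rightarrow> real) \<Rightarrow> nat \<Rightarrow> (nat \<Rightarrow> 'a) \<Rightarrow> 'a \<Rightarrow> real \<Rightarrow> 'a" where
  "step_path r n f z s = (if r n \<le> s then z else f (step_index r n s))"

lemma step_index_eventually:
  "\<forall>\<^sub>F s' in at_right s. step_index r n s' = step_index r n s"
  "\<exists>j. \<forall>\<^sub>F s' in at_left s. step_index r n s' = j"
proof -
  have "\<forall>\<^sub>F s' in at_right s. \<forall>k\<in>{1..<n}. r k \<le> s' \<longleftrightarrow> r k \<le> s"
  proof (intro eventually_ball_finite ballI)
    fix k
    show "\<forall>\<^sub>F s' in at_right s. r k \<le> s' \<longleftrightarrow> r k \<le> s"
    proof (cases "r k \<le> s")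
      case True
      have "\<forall>\<^sub>F s' in at_right s. s < s'" by (rule eventually_at_right_less)
      then show ?thesis by eventually_elim (use True in auto)
    next
      case False
      then have "\<forall>\<^sub>F s' in at_right s. s' < r k" 
        by (intro eventually_at_right_real[THEN eventually_mono]) auto
      then show ?thesis by eventually_elim (use False in auto)
    qed
  qed simp
  then show "\<forall>\<^sub>F s' in at_right s. step_index r n s' = step_index r n s"
    by eventually_elim (auto simp: step_index_def intro!: arg_cong[where f=card])
  have "\<forall>\<^sub>F s' in at_left s. \<forall>k\<in>{1..<n}. r k \<le> s' \<longleftrightarrow> r k < s"
  proof (intro eventually_ball_finite ballI)
    fix k
    show "\<forall>\<^sub>F s' in at_left s. r k \<le> s' \<longleftrightarrow> r k < s"
    proof (cases "r k < s")
      case True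
      then have "\<forall>\<^sub>F s' in at_left s. r k < s'"
        by (intro eventually_at_left_real[THEN eventually_mono]) auto
      then show ?thesis by eventually_elim (use True in auto)
    next
      case False
      have "\<forall>\<^sub>F s' in at_left s. s' < s" by (rule eventually_at_leftI[of "s - 1"]) auto
      then show ?thesis by eventually_elim (use False in auto)
    qed
  qed simp
  then have "\<forall>\<^sub>F s' in at_left s. step_index r n s' = card {k\<in>{1..<n}. r k < s}"
    by eventually_elim (auto simp: step_index_def intro!: arg_cong[where f=card])
  then show "\<exists>j. \<forall>\<^sub>F s' in at_left s. step_index r n s' = j" by blast
qed

lemma step_path_cadlag: "cadlag (step_path r n f z)"
  unfolding cadlag_def
proof (intro allI conjI)
  fix s
  have "\<forall>\<^sub>F s' in at_right s. r n \<le> s' \<longleftrightarrow> r n \<le> s"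
  proof (cases "r n \<le> s")
    case True
    have "\<forall>\<^sub>F s' in at_right s. s < s'" by (rule eventually_at_right_less)
    then show ?thesis by eventually_elim (use True in auto)
  next
    case False
    then have "\<forall>\<^sub>F s' in at_right s. s' < r n" 
      by (intro eventually_at_right_real[THEN eventually_mono]) auto
    then show ?thesis by eventually_elim (use False in auto)
  qed
  then have "\<forall>\<^sub>F s' in at_right s. step_path r n f z s' = step_path r n f z s"
    using step_index_eventually(1)[of r n s] by eventually_elim (auto simp: step_path_def)
  then show "(step_path r n f z \<longlongrightarrow> step_path r n f z s) (at_right s)" by (rule tendsto_eventually)
  obtain j where j: "\<forall>\<^sub>F s' in at_left s. step_index r n s' = j" using step_index_eventually(2) by blast
  have "\<exists>b. \<forall>\<^sub>F s' in at_left s. (r n \<le> s') = b"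
  proof (cases "r n < s")
    case True
    then have "\<forall>\<^sub>F s' in at_left s. r n < s'"
      by (intro eventually_at_left_real[THEN eventually_mono]) auto
    then have "\<forall>\<^sub>F s' in at_left s. (r n \<le> s') = True" by eventually_elim auto
    then show ?thesis by blast
  next
    case False
    have "\<forall>\<^sub>F s' in at_left s. s' < s" by (rule eventually_at_leftI[of "s - 1"]) auto
    then have "\<forall>\<^sub>F s' in at_left s. (r n \<le> s') = False" by eventually_elim (use False in auto)
    then show ?thesis by blast
  qed
  then obtain b where "\<forall>\<^sub>F s' in at_left s. (r n \<le> s') = b" by blast
  with j have "\<forall>\<^sub>F s' in at_left s. step_path r n f z s' = (if b then z else f j)"
    by eventually_elim (auto simp: step_path_def)
  then show "\<exists>l. (step_path r n f z \<longlongrightarrow> l) (at_left s)" by (blast intro: tendsto_eventually)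
qed

lemma step_index_0:
  assumes "grid r n" "s < r 0"
  shows "step_index r n s = 0"
proof -
  have "\<not> r k \<le> s" if "k < n" for k using grid_le[OF assms(1), of 0 k] assms(2) that by simp
  then have "{k\<in>{1..<n}. r k \<le> s} = {}" by auto
  then show ?thesis by (simp only: step_index_def card.empty)
qed

lemma step_path_paths:
  assumes "grid r n" "\<And>k. k < n \<Longrightarrow> f k \<in> prob_simplex" "z \<in> prob_simplex"
  shows "step_path r n f z \<in> paths (r 0) (r n)"
proof -
  have "step_path r n f z s \<in> prob_simplex" for s
    using assms step_index_bound[of n r s] by (auto simp: step_path_def grid_def)
  moreover have "step_path r n f z constant_on {..<r 0}"
    using step_index_0[OF assms(1)] grid_le[OF assms(1), of 0 n]
    by (auto simp: constant_on_def step_path_def intro!: exI[of _ "f 0"])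
  moreover have "step_path r n f z constant_on {r n..}"
    by (auto simp: constant_on_def step_path_def)
  ultimately show ?thesis using step_path_cadlag by (auto simp: paths_def)
qed

context game
begin

context
  fixes r :: "nat \<Rightarrow> real" and n :: nat and A :: "'c set" and m :: "'c list \<Rightarrow> real^'i" and p :: "real^'i"
  assumes g: "grid r n" "0 \<le> r 0" "r n = T" and m: "weight_tree A n m" and mp: "m [] = p" and p: "p \<in> prob_simplex"
begin

text \<open>At a null node the default \<open>p\<close> keeps the sample paths in the
  simplex.\<close>

definition belief :: "'c list \<Rightarrow> real^'i" where
  "belief h = (if mass (m h) = 0 then p else (1 / mass (m h)) *\<^sub>R m h)"

text \<open>A leaf pairs a complete history with the type, because the path jumps to the vertex of
  the type at time \<open>T\<close>.\<close>

definition leaves :: "('i \<times> 'c list) set" where "leaves = UNIV \<times> words A n"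

definition leaf_weight :: "'i \<times> 'c list \<Rightarrow> real" where
  "leaf_weight x = (if x \<in> leaves then m (snd x) $ fst x else 0)"

definition leaf_path :: "'i \<times> 'c list \<Rightarrow> real \<Rightarrow> real^'i" where
  "leaf_path x = step_path r n (\<lambda>k. belief (take k (snd x))) (axis (fst x) 1)"

definition tree_measure :: "(real \<Rightarrow> real^'i) measure" where
  "tree_measure = distr (point_measure leaves (\<lambda>x. ennreal (leaf_weight x))) (path_space (r 0) T) leaf_path"

lemma finite_leaves: "finite leaves"
  using m by (simp add: leaves_def finite_words weight_tree_def)

lemma m_nonneg: "h \<in> words A k \<Longrightarrow> k \<le> n \<Longrightarrow> nonneg (m h)"
  using m by (auto simp: weight_tree_def)

lemma take_words: "h \<in> words A n \<Longrightarrow> k \<le> n \<Longrightarrow> take k h \<in> words A k"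
  by (auto simp: words_def dest: in_set_takeD)

lemma leaf_weight_nonneg: "0 \<le> leaf_weight x"
  using m_nonneg by (auto simp: leaf_weight_def leaves_def nonneg_def)

lemma mass_belief: "h \<in> words A k \<Longrightarrow> k \<le> n \<Longrightarrow> mass (m h) *\<^sub>R belief h = m h"
  using mass_eq_0[OF m_nonneg] by (auto simp: belief_def)

lemma belief_simplex: "h \<in> words A k \<Longrightarrow> k \<le> n \<Longrightarrow> belief h \<in> prob_simplex"
  using m_nonneg[of h k] p mass_nonneg[OF m_nonneg, of h k]
  by (auto simp: belief_def prob_simplex_iff mass_scaleR intro!: nonneg_scaleR)

lemma leaf_path_paths: "x \<in> leaves \<Longrightarrow> leaf_path x \<in> paths (r 0) T"
  unfolding leaf_path_def g(3)[symmetric]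
  by (intro step_path_paths g axis_simplex) (auto simp: leaves_def intro!: belief_simplex take_words)

lemma leaf_path_measurable: "leaf_path \<in> point_measure leaves (\<lambda>x. ennreal (leaf_weight x)) \<rightarrow>\<^sub>M path_space (r 0) T"
  using leaf_path_paths by (auto simp: measurable_point_measure_eq1)

lemma leaf_sum: "(\<Sum>x\<in>leaves. leaf_weight x *\<^sub>R f x) = (\<Sum>h\<in>words A n. \<Sum>i\<in>UNIV. m h $ i *\<^sub>R f (i, h))"
  for f :: "_ \<Rightarrow> 'b::real_vector"
proof -
  have "(\<Sum>x\<in>leaves. leaf_weight x *\<^sub>R f x) = (\<Sum>(i, h)\<in>UNIV \<times> words A n. m h $ i *\<^sub>R f (i, h))"
    unfolding leaves_def[symmetric] by (intro sum.cong) (auto simp: leaf_weight_def)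
  also have "\<dots> = (\<Sum>i\<in>UNIV. \<Sum>h\<in>words A n. m h $ i *\<^sub>R f (i, h))"
    by (simp add: sum.cartesian_product)
  finally show ?thesis by (subst sum.swap) 
qed

lemma tree_measure_integral:
  fixes f :: "_ \<Rightarrow> 'b::{banach, second_countable_topology}"
  assumes "f \<in> borel_measurable (path_space (r 0) T)"
  shows "integrable tree_measure f" "integral\<^sup>L tree_measure f = (\<Sum>x\<in>leaves. leaf_weight x *\<^sub>R f (leaf_path x))"
proof -
  show "integrable tree_measure f"
    unfolding tree_measure_def
    by (subst integrable_distr_eq[OF leaf_path_measurable assms])
      (rule integrable_point_measure_finite[OF finite_leaves])
  show "integral\<^sup>L tree_measure f = (\<Sum>x\<in>leaves. leaf_weight x *\<^sub>R f (leaf_path x))"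
    unfolding tree_measure_def integral_distr[OF leaf_path_measurable assms]
    using leaf_weight_nonneg by (subst lebesgue_integral_point_measure_finite[OF finite_leaves]) auto
qed

lemma tree_measure_prob: "prob_space tree_measure"
proof -
  have "(\<Sum>x\<in>leaves. leaf_weight x) = 1"
    using leaf_sum[of "\<lambda>_. 1 :: real"] weight_tree_sum[OF m order_refl] p mp mass_sum[of m "words A n"]
    by (simp add: prob_simplex_iff mass_def)
  then have "(\<Sum>x\<in>leaves. ennreal (leaf_weight x)) = 1"
    using leaf_weight_nonneg by (simp add: sum_ennreal)
  then have "prob_space (point_measure leaves (\<lambda>x. ennreal (leaf_weight x)))"
    using finite_leaves by (intro prob_spaceI) (simp add: space_point_measure emeasure_point_measure_finite)
  then show ?thesis unfolding tree_measure_def by (rule prob_space.prob_space_distr[OF _ leaf_path_measurable])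
qed

lemma sets_tree_measure [simp]: "sets tree_measure = sets (path_space (r 0) T)"
  by (simp add: tree_measure_def)

lemma space_tree_measure [simp]: "space tree_measure = paths (r 0) T"
  by (simp add: tree_measure_def)

text \<open>Both later beliefs and the final type have the current belief as conditional mean.\<close>

lemma belief_sum:
  assumes "k \<le> j" "j \<le> n"
  shows "(\<Sum>h\<in>words A n. \<Sum>i\<in>UNIV. m h $ i *\<^sub>R (f (take k h) *\<^sub>R belief (take j h))) = (\<Sum>h\<in>words A k. f h *\<^sub>R m h)"
proof -
  have "(\<Sum>h\<in>words A n. \<Sum>i\<in>UNIV. m h $ i *\<^sub>R (f (take k h) *\<^sub>R belief (take j h))) $ i0 = (\<Sum>h\<in>words A k. f h *\<^sub>R m h) $ i0" for i0
  proof -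
    have "(\<Sum>h\<in>words A n. \<Sum>i\<in>UNIV. m h $ i *\<^sub>R (f (take k h) *\<^sub>R belief (take j h))) $ i0 =
        (\<Sum>h\<in>words A n. m h \<bullet> ((f (take k (take j h)) * belief (take j h) $ i0) *\<^sub>R 1))"
      using assms by (simp add: inner_vec_def sum_distrib_right sum_distrib_left min_def mult_ac)
    also have "\<dots> = (\<Sum>h\<in>words A j. m h \<bullet> ((f (take k h) * belief h $ i0) *\<^sub>R 1))"
      by (rule weight_tree_marginal[OF m assms(2), of "\<lambda>h. (f (take k h) * belief h $ i0) *\<^sub>R 1"])
    \<comment> \<open>The inner product with the vector of ones is the mass, and mass times belief
      is the weight. The belief is thus traded for an axis vector, which is the same at all
      levels.\<close>
    also have "\<dots> = (\<Sum>h\<in>words A j. m h \<bullet> (f (take k h) *\<^sub>R axis i0 1))"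
    proof (intro sum.cong refl)
      fix h assume "h \<in> words A j"
      then have "belief h $ i0 * mass (m h) = m h $ i0"
        using mass_belief[of h j] assms(2) by (metis real_scaleR_def vector_scaleR_component mult.commute)
      moreover have "m h \<bullet> 1 = mass (m h)" by (simp add: inner_vec_def mass_def)
      ultimately show "m h \<bullet> ((f (take k h) * belief h $ i0) *\<^sub>R 1) = m h \<bullet> (f (take k h) *\<^sub>R axis i0 1)"
        by (simp add: inner_axis)
    qed
    also have "\<dots> = (\<Sum>h\<in>words A n. m h \<bullet> (f (take k (take j h)) *\<^sub>R axis i0 1))"
      by (rule weight_tree_marginal[OF m assms(2), symmetric])
    also have "\<dots> = (\<Sum>h\<in>words A n. m h \<bullet> (f (take k h) *\<^sub>R axis i0 1))"
      using assms by (simp add: min_def)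
    also have "\<dots> = (\<Sum>h\<in>words A k. m h \<bullet> (f h *\<^sub>R axis i0 1))"
      using assms by (intro weight_tree_marginal[OF m]) auto
    finally show ?thesis by (simp add: inner_axis)
  qed
  then show ?thesis by (simp add: vec_eq_iff)
qed

lemma type_sum:
  assumes "k \<le> n"
  shows "(\<Sum>h\<in>words A n. \<Sum>i\<in>UNIV. m h $ i *\<^sub>R (f (take k h) *\<^sub>R axis i 1)) = (\<Sum>h\<in>words A k. f h *\<^sub>R m h)"
proof -
  have "(\<Sum>h\<in>words A n. \<Sum>i\<in>UNIV. m h $ i *\<^sub>R (f (take k h) *\<^sub>R axis i 1)) $ i0 = (\<Sum>h\<in>words A k. f h *\<^sub>R m h) $ i0" for i0 :: 'i
  proof -
    have "(\<Sum>h\<in>words A n. \<Sum>i\<in>UNIV. m h $ i *\<^sub>R (f (take k h) *\<^sub>R axis i 1)) $ i0 =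
        (\<Sum>h\<in>words A n. m h \<bullet> (f (take k h) *\<^sub>R axis i0 1))"
    proof -
      have "(\<Sum>i\<in>UNIV. m h $ i *\<^sub>R (c *\<^sub>R axis i 1)) $ i0 = m h \<bullet> (c *\<^sub>R axis i0 1)" for h c
      proof -
        have "(\<Sum>i\<in>UNIV. m h $ i *\<^sub>R (c *\<^sub>R axis i 1)) $ i0 = (\<Sum>i\<in>UNIV. if i = i0 then m h $ i * c else 0)"
          unfolding sum_component by (intro sum.cong) (auto simp: axis_def)
        then show ?thesis by (simp add: inner_axis)
      qed
      then show ?thesis by simp
    qed
    also have "\<dots> = (\<Sum>h\<in>words A k. m h \<bullet> (f h *\<^sub>R axis i0 1))"
      using assms by (intro weight_tree_marginal[OF m]) auto
    finally show ?thesis by (simp add: inner_axis)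
  qed
  then show ?thesis by (simp add: vec_eq_iff)
qed

lemma leaf_path_eq:
  "leaf_path (i, h) s = (if T \<le> s then axis i 1 else belief (take (step_index r n s) h))"
  by (simp add: leaf_path_def step_path_def g)

text \<open>From \<open>T\<close> on the paths are constant. Before \<open>T\<close> an event of
  time \<open>s\<close> depends on the first \<open>k\<close> labels only, and both sides reduce to
  the same sum over histories of length \<open>k\<close>, whether time \<open>t\<close> shows a
  later belief or the final type.\<close>

lemma tree_martingale:
  assumes st: "s \<le> t" and B: "B \<in> sets (path_filtration (r 0) T s)"
  shows "(\<integral>\<omega>. indicator B \<omega> *\<^sub>R \<omega> t \<partial>tree_measure) = (\<integral>\<omega>. indicator B \<omega> *\<^sub>R \<omega> s \<partial>tree_measure)"
proof -
  have Bm: "B \<in> sets (path_space (r 0) T)" using B sets_path_filtration_subset by blast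
  have meas: "(\<lambda>\<omega>. indicator B \<omega> *\<^sub>R \<omega> u) \<in> borel_measurable (path_space (r 0) T)" for u
    using Bm coordinate_measurable by (intro borel_measurable_scaleR) auto
  have eq: "(\<integral>\<omega>. indicator B \<omega> *\<^sub>R \<omega> u \<partial>tree_measure) =
      (\<Sum>h\<in>words A n. \<Sum>i\<in>UNIV. m h $ i *\<^sub>R (indicator B (leaf_path (i, h)) *\<^sub>R leaf_path (i, h) u))" for u
    unfolding tree_measure_integral(2)[OF meas] leaf_sum ..
  show ?thesis
  proof (cases "T \<le> s")
    case True
    then have "leaf_path (i, h) t = leaf_path (i, h) s" for i h using st by (simp add: leaf_path_eq)
    then show ?thesis unfolding eq by simp
  next
    case False
    have n: "0 < n" using g by (simp add: grid_def)
    define k where "k = step_index r n s"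
    have k: "k < n" unfolding k_def by (rule step_index_bound[OF n])
    have kt: "k \<le> step_index r n t" "step_index r n t \<le> n"
      unfolding k_def using step_index_bound[OF n, of r t] st by (auto simp: step_index_def intro!: card_mono)
    \<comment> \<open>The indicator of \<open>B\<close> factored through the prefix of length
      \<open>k\<close>; it is well defined because leaves with a common prefix have the same path up
      to \<open>s\<close>.\<close>
    define f where "f h' = (if \<exists>i. \<exists>h\<in>words A n. take k h = h' \<and> leaf_path (i, h) \<in> B then 1 else 0 :: real)" for h'
    have ind: "indicator B (leaf_path (i, h)) = f (take k h)" if h: "h \<in> words A n" for i h
    proof -
      have iff: "leaf_path (i, h) \<in> B \<longleftrightarrow> leaf_path (i', h') \<in> B" if h': "h' \<in> words A n" "take k h' = take k h" for i' h'
      proof (rule path_filtration_determined[OF B])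
        show "leaf_path (i, h) \<in> paths (r 0) T" "leaf_path (i', h') \<in> paths (r 0) T"
          using h h' by (auto intro!: leaf_path_paths simp: leaves_def)
        fix u assume u: "u \<le> s"
        have "step_index r n u \<le> k" unfolding k_def step_index_def using u by (intro card_mono) auto
        then have "take (step_index r n u) h = take (step_index r n u) (take k h)"
          "take (step_index r n u) h' = take (step_index r n u) (take k h')" by (auto simp: min_def)
        then show "leaf_path (i, h) u = leaf_path (i', h') u" using u False h'(2) by (simp add: leaf_path_eq)
      qed
      show ?thesis
      proof (cases "leaf_path (i, h) \<in> B")
        case True
        then have "\<exists>i. \<exists>h'\<in>words A n. take k h' = take k h \<and> leaf_path (i, h') \<in> B" using h by blast
        then show ?thesis using True by (simp only: f_def if_True indicator_simps)
      next
        case False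
        then have "\<not> (\<exists>i. \<exists>h'\<in>words A n. take k h' = take k h \<and> leaf_path (i, h') \<in> B)" using iff by blast
        then show ?thesis using False by (simp add: f_def)
      qed
    qed
    have val: "(\<integral>\<omega>. indicator B \<omega> *\<^sub>R \<omega> u \<partial>tree_measure) = (\<Sum>h\<in>words A k. f h *\<^sub>R m h)"
      if u: "k \<le> step_index r n u" for u
    proof -
      have un: "step_index r n u \<le> n" using step_index_bound[OF n, of r u] by simp
      have "(\<integral>\<omega>. indicator B \<omega> *\<^sub>R \<omega> u \<partial>tree_measure) =
        (\<Sum>h\<in>words A n. \<Sum>i\<in>UNIV. m h $ i *\<^sub>R (f (take k h) *\<^sub>R leaf_path (i, h) u))"
        unfolding eq using ind by (intro sum.cong refl) simp
      also have "\<dots> = (\<Sum>h\<in>words A k. f h *\<^sub>R m h)"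
        using type_sum[of k f] belief_sum[OF u un, of f] k by (cases "T \<le> u") (simp_all add: leaf_path_eq)
      finally show ?thesis .
    qed
    show ?thesis using val[of t] val[of s] kt by (simp add: k_def)
  qed
qed

lemma tree_measure_martingale: "tree_measure \<in> martingale_measures T (r 0) p"
proof -
  interpret prob_space tree_measure by (rule tree_measure_prob)
  have sub: "subalgebra tree_measure (path_filtration (r 0) T t)" for t
    using sets_path_filtration_subset by (auto simp: subalgebra_def)
  have int: "integrable tree_measure (\<lambda>\<omega>. \<omega> t)" for t
    by (rule tree_measure_integral(1)[OF coordinate_measurable])
  have AE1: "AE \<omega> in tree_measure. Q \<omega>" if "\<And>x. x \<in> leaves \<Longrightarrow> Q (leaf_path x)" "{\<omega> \<in> paths (r 0) T. Q \<omega>} \<in> sets (path_space (r 0) T)" for Q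
    unfolding tree_measure_def
    using that finite_leaves by (subst AE_distr_iff[OF leaf_path_measurable]) (auto simp: AE_point_measure)
  have "vector_martingale tree_measure (path_filtration (r 0) T) (\<lambda>t \<omega>. \<omega> t)"
    unfolding vector_martingale_def
  proof (intro conjI allI impI)
    fix s t :: real and i :: 'i assume st: "s \<le> t"
    interpret sigma_finite_subalgebra tree_measure "path_filtration (r 0) T s"
      by (rule finite_measure_subalgebra_is_sigma_finite) (auto simp: finite_measure_subalgebra_def finite_measure_subalgebra_axioms_def sub finite_measure_axioms)
    have inti: "integrable tree_measure (\<lambda>\<omega>. \<omega> t $ i)" for t
    proof -
      have "integrable tree_measure (\<lambda>\<omega>. \<omega> t \<bullet> axis i 1)" by (intro integrable_inner_left int)
      then show ?thesis by (simp add: inner_axis)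
    qed
    show "AE \<omega> in tree_measure. real_cond_exp tree_measure (path_filtration (r 0) T s) (\<lambda>\<omega>'. \<omega>' t $ i) \<omega> = \<omega> s $ i"
    proof (rule real_cond_exp_charact)
      fix B :: "(real \<Rightarrow> real^'i) set" assume B: "B \<in> sets (path_filtration (r 0) T s)"
      have intB: "integrable tree_measure (\<lambda>\<omega>. indicator B \<omega> *\<^sub>R \<omega> u)" for u
        using B sets_path_filtration_subset by (intro integrable_mult_indicator int) auto
      have "(\<integral>\<omega>\<in>B. \<omega> u $ i \<partial>tree_measure) = (\<integral>\<omega>. indicator B \<omega> *\<^sub>R \<omega> u \<partial>tree_measure) $ i" for u
      proof -
        have "(\<integral>\<omega>. (indicator B \<omega> *\<^sub>R \<omega> u) \<bullet> axis i 1 \<partial>tree_measure) =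
            (\<integral>\<omega>. indicator B \<omega> *\<^sub>R \<omega> u \<partial>tree_measure) \<bullet> axis i 1"
          by (rule integral_inner_left) (rule intB)
        then show ?thesis by (simp add: set_lebesgue_integral_def inner_axis)
      qed
      then show "(\<integral>\<omega>\<in>B. \<omega> t $ i \<partial>tree_measure) = (\<integral>\<omega>\<in>B. \<omega> s $ i \<partial>tree_measure)"
        using tree_martingale[OF st B] by simp
    next
      show "(\<lambda>\<omega>. \<omega> s $ i) \<in> borel_measurable (path_filtration (r 0) T s)"
        by (rule measurable_compose[OF coordinate_measurable_filtration[OF order_refl] vec_nth_borel_measurable])
    qed (use inti in auto)
  qed (rule sub | erule sets_path_filtration_mono | rule coordinate_measurable_filtration[OF order_refl] | rule int)+
  moreover have "AE \<omega> in tree_measure. \<forall>t<r 0. \<omega> t = p"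
  proof -
    \<comment> \<open>Paths are constant before \<open>r 0\<close>, so a single earlier time tests
      all of them.\<close>
    have "AE \<omega> in tree_measure. \<omega> (r 0 - 1) = p"
    proof (rule AE1)
      have "belief [] = p" using p mp by (simp add: belief_def prob_simplex_iff)
      then show "leaf_path x (r 0 - 1) = p" for x
        using step_index_0[OF g(1), of "r 0 - 1"] grid_le[OF g(1), of 0 n] g
        by (cases x) (simp add: leaf_path_eq)
      show "{\<omega> \<in> paths (r 0) T. \<omega> (r 0 - 1) = p} \<in> sets (path_space (r 0) T)"
        unfolding sets_path_space by (intro sigma_sets.Basic) (auto intro!: exI[of _ "r 0 - 1"] exI[of _ "{p}"])
    qed
    then show ?thesis
      using AE_space
    proof eventually_elim
      case (elim \<omega>)
      then have "\<omega> constant_on {..<r 0}" by (simp add: paths_def)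
      then obtain c where "\<And>s. s < r 0 \<Longrightarrow> \<omega> s = c" by (auto simp: constant_on_def)
      then show ?case using elim(1) by (metis diff_less_eq less_add_one linorder_not_less order_less_irrefl)
    qed
  qed
  moreover have "AE \<omega> in tree_measure. \<forall>t\<ge>T. \<omega> t \<in> range (\<lambda>i. axis i 1)"
  proof -
    have "AE \<omega> in tree_measure. \<omega> T \<in> range (\<lambda>i. axis i 1)"
    proof (rule AE1)
      show "leaf_path x T \<in> range (\<lambda>i. axis i 1)" for x by (cases x) (simp add: leaf_path_eq)
      have "finite (range (\<lambda>i. axis i 1 :: real^'i))" by simp
      then have "range (\<lambda>i. axis i 1 :: real^'i) \<in> sets borel" by (intro borel_closed finite_imp_closed)
      then show "{\<omega> \<in> paths (r 0) T. \<omega> T \<in> range (\<lambda>i. axis i 1 :: real^'i)} \<in> sets (path_space (r 0) T)"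
        unfolding sets_path_space by (intro sigma_sets.Basic) (auto intro!: exI[of _ T] exI[of _ "range (\<lambda>i. axis i 1 :: real^'i)"])
    qed
    then show ?thesis
      using AE_space
    proof eventually_elim
      case (elim \<omega>)
      then have "\<omega> constant_on {T..}" by (simp add: paths_def)
      then obtain c where "\<And>s. T \<le> s \<Longrightarrow> \<omega> s = c" by (auto simp: constant_on_def)
      then show ?case using elim(1) by (metis order_refl)
    qed
  qed
  ultimately show ?thesis using prob_space_axioms by (simp add: martingale_measures_def)
qed

end

end

section \<open>Convexity, dynamic programming and representation of the value\<close>

lemma compact_prob_simplex: "compact (prob_simplex :: (real^'i::finite) set)"
proof -
  have eq: "(prob_simplex :: (real^'i) set) = (\<Inter>i. {p. 0 \<le> p $ i}) \<inter> {p. (\<Sum>i\<in>UNIV. p $ i) = 1}"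
    by (auto simp: prob_simplex_def)
  have "closed {p :: real^'i. 0 \<le> p $ i}" for i
    by (rule closed_Collect_le) (intro continuous_intros)+
  moreover have "closed {p :: real^'i. (\<Sum>i\<in>UNIV. p $ i) = 1}"
    by (rule closed_Collect_eq) (intro continuous_intros)+
  ultimately have closed: "closed (prob_simplex :: (real^'i) set)"
    unfolding eq by (intro closed_Int closed_INT ballI)
  have "norm p \<le> 1" if "p \<in> prob_simplex" for p :: "real^'i"
    using norm_le_l1_cart[of p] that by (simp add: prob_simplex_def)
  then have "bounded (prob_simplex :: (real^'i) set)" unfolding bounded_iff by blast
  with closed show ?thesis by (simp add: compact_eq_bounded_closed)
qed

lemma prob_simplex_borel [measurable]: "(prob_simplex :: (real^'i::finite) set) \<in> sets borel"
  by (intro borel_closed compact_imp_closed compact_prob_simplex)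

lemma sum_abs_le_norm: "(\<Sum>i\<in>UNIV. \<bar>x $ i\<bar>) \<le> CARD('i) * norm (x :: real^'i::finite)"
  using sum_bounded_above[of UNIV "\<lambda>i. \<bar>x $ i\<bar>" "norm x"] component_le_norm_cart[of x] by simp

lemma filterlim_at_rightI:
  fixes f :: "nat \<Rightarrow> real"
  assumes "f \<longlonglongrightarrow> x" "\<And>N. x < f N"
  shows "filterlim f (at_right x) sequentially"
  unfolding filterlim_at
proof (intro conjI assms(1) always_eventually allI)
  fix N
  show "f N \<in> {x<..}" "f N \<noteq> x" using assms(2)[of N] by auto
qed

text \<open>Floor plus one, unlike a ceiling, stays strictly to the right even of dyadic
  \<open>x\<close>; this is what limits from the right call for.\<close>

lemma filterlim_dyadic_right:
  "filterlim (\<lambda>N. (of_int \<lfloor>x * 2 ^ N\<rfloor> + 1) / 2 ^ N) (at_right x) sequentially" for x :: real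
proof (rule filterlim_at_rightI)
  show less: "x < (of_int \<lfloor>x * 2 ^ N\<rfloor> + 1) / 2 ^ N" for N
    by (simp add: pos_less_divide_eq)
  have le: "(of_int \<lfloor>x * 2 ^ N\<rfloor> + 1) / 2 ^ N \<le> x + (1 / 2) ^ N" for N
  proof -
    have "(of_int \<lfloor>x * 2 ^ N\<rfloor> + 1) / 2 ^ N \<le> (x * 2 ^ N + 1) / 2 ^ N"
      by (intro divide_right_mono) auto
    also have "(x * 2 ^ N + 1) / 2 ^ N = x + (1 / 2) ^ N"
      by (simp add: add_divide_distrib power_one_over)
    finally show ?thesis .
  qed
  have lim: "(\<lambda>N. x + (1 / 2 :: real) ^ N) \<longlonglongrightarrow> x"
    using tendsto_add[OF tendsto_const LIMSEQ_power_zero[of "1 / 2 :: real"], of x] by simp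
  show "(\<lambda>N. (of_int \<lfloor>x * 2 ^ N\<rfloor> + 1) / 2 ^ N) \<longlonglongrightarrow> x"
    by (rule tendsto_sandwich[OF always_eventually always_eventually tendsto_const lim])
      (intro allI less_imp_le less le)+
qed

lemma cadlag_borel_measurable:
  fixes f :: "real \<Rightarrow> 'a::metric_space"
  assumes "cadlag f" shows "f \<in> borel_measurable borel"
proof (rule borel_measurable_LIMSEQ_metric)
  fix N :: nat
  have "(\<lambda>x::real. \<lfloor>x * 2 ^ N\<rfloor>) \<in> borel \<rightarrow>\<^sub>M count_space UNIV" by measurable
  then show "(\<lambda>x::real. f ((of_int \<lfloor>x * 2 ^ N\<rfloor> + 1) / 2 ^ N)) \<in> borel_measurable borel"
    by (rule measurable_compose) simp
next
  fix x
  have "(f \<longlongrightarrow> f x) (at_right x)" using assms by (simp add: cadlag_def)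
  then show "(\<lambda>N. f ((of_int \<lfloor>x * 2 ^ N\<rfloor> + 1) / 2 ^ N)) \<longlonglongrightarrow> f x"
    by (rule filterlim_compose[OF _ filterlim_dyadic_right])
qed

lemma step_index_interval:
  assumes g: "grid r n" and s: "r 0 \<le> s" "s < r n"
  shows "step_index r n s < n" "r (step_index r n s) \<le> s" "s < r (Suc (step_index r n s))"
proof -
  define m where "m = (LEAST k. s < r k)"
  have m: "s < r m" unfolding m_def using s(2) by (rule LeastI)
  have mn: "m \<le> n" unfolding m_def using s(2) by (rule Least_le)
  have "m \<noteq> 0" using m s(1) by (cases m) auto
  then obtain k where k: "m = Suc k" by (cases m) auto
  then have "\<not> s < r k" unfolding m_def by (metis lessI not_less_Least)
  then show "step_index r n s < n" "r (step_index r n s) \<le> s" "s < r (Suc (step_index r n s))"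
    using step_index_eq[OF g, of k s] m mn k by auto
qed

lemma step_index_integral:
  fixes h :: "nat \<Rightarrow> real"
  assumes g: "grid r n"
  shows "set_integrable lborel {r 0..r n} (\<lambda>s. h (step_index r n s))"
    "(LINT s:{r 0..r n}|lborel. h (step_index r n s)) = (\<Sum>k<n. (r (Suc k) - r k) * h k)"
proof -
  have eq: "AE s in lborel. indicator {r 0..r n} s *\<^sub>R h (step_index r n s) =
      (\<Sum>k<n. indicator {r k..<r (Suc k)} s *\<^sub>R h k)"
    using AE_lborel_singleton[of "r n"]
  proof eventually_elim
    case (elim s)
    show ?case
    proof (cases "s \<in> {r 0..r n}")
      case True
      then have "r 0 \<le> s" "s < r n" using elim by auto
      from step_index_interval[OF g this] obtain k where k: "k < n" "r k \<le> s" "s < r (Suc k)" by blast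
      have uniq: "s \<in> {r i..<r (Suc i)} \<longleftrightarrow> i = k" if "i < n" for i
        using step_index_eq[OF g that, of s] step_index_eq[OF g k] k by auto
      have "(\<Sum>i<n. indicator {r i..<r (Suc i)} s *\<^sub>R h i) = (\<Sum>i<n. if i = k then h i else 0)"
        using uniq by (intro sum.cong) (auto simp: indicator_def)
      also have "\<dots> = h k" using k by simp
      finally show ?thesis using True step_index_eq[OF g k] by simp
    next
      case False
      have "s \<notin> {r i..<r (Suc i)}" if "i < n" for i
        using False grid_le[OF g, of 0 i] grid_le[OF g, of "Suc i" n] that by auto
      then show ?thesis using False by simp
    qed
  qed
  have int: "integrable lborel (\<lambda>s. \<Sum>k<n. indicator {r k..<r (Suc k)} s *\<^sub>R h k)"
    by (intro Bochner_Integration.integrable_sum integrable_scaleR_left integrable_real_indicator)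
      (auto simp: emeasure_lborel_Ico grid_less[OF g] less_imp_le)
  have meas: "(\<lambda>s. indicator {r 0..r n} s *\<^sub>R h (step_index r n s)) \<in> borel_measurable lborel"
  proof -
    have "(\<lambda>s. h (step_index r n s)) \<in> borel_measurable borel"
      by (rule measurable_compose[OF step_index_measurable]) simp
    then show ?thesis by (intro borel_measurable_scaleR) auto
  qed
  show "set_integrable lborel {r 0..r n} (\<lambda>s. h (step_index r n s))"
    unfolding set_integrable_def using integrable_cong_AE[OF meas _ eq] int by auto
  have "(LINT s:{r 0..r n}|lborel. h (step_index r n s)) = (LINT s|lborel. (\<Sum>k<n. indicator {r k..<r (Suc k)} s *\<^sub>R h k))"
    unfolding set_lebesgue_integral_def using int by (intro integral_cong_AE meas eq) auto
  also have "\<dots> = (\<Sum>k<n. (LINT s|lborel. indicator {r k..<r (Suc k)} s *\<^sub>R h k))"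
    by (rule Bochner_Integration.integral_sum)
      (intro integrable_scaleR_left integrable_real_indicator, auto simp: emeasure_lborel_Ico grid_less[OF g] less_imp_le)
  also have "\<dots> = (\<Sum>k<n. (r (Suc k) - r k) * h k)"
    using grid_le[OF g] by (intro sum.cong refl) (simp add: measure_lborel_Ico)
  finally show "(LINT s:{r 0..r n}|lborel. h (step_index r n s)) = (\<Sum>k<n. (r (Suc k) - r k) * h k)" .
qed

definition uniform_grid :: "real \<Rightarrow> real \<Rightarrow> nat \<Rightarrow> nat \<Rightarrow> real" where
  "uniform_grid a b n k = a + real k * ((b - a) / real n)"

lemma uniform_grid:
  assumes "a < b" "0 < n"
  shows "grid (uniform_grid a b n) n" "uniform_grid a b n 0 = a" "uniform_grid a b n n = b"
    "uniform_grid a b n (Suc k) - uniform_grid a b n k = (b - a) / real n"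
  using assms by (auto simp: grid_def uniform_grid_def field_simps)

section \<open>The running cost along cadlag paths\<close>

context game
begin

lemma H_continuous: "continuous_on ({0..T} \<times> prob_simplex) (\<lambda>(t, p). H t p)"
proof (rule continuous_onI)
  fix x :: "real \<times> (real^'i)" and e :: real
  assume x: "x \<in> {0..T} \<times> prob_simplex" and e: "0 < e"
  obtain L where L: "0 \<le> L"
    "\<And>i s s' u u' v v'. s \<in> {0..T} \<Longrightarrow> s' \<in> {0..T} \<Longrightarrow> u \<in> U \<Longrightarrow> u' \<in> U \<Longrightarrow> v \<in> V \<Longrightarrow> v' \<in> V
      \<Longrightarrow> \<bar>l i s u v - l i s' u' v'\<bar> \<le> e / 2 + L * (\<bar>s - s'\<bar> + norm (u - u') + norm (v - v'))"
    using l_modulus[of "e / 2"] e by auto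
  define K where "K = L + C * CARD('i) + 1"
  have K: "0 < K" using L(1) C_pos by (simp add: K_def add_nonneg_pos)
  show "\<exists>d>0. \<forall>y\<in>{0..T} \<times> prob_simplex. dist y x < d \<longrightarrow> dist (case y of (t, p) \<Rightarrow> H t p) (case x of (t, p) \<Rightarrow> H t p) \<le> e"
  proof (intro exI[of _ "e / (2 * K)"] conjI ballI impI)
    show "0 < e / (2 * K)" using e K by simp
    fix y :: "real \<times> (real^'i)" assume y: "y \<in> {0..T} \<times> prob_simplex" and d: "dist y x < e / (2 * K)"
    obtain t p s q where xy: "x = (t, p)" "y = (s, q)" by (cases x, cases y)
    have d1: "\<bar>s - t\<bar> \<le> dist y x" "norm (q - p) \<le> dist y x"
      using dist_fst_le[of y x] dist_snd_le[of y x] by (auto simp: xy dist_real_def dist_norm)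
    have "\<bar>H s q - H t p\<bar> \<le> (e / 2 + L * \<bar>s - t\<bar>) * mass q + C * (\<Sum>i\<in>UNIV. \<bar>q $ i - p $ i\<bar>)"
    proof (rule H_diff)
      fix i u v assume "u \<in> U" "v \<in> V"
      then show "\<bar>l i s u v - l i t u v\<bar> \<le> e / 2 + L * \<bar>s - t\<bar>"
        using L(2)[of s t u u v v i] x y by (simp add: xy)
    qed (use x y in \<open>auto simp: xy prob_simplex_iff\<close>)
    also have "\<dots> \<le> e / 2 + L * \<bar>s - t\<bar> + C * (CARD('i) * norm (q - p))"
      using y C_pos sum_abs_le_norm[of "q - p"] by (simp add: xy prob_simplex_iff)
    also have "\<dots> \<le> e / 2 + L * dist y x + C * (CARD('i) * dist y x)"
      using d1 L(1) C_pos by (intro add_mono mult_left_mono order_refl) auto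
    also have "\<dots> \<le> e / 2 + K * dist y x" by (simp add: K_def algebra_simps)
    also have "K * dist y x \<le> K * (e / (2 * K))" using d K by (intro mult_left_mono) auto
    also have "K * (e / (2 * K)) = e / 2" using K by simp
    finally show "dist (case y of (t, p) \<Rightarrow> H t p) (case x of (t, p) \<Rightarrow> H t p) \<le> e"
      by (simp add: xy dist_real_def)
  qed
qed

lemma H_simplex_bound: "t \<in> {0..T} \<Longrightarrow> p \<in> prob_simplex \<Longrightarrow> \<bar>H t p\<bar> \<le> C"
  using H_bound_nonneg[of t p] by (simp add: prob_simplex_iff)

lemma running_cost_measurable:
  assumes \<omega>: "\<omega> \<in> borel_measurable borel" and S: "\<And>s. \<omega> s \<in> prob_simplex" and "0 \<le> a" "b \<le> T"
  shows "(\<lambda>s. indicator {a..b} s *\<^sub>R H s (\<omega> s)) \<in> borel_measurable borel"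
proof -
  define K where "K = {0..T} \<times> (prob_simplex :: (real^'i) set)"
  have "closed K" unfolding K_def by (intro closed_Times compact_imp_closed compact_prob_simplex) auto
  then have 1: "(\<lambda>x. indicator K x *\<^sub>R (case x of (t, p) \<Rightarrow> H t p)) \<in> borel_measurable borel"
    unfolding K_def by (intro borel_measurable_continuous_on_indicator H_continuous) auto
  have "(\<lambda>s. (s, \<omega> s)) \<in> borel \<rightarrow>\<^sub>M borel" using \<omega> by (intro borel_measurable_Pair) auto
  from measurable_compose[OF this 1]
  have "(\<lambda>s. indicator {a..b} s *\<^sub>R (indicator K (s, \<omega> s) *\<^sub>R H s (\<omega> s))) \<in> borel_measurable borel"
    by (intro borel_measurable_scaleR[of "indicator {a..b}"]) auto
  moreover have "(\<lambda>s. indicator {a..b} s *\<^sub>R (indicator K (s, \<omega> s) *\<^sub>R H s (\<omega> s))) = (\<lambda>s. indicator {a..b} s *\<^sub>R H s (\<omega> s))"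
    using assms by (auto simp: K_def indicator_def fun_eq_iff)
  ultimately show ?thesis by simp
qed

lemma running_cost_integrable:
  assumes \<omega>: "\<omega> \<in> borel_measurable borel" and S: "\<And>s. \<omega> s \<in> prob_simplex" and "0 \<le> a" "b \<le> T"
  shows "set_integrable lborel {a..b} (\<lambda>s. H s (\<omega> s))"
  unfolding set_integrable_def
proof (rule integrableI_bounded_set[where A="{a..b}" and B=C])
  show "(\<lambda>s. indicator {a..b} s *\<^sub>R H s (\<omega> s)) \<in> borel_measurable lborel"
    using running_cost_measurable[OF assms] by simp
  show "AE s in lborel. s \<in> {a..b} \<longrightarrow> norm (indicator {a..b} s *\<^sub>R H s (\<omega> s)) \<le> C"
    using H_simplex_bound[OF _ S] assms(3,4) by (intro AE_I2) auto
  show "emeasure lborel {a..b} < \<infinity>" by (simp add: emeasure_lborel_Icc_eq)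
qed auto

lemma step_path_cost_le:
  assumes g: "grid r n" and r: "0 \<le> r 0" "r n = T" and f: "\<And>k. k < n \<Longrightarrow> f k \<in> prob_simplex" and z: "z \<in> prob_simplex"
    and \<rho>: "fine_grid \<rho> r n"
  shows "(LINT s:{r 0..T}|lborel. H s (step_path r n f z s)) \<le> (\<Sum>k<n. (r (Suc k) - r k) * (H (r k) (f k) + \<rho>))"
proof -
  have n: "0 < n" using g by (simp add: grid_def)
  have path: "step_path r n f z \<in> paths (r 0) (r n)" by (rule step_path_paths[OF g f z])
  have "(LINT s:{r 0..T}|lborel. H s (step_path r n f z s)) \<le>
      (LINT s:{r 0..r n}|lborel. H (r (step_index r n s)) (f (step_index r n s)) + \<rho>)"
    unfolding r(2)
  proof (rule set_integral_mono_AE)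
    show "set_integrable lborel {r 0..T} (\<lambda>s. H s (step_path r n f z s))"
      using path r by (intro running_cost_integrable cadlag_borel_measurable) (auto simp: paths_def)
    show "set_integrable lborel {r 0..T} (\<lambda>s. H (r (step_index r n s)) (f (step_index r n s)) + \<rho>)"
      using step_index_integral(1)[OF g, of "\<lambda>k. H (r k) (f k) + \<rho>"] by (simp add: r)
    show "AE s\<in>{r 0..T} in lborel. H s (step_path r n f z s) \<le> H (r (step_index r n s)) (f (step_index r n s)) + \<rho>"
      using AE_lborel_singleton[of T]
    proof eventually_elim
      case (elim s)
      show ?case
      proof
        assume s: "s \<in> {r 0..T}"
        define k where "k = step_index r n s"
        have k: "k < n" and "r k \<le> s \<and> s \<le> r (Suc k)"
          using step_index_interval[OF g, of s] s elim r by (auto simp: k_def)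
        then have "\<bar>H s (f k) - H (r k) (f k)\<bar> \<le> \<rho> * mass (f k) + C * (\<Sum>i\<in>UNIV. \<bar>f k $ i - f k $ i\<bar>)"
          using \<rho> k f[OF k] s r fine_grid_range[OF \<rho>, of k]
          by (intro H_diff) (auto simp: fine_grid_def prob_simplex_iff)
        then have "H s (f k) \<le> H (r k) (f k) + \<rho>" using f[OF k] by (simp add: prob_simplex_iff abs_le_iff)
        moreover have "step_path r n f z s = f k" using s elim r by (auto simp: step_path_def k_def)
        ultimately show "H s (step_path r n f z s) \<le> H (r (step_index r n s)) (f (step_index r n s)) + \<rho>"
          by (simp add: k_def)
      qed
    qed
  qed
  also have "\<dots> = (\<Sum>k<n. (r (Suc k) - r k) * (H (r k) (f k) + \<rho>))"
    by (rule step_index_integral(2)[OF g])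
  finally show ?thesis .
qed

text \<open>The state is read at the right end of each interval: those points tend to
  \<open>s\<close> strictly from the right, where a cadlag path converges to its value. The time
  argument comes from the left, which continuity of \<open>H\<close> permits.\<close>

lemma riemann_sums_path:
  assumes \<omega>: "cadlag \<omega>" "\<And>s. \<omega> s \<in> prob_simplex" and ab: "0 \<le> a" "a < b" "b \<le> T"
  shows "(\<lambda>N. \<Sum>k<Suc N. ((b - a) / Suc N) * H (uniform_grid a b (Suc N) k) (\<omega> (uniform_grid a b (Suc N) (Suc k))))
    \<longlonglongrightarrow> (LINT s:{a..b}|lborel. H s (\<omega> s))"
proof -
  define g where "g N = uniform_grid a b (Suc N)" for N
  note ug = uniform_grid[OF ab(2) zero_less_Suc, folded g_def]
  define h where "h N k = H (g N k) (\<omega> (g N (Suc k)))" for N k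
  have range: "g N k \<in> {0..T}" if "k \<le> Suc N" for N k
    using grid_le[OF ug(1), of 0 k N] grid_le[OF ug(1), of k "Suc N" N] ug(2,3)[of N] that ab by auto
  have sum: "(\<Sum>k<Suc N. ((b - a) / Suc N) * h N k) = (LINT s:{a..b}|lborel. h N (step_index (g N) (Suc N) s))" for N
    using step_index_integral(2)[OF ug(1)[of N], of "h N"] ug(2-4)[of N] by simp
  have "(\<lambda>N. (LINT s:{a..b}|lborel. h N (step_index (g N) (Suc N) s))) \<longlonglongrightarrow> (LINT s:{a..b}|lborel. H s (\<omega> s))"
    unfolding set_lebesgue_integral_def
  proof (rule integral_dominated_convergence[where w="\<lambda>s. indicator {a..b} s *\<^sub>R C"])
    show "(\<lambda>s. indicator {a..b} s *\<^sub>R H s (\<omega> s)) \<in> borel_measurable lborel"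
      using running_cost_measurable[OF cadlag_borel_measurable[OF \<omega>(1)] \<omega>(2) ab(1,3)] by simp
    show "(\<lambda>s. indicator {a..b} s *\<^sub>R h N (step_index (g N) (Suc N) s)) \<in> borel_measurable lborel" for N
      using step_index_integral(1)[OF ug(1)[of N], of "h N"] ug(2,3)[of N] by (simp add: set_integrable_def)
    show "integrable lborel (\<lambda>s. indicator {a..b} s *\<^sub>R C)"
      by (intro integrable_scaleR_left integrable_real_indicator) (auto simp: emeasure_lborel_Icc_eq)
    show "AE s in lborel. norm (indicator {a..b} s *\<^sub>R h N (step_index (g N) (Suc N) s)) \<le> indicator {a..b} s *\<^sub>R C" for N
      by (intro AE_I2) (auto simp: h_def indicator_def
          intro!: H_simplex_bound[OF range \<omega>(2)] less_imp_le[OF step_index_bound])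
    show "AE s in lborel. (\<lambda>N. indicator {a..b} s *\<^sub>R h N (step_index (g N) (Suc N) s)) \<longlonglongrightarrow> indicator {a..b} s *\<^sub>R H s (\<omega> s)"
      using AE_lborel_singleton[of b]
    proof eventually_elim
      case (elim s)
      show ?case
      proof (cases "s \<in> {a..b}")
        case True
        then have s: "a \<le> s" "s < b" using elim by auto
        define \<alpha> where "\<alpha> N = g N (step_index (g N) (Suc N) s)" for N
        define \<beta> where "\<beta> N = g N (Suc (step_index (g N) (Suc N) s))" for N
        have idx: "step_index (g N) (Suc N) s < Suc N" "\<alpha> N \<le> s" "s < \<beta> N" for N
          using step_index_interval[OF ug(1)[of N], of s] s ug(2,3)[of N] by (auto simp: \<alpha>_def \<beta>_def)
        have diff: "\<beta> N - \<alpha> N = (b - a) / Suc N" for N by (simp add: \<alpha>_def \<beta>_def ug(4))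
        have "(\<lambda>N. (b - a) / Suc N) \<longlonglongrightarrow> 0"
          using LIMSEQ_Suc[OF lim_const_over_n[of "b - a"]] by simp
        then have lim: "(\<lambda>N. s + (b - a) / Suc N) \<longlonglongrightarrow> s" "(\<lambda>N. s - (b - a) / Suc N) \<longlonglongrightarrow> s"
          using tendsto_add[OF tendsto_const, of _ 0 sequentially s] tendsto_diff[OF tendsto_const, of _ 0 sequentially s] by auto
        have \<beta>lim: "\<beta> \<longlonglongrightarrow> s"
        proof (rule tendsto_sandwich[OF _ _ tendsto_const lim(1)])
          show "\<forall>\<^sub>F N in sequentially. s \<le> \<beta> N" by (intro always_eventually allI less_imp_le idx)
          have "\<beta> N \<le> s + (b - a) / Suc N" for N using diff[of N] idx(2)[of N] by linarith
          then show "\<forall>\<^sub>F N in sequentially. \<beta> N \<le> s + (b - a) / Suc N" by (intro always_eventually allI)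
        qed
        have \<alpha>lim: "\<alpha> \<longlonglongrightarrow> s"
        proof (rule tendsto_sandwich[OF _ _ lim(2) tendsto_const])
          have "s - (b - a) / Suc N \<le> \<alpha> N" for N using diff[of N] idx(3)[of N] by linarith
          then show "\<forall>\<^sub>F N in sequentially. s - (b - a) / Suc N \<le> \<alpha> N" by (intro always_eventually allI)
          show "\<forall>\<^sub>F N in sequentially. \<alpha> N \<le> s" by (intro always_eventually allI idx)
        qed
        have "filterlim \<beta> (at_right s) sequentially"
          using \<beta>lim idx(3) by (rule filterlim_at_rightI)
        then have "(\<lambda>N. \<omega> (\<beta> N)) \<longlonglongrightarrow> \<omega> s"
          using \<omega>(1) by (auto simp: cadlag_def intro: filterlim_compose)
        then have "(\<lambda>N. (\<alpha> N, \<omega> (\<beta> N))) \<longlonglongrightarrow> (s, \<omega> s)" using \<alpha>lim by (intro tendsto_Pair)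
        then have "(\<lambda>N. (\<lambda>(t, p). H t p) (\<alpha> N, \<omega> (\<beta> N))) \<longlonglongrightarrow> (\<lambda>(t, p). H t p) (s, \<omega> s)"
          using range idx(1) \<omega>(2) s ab unfolding \<alpha>_def
          by (intro continuous_on_tendsto_compose[OF H_continuous] always_eventually) (auto intro: less_imp_le)
        then show ?thesis using True by (simp add: h_def \<alpha>_def \<beta>_def)
      qed simp
    qed
  qed
  then have "(\<lambda>N. \<Sum>k<Suc N. ((b - a) / Suc N) * h N k) \<longlonglongrightarrow> (LINT s:{a..b}|lborel. H s (\<omega> s))"
    by (simp only: sum)
  then show ?thesis unfolding h_def g_def .
qed

text \<open>As a limit of Riemann sums the cost involves finitely many coordinates at a time, which
  avoids joint measurability in time and path.\<close>

lemma path_cost_measurable: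
  assumes "0 \<le> a" "a < b" "b \<le> T"
  shows "(\<lambda>\<omega>. LINT s:{a..b}|lborel. H s (\<omega> s)) \<in> borel_measurable (path_space t0 T)"
proof (rule borel_measurable_LIMSEQ_real)
  fix \<omega> :: "real \<Rightarrow> real^'i" assume "\<omega> \<in> space (path_space t0 T)"
  then show "(\<lambda>N. \<Sum>k<Suc N. ((b - a) / Suc N) * H (uniform_grid a b (Suc N) k) (\<omega> (uniform_grid a b (Suc N) (Suc k))))
    \<longlonglongrightarrow> (LINT s:{a..b}|lborel. H s (\<omega> s))"
    using assms by (intro riemann_sums_path) (auto simp: paths_def)
next
  fix N
  define g where "g = uniform_grid a b (Suc N)"
  note ug = uniform_grid[OF assms(2) zero_less_Suc, of N, folded g_def]
  have "(\<lambda>\<omega>. H (g k) (\<omega> (g (Suc k)))) \<in> borel_measurable (path_space t0 T)" if "k < Suc N" for k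
  proof -
    have gk: "g k \<in> {0..T}" using grid_le[OF ug(1), of 0 k] grid_le[OF ug(1), of k "Suc N"] ug(2,3) that assms by auto
    have "continuous_on prob_simplex (H (g k))"
    proof -
      have "continuous_on (prob_simplex :: (real^'i) set) (\<lambda>p. (g k, p))" by (intro continuous_intros)
      from continuous_on_compose2[OF H_continuous this] gk show ?thesis by fastforce
    qed
    then have "(\<lambda>p. indicator prob_simplex p *\<^sub>R H (g k) p) \<in> borel_measurable borel"
      by (intro borel_measurable_continuous_on_indicator prob_simplex_borel)
    from measurable_compose[OF coordinate_measurable[where s="g (Suc k)"] this]
    show ?thesis by (rule measurable_cong[THEN iffD1, rotated]) (auto simp: paths_def image_subset_iff)
  qed
  then show "(\<lambda>\<omega>. \<Sum>k<Suc N. ((b - a) / Suc N) * H (uniform_grid a b (Suc N) k) (\<omega> (uniform_grid a b (Suc N) (Suc k))))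
    \<in> borel_measurable (path_space t0 T)"
    unfolding g_def by (intro borel_measurable_sum borel_measurable_times borel_measurable_const) auto
qed

end

context game
begin

text \<open>Homogeneity turns mass times \<open>H\<close> at the belief into \<open>H\<close> at the
  weight, and the marginal property collapses leaves to nodes. Freezing the payoffs at grid times
  costs at most \<open>\<rho>\<close> per unit of time.\<close>

lemma tree_measure_cost_le:
  fixes m :: "'c list \<Rightarrow> real^'i"
  assumes \<rho>: "fine_grid \<rho> r n" and m: "weight_tree A n m" and mp: "m [] = p" and p: "p \<in> prob_simplex"
  shows "martingale_cost T U V l (r 0) (tree_measure TYPE('c) r n A m p) \<le> weight_tree_cost r A n m + \<rho> * T"
proof -
  have g: "grid r n" "0 \<le> r 0" "r n = T" "0 \<le> \<rho>" using \<rho> by (auto simp: fine_grid_def)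
  note ctx = g(1-3) m mp p
  have rT: "r 0 < T" using grid_less[OF g(1), of 0 n] g by (simp add: grid_def)
  define c where "c \<omega> = (LINT s:{r 0..T}|lborel. H s (\<omega> s))" for \<omega> :: "real \<Rightarrow> real^'i"
  define b where "b h = belief m p h" for h
  define \<phi> where "\<phi> h = (\<Sum>k<n. (r (Suc k) - r k) * (H (r k) (b (take k h)) + \<rho>))" for h
  have c_meas: "c \<in> borel_measurable (path_space (r 0) T)"
    unfolding c_def using g rT by (intro path_cost_measurable) auto
  have mass1: "(\<Sum>h\<in>words A n. mass (m h)) = 1"
    using weight_tree_sum[OF m order_refl] mp p by (simp add: mass_sum[symmetric] prob_simplex_iff)
  have "martingale_cost T U V l (r 0) (tree_measure TYPE('c) r n A m p) = integral\<^sup>L (tree_measure TYPE('c) r n A m p) c"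
    by (simp add: martingale_cost_def c_def[abs_def])
  also have "\<dots> = (\<Sum>x\<in>leaves n A. leaf_weight n A m x *\<^sub>R c (leaf_path r n m p x))"
    by (rule tree_measure_integral(2)[OF ctx c_meas])
  also have "\<dots> \<le> (\<Sum>x\<in>leaves n A. leaf_weight n A m x *\<^sub>R \<phi> (snd x))"
  proof (rule sum_mono, rule scaleR_left_mono)
    fix x assume x: "x \<in> leaves n A"
    have h: "snd x \<in> words A n" using x by (auto simp: leaves_def[OF ctx])
    have "b (take k (snd x)) \<in> prob_simplex" if "k < n" for k
      unfolding b_def using that by (intro belief_simplex[OF ctx, of _ k] take_words[OF ctx h]) auto
    then show "c (leaf_path r n m p x) \<le> \<phi> (snd x)"
      unfolding c_def \<phi>_def leaf_path_def[OF ctx] b_def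
      by (intro step_path_cost_le[OF g(1-3) _ axis_simplex \<rho>]) auto
    show "0 \<le> leaf_weight n A m x" by (rule leaf_weight_nonneg[OF ctx])
  qed
  also have "\<dots> = (\<Sum>h\<in>words A n. mass (m h) * \<phi> h)"
    unfolding leaf_sum[OF ctx] by (simp add: mass_def sum_distrib_right)
  also have "\<dots> = (\<Sum>h\<in>words A n. \<Sum>k<n. (r (Suc k) - r k) * (m h \<bullet> (H (r k) (b (take k h)) *\<^sub>R 1)) + (r (Suc k) - r k) * (\<rho> * mass (m h)))"
  proof (intro sum.cong refl)
    fix h
    have "m h \<bullet> 1 = mass (m h)" by (simp add: inner_vec_def mass_def)
    then show "mass (m h) * \<phi> h = (\<Sum>k<n. (r (Suc k) - r k) * (m h \<bullet> (H (r k) (b (take k h)) *\<^sub>R 1)) + (r (Suc k) - r k) * (\<rho> * mass (m h)))"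
      unfolding \<phi>_def sum_distrib_left by (intro sum.cong refl) (simp add: algebra_simps)
  qed
  also have "\<dots> = (\<Sum>k<n. \<Sum>h\<in>words A n. (r (Suc k) - r k) * (m h \<bullet> (H (r k) (b (take k h)) *\<^sub>R 1)) + (r (Suc k) - r k) * (\<rho> * mass (m h)))"
    by (rule sum.swap)
  also have "\<dots> = (\<Sum>k<n. (r (Suc k) - r k) * (\<Sum>h\<in>words A n. m h \<bullet> (H (r k) (b (take k h)) *\<^sub>R 1)) + (r (Suc k) - r k) * \<rho>)"
    using mass1 by (simp add: sum.distrib flip: sum_distrib_left)
  also have "\<dots> = (\<Sum>k<n. (r (Suc k) - r k) * (\<Sum>h\<in>words A k. H (r k) (m h)) + (r (Suc k) - r k) * \<rho>)"
  proof (rule sum.cong[OF refl])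
    fix k assume "k \<in> {..<n}"
    then have k: "k < n" by simp
    have "(\<Sum>h\<in>words A n. m h \<bullet> (H (r k) (b (take k h)) *\<^sub>R 1)) = (\<Sum>h\<in>words A k. m h \<bullet> (H (r k) (b h) *\<^sub>R 1))"
      using k by (intro weight_tree_marginal[OF m]) simp
    also have "\<dots> = (\<Sum>h\<in>words A k. H (r k) (m h))"
    proof (rule sum.cong[OF refl])
      fix h assume h: "h \<in> words A k"
      have "nonneg (m h)" using m_nonneg[OF ctx h] k by simp
      then have "H (r k) (mass (m h) *\<^sub>R b h) = mass (m h) * H (r k) (b h)"
        using fine_grid_range[OF \<rho>, of k] k by (intro H_scaleR mass_nonneg) auto
      moreover have "mass (m h) *\<^sub>R b h = m h"
        unfolding b_def using mass_belief[OF ctx h] k by simp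
      moreover have "m h \<bullet> 1 = mass (m h)" by (simp add: inner_vec_def mass_def)
      ultimately show "m h \<bullet> (H (r k) (b h) *\<^sub>R 1) = H (r k) (m h)" by simp
    qed
    finally show "(r (Suc k) - r k) * (\<Sum>h\<in>words A n. m h \<bullet> (H (r k) (b (take k h)) *\<^sub>R 1)) + (r (Suc k) - r k) * \<rho> =
        (r (Suc k) - r k) * (\<Sum>h\<in>words A k. H (r k) (m h)) + (r (Suc k) - r k) * \<rho>" by simp
  qed
  also have "\<dots> = weight_tree_cost r A n m + (T - r 0) * \<rho>"
    using sum_lessThan_telescope[of r n] g
    by (simp add: weight_tree_cost_def sum.distrib flip: sum_distrib_right)
  also have "(T - r 0) * \<rho> \<le> \<rho> * T" using g by (simp add: algebra_simps)
  finally show ?thesis by simp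
qed

lemma martingale_cost_bdd_below:
  assumes "0 \<le> t0" "t0 < T"
  shows "bdd_below (martingale_cost T U V l t0 ` martingale_measures T t0 p0)"
proof (rule bdd_belowI2)
  fix P :: "(real \<Rightarrow> real^'i) measure" assume P: "P \<in> martingale_measures T t0 p0"
  have "\<bar>integral\<^sup>L P (\<lambda>\<omega>. LINT s:{t0..T}|lborel. H s (\<omega> s))\<bar> \<le> C * T"
  proof (rule prob_integral_abs_le)
    show "prob_space P" using P by (simp add: martingale_measures_def)
    fix \<omega> :: "real \<Rightarrow> real^'i" assume "\<omega> \<in> space P"
    moreover have "space P = paths t0 T"
      using P sets_eq_imp_space_eq[of P "path_space t0 T"] by (simp add: martingale_measures_def)
    ultimately have \<omega>: "cadlag \<omega>" "\<And>s. \<omega> s \<in> prob_simplex" by (auto simp: paths_def)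
    have int: "set_integrable lborel {t0..T} (\<lambda>s. H s (\<omega> s))"
      using assms by (intro running_cost_integrable cadlag_borel_measurable \<omega>) auto
    have intc: "set_integrable lborel {t0..T} (\<lambda>s. c)" for c :: real
      by (simp add: set_integrable_def emeasure_lborel_Icc_eq)
    have H: "- C \<le> H s (\<omega> s) \<and> H s (\<omega> s) \<le> C" if "s \<in> {t0..T}" for s
      using H_simplex_bound[OF _ \<omega>(2), of s s] that assms by (auto simp: abs_le_iff)
    have "(LINT s:{t0..T}|lborel. H s (\<omega> s)) \<le> (LINT s:{t0..T}|lborel. C)"
      using H by (intro set_integral_mono int intc) auto
    moreover have "(LINT s:{t0..T}|lborel. - C) \<le> (LINT s:{t0..T}|lborel. H s (\<omega> s))"
      using H by (intro set_integral_mono int intc) auto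
    moreover have "(LINT s:{t0..T}|lborel. c) = (T - t0) * c" for c :: real
      using assms by (simp add: set_lebesgue_integral_def)
    moreover have "(T - t0) * C \<le> C * T" using assms C_pos by (simp add: algebra_simps)
    ultimately show "\<bar>LINT s:{t0..T}|lborel. H s (\<omega> s)\<bar> \<le> C * T" by (simp add: abs_le_iff)
  qed (use C_pos T_pos in simp)
  then show "- (C * T) \<le> martingale_cost T U V l t0 P" by (simp add: martingale_cost_def abs_le_iff)
qed

end

section \<open>Representation, convexity and one-step dynamic programming\<close>

context random_game
begin

lemma uniform_grid_mesh:
  assumes "0 < \<delta>" obtains n where "0 < n" "T / real n \<le> \<delta>"
proof -
  obtain n :: nat where n: "T / \<delta> < real n" using reals_Archimedean2 by blast
  have "0 < n" using n T_pos assms by (cases n) (auto simp: divide_less_0_iff)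
  with n assms show ?thesis by (intro that[of n]) (auto simp: field_simps)
qed

text \<open>A near-optimal tree of the lower bound is realised as a martingale measure. For an
  optimal \<open>P\<close> this bounds its cost by the value; the opposite inequality is contained
  in \<open>value_submartingale\<close>.\<close>

theorem INF_martingale_cost_le_Val:
  assumes t: "t \<in> {0..<T}" and p: "p \<in> prob_simplex"
  shows "(INF P\<in>martingale_measures T t p. martingale_cost T U V l t P) \<le> Val t p"
proof (rule field_le_epsilon)
  fix e :: real assume e: "0 < e"
  obtain \<delta>1 where \<delta>1: "0 < \<delta>1" "\<And>r n p. grid r n \<Longrightarrow> 0 \<le> r 0 \<Longrightarrow> r n = T \<Longrightarrow> (\<And>k. k < n \<Longrightarrow> r (Suc k) - r k \<le> \<delta>1) \<Longrightarrow>
      p \<in> prob_simplex \<Longrightarrow> \<exists>(A :: (int^'i) set) m. weight_tree A n m \<and> m [] = p \<and>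
        weight_tree_cost r A n m \<le> Val (r 0) p + e / 2"
    using near_optimal_tree[of "e / 2"] e by auto
  define \<rho> where "\<rho> = e / (2 * T)"
  have \<rho>: "0 < \<rho>" "\<rho> * T = e / 2" using e T_pos by (auto simp: \<rho>_def)
  obtain \<delta>2 where \<delta>2: "0 < \<delta>2" "\<And>r n. grid r n \<Longrightarrow> 0 \<le> r 0 \<Longrightarrow> r n = T \<Longrightarrow>
    (\<And>k. k < n \<Longrightarrow> r (Suc k) - r k \<le> \<delta>2) \<Longrightarrow> fine_grid \<rho> r n"
    using fine_grid_exists[OF \<rho>(1)] by blast
  obtain n where n: "0 < n" "T / real n \<le> min \<delta>1 \<delta>2" using uniform_grid_mesh[of "min \<delta>1 \<delta>2"] \<delta>1(1) \<delta>2(1) by auto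
  define r where "r = uniform_grid t T n"
  have tT: "t < T" "0 \<le> t" using t by auto
  note r = uniform_grid[OF tT(1) n(1), folded r_def]
  have "(T - t) / real n \<le> T / real n" using t by (intro divide_right_mono) auto
  then have mesh: "r (Suc k) - r k \<le> \<delta>1" "r (Suc k) - r k \<le> \<delta>2" for k using n(2) r(4)[of k] by auto
  have r0: "0 \<le> r 0" using r(2) tT by simp
  obtain A :: "(int^'i) set" and m where m: "weight_tree A n m" "m [] = p" "weight_tree_cost r A n m \<le> Val (r 0) p + e / 2"
    using \<delta>1(2)[OF r(1) r0 r(3) mesh(1) p] by blast
  have fg: "fine_grid \<rho> r n" by (rule \<delta>2(2)[OF r(1) r0 r(3) mesh(2)])
  have M: "tree_measure TYPE(int^'i) r n A m p \<in> martingale_measures T t p"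
    using tree_measure_martingale[OF r(1) r0 r(3) m(1,2) p] r(2) by simp
  have "(INF P\<in>martingale_measures T t p. martingale_cost T U V l t P) \<le> martingale_cost T U V l t (tree_measure TYPE(int^'i) r n A m p)"
    using martingale_cost_bdd_below[OF tT(2,1)] M by (rule cINF_lower)
  also have "\<dots> \<le> Val t p + e"
    using tree_measure_cost_le[OF fg m(1,2) p] m(3) \<rho>(2) r(2) by simp
  finally show "(INF P\<in>martingale_measures T t p. martingale_cost T U V l t P) \<le> Val t p + e" .
qed

text \<open>Near-optimal trees at \<open>p\<close> and \<open>q\<close>, scaled by \<open>a\<close>
  and \<open>b\<close>, merge into one tree by a split at the root. The lower bound supplies the
  trees and the upper bound evaluates the merged one.\<close>

theorem Val_convex:
  assumes t: "t \<in> {0..T}" and pq: "p \<in> prob_simplex" "q \<in> prob_simplex" and ab: "0 \<le> a" "0 \<le> b" "a + b = 1"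
  shows "Val t (a *\<^sub>R p + b *\<^sub>R q) \<le> a * Val t p + b * Val t q"
proof (cases "t = T")
  case False
  then have tT: "t < T" "0 \<le> t" using t by auto
  show ?thesis
  proof (rule field_le_epsilon)
    fix e :: real assume e: "0 < e"
    obtain \<delta>1 where \<delta>1: "0 < \<delta>1" "\<And>r n p. grid r n \<Longrightarrow> 0 \<le> r 0 \<Longrightarrow> r n = T \<Longrightarrow> (\<And>k. k < n \<Longrightarrow> r (Suc k) - r k \<le> \<delta>1) \<Longrightarrow>
      p \<in> prob_simplex \<Longrightarrow> \<exists>(A :: (int^'i) set) m. weight_tree A n m \<and> m [] = p \<and>
        weight_tree_cost r A n m \<le> Val (r 0) p + e / 2"
      using near_optimal_tree[of "e / 2"] e by auto
    define \<rho> where "\<rho> = e / (2 * T)"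
    have \<rho>: "0 < \<rho>" "\<rho> * T = e / 2" using e T_pos by (auto simp: \<rho>_def)
    obtain \<delta>2 where \<delta>2: "0 < \<delta>2" "\<And>r n. grid r n \<Longrightarrow> 0 \<le> r 0 \<Longrightarrow> r n = T \<Longrightarrow>
      (\<And>k. k < n \<Longrightarrow> r (Suc k) - r k \<le> \<delta>2) \<Longrightarrow> fine_grid \<rho> r n"
      using fine_grid_exists[OF \<rho>(1)] by blast
    obtain n where n: "0 < n" "T / real n \<le> min \<delta>1 \<delta>2" using uniform_grid_mesh[of "min \<delta>1 \<delta>2"] \<delta>1(1) \<delta>2(1) by auto
    define r where "r = uniform_grid t T n"
    note r = uniform_grid[OF tT(1) n(1), folded r_def]
    have "(T - t) / real n \<le> T / real n" using t by (intro divide_right_mono) auto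
    then have mesh: "r (Suc k) - r k \<le> \<delta>1" "r (Suc k) - r k \<le> \<delta>2" for k using n(2) r(4)[of k] by auto
    have r0: "0 \<le> r 0" using r(2) tT by simp
    have fg: "fine_grid \<rho> r n" by (rule \<delta>2(2)[OF r(1) r0 r(3) mesh(2)])
    have "\<exists>x. tree_cost r n p x \<and> x \<le> Val t p + e / 2" if "p \<in> prob_simplex" for p
      using \<delta>1(2)[OF r(1) r0 r(3) mesh(1) that] weight_tree_imp_tree_cost r(2) by metis
    then obtain x y where x: "tree_cost r n p x" "x \<le> Val t p + e / 2" and y: "tree_cost r n q y" "y \<le> Val t q + e / 2"
      using pq by metis
    have "r k \<in> {0..T}" if "k < n" for k using fine_grid_range[OF fg, of k] that by simp
    then have "tree_cost r n (a *\<^sub>R p + b *\<^sub>R q) (a * x + b * y)"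
      using ab by (intro tree_cost.split tree_cost_scaleR x y) auto
    moreover have "a *\<^sub>R p + b *\<^sub>R q \<in> prob_simplex"
      using pq ab by (auto simp: prob_simplex_iff mass_add mass_scaleR intro!: nonneg_add nonneg_scaleR)
    ultimately have "Val t (a *\<^sub>R p + b *\<^sub>R q) \<le> a * x + b * y + \<rho> * T"
      using Val_le_tree_cost[OF fg] r(2) by simp
    also have "a * x \<le> a * (Val t p + e / 2)" using x ab by (intro mult_left_mono)
    also have "b * y \<le> b * (Val t q + e / 2)" using y ab by (intro mult_left_mono)
    also have "a * (Val t p + e / 2) + b * (Val t q + e / 2) + \<rho> * T = a * Val t p + b * Val t q + ((a + b) * (e / 2) + e / 2)"
      unfolding \<rho>(2) by (simp add: field_simps)
    finally show "Val t (a *\<^sub>R p + b *\<^sub>R q) \<le> a * Val t p + b * Val t q + e" using ab by simp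
  qed
qed simp

text \<open>The tree reveals nothing on a grid of the interval up to \<open>t'\<close> and continues
  with a near-optimal tree from there; the upper bound for it is the claim.\<close>

theorem Val_step:
  assumes t: "0 \<le> t" "t < t'" "t' \<le> T" and p: "p \<in> prob_simplex"
    and d: "\<And>s i u v. s \<in> {t..t'} \<Longrightarrow> u \<in> U \<Longrightarrow> v \<in> V \<Longrightarrow> \<bar>l i s u v - l i t u v\<bar> \<le> d"
  shows "Val t p \<le> (t' - t) * (H t p + d) + Val t' p"
proof (rule field_le_epsilon)
  fix e :: real assume e: "0 < e"
  obtain \<delta>1 where \<delta>1: "0 < \<delta>1" "\<And>r n p. grid r n \<Longrightarrow> 0 \<le> r 0 \<Longrightarrow> r n = T \<Longrightarrow> (\<And>k. k < n \<Longrightarrow> r (Suc k) - r k \<le> \<delta>1) \<Longrightarrow>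
      p \<in> prob_simplex \<Longrightarrow> \<exists>(A :: (int^'i) set) m. weight_tree A n m \<and> m [] = p \<and>
        weight_tree_cost r A n m \<le> Val (r 0) p + e / 2"
    using near_optimal_tree[of "e / 2"] e by auto
  define \<rho> where "\<rho> = e / (2 * T)"
  have \<rho>: "0 < \<rho>" "\<rho> * T = e / 2" using e T_pos by (auto simp: \<rho>_def)
  obtain \<delta>2 where \<delta>2: "0 < \<delta>2" "\<And>r n. grid r n \<Longrightarrow> 0 \<le> r 0 \<Longrightarrow> r n = T \<Longrightarrow>
    (\<And>k. k < n \<Longrightarrow> r (Suc k) - r k \<le> \<delta>2) \<Longrightarrow> fine_grid \<rho> r n"
    using fine_grid_exists[OF \<rho>(1)] by blast
  obtain K where K: "0 < K" "T / real K \<le> min \<delta>1 \<delta>2" using uniform_grid_mesh[of "min \<delta>1 \<delta>2"] \<delta>1(1) \<delta>2(1) by auto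
  have short: "(b - a) / real K \<le> min \<delta>1 \<delta>2" if "0 \<le> a" "b \<le> T" for a b
    using divide_right_mono[of "b - a" T "real K"] that K(2) by simp
  define r1 where "r1 = uniform_grid t t' K"
  note r1 = uniform_grid[OF t(2) K(1), folded r1_def]
  obtain n r2 x where r2: "r2 0 = t'" "r2 n = T" "\<And>k. k < n \<Longrightarrow> r2 k < r2 (Suc k) \<and> r2 (Suc k) - r2 k \<le> min \<delta>1 \<delta>2"
    and x: "tree_cost r2 n p x" "x \<le> Val t' p + e / 2"
  proof (cases "t' = T")
    case True
    \<comment> \<open>At \<open>t' = T\<close> the continuation is a bare leaf, because a grid has
      at least one interval.\<close>
    have "tree_cost (\<lambda>_. T) 0 p 0" using p by (intro tree_cost.leaf) (simp add: prob_simplex_iff)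
    then show ?thesis using True e by (intro that[of "\<lambda>_. T" 0 0]) auto
  next
    case False
    then have t': "t' < T" using t by simp
    define r2 where "r2 = uniform_grid t' T K"
    note r2 = uniform_grid[OF t' K(1), folded r2_def]
    have mesh: "r2 (Suc k) - r2 k \<le> min \<delta>1 \<delta>2" for k using short[of t' T] r2(4)[of k] t by simp
    obtain A :: "(int^'i) set" and m where m: "weight_tree A K m" "m [] = p" "weight_tree_cost r2 A K m \<le> Val (r2 0) p + e / 2"
      using \<delta>1(2)[OF r2(1) _ r2(3) _ p] mesh r2(2) t by fastforce
    show ?thesis
      using weight_tree_imp_tree_cost[OF m(1), of r2] m r2 mesh
      by (intro that[of r2 K "weight_tree_cost r2 A K m"]) (auto simp: grid_def)
  qed
  \<comment> \<open>The grids share the point \<open>t'\<close>; both meshes were kept below both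
    thresholds, so the glued grid is fine as well.\<close>
  define r where "r j = (if j \<le> K then r1 j else r2 (j - K))" for j
  have rK: "r (K + j) = r2 j" for j using r1(3) r2(1) by (cases j) (auto simp: r_def)
  have r_step: "r j < r (Suc j) \<and> r (Suc j) - r j \<le> min \<delta>1 \<delta>2" if j: "j < K + n" for j
  proof (cases "j < K")
    case True
    then show ?thesis using r1(1,4) short[of t t'] t by (auto simp: r_def grid_def)
  next
    case False
    then have "r j = r2 (j - K)" "r (Suc j) = r2 (Suc (j - K))"
      using rK[of "j - K"] rK[of "Suc (j - K)"] by auto
    then show ?thesis using r2(3)[of "j - K"] j False by auto
  qed
  have r: "grid r (K + n)" "r 0 = t" "r (K + n) = T"
    using r_step K(1) r1(2) rK[of n] r2(2) by (auto simp: grid_def r_def)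
  have fg: "fine_grid \<rho> r (K + n)"
    using \<delta>2(2)[OF r(1) _ r(3)] r_step r(2) t by fastforce
  have "tree_cost (\<lambda>j. r (K + j)) n p x" using x(1) unfolding rK by simp
  from tree_cost_constant_steps[OF this]
  have "Val t p \<le> (\<Sum>j<K. (r (Suc j) - r j) * H (r j) p) + x + \<rho> * T"
    using Val_le_tree_cost[OF fg p] r(2) by simp
  also have "(\<Sum>j<K. (r (Suc j) - r j) * H (r j) p) \<le> (\<Sum>j<K. (r (Suc j) - r j) * (H t p + d))"
  proof (intro sum_mono mult_left_mono)
    fix j assume "j \<in> {..<K}"
    then have j: "j < K" by simp
    show "0 \<le> r (Suc j) - r j" using r_step[of j] j by simp
    have rj: "r j \<in> {t..t'}"
      using grid_le[OF r1(1), of 0 j] grid_le[OF r1(1), of j K] r1(2,3) j by (auto simp: r_def)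
    have "\<bar>H (r j) p - H t p\<bar> \<le> d * mass p + C * (\<Sum>i\<in>UNIV. \<bar>p $ i - p $ i\<bar>)"
      using rj t p d[OF rj] by (intro H_diff) (auto simp: prob_simplex_iff)
    then show "H (r j) p \<le> H t p + d" using p by (simp add: prob_simplex_iff abs_le_iff)
  qed
  also have "(\<Sum>j<K. (r (Suc j) - r j) * (H t p + d)) = (t' - t) * (H t p + d)"
    using sum_lessThan_telescope[of r K] rK[of 0] r2(1) r(2) by (simp flip: sum_distrib_right)
  finally show "Val t p \<le> (t' - t) * (H t p + d) + Val t' p + e"
    using x(2) \<rho>(2) by simp
qed

end

section \<open>Bounded measurable selections of the subdifferential\<close>

context
  fixes W :: "real^'i::finite \<Rightarrow> real" and L :: real
  assumes convex_W: "\<And>p q a b. p \<in> prob_simplex \<Longrightarrow> q \<in> prob_simplex \<Longrightarrow> 0 \<le> a \<Longrightarrow> 0 \<le> b \<Longrightarrow> a + b = 1 \<Longrightarrow>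
      W (a *\<^sub>R p + b *\<^sub>R q) \<le> a * W p + b * W q"
    and Lip_W: "\<And>p q. p \<in> prob_simplex \<Longrightarrow> q \<in> prob_simplex \<Longrightarrow> W p \<le> W q + L * norm (p - q)"
    and L: "0 \<le> L"
begin

text \<open>Separating the point \<open>(p, W p)\<close> from the strict epigraph of the inf-convolution of \<open>W\<close> with
  \<open>L * norm\<close> gives subgradients bounded by \<open>L\<close> also on the boundary of the simplex.\<close>

lemma bounded_subgradient_exists:
  assumes p: "p \<in> prob_simplex"
  shows "\<exists>x. norm x \<le> L \<and> x \<in> simplex_subdifferential W p"
proof -
  define E where "E = {z :: (real^'i) \<times> real. \<exists>q\<in>prob_simplex. W q + L * norm (fst z - q) < snd z}"
  have "convex E"
  proof (rule convexI)
    fix z1 z2 :: "(real^'i) \<times> real" and a b :: real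
    assume "z1 \<in> E" "z2 \<in> E" and ab: "0 \<le> a" "0 \<le> b" "a + b = 1"
    then obtain q1 q2 where q: "q1 \<in> prob_simplex" "q2 \<in> prob_simplex"
      "W q1 + L * norm (fst z1 - q1) < snd z1" "W q2 + L * norm (fst z2 - q2) < snd z2"
      by (auto simp: E_def)
    define q3 where "q3 = a *\<^sub>R q1 + b *\<^sub>R q2"
    have q3: "q3 \<in> prob_simplex"
      using q(1,2) ab unfolding q3_def
      by (auto simp: prob_simplex_iff mass_add mass_scaleR intro!: nonneg_add nonneg_scaleR)
    have "norm (fst (a *\<^sub>R z1 + b *\<^sub>R z2) - q3) = norm (a *\<^sub>R (fst z1 - q1) + b *\<^sub>R (fst z2 - q2))"
      by (simp add: q3_def algebra_simps)
    also have "\<dots> \<le> a * norm (fst z1 - q1) + b * norm (fst z2 - q2)"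
      using norm_triangle_ineq[of "a *\<^sub>R (fst z1 - q1)" "b *\<^sub>R (fst z2 - q2)"] ab by simp
    finally have "L * norm (fst (a *\<^sub>R z1 + b *\<^sub>R z2) - q3) \<le> L * (a * norm (fst z1 - q1) + b * norm (fst z2 - q2))"
      using L by (rule mult_left_mono)
    then have "W q3 + L * norm (fst (a *\<^sub>R z1 + b *\<^sub>R z2) - q3)
        \<le> a * (W q1 + L * norm (fst z1 - q1)) + b * (W q2 + L * norm (fst z2 - q2))"
      using convex_W[OF q(1,2) ab] by (simp add: q3_def algebra_simps)
    also have "\<dots> < a * snd z1 + b * snd z2"
    proof (cases "a = 0")
      case True
      then show ?thesis using q(4) ab by simp
    next
      case False
      then have "a * (W q1 + L * norm (fst z1 - q1)) < a * snd z1" using q(3) ab by (intro mult_strict_left_mono) auto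
      moreover have "b * (W q2 + L * norm (fst z2 - q2)) \<le> b * snd z2" using q(4) ab by (intro mult_left_mono) auto
      ultimately show ?thesis by linarith
    qed
    finally show "a *\<^sub>R z1 + b *\<^sub>R z2 \<in> E" using q3 by (auto simp: E_def)
  qed
  moreover have "{(p, W p)} \<inter> E = {}" using Lip_W[OF p] by (force simp: E_def)
  moreover have "E \<noteq> {}"
  proof -
    have "(p, W p + 1) \<in> E" using p by (auto simp: E_def intro!: bexI[of _ p])
    then show ?thesis by blast
  qed
  ultimately obtain n b where n: "n \<noteq> 0" "\<forall>z\<in>{(p, W p)}. inner n z \<le> b" "\<forall>z\<in>E. b \<le> inner n z"
    using separating_hyperplane_sets[of "{(p, W p)}" E] by auto
  define c s where "c = fst n" and "s = snd n"
  have sep: "c \<bullet> p + s * W p \<le> c \<bullet> x + s * (W q + L * norm (x - q) + e)" if "q \<in> prob_simplex" "0 < e" for q x e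
  proof -
    have "(x, W q + L * norm (x - q) + e) \<in> E"
      using that unfolding E_def by (intro CollectI bexI[of _ q]) auto
    then have "b \<le> inner n (x, W q + L * norm (x - q) + e)" using n(3) by blast
    moreover have "inner n (p, W p) \<le> b" using n(2) by simp
    ultimately show ?thesis by (simp add: inner_prod_def c_def s_def)
  qed
  have "0 \<le> s" using sep[OF p, of 1 p] by (simp add: algebra_simps)
  \<comment> \<open>A vertical hyperplane is impossible: the epigraph projects onto the whole space,
    so its normal can be tested at \<open>p - c\<close>, outside the simplex as well.\<close>
  moreover have "s \<noteq> 0"
  proof
    assume "s = 0"
    then have "c \<bullet> c \<le> 0" using sep[OF p, of 1 "p - c"] by (simp add: inner_diff_right)
    then have "c = 0" by (metis inner_gt_zero_iff not_le)
    then show False using n(1) \<open>s = 0\<close> by (simp add: c_def s_def prod_eq_iff)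
  qed
  ultimately have s: "0 < s" by simp
  define \<xi> where "\<xi> = - (1 / s) *\<^sub>R c"
  have c: "c = - s *\<^sub>R \<xi>" using s by (simp add: \<xi>_def)
  have key: "W p + \<xi> \<bullet> (x - p) \<le> W q + L * norm (x - q)" if "q \<in> prob_simplex" for q x
  proof (rule field_le_epsilon)
    fix e :: real assume "0 < e"
    from sep[OF that this, of x] have "s * (W p + \<xi> \<bullet> (x - p)) \<le> s * (W q + L * norm (x - q) + e)"
      by (simp add: c inner_diff_right algebra_simps)
    then show "W p + \<xi> \<bullet> (x - p) \<le> W q + L * norm (x - q) + e" using s by simp
  qed
  have "\<xi> \<in> simplex_subdifferential W p"
    using key[of q q for q] by (auto simp: simplex_subdifferential_def)
  \<comment> \<open>Testing at \<open>p + \<xi>\<close> with \<open>q = p\<close> gives the square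
    of the norm on the left and \<open>L\<close> times the norm on the right.\<close>
  moreover have "norm \<xi> \<le> L"
  proof (cases "\<xi> = 0")
    case False
    have "norm \<xi> * norm \<xi> \<le> L * norm \<xi>"
      using key[OF p, of "p + \<xi>"] by (simp add: power2_norm_eq_inner[symmetric] power2_eq_square)
    then show ?thesis using False by simp
  qed (use L in simp)
  ultimately show ?thesis by blast
qed

definition subgradients :: "real^'i \<Rightarrow> (real^'i) set" where
  "subgradients p = cball 0 L \<inter> simplex_subdifferential W p"

lemma W_continuous: "continuous_on prob_simplex W"
proof (rule continuous_onI)
  fix p :: "real^'i" and e :: real assume p: "p \<in> prob_simplex" and e: "0 < e"
  show "\<exists>d>0. \<forall>q\<in>prob_simplex. dist q p < d \<longrightarrow> dist (W q) (W p) \<le> e"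
  proof (intro exI[of _ "e / (L + 1)"] conjI ballI impI)
    show "0 < e / (L + 1)" using e L by simp
    fix q assume q: "q \<in> prob_simplex" and d: "dist q p < e / (L + 1)"
    have "\<bar>W q - W p\<bar> \<le> L * norm (q - p)"
      using Lip_W[OF p q] Lip_W[OF q p] by (simp add: norm_minus_commute abs_le_iff)
    also have "\<dots> \<le> (L + 1) * (e / (L + 1))"
      using d L by (intro mult_mono) (auto simp: dist_norm)
    finally show "dist (W q) (W p) \<le> e" using L by (simp add: dist_real_def)
  qed
qed

text \<open>The projection of a compact set: the graph of bounded subgradients is cut out by one
  closed condition for each \<open>q\<close>. Radius and \<open>Z\<close> are parameters so that
  preimages of the selection can be assembled from such sets.\<close>

lemma subgradient_graph_closed:
  assumes "closed Z" shows "closed {p \<in> prob_simplex. \<exists>x\<in>subgradients p \<inter> Z. norm x \<le> \<rho>}"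
proof -
  define K where "K = (prob_simplex :: (real^'i) set) \<times> (cball 0 L \<inter> cball 0 \<rho> \<inter> Z)"
  have K: "compact K" unfolding K_def
    by (intro compact_Times compact_prob_simplex compact_Int_closed compact_cball assms closed_cball)
  define G where "G = K \<inter> (\<Inter>q\<in>prob_simplex. K \<inter> (\<lambda>z. W (fst z) + snd z \<bullet> (q - fst z)) -` {..W q})"
  have "continuous_on K (\<lambda>z. W (fst z) + snd z \<bullet> (q - fst z))" for q
  proof (intro continuous_intros)
    show "continuous_on K (\<lambda>z. W (fst z))"
      by (rule continuous_on_compose2[OF W_continuous]) (auto simp: K_def intro!: continuous_intros)
  qed
  then have "closed (K \<inter> (\<lambda>z. W (fst z) + snd z \<bullet> (q - fst z)) -` {..W q})" for q
    by (rule continuous_closed_preimage) (auto intro: compact_imp_closed K)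
  then have "compact G"
    unfolding G_def by (intro compact_Int_closed K closed_INT) auto
  then have "compact (fst ` G)" by (intro compact_continuous_image continuous_intros)
  moreover have "fst ` G = {p \<in> prob_simplex. \<exists>x\<in>subgradients p \<inter> Z. norm x \<le> \<rho>}"
  proof (intro set_eqI iffI)
    fix p assume "p \<in> fst ` G"
    then obtain x where x: "(p, x) \<in> G" by auto
    have "W p + x \<bullet> (q - p) \<le> W q" if "q \<in> prob_simplex" for q
      using x that unfolding G_def by (elim IntE INT_E[where a=q]) auto
    moreover have "(p, x) \<in> K" using x by (simp add: G_def)
    ultimately have "p \<in> prob_simplex" "x \<in> subgradients p \<inter> Z" "norm x \<le> \<rho>"
      by (auto simp: K_def subgradients_def simplex_subdifferential_def)
    then show "p \<in> {p \<in> prob_simplex. \<exists>x\<in>subgradients p \<inter> Z. norm x \<le> \<rho>}" by blast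
  next
    fix p assume "p \<in> {p \<in> prob_simplex. \<exists>x\<in>subgradients p \<inter> Z. norm x \<le> \<rho>}"
    then obtain x where "p \<in> prob_simplex" "x \<in> subgradients p \<inter> Z" "norm x \<le> \<rho>" by blast
    then have "(p, x) \<in> G" by (auto simp: G_def K_def subgradients_def simplex_subdifferential_def)
    then show "p \<in> fst ` G" by force
  qed
  ultimately show ?thesis by (simp add: compact_imp_closed)
qed

lemma subgradients_compact_convex:
  "compact (subgradients p)" "convex (subgradients p)"
proof -
  have eq: "simplex_subdifferential W p = (\<Inter>q\<in>prob_simplex. {x. (q - p) \<bullet> x \<le> W q - W p})"
    by (auto simp: simplex_subdifferential_def inner_commute algebra_simps)
  show "compact (subgradients p)" unfolding subgradients_def eq
    by (intro compact_Int_closed compact_cball closed_INT ballI closed_halfspace_le)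
  show "convex (subgradients p)" unfolding subgradients_def eq
    by (intro convex_Int convex_cball convex_INT convex_halfspace_le)
qed

text \<open>The element of least norm is unique by convexity, a canonical choice whose preimages can
  be written down explicitly. Outside the simplex the value is arbitrary.\<close>

definition minimal_subgradient :: "real^'i \<Rightarrow> real^'i" where
  "minimal_subgradient p = (if p \<in> prob_simplex then closest_point (subgradients p) 0 else 0)"

lemma minimal_subgradient:
  assumes "p \<in> prob_simplex"
  shows "minimal_subgradient p \<in> subgradients p"
    "x \<in> subgradients p \<Longrightarrow> norm (minimal_subgradient p) \<le> norm x"
    "x \<in> subgradients p \<Longrightarrow> norm x \<le> norm (minimal_subgradient p) \<Longrightarrow> x = minimal_subgradient p"
proof -
  have cl: "closed (subgradients p)" using subgradients_compact_convex(1) by (rule compact_imp_closed)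
  have ne: "subgradients p \<noteq> {}"
    using bounded_subgradient_exists[OF assms] by (auto simp: subgradients_def)
  show "minimal_subgradient p \<in> subgradients p"
    using closest_point_in_set[OF cl ne] assms by (simp add: minimal_subgradient_def)
  show le: "norm (minimal_subgradient p) \<le> norm x" if "x \<in> subgradients p" for x
    using closest_point_le[OF cl that, of 0] assms by (simp add: minimal_subgradient_def)
  show "x = minimal_subgradient p" if x: "x \<in> subgradients p" "norm x \<le> norm (minimal_subgradient p)"
  proof -
    have "\<forall>z\<in>subgradients p. dist 0 x \<le> dist 0 z" using le x by force
    from closest_point_unique[OF subgradients_compact_convex(2) cl x(1) this] show ?thesis
      using assms by (simp add: minimal_subgradient_def)
  qed
qed

lemma minimal_subgradient_norm: "norm (minimal_subgradient p) \<le> L"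
  using minimal_subgradient(1)[of p] L
  by (cases "p \<in> prob_simplex") (auto simp: subgradients_def minimal_subgradient_def)

lemma minimal_subgradient_subdifferential:
  "p \<in> prob_simplex \<Longrightarrow> minimal_subgradient p \<in> simplex_subdifferential W p"
  using minimal_subgradient(1)[of p] by (auto simp: subgradients_def)

text \<open>The least subgradient lies in \<open>Z\<close> exactly if every ball around 0 that meets
  the subgradients also meets them inside \<open>Z\<close>. Rational radii suffice because
  compactness provides a least subgradient in \<open>Z\<close>, whose norm cannot exceed the global
  minimum.\<close>

lemma minimal_subgradient_preimage:
  assumes Z: "closed Z" and B: "\<And>Z \<rho>. B Z \<rho> = {p \<in> prob_simplex. \<exists>x\<in>subgradients p \<inter> Z. norm x \<le> \<rho>}"
  shows "minimal_subgradient p \<in> Z \<and> p \<in> prob_simplex \<longleftrightarrow>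
    p \<in> prob_simplex \<and> (\<forall>\<rho>\<in>\<rat>. p \<in> B UNIV \<rho> \<longrightarrow> p \<in> B Z \<rho>)"
proof safe
  fix \<rho> assume pZ: "minimal_subgradient p \<in> Z" and ps: "p \<in> prob_simplex" and "p \<in> B UNIV \<rho>"
  then obtain x where x: "x \<in> subgradients p" "norm x \<le> \<rho>" unfolding B by blast
  have "norm (minimal_subgradient p) \<le> \<rho>"
    using minimal_subgradient(2)[OF ps x(1)] x(2) by (rule order_trans)
  then show "p \<in> B Z \<rho>" using pZ ps minimal_subgradient(1)[OF ps] unfolding B by blast
next
  assume ps: "p \<in> prob_simplex" and imp: "\<forall>\<rho>\<in>\<rat>. p \<in> B UNIV \<rho> \<longrightarrow> p \<in> B Z \<rho>"
  define d where "d = norm (minimal_subgradient p)"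
  have inZ: "\<exists>x\<in>subgradients p \<inter> Z. norm x \<le> \<rho>" if "d < \<rho>" "\<rho> \<in> \<rat>" for \<rho>
  proof -
    have "norm (minimal_subgradient p) \<le> \<rho>" using that(1) by (simp add: d_def)
    then have "p \<in> B UNIV \<rho>" using minimal_subgradient(1)[OF ps] ps unfolding B by blast
    then have "p \<in> B Z \<rho>" using imp that(2) by (elim ballE[where x=\<rho>]) simp_all
    then show ?thesis unfolding B by (elim CollectE conjE)
  qed
  have "d < d + 1" by simp
  from Rats_dense_in_real[OF this] obtain \<rho>0 where "\<rho>0 \<in> \<rat>" "d < \<rho>0" by (elim bexE conjE)
  then have ne: "subgradients p \<inter> Z \<noteq> {}" using inZ[of \<rho>0] by blast
  have cl: "closed (subgradients p \<inter> Z)"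
    by (intro closed_Int[OF compact_imp_closed[OF subgradients_compact_convex(1)] Z])
  obtain y where y: "y \<in> subgradients p \<inter> Z" "\<And>z. z \<in> subgradients p \<inter> Z \<Longrightarrow> dist 0 y \<le> dist 0 z"
    using distance_attains_inf[OF cl ne, of 0] by blast
  have "norm y \<le> d"
  proof (rule ccontr)
    assume "\<not> norm y \<le> d"
    then have "d < norm y" by simp
    from Rats_dense_in_real[OF this] obtain \<rho> where q: "\<rho> \<in> \<rat>" "d < \<rho>" "\<rho> < norm y" by (elim bexE conjE)
    obtain x where x: "x \<in> subgradients p \<inter> Z" "norm x \<le> \<rho>" using inZ[OF q(2,1)] by (elim bexE)
    have "norm y \<le> norm x" using y(2)[OF x(1)] by simp
    then show False using x(2) q(3) by linarith
  qed
  then have "y = minimal_subgradient p" using minimal_subgradient(3)[OF ps, of y] y(1) by (simp add: d_def)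
  then show "minimal_subgradient p \<in> Z" using y(1) by simp
qed

lemma minimal_subgradient_measurable: "minimal_subgradient \<in> borel_measurable borel"
  unfolding borel_eq_closed
proof (rule measurable_measure_of)
  fix Z :: "(real^'i) set" assume "Z \<in> {S. closed S}"
  then have Z: "closed Z" by simp
  define B where "B Z \<rho> = {p \<in> prob_simplex. \<exists>x\<in>subgradients p \<inter> Z. norm x \<le> \<rho>}" for Z \<rho>
  have B: "B Z \<rho> \<in> sets borel" if "closed Z" for Z \<rho>
    unfolding B_def by (intro borel_closed subgradient_graph_closed that)
  have "- B UNIV \<rho> \<union> B Z \<rho> \<in> sets borel" for \<rho>
    by (intro sets.Un borel_comp B Z closed_UNIV)
  then have INT: "(\<Inter>\<rho>\<in>\<rat>. - B UNIV \<rho> \<union> B Z \<rho>) \<in> sets borel"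
    by (intro sets.countable_INT'' countable_rat) auto
  have "{p. minimal_subgradient p \<in> Z \<and> p \<in> prob_simplex} = prob_simplex \<inter> (\<Inter>\<rho>\<in>\<rat>. - B UNIV \<rho> \<union> B Z \<rho>)"
    unfolding minimal_subgradient_preimage[OF Z B_def] by blast
  then have 1: "{p. minimal_subgradient p \<in> Z \<and> p \<in> prob_simplex} \<in> sets borel"
    using INT by (simp only: sets.Int prob_simplex_borel)
  have "minimal_subgradient -` Z =
      {p. minimal_subgradient p \<in> Z \<and> p \<in> prob_simplex} \<union> (if 0 \<in> Z then - prob_simplex else {})"
    by (auto simp: minimal_subgradient_def split: if_splits)
  moreover have "(if 0 \<in> Z then - prob_simplex else {}) \<in> sets (borel :: (real^'i) measure)"
    using borel_comp[OF prob_simplex_borel] by simp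
  ultimately have "minimal_subgradient -` Z \<in> sets borel"
    using sets.Un[OF 1] by simp
  then show "minimal_subgradient -` Z \<inter> space (sigma UNIV {S. closed S}) \<in> sets (sigma UNIV {S. closed S})"
    by (simp add: borel_eq_closed[symmetric])
qed auto

end

text \<open>The Sorgenfrey line is hereditarily separable. This reduces statements about all times of a
  right-continuous path to countably many times.\<close>

lemma right_dense_countable_subset:
  fixes S :: "real set"
  obtains D where "countable D" "D \<subseteq> S" "\<And>s e. s \<in> S \<Longrightarrow> 0 < e \<Longrightarrow> \<exists>d\<in>D. s \<le> d \<and> d < s + e"
proof -
  \<comment> \<open>The points isolated from the right. Each of them owns a rational in the gap to
    its right, so there are countably many.\<close>
  define R where "R = {s\<in>S. \<exists>e>0. \<forall>x\<in>S. s < x \<longrightarrow> s + e \<le> x}"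
  have "\<exists>q::rat. s < of_rat q \<and> (\<forall>x\<in>S. s < x \<longrightarrow> of_rat q < x)" if s: "s \<in> R" for s
  proof -
    obtain e where e: "0 < e" "\<And>x. x \<in> S \<Longrightarrow> s < x \<Longrightarrow> s + e \<le> x"
      using s by (auto simp: R_def)
    have "s < s + e" using e(1) by simp
    from of_rat_dense[OF this] obtain q :: rat where q: "s < of_rat q" "of_rat q < s + e" by (elim exE conjE)
    have "of_rat q < x" if "x \<in> S" "s < x" for x
      using e(2)[OF that] q(2) by linarith
    then show ?thesis using q(1) by (intro exI[of _ q] conjI ballI impI)
  qed
  then have "\<forall>s\<in>R. \<exists>q::rat. s < of_rat q \<and> (\<forall>x\<in>S. s < x \<longrightarrow> of_rat q < x)" by (rule ballI)
  from bchoice[OF this] obtain f :: "real \<Rightarrow> rat"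
    where f': "\<forall>s\<in>R. s < of_rat (f s) \<and> (\<forall>x\<in>S. s < x \<longrightarrow> of_rat (f s) < x)" by (elim exE)
  have f: "\<And>s. s \<in> R \<Longrightarrow> s < of_rat (f s)" "\<And>s x. s \<in> R \<Longrightarrow> x \<in> S \<Longrightarrow> s < x \<Longrightarrow> of_rat (f s) < x"
    using f' by simp_all
  have RS: "R \<subseteq> S" unfolding R_def by blast
  have neq: "f s \<noteq> f t" if "s \<in> R" "t \<in> R" "s < t" for s t
  proof
    assume "f s = f t"
    moreover have "of_rat (f s) < t" using f(2)[OF that(1) _ that(3)] RS that(2) by blast
    moreover have "t < of_rat (f t)" by (rule f(1)[OF that(2)])
    ultimately show False by simp
  qed
  have "inj_on f R"
  proof (rule inj_onI, rule ccontr)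
    fix s t assume st: "s \<in> R" "t \<in> R" "f s = f t" and "s \<noteq> t"
    then consider "s < t" | "t < s" by linarith
    then show False using neq[OF st(1,2)] neq[OF st(2,1)] st(3) by cases simp_all
  qed
  then have R: "countable R" by (rule countableI')
  define g where "g ab = (SOME s. s \<in> S \<inter> {of_rat (fst ab)<..<of_rat (snd ab)})" for ab :: "rat \<times> rat"
  \<comment> \<open>Intersecting with \<open>S\<close> discards the choices of \<open>g\<close> for
    rational intervals that contain no point of \<open>S\<close>.\<close>
  define D where "D = R \<union> (range g \<inter> S)"
  show ?thesis
  proof (rule that[of D])
    show "countable D" unfolding D_def by (intro countable_Un R countable_Int1 countable_image countableI_type)
    show "D \<subseteq> S" using RS by (simp add: D_def)
    fix s e :: real assume s: "s \<in> S" and e: "0 < e"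
    show "\<exists>d\<in>D. s \<le> d \<and> d < s + e"
    proof (cases "s \<in> R")
      case True
      then show ?thesis using e by (intro bexI[of _ s]) (auto simp: D_def)
    next
      case False
      then have "\<not> (\<forall>x\<in>S. s < x \<longrightarrow> s + e \<le> x)" using s e by (auto simp: R_def)
      then obtain x where x: "x \<in> S" "s < x" "x < s + e" by (auto simp: not_le)
      obtain a b :: rat where ab: "s < of_rat a" "of_rat a < x" "x < of_rat b" "of_rat b < s + e"
        using of_rat_dense[OF x(2)] of_rat_dense[OF x(3)] by (elim exE conjE)
      have "g (a, b) \<in> S \<inter> {of_rat a<..<of_rat b}"
        unfolding g_def fst_conv snd_conv by (rule someI[of _ x]) (use x ab in auto)
      then show ?thesis using ab by (intro bexI[of _ "g (a, b)"]) (auto simp: D_def)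
    qed
  qed
qed

section \<open>Optimal martingale measures\<close>

lemma simplex_continuous_measurable:
  fixes g :: "real^'i::finite \<Rightarrow> real"
  assumes X: "X \<in> borel_measurable M" and S: "\<And>\<omega>. \<omega> \<in> space M \<Longrightarrow> X \<omega> \<in> prob_simplex"
    and g: "continuous_on prob_simplex g"
  shows "(\<lambda>\<omega>. g (X \<omega>)) \<in> borel_measurable M"
proof -
  have "(\<lambda>p. indicator prob_simplex p *\<^sub>R g p) \<in> borel_measurable borel"
    using g by (intro borel_measurable_continuous_on_indicator prob_simplex_borel)
  from measurable_compose[OF X this] show ?thesis
    by (rule measurable_cong[THEN iffD1, rotated]) (use S in simp)
qed

lemma continuous_simplex_bounded:
  fixes g :: "real^'i::finite \<Rightarrow> real"
  assumes "continuous_on prob_simplex g"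
  obtains B where "0 \<le> B" "\<And>p. p \<in> prob_simplex \<Longrightarrow> \<bar>g p\<bar> \<le> B"
proof -
  have "bounded (g ` prob_simplex)"
    by (intro compact_imp_bounded compact_continuous_image assms compact_prob_simplex)
  then obtain B where B: "\<forall>x\<in>g ` prob_simplex. norm x \<le> B" by (auto simp: bounded_iff)
  show ?thesis
  proof (rule that[of "\<bar>B\<bar>"])
    fix p :: "real^'i" assume "p \<in> prob_simplex"
    then have "norm (g p) \<le> B" using B by blast
    then show "\<bar>g p\<bar> \<le> \<bar>B\<bar>" by simp
  qed simp
qed

lemma prob_simplex_component: "p \<in> prob_simplex \<Longrightarrow> 0 \<le> p $ i \<and> p $ i \<le> 1"
  using nonneg_le_mass[of p i] by (auto simp: prob_simplex_iff nonneg_def)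

context random_game
begin

lemma Val_Lipschitz:
  assumes "t \<in> {0..T}" shows "Val t p \<le> Val t q + (C * T * CARD('i)) * norm (p - q)"
proof -
  have "C * T * (\<Sum>i\<in>UNIV. \<bar>(p - q) $ i\<bar>) \<le> C * T * (CARD('i) * norm (p - q))"
    using C_pos T_pos by (intro mult_left_mono sum_abs_le_norm) auto
  then show ?thesis using Val_Lipschitz_le[OF assms, of p q] unfolding mult.assoc by simp
qed

lemma Lipschitz_const_nonneg: "0 \<le> C * T * CARD('i)"
  using C_pos T_pos by simp

lemma Val_continuous: "t \<in> {0..T} \<Longrightarrow> continuous_on prob_simplex (Val t)"
  by (rule W_continuous[OF Val_convex Val_Lipschitz Lipschitz_const_nonneg])

lemma H_continuous_simplex: "t \<in> {0..T} \<Longrightarrow> continuous_on prob_simplex (H t)"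
proof -
  assume t: "t \<in> {0..T}"
  have "continuous_on (prob_simplex :: (real^'i) set) (\<lambda>p. (t, p))" by (intro continuous_intros)
  from continuous_on_compose2[OF H_continuous this] t show ?thesis by fastforce
qed

definition path_cost :: "real \<Rightarrow> real \<Rightarrow> (real \<Rightarrow> real^'i) \<Rightarrow> real" where
  "path_cost a b \<omega> = (LINT s:{a..b}|lborel. H s (\<omega> s))"

lemma path_cost_add:
  assumes \<omega>: "cadlag \<omega>" "\<And>s. \<omega> s \<in> prob_simplex" and "0 \<le> a" "a \<le> b" "b \<le> c" "c \<le> T"
  shows "path_cost a c \<omega> = path_cost a b \<omega> + path_cost b c \<omega>"
proof -
  have eq: "{a..c} = {a..b} \<union> {b..c}" using assms by auto
  show ?thesis unfolding path_cost_def eq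
  proof (rule set_integral_Un_AE)
    show "AE x in lborel. \<not> (x \<in> {a..b} \<and> x \<in> {b..c})"
      using AE_lborel_singleton[of b] by eventually_elim auto
  qed (use assms in \<open>auto intro!: running_cost_integrable cadlag_borel_measurable\<close>)
qed

lemma path_cost_bound:
  assumes \<omega>: "cadlag \<omega>" "\<And>s. \<omega> s \<in> prob_simplex" and ab: "0 \<le> a" "a \<le> b" "b \<le> T"
    and g: "\<And>s. a \<le> s \<Longrightarrow> s < b \<Longrightarrow> \<bar>H s (\<omega> s) - x\<bar> \<le> B"
  shows "\<bar>path_cost a b \<omega> - (b - a) * x\<bar> \<le> (b - a) * B"
proof -
  have int: "set_integrable lborel {a..b} (\<lambda>s. H s (\<omega> s))"
    using ab by (intro running_cost_integrable cadlag_borel_measurable \<omega>) auto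
  have intc: "set_integrable lborel {a..b} (\<lambda>s. c)" and val: "(LINT s:{a..b}|lborel. c) = (b - a) * c" for c :: real
    using ab by (simp_all add: set_integrable_def set_lebesgue_integral_def emeasure_lborel_Icc_eq)
  have g': "x - B \<le> H s (\<omega> s)" "H s (\<omega> s) \<le> x + B" if "a \<le> s" "s < b" for s
    using g[OF that] by (auto simp: abs_le_iff)
  have "path_cost a b \<omega> \<le> (LINT s:{a..b}|lborel. x + B)"
    unfolding path_cost_def
  proof (rule set_integral_mono_AE[OF int intc])
    show "AE s\<in>{a..b} in lborel. H s (\<omega> s) \<le> x + B"
      using AE_lborel_singleton[of b] by eventually_elim (use g'(2) in force)
  qed
  moreover have "(LINT s:{a..b}|lborel. x - B) \<le> path_cost a b \<omega>"
    unfolding path_cost_def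
  proof (rule set_integral_mono_AE[OF intc int])
    show "AE s\<in>{a..b} in lborel. x - B \<le> H s (\<omega> s)"
      using AE_lborel_singleton[of b] by eventually_elim (use g'(1) in force)
  qed
  ultimately show ?thesis unfolding val by (simp add: abs_le_iff algebra_simps)
qed

context
  fixes t0 :: real and p0 :: "real^'i" and P :: "(real \<Rightarrow> real^'i) measure"
  assumes t0: "0 \<le> t0" "t0 < T" and P: "P \<in> martingale_measures T t0 p0"
begin

lemma P_prob: "prob_space P" using P by (simp add: martingale_measures_def)

interpretation P: prob_space P by (rule P_prob)

lemma sets_P: "sets P = sets (path_space t0 T)" using P by (simp add: martingale_measures_def)

lemma space_P: "space P = paths t0 T"
  using sets_eq_imp_space_eq[OF sets_P] by simp

lemma path_P: "\<omega> \<in> space P \<Longrightarrow> cadlag \<omega>" "\<omega> \<in> space P \<Longrightarrow> \<omega> s \<in> prob_simplex"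
  by (auto simp: space_P paths_def)

lemma coordinate_P: "(\<lambda>\<omega>. \<omega> s) \<in> borel_measurable P"
  using coordinate_measurable measurable_cong_sets[OF sets_P refl] by blast

lemma filtration_sets_P: "A \<in> sets (path_filtration t0 T s) \<Longrightarrow> A \<in> sets P"
  using sets_path_filtration_subset sets_P by blast

lemma integrable_P:
  fixes f :: "_ \<Rightarrow> real"
  assumes "f \<in> borel_measurable P" "\<And>\<omega>. \<omega> \<in> space P \<Longrightarrow> \<bar>f \<omega>\<bar> \<le> B"
  shows "integrable P f"
  using assms by (intro P.integrable_const_bound[where B=B] AE_I2) auto

lemma coordinate_fun_P:
  fixes g :: "_ \<Rightarrow> real"
  assumes g: "continuous_on prob_simplex g"
  shows "(\<lambda>\<omega>. g (\<omega> s)) \<in> borel_measurable P" "integrable P (\<lambda>\<omega>. g (\<omega> s))"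
    "A \<in> sets P \<Longrightarrow> integrable P (\<lambda>\<omega>. indicator A \<omega> * g (\<omega> s))"
proof -
  show m: "(\<lambda>\<omega>. g (\<omega> s)) \<in> borel_measurable P"
    by (rule simplex_continuous_measurable[OF coordinate_P path_P(2) g])
  obtain B where B: "0 \<le> B" "\<And>p. p \<in> prob_simplex \<Longrightarrow> \<bar>g p\<bar> \<le> B"
    using continuous_simplex_bounded[OF g] by blast
  show "integrable P (\<lambda>\<omega>. g (\<omega> s))"
    by (rule integrable_P[OF m, where B=B]) (rule B(2)[OF path_P(2)])
  then show "integrable P (\<lambda>\<omega>. indicator A \<omega> * g (\<omega> s))" if "A \<in> sets P"
    using integrable_mult_indicator[OF that, of "\<lambda>\<omega>. g (\<omega> s)"] by simp
qed

text \<open>Bounded adapted factors in place of events; subgradient components at the current state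
  enter as such factors.\<close>

lemma martingale_mult:
  assumes st: "s \<le> t" and Z: "Z \<in> borel_measurable (path_filtration t0 T s)"
    and B: "\<And>\<omega>. \<omega> \<in> space P \<Longrightarrow> \<bar>Z \<omega>\<bar> \<le> B"
  shows "(\<integral>\<omega>. Z \<omega> * \<omega> t $ i \<partial>P) = (\<integral>\<omega>. Z \<omega> * \<omega> s $ i \<partial>P)"
proof -
  have vm: "vector_martingale P (path_filtration t0 T) (\<lambda>t \<omega>. \<omega> t)" using P by (simp add: martingale_measures_def)
  then have sub: "subalgebra P (path_filtration t0 T s)" by (simp add: vector_martingale_def)
  interpret sigma_finite_subalgebra P "path_filtration t0 T s"
    by (rule finite_measure_subalgebra_is_sigma_finite)
      (auto simp: finite_measure_subalgebra_def finite_measure_subalgebra_axioms_def sub P.finite_measure_axioms)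
  have ZP: "Z \<in> borel_measurable P" by (rule measurable_from_subalg[OF sub Z])
  have m: "(\<lambda>\<omega>. \<omega> u $ i) \<in> borel_measurable P" for u
    by (rule measurable_compose[OF coordinate_P vec_nth_borel_measurable])
  have int: "integrable P (\<lambda>\<omega>. Z \<omega> * \<omega> t $ i)"
  proof (rule integrable_P[where B="B"])
    show "(\<lambda>\<omega>. Z \<omega> * \<omega> t $ i) \<in> borel_measurable P" using ZP m by (rule borel_measurable_times)
    fix \<omega> assume w: "\<omega> \<in> space P"
    have "\<bar>Z \<omega>\<bar> * \<bar>\<omega> t $ i\<bar> \<le> B * 1"
      using B[OF w] prob_simplex_component[OF path_P(2)[OF w], of t i] by (intro mult_mono) auto
    then show "\<bar>Z \<omega> * \<omega> t $ i\<bar> \<le> B" by (simp add: abs_mult)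
  qed
  have AE: "AE \<omega> in P. real_cond_exp P (path_filtration t0 T s) (\<lambda>\<omega>'. \<omega>' t $ i) \<omega> = \<omega> s $ i"
    using vm st by (simp add: vector_martingale_def)
  have "(\<integral>\<omega>. Z \<omega> * \<omega> t $ i \<partial>P) = (\<integral>\<omega>. Z \<omega> * real_cond_exp P (path_filtration t0 T s) (\<lambda>\<omega>'. \<omega>' t $ i) \<omega> \<partial>P)"
    by (rule real_cond_exp_intg(2)[OF int Z m, symmetric])
  also have "\<dots> = (\<integral>\<omega>. Z \<omega> * \<omega> s $ i \<partial>P)"
  proof (rule integral_cong_AE)
    show "AE \<omega> in P. Z \<omega> * real_cond_exp P (path_filtration t0 T s) (\<lambda>\<omega>'. \<omega>' t $ i) \<omega> = Z \<omega> * \<omega> s $ i"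
      using AE by eventually_elim simp
    show "(\<lambda>\<omega>. Z \<omega> * real_cond_exp P (path_filtration t0 T s) (\<lambda>\<omega>'. \<omega>' t $ i) \<omega>) \<in> borel_measurable P"
      using ZP by (intro borel_measurable_times borel_measurable_cond_exp2)
  qed (use ZP m in \<open>rule borel_measurable_times\<close>)
  finally show ?thesis .
qed

text \<open>The subgradient inequality at the state of time \<open>s\<close>, with a measurable
  bounded selection; its linear term has mean zero by the martingale property. The indicator
  localises the inequality to any event of the past.\<close>

lemma jensen:
  assumes u: "u \<in> {0..T}" and st: "s \<le> t" and A: "A \<in> sets (path_filtration t0 T s)"
  shows "(\<integral>\<omega>. indicator A \<omega> * Val u (\<omega> s) \<partial>P) \<le> (\<integral>\<omega>. indicator A \<omega> * Val u (\<omega> t) \<partial>P)"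
proof -
  note sel = Val_convex[OF u] Val_Lipschitz[OF u] Lipschitz_const_nonneg
  define \<xi> where "\<xi> = minimal_subgradient (Val u) (C * T * CARD('i))"
  have \<xi>: "\<xi> \<in> borel_measurable borel" "\<And>p. norm (\<xi> p) \<le> C * T * CARD('i)"
    "\<And>p. p \<in> prob_simplex \<Longrightarrow> \<xi> p \<in> simplex_subdifferential (Val u) p"
    unfolding \<xi>_def using minimal_subgradient_measurable[OF sel] minimal_subgradient_norm[OF sel]
      minimal_subgradient_subdifferential[OF sel] by blast+
  have AP: "A \<in> sets P" by (rule filtration_sets_P[OF A])
  define Z where "Z i \<omega> = indicator A \<omega> * \<xi> (\<omega> s) $ i" for i \<omega>
  have Zm: "Z i \<in> borel_measurable (path_filtration t0 T s)" for i
    unfolding Z_def[abs_def]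
    by (intro borel_measurable_times borel_measurable_indicator A
        measurable_compose[OF measurable_compose[OF coordinate_measurable_filtration[OF order_refl] \<xi>(1)] vec_nth_borel_measurable])
  have ZP: "Z i \<in> borel_measurable P" for i
    unfolding Z_def[abs_def]
    by (intro borel_measurable_times borel_measurable_indicator AP
        measurable_compose[OF measurable_compose[OF coordinate_P \<xi>(1)] vec_nth_borel_measurable])
  have ZB: "\<bar>Z i \<omega>\<bar> \<le> C * T * CARD('i)" for i \<omega>
    using order_trans[OF component_le_norm_cart[of "\<xi> (\<omega> s)" i] \<xi>(2)] Lipschitz_const_nonneg
    by (auto simp: Z_def indicator_def)
  have int: "integrable P (\<lambda>\<omega>. Z i \<omega> * \<omega> r $ i)" for i r
  proof (rule integrable_P[where B="C * T * CARD('i)"])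
    show "(\<lambda>\<omega>. Z i \<omega> * \<omega> r $ i) \<in> borel_measurable P"
      by (intro borel_measurable_times ZP measurable_compose[OF coordinate_P vec_nth_borel_measurable])
    fix \<omega> assume w: "\<omega> \<in> space P"
    have "\<bar>Z i \<omega>\<bar> * \<bar>\<omega> r $ i\<bar> \<le> C * T * CARD('i) * 1"
      using ZB[of i \<omega>] prob_simplex_component[OF path_P(2)[OF w], of r i] by (intro mult_mono) auto
    then show "\<bar>Z i \<omega> * \<omega> r $ i\<bar> \<le> C * T * CARD('i)" by (simp add: abs_mult)
  qed
  have intV: "integrable P (\<lambda>\<omega>. indicator A \<omega> * Val u (\<omega> r))" for r
    by (rule coordinate_fun_P(3)[OF Val_continuous[OF u] AP])
  have zero: "(\<integral>\<omega>. (\<Sum>i\<in>UNIV. Z i \<omega> * \<omega> t $ i - Z i \<omega> * \<omega> s $ i) \<partial>P) = 0"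
    using int martingale_mult[OF st Zm ZB] by simp
  have "(\<integral>\<omega>. indicator A \<omega> * Val u (\<omega> s) \<partial>P) =
      (\<integral>\<omega>. indicator A \<omega> * Val u (\<omega> s) + (\<Sum>i\<in>UNIV. Z i \<omega> * \<omega> t $ i - Z i \<omega> * \<omega> s $ i) \<partial>P)"
    using intV int zero by (subst Bochner_Integration.integral_add) auto
  also have "\<dots> \<le> (\<integral>\<omega>. indicator A \<omega> * Val u (\<omega> t) \<partial>P)"
  proof (rule integral_mono)
    fix \<omega> assume w: "\<omega> \<in> space P"
    have "Val u (\<omega> s) + \<xi> (\<omega> s) \<bullet> (\<omega> t - \<omega> s) \<le> Val u (\<omega> t)"
      using \<xi>(3)[OF path_P(2)[OF w]] path_P(2)[OF w] by (simp add: simplex_subdifferential_def)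
    then have "indicator A \<omega> * (Val u (\<omega> s) + \<xi> (\<omega> s) \<bullet> (\<omega> t - \<omega> s)) \<le> indicator A \<omega> * Val u (\<omega> t)"
      by (intro mult_left_mono) auto
    moreover have "indicator A \<omega> * (\<xi> (\<omega> s) \<bullet> (\<omega> t - \<omega> s)) = (\<Sum>i\<in>UNIV. Z i \<omega> * \<omega> t $ i - Z i \<omega> * \<omega> s $ i)"
      by (simp add: Z_def inner_vec_def sum_distrib_left algebra_simps)
    ultimately show "indicator A \<omega> * Val u (\<omega> s) + (\<Sum>i\<in>UNIV. Z i \<omega> * \<omega> t $ i - Z i \<omega> * \<omega> s $ i)
        \<le> indicator A \<omega> * Val u (\<omega> t)"
      by (simp add: distrib_left)
  qed (use intV int in auto)
  finally show ?thesis .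
qed

lemma path_cost_P:
  assumes "0 \<le> a" "a < b" "b \<le> T"
  shows "path_cost a b \<in> borel_measurable P" "\<omega> \<in> space P \<Longrightarrow> \<bar>path_cost a b \<omega>\<bar> \<le> (b - a) * C"
    "integrable P (path_cost a b)" "A \<in> sets P \<Longrightarrow> integrable P (\<lambda>\<omega>. indicator A \<omega> * path_cost a b \<omega>)"
proof -
  show m: "path_cost a b \<in> borel_measurable P"
    using path_cost_measurable[OF assms, of t0] measurable_cong_sets[OF sets_P refl]
    unfolding path_cost_def[abs_def] by blast
  show b: "\<bar>path_cost a b \<omega>\<bar> \<le> (b - a) * C" if "\<omega> \<in> space P" for \<omega>
  proof -
    have "\<bar>path_cost a b \<omega> - (b - a) * 0\<bar> \<le> (b - a) * C"
      using assms H_simplex_bound[OF _ path_P(2)[OF that]] by (intro path_cost_bound path_P that) auto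
    then show ?thesis by simp
  qed
  show "integrable P (path_cost a b)" by (rule integrable_P[OF m b])
  then show "A \<in> sets P \<Longrightarrow> integrable P (\<lambda>\<omega>. indicator A \<omega> * path_cost a b \<omega>)"
    using integrable_mult_indicator[of A P "path_cost a b"] by simp
qed

text \<open>Jensen's inequality at the left end point and a constant step at the right end point: the
  Hamiltonian is evaluated at the later state, so that Riemann sums converge by right-continuity.\<close>

lemma value_step:
  assumes ab: "0 \<le> a" "a < b" "b \<le> T" and A: "A \<in> sets (path_filtration t0 T a)"
    and d: "\<And>s i u v. s \<in> {a..b} \<Longrightarrow> u \<in> U \<Longrightarrow> v \<in> V \<Longrightarrow> \<bar>l i s u v - l i a u v\<bar> \<le> d" and d0: "0 \<le> d"
  shows "(\<integral>\<omega>. indicator A \<omega> * Val a (\<omega> a) \<partial>P) \<le>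
    (\<integral>\<omega>. indicator A \<omega> * ((b - a) * H a (\<omega> b)) \<partial>P) + (b - a) * d + (\<integral>\<omega>. indicator A \<omega> * Val b (\<omega> b) \<partial>P)"
proof -
  have AP: "A \<in> sets P" by (rule filtration_sets_P[OF A])
  have aT: "a \<in> {0..T}" "b \<in> {0..T}" using ab by auto
  have iH: "integrable P (\<lambda>\<omega>. indicator A \<omega> * ((b - a) * H a (\<omega> b)))"
    by (rule coordinate_fun_P(3)[OF continuous_on_mult_left[OF H_continuous_simplex[OF aT(1)]] AP])
  have iV: "integrable P (\<lambda>\<omega>. indicator A \<omega> * Val u (\<omega> b))" if "u \<in> {0..T}" for u
    by (rule coordinate_fun_P(3)[OF Val_continuous[OF that] AP])
  have "(\<integral>\<omega>. indicator A \<omega> * Val a (\<omega> a) \<partial>P) \<le> (\<integral>\<omega>. indicator A \<omega> * Val a (\<omega> b) \<partial>P)"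
    using ab by (intro jensen aT A) auto
  also have "\<dots> \<le> (\<integral>\<omega>. indicator A \<omega> * ((b - a) * H a (\<omega> b)) + (b - a) * d + indicator A \<omega> * Val b (\<omega> b) \<partial>P)"
  proof (rule integral_mono[OF iV[OF aT(1)]])
    show "integrable P (\<lambda>\<omega>. indicator A \<omega> * ((b - a) * H a (\<omega> b)) + (b - a) * d + indicator A \<omega> * Val b (\<omega> b))"
      using iH iV[OF aT(2)] by auto
    fix \<omega> assume w: "\<omega> \<in> space P"
    have "Val a (\<omega> b) \<le> (b - a) * (H a (\<omega> b) + d) + Val b (\<omega> b)"
      by (rule Val_step[OF ab path_P(2)[OF w] d])
    moreover have "0 \<le> (b - a) * d" using ab d0 by simp
    ultimately show "indicator A \<omega> * Val a (\<omega> b) \<le>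
        indicator A \<omega> * ((b - a) * H a (\<omega> b)) + (b - a) * d + indicator A \<omega> * Val b (\<omega> b)"
      by (simp add: indicator_def algebra_simps)
  qed
  also have "\<dots> = (\<integral>\<omega>. indicator A \<omega> * ((b - a) * H a (\<omega> b)) \<partial>P) + (b - a) * d + (\<integral>\<omega>. indicator A \<omega> * Val b (\<omega> b) \<partial>P)"
    using iH iV[OF aT(2)] by (simp add: P.prob_space)
  finally show ?thesis .
qed

text \<open>Iterates \<open>value_step\<close> on uniform grids. The Hamiltonian terms are Riemann
  sums of the cost, the mesh term vanishes in the limit and only the slack \<open>\<rho>\<close>
  survives.\<close>

lemma value_submartingale:
  assumes ab: "0 \<le> a" "a < b" "b \<le> T" and A: "A \<in> sets (path_filtration t0 T a)"
  shows "(\<integral>\<omega>. indicator A \<omega> * Val a (\<omega> a) \<partial>P) \<le>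
    (\<integral>\<omega>. indicator A \<omega> * path_cost a b \<omega> \<partial>P) + (\<integral>\<omega>. indicator A \<omega> * Val b (\<omega> b) \<partial>P)"
proof (rule field_le_epsilon)
  fix e :: real assume e: "0 < e"
  define E where "E f = (\<integral>\<omega>. indicator A \<omega> * f \<omega> \<partial>P)" for f :: "_ \<Rightarrow> real"
  have AP: "A \<in> sets P" by (rule filtration_sets_P[OF A])
  \<comment> \<open>Chosen so that the slack remaining after the limit, accumulated over the
    interval, is exactly \<open>e\<close>.\<close>
  define \<rho> where "\<rho> = e / (b - a)"
  have \<rho>: "0 < \<rho>" "(b - a) * \<rho> = e" using e ab by (auto simp: \<rho>_def)
  obtain L where L: "0 \<le> L"
    "\<And>i s s' u u' v v'. s \<in> {0..T} \<Longrightarrow> s' \<in> {0..T} \<Longrightarrow> u \<in> U \<Longrightarrow> u' \<in> U \<Longrightarrow> v \<in> V \<Longrightarrow> v' \<in> V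
      \<Longrightarrow> \<bar>l i s u v - l i s' u' v'\<bar> \<le> \<rho> + L * (\<bar>s - s'\<bar> + norm (u - u') + norm (v - v'))"
    using l_modulus[OF \<rho>(1)] by blast
  define S where "S N \<omega> = (\<Sum>k<Suc N. ((b - a) / Suc N) * H (uniform_grid a b (Suc N) k) (\<omega> (uniform_grid a b (Suc N) (Suc k))))"
    for N and \<omega> :: "real \<Rightarrow> real^'i"
  have key: "E (\<lambda>\<omega>. Val a (\<omega> a)) \<le> E (S N) + (b - a) * (\<rho> + L * ((b - a) / Suc N)) + E (\<lambda>\<omega>. Val b (\<omega> b))" for N
  proof -
    define g where "g = uniform_grid a b (Suc N)"
    note ug = uniform_grid[OF ab(2) zero_less_Suc, of N, folded g_def]
    define \<Delta> where "\<Delta> = (b - a) / Suc N"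
    define d where "d = \<rho> + L * \<Delta>"
    have \<Delta>: "0 < \<Delta>" using ab by (simp add: \<Delta>_def)
    have d0: "0 \<le> d" using \<rho>(1) L(1) \<Delta> by (simp add: d_def)
    have range: "a \<le> g k" "g k \<le> b" if "k \<le> Suc N" for k
      using grid_le[OF ug(1), of 0 k] grid_le[OF ug(1), of k "Suc N"] ug(2,3) that by auto
    have iH: "integrable P (\<lambda>\<omega>. indicator A \<omega> * (\<Delta> * H (g k) (\<omega> (g (Suc k)))))" if "k \<le> Suc N" for k
      using range[OF that] ab
      by (intro coordinate_fun_P(3)[OF continuous_on_mult_left[OF H_continuous_simplex] AP]) auto
    have "j \<le> Suc N \<Longrightarrow> E (\<lambda>\<omega>. Val a (\<omega> a)) \<le>
        (\<Sum>k<j. E (\<lambda>\<omega>. \<Delta> * H (g k) (\<omega> (g (Suc k))))) + j * (\<Delta> * d) + E (\<lambda>\<omega>. Val (g j) (\<omega> (g j)))" for j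
    proof (induction j)
      case 0
      then show ?case by (simp add: ug(2))
    next
      case (Suc j)
      have j: "j \<le> Suc N" "Suc j \<le> Suc N" using Suc.prems by auto
      have st: "g (Suc j) - g j = \<Delta>" by (simp add: ug(4) \<Delta>_def)
      have "E (\<lambda>\<omega>. Val (g j) (\<omega> (g j))) \<le> (\<integral>\<omega>. indicator A \<omega> * ((g (Suc j) - g j) * H (g j) (\<omega> (g (Suc j)))) \<partial>P)
          + (g (Suc j) - g j) * d + E (\<lambda>\<omega>. Val (g (Suc j)) (\<omega> (g (Suc j))))"
        unfolding E_def
      proof (rule value_step)
        show "0 \<le> g j" "g (Suc j) \<le> T" using range[OF j(1)] range[OF j(2)] ab by auto
        show "g j < g (Suc j)" using st \<Delta> by simp
        show "A \<in> sets (path_filtration t0 T (g j))"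
          using A sets_path_filtration_mono[OF range(1)[OF j(1)]] by blast
        fix s i u v assume s: "s \<in> {g j..g (Suc j)}" and uv: "u \<in> U" "v \<in> V"
        have "\<bar>l i s u v - l i (g j) u v\<bar> \<le> \<rho> + L * (\<bar>s - g j\<bar> + norm (u - u) + norm (v - v))"
          using s uv range[OF j(1)] range[OF j(2)] ab by (intro L(2)) auto
        also have "\<dots> \<le> d" unfolding d_def using s st L(1) by (auto intro!: mult_left_mono)
        finally show "\<bar>l i s u v - l i (g j) u v\<bar> \<le> d" .
      qed (rule d0)
      then show ?case using Suc.IH[OF j(1)] unfolding st by (simp add: E_def algebra_simps)
    qed
    from this[of "Suc N"] have "E (\<lambda>\<omega>. Val a (\<omega> a)) \<le>
        (\<Sum>k<Suc N. E (\<lambda>\<omega>. \<Delta> * H (g k) (\<omega> (g (Suc k))))) + Suc N * (\<Delta> * d) + E (\<lambda>\<omega>. Val b (\<omega> b))"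
      by (simp only: ug(3) order_refl)
    moreover have "Suc N * (\<Delta> * d) = (b - a) * d" by (simp add: \<Delta>_def)
    moreover have "(\<Sum>k<Suc N. E (\<lambda>\<omega>. \<Delta> * H (g k) (\<omega> (g (Suc k))))) = E (S N)"
    proof -
      have "(\<Sum>k<Suc N. E (\<lambda>\<omega>. \<Delta> * H (g k) (\<omega> (g (Suc k))))) =
          (\<integral>\<omega>. (\<Sum>k<Suc N. indicator A \<omega> * (\<Delta> * H (g k) (\<omega> (g (Suc k))))) \<partial>P)"
        unfolding E_def by (rule Bochner_Integration.integral_sum[symmetric]) (use iH in auto)
      then show ?thesis by (simp only: E_def S_def g_def \<Delta>_def sum_distrib_left)
    qed
    ultimately show ?thesis by (simp add: d_def \<Delta>_def)
  qed
  have SB: "\<bar>S N \<omega>\<bar> \<le> (b - a) * C" if w: "\<omega> \<in> space P" for N \<omega>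
  proof -
    note ug = uniform_grid[OF ab(2) zero_less_Suc, of N]
    have "\<bar>S N \<omega>\<bar> \<le> (\<Sum>k<Suc N. ((b - a) / Suc N) * C)"
      unfolding S_def
    proof (intro order_trans[OF sum_abs] sum_mono)
      fix k assume "k \<in> {..<Suc N}"
      then have "uniform_grid a b (Suc N) k \<in> {0..T}"
        using grid_le[OF ug(1), of 0 k] grid_le[OF ug(1), of k "Suc N"] ug(2,3) ab by auto
      then have "\<bar>H (uniform_grid a b (Suc N) k) (\<omega> (uniform_grid a b (Suc N) (Suc k)))\<bar> \<le> C"
        by (rule H_simplex_bound[OF _ path_P(2)[OF w]])
      then show "\<bar>(b - a) / Suc N * H (uniform_grid a b (Suc N) k) (\<omega> (uniform_grid a b (Suc N) (Suc k)))\<bar> \<le> (b - a) / Suc N * C"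
        unfolding abs_mult using ab by (intro mult_mono) auto
    qed
    also have "\<dots> = (b - a) * C" by simp
    finally show ?thesis .
  qed
  have Sm: "S N \<in> borel_measurable P" for N
  proof -
    note ug = uniform_grid[OF ab(2) zero_less_Suc, of N]
    have r: "uniform_grid a b (Suc N) k \<in> {0..T}" if "k < Suc N" for k
      using grid_le[OF ug(1), of 0 k] grid_le[OF ug(1), of k "Suc N"] ug(2,3) ab that by auto
    show ?thesis unfolding S_def[abs_def]
      by (intro borel_measurable_sum borel_measurable_times borel_measurable_const coordinate_fun_P(1) H_continuous_simplex r) auto
  qed
  have lim: "(\<lambda>N. E (S N)) \<longlonglongrightarrow> E (path_cost a b)"
    unfolding E_def
  proof (rule integral_dominated_convergence[where w="\<lambda>_. (b - a) * C"])
    show "(\<lambda>\<omega>. indicator A \<omega> * path_cost a b \<omega>) \<in> borel_measurable P"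
      using AP path_cost_P(1)[OF ab] by (intro borel_measurable_times borel_measurable_indicator)
    show "(\<lambda>\<omega>. indicator A \<omega> * S N \<omega>) \<in> borel_measurable P" for N
      using AP Sm by (intro borel_measurable_times borel_measurable_indicator)
    show "integrable P (\<lambda>_. (b - a) * C)" by simp
    show "AE \<omega> in P. norm (indicator A \<omega> * S N \<omega>) \<le> (b - a) * C" for N
    proof (rule AE_I2)
      fix \<omega> assume "\<omega> \<in> space P"
      from SB[OF this, of N] show "norm (indicator A \<omega> * S N \<omega>) \<le> (b - a) * C"
        using ab C_pos by (simp add: indicator_def)
    qed
    show "AE \<omega> in P. (\<lambda>N. indicator A \<omega> * S N \<omega>) \<longlonglongrightarrow> indicator A \<omega> * path_cost a b \<omega>"
      unfolding S_def path_cost_def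
      by (intro AE_I2 tendsto_mult_left riemann_sums_path path_P ab)
  qed
  have "(\<lambda>N. (b - a) / real (Suc N)) \<longlonglongrightarrow> 0"
    using LIMSEQ_Suc[OF lim_const_over_n[of "b - a"]] by simp
  then have "(\<lambda>N. E (S N) + (b - a) * (\<rho> + L * ((b - a) / Suc N)) + E (\<lambda>\<omega>. Val b (\<omega> b)))
      \<longlonglongrightarrow> E (path_cost a b) + (b - a) * (\<rho> + L * 0) + E (\<lambda>\<omega>. Val b (\<omega> b))"
    by (intro tendsto_intros lim)
  then have "E (\<lambda>\<omega>. Val a (\<omega> a)) \<le> E (path_cost a b) + (b - a) * (\<rho> + L * 0) + E (\<lambda>\<omega>. Val b (\<omega> b))"
    by (rule LIMSEQ_le_const) (use key in blast)
  then show "(\<integral>\<omega>. indicator A \<omega> * Val a (\<omega> a) \<partial>P) \<le>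
    (\<integral>\<omega>. indicator A \<omega> * path_cost a b \<omega> \<partial>P) + (\<integral>\<omega>. indicator A \<omega> * Val b (\<omega> b) \<partial>P) + e"
    using \<rho>(2) by (simp add: E_def)
qed

end

end

section \<open>Consequences of optimality at fixed times\<close>

context random_game
begin

context
  fixes t0 :: real and p0 :: "real^'i" and P :: "(real \<Rightarrow> real^'i) measure"
  assumes t0: "0 \<le> t0" "t0 < T" and P: "P \<in> martingale_measures T t0 p0"
    and opt: "(\<integral>\<omega>. path_cost t0 T \<omega> \<partial>P) \<le> Val t0 p0"
begin

interpretation P: prob_space P by (rule P_prob[OF t0 P])

text \<open>The path may already have jumped away from \<open>p0\<close> at time \<open>t0\<close>;
  Jensen's inequality is applied between \<open>t0 - 1\<close> and \<open>t0\<close>.\<close>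

lemma initial_value_le: "Val t0 p0 \<le> (\<integral>\<omega>. Val t0 (\<omega> t0) \<partial>P)"
proof -
  have t: "t0 \<in> {0..T}" using t0 by simp
  have AE: "AE \<omega> in P. \<omega> (t0 - 1) = p0"
    using P unfolding martingale_measures_def by auto
  have "space P \<in> sets (path_filtration t0 T (t0 - 1))"
    using sets.top[of "path_filtration t0 T (t0 - 1)"] by (simp add: space_P[OF t0 P])
  from jensen[OF t0 P t _ this, of t0]
  have "(\<integral>\<omega>. indicator (space P) \<omega> * Val t0 (\<omega> (t0 - 1)) \<partial>P) \<le> (\<integral>\<omega>. indicator (space P) \<omega> * Val t0 (\<omega> t0) \<partial>P)"
    by simp
  moreover have "(\<integral>\<omega>. indicator (space P) \<omega> * f \<omega> \<partial>P) = (\<integral>\<omega>. f \<omega> \<partial>P)" for f :: "_ \<Rightarrow> real"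
    by (rule Bochner_Integration.integral_cong) auto
  moreover have "(\<integral>\<omega>. Val t0 (\<omega> (t0 - 1)) \<partial>P) = (\<integral>\<omega>. Val t0 p0 \<partial>P)"
    using AE by (intro integral_cong_AE coordinate_fun_P(1)[OF t0 P Val_continuous[OF t]]) auto
  ultimately show ?thesis by (simp add: P.prob_space)
qed

lemma whole_space_filtration: "space P \<in> sets (path_filtration t0 T s)"
  using sets.top[of "path_filtration t0 T s"] by (simp add: space_P[OF t0 P])

lemma integral_space: "(\<integral>\<omega>. indicator (space P) \<omega> * f \<omega> \<partial>P) = (\<integral>\<omega>. f \<omega> \<partial>P)" for f :: "_ \<Rightarrow> real"
  by (rule Bochner_Integration.integral_cong) auto

text \<open>Optimality leaves no slack in total. Subtracting the submartingale inequality up to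
  \<open>s\<close> from it gives the reverse inequality for the remaining time.\<close>

lemma optimal_value_expectation:
  assumes s: "t0 \<le> s" "s < T"
  shows "(\<integral>\<omega>. path_cost s T \<omega> \<partial>P) \<le> (\<integral>\<omega>. Val s (\<omega> s) \<partial>P)"
proof (cases "s = t0")
  case True
  then show ?thesis using opt initial_value_le by simp
next
  case False
  then have ts: "t0 < s" using s by simp
  have "Val t0 p0 \<le> (\<integral>\<omega>. path_cost t0 s \<omega> \<partial>P) + (\<integral>\<omega>. Val s (\<omega> s) \<partial>P)"
    using initial_value_le value_submartingale[OF t0 P t0(1) ts _ whole_space_filtration] s
    by (simp add: integral_space)
  moreover have "(\<integral>\<omega>. path_cost t0 T \<omega> \<partial>P) = (\<integral>\<omega>. path_cost t0 s \<omega> + path_cost s T \<omega> \<partial>P)"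
    using t0 s by (intro Bochner_Integration.integral_cong refl path_cost_add path_P[OF t0 P]) auto
  moreover have "\<dots> = (\<integral>\<omega>. path_cost t0 s \<omega> \<partial>P) + (\<integral>\<omega>. path_cost s T \<omega> \<partial>P)"
    using t0 s ts by (intro Bochner_Integration.integral_add path_cost_P(3)[OF t0 P]) auto
  ultimately show ?thesis using opt by linarith
qed

text \<open>The submartingale inequality holds on \<open>A\<close> and on its complement, and the
  reverse one holds for the sum; hence equality on each.\<close>

lemma value_to_end:
  assumes s: "t0 \<le> s" "s < T" and A: "A \<in> sets (path_filtration t0 T s)"
  shows "(\<integral>\<omega>. indicator A \<omega> * Val s (\<omega> s) \<partial>P) = (\<integral>\<omega>. indicator A \<omega> * path_cost s T \<omega> \<partial>P)"
proof -
  have s0: "0 \<le> s" "s \<in> {0..T}" using s t0 by auto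
  have le: "(\<integral>\<omega>. indicator B \<omega> * Val s (\<omega> s) \<partial>P) \<le> (\<integral>\<omega>. indicator B \<omega> * path_cost s T \<omega> \<partial>P)"
    if "B \<in> sets (path_filtration t0 T s)" for B
    using value_submartingale[OF t0 P s0(1) s(2) order_refl that] by simp
  define B where "B = space P - A"
  have B: "B \<in> sets (path_filtration t0 T s)"
    unfolding B_def using A whole_space_filtration by (rule sets.Diff[rotated])
  have AP: "A \<in> sets P" "B \<in> sets P" using A B filtration_sets_P[OF t0 P] by auto
  have ind: "f \<omega> = indicator A \<omega> * f \<omega> + indicator B \<omega> * f \<omega>" if "\<omega> \<in> space P" for f :: "_ \<Rightarrow> real" and \<omega>
    using that by (simp add: B_def indicator_def)
  have split: "(\<integral>\<omega>. f \<omega> \<partial>P) = (\<integral>\<omega>. indicator A \<omega> * f \<omega> \<partial>P) + (\<integral>\<omega>. indicator B \<omega> * f \<omega> \<partial>P)"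
    if f: "integrable P f" for f :: "_ \<Rightarrow> real"
  proof -
    have "(\<integral>\<omega>. f \<omega> \<partial>P) = (\<integral>\<omega>. indicator A \<omega> * f \<omega> + indicator B \<omega> * f \<omega> \<partial>P)"
      by (rule Bochner_Integration.integral_cong[OF refl ind])
    also have "\<dots> = (\<integral>\<omega>. indicator A \<omega> * f \<omega> \<partial>P) + (\<integral>\<omega>. indicator B \<omega> * f \<omega> \<partial>P)"
      using integrable_mult_indicator[OF AP(1) f] integrable_mult_indicator[OF AP(2) f]
      by (intro Bochner_Integration.integral_add) simp_all
    finally show ?thesis .
  qed
  have "(\<integral>\<omega>. path_cost s T \<omega> \<partial>P) \<le> (\<integral>\<omega>. Val s (\<omega> s) \<partial>P)" by (rule optimal_value_expectation[OF s])
  then show ?thesis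
    using le[OF A] le[OF B] split[OF path_cost_P(3)[OF t0 P s0(1) s(2) order_refl]]
      split[OF coordinate_fun_P(2)[OF t0 P Val_continuous[OF s0(2)], of s]] by linarith
qed

text \<open>Compare \<open>value_to_end\<close> at both times on the same event and cancel the cost
  after \<open>b\<close>.\<close>

lemma value_martingale:
  assumes ab: "t0 \<le> a" "a < b" "b \<le> T" and A: "A \<in> sets (path_filtration t0 T a)"
  shows "(\<integral>\<omega>. indicator A \<omega> * Val a (\<omega> a) \<partial>P) =
    (\<integral>\<omega>. indicator A \<omega> * path_cost a b \<omega> \<partial>P) + (\<integral>\<omega>. indicator A \<omega> * Val b (\<omega> b) \<partial>P)"
proof (cases "b = T")
  case True
  then show ?thesis using value_to_end[OF ab(1) _ A] ab by simp
next
  case False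
  then have bT: "b < T" using ab by simp
  have AP: "A \<in> sets P" by (rule filtration_sets_P[OF t0 P A])
  have Ab: "A \<in> sets (path_filtration t0 T b)" using A sets_path_filtration_mono[of a b] ab by auto
  have a0: "0 \<le> a" "0 \<le> b" using ab t0 by auto
  have "(\<integral>\<omega>. indicator A \<omega> * path_cost a T \<omega> \<partial>P) = (\<integral>\<omega>. indicator A \<omega> * path_cost a b \<omega> + indicator A \<omega> * path_cost b T \<omega> \<partial>P)"
  proof (rule Bochner_Integration.integral_cong[OF refl])
    fix \<omega> assume "\<omega> \<in> space P"
    then have "path_cost a T \<omega> = path_cost a b \<omega> + path_cost b T \<omega>"
      using ab a0 by (intro path_cost_add path_P[OF t0 P]) auto
    then show "indicator A \<omega> * path_cost a T \<omega> = indicator A \<omega> * path_cost a b \<omega> + indicator A \<omega> * path_cost b T \<omega>"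
      by (simp add: distrib_left)
  qed
  also have "\<dots> = (\<integral>\<omega>. indicator A \<omega> * path_cost a b \<omega> \<partial>P) + (\<integral>\<omega>. indicator A \<omega> * path_cost b T \<omega> \<partial>P)"
    using ab bT a0 by (intro Bochner_Integration.integral_add path_cost_P(4)[OF t0 P _ _ _ AP]) auto
  finally show ?thesis
    using value_to_end[OF ab(1) _ A] value_to_end[OF _ bT Ab] ab by simp
qed

text \<open>Let \<open>A\<close> be the excluded event. The martingale property, Jensen's inequality
  at time \<open>s + h\<close> and the growth assumption show that cost plus \<open>h * c\<close>
  has nonpositive mean on \<open>A\<close>. After division by \<open>h\<close>, right-continuity
  gives the limit \<open>H + c\<close>, which is positive on \<open>A\<close>, so \<open>A\<close>
  is null.\<close>

lemma no_fast_growth_at_fixed_time: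
  assumes s: "t0 \<le> s" "s < T" and e: "0 < e"
    and growth: "\<And>h p. 0 < h \<Longrightarrow> h < e \<Longrightarrow> s + h \<le> T \<Longrightarrow> p \<in> ball q e \<Longrightarrow> p \<in> prob_simplex \<Longrightarrow>
      h * c \<le> Val (s + h) p - Val s p"
  shows "AE \<omega> in P. \<not> (\<omega> s \<in> ball q e \<and> - H s (\<omega> s) < c)"
proof -
  have s0: "0 \<le> s" "s \<in> {0..T}" using s t0 by auto
  define A where "A = {\<omega> \<in> paths t0 T. \<omega> s \<in> ball q e \<and> - H s (\<omega> s) < c}"
  have AF: "A \<in> sets (path_filtration t0 T s)"
  proof -
    have 1: "(\<lambda>\<omega>. \<omega> s) \<in> borel_measurable (path_filtration t0 T s)" by (rule coordinate_measurable_filtration[OF order_refl])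
    have 2: "(\<lambda>\<omega>. H s (\<omega> s)) \<in> borel_measurable (path_filtration t0 T s)"
      by (rule simplex_continuous_measurable[OF 1 _ H_continuous_simplex[OF s0(2)]]) (auto simp: paths_def)
    have "A = ((\<lambda>\<omega>. \<omega> s) -` ball q e \<inter> space (path_filtration t0 T s)) \<inter>
        ((\<lambda>\<omega>. H s (\<omega> s)) -` {- c<..} \<inter> space (path_filtration t0 T s))"
      by (auto simp: A_def)
    also have "\<dots> \<in> sets (path_filtration t0 T s)"
      by (intro sets.Int measurable_sets[OF 1] measurable_sets[OF 2]) auto
    finally show ?thesis .
  qed
  have AP: "A \<in> sets P" by (rule filtration_sets_P[OF t0 P AF])
  \<comment> \<open>Denominators from 2 on keep the steps strictly below \<open>e\<close> and
    \<open>T - s\<close>.\<close>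
  define h where "h n = min e (T - s) / real (Suc (Suc n))" for n
  have m: "0 < min e (T - s)" using e s by simp
  have h: "0 < h n" "h n < e" "s + h n \<le> T" for n
  proof -
    have "h n < min e (T - s)"
    proof -
      have "M / real (Suc (Suc n)) < M" if "0 < M" for M using that by (simp add: divide_less_eq)
      from this[OF m] show ?thesis unfolding h_def .
    qed
    then show "0 < h n" "h n < e" "s + h n \<le> T" using m by (auto simp: h_def)
  qed
  have h0: "h \<longlonglongrightarrow> 0"
    unfolding h_def[abs_def] using LIMSEQ_Suc[OF LIMSEQ_Suc[OF lim_const_over_n[of "min e (T - s)"]]] by simp
  have neg: "(\<integral>\<omega>. indicator A \<omega> * (path_cost s (s + h n) \<omega> / h n + c) \<partial>P) \<le> 0" for n
  proof -
    have sh: "s < s + h n" "s + h n \<le> T" "s + h n \<in> {0..T}" using h[of n] s0 by auto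
    have iC: "integrable P (\<lambda>\<omega>. indicator A \<omega> * path_cost s (s + h n) \<omega>)"
      by (rule path_cost_P(4)[OF t0 P s0(1) sh(1,2) AP])
    have iV: "integrable P (\<lambda>\<omega>. indicator A \<omega> * Val r (\<omega> u))" if "r \<in> {0..T}" for r u
      by (rule coordinate_fun_P(3)[OF t0 P Val_continuous[OF that] AP])
    have iA: "integrable P (\<lambda>\<omega>. indicator A \<omega> * (h n * c))"
      using AP by (intro integrable_mult_left integrable_real_indicator) (auto simp: P.emeasure_eq_measure)
    have "(\<integral>\<omega>. indicator A \<omega> * Val s (\<omega> s) \<partial>P) =
      (\<integral>\<omega>. indicator A \<omega> * path_cost s (s + h n) \<omega> \<partial>P) + (\<integral>\<omega>. indicator A \<omega> * Val (s + h n) (\<omega> (s + h n)) \<partial>P)"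
      by (rule value_martingale[OF s(1) sh(1,2) AF])
    moreover have "(\<integral>\<omega>. indicator A \<omega> * Val (s + h n) (\<omega> s) \<partial>P) \<le> (\<integral>\<omega>. indicator A \<omega> * Val (s + h n) (\<omega> (s + h n)) \<partial>P)"
      using sh by (intro jensen[OF t0 P sh(3) _ AF]) auto
    moreover have "(\<integral>\<omega>. indicator A \<omega> * (h n * c) + indicator A \<omega> * Val s (\<omega> s) \<partial>P) \<le> (\<integral>\<omega>. indicator A \<omega> * Val (s + h n) (\<omega> s) \<partial>P)"
    proof (rule integral_mono)
      fix \<omega> assume w: "\<omega> \<in> space P"
      have "h n * c + Val s (\<omega> s) \<le> Val (s + h n) (\<omega> s)" if "\<omega> \<in> A"
        using growth[OF h(1,2,3)[of n], of "\<omega> s"] that path_P(2)[OF t0 P w] by (simp add: A_def)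
      then show "indicator A \<omega> * (h n * c) + indicator A \<omega> * Val s (\<omega> s) \<le> indicator A \<omega> * Val (s + h n) (\<omega> s)"
        by (simp add: indicator_def)
    qed (use iA iV s0 sh in auto)
    moreover have "(\<integral>\<omega>. indicator A \<omega> * (h n * c) + indicator A \<omega> * Val s (\<omega> s) \<partial>P) =
        (\<integral>\<omega>. indicator A \<omega> * (h n * c) \<partial>P) + (\<integral>\<omega>. indicator A \<omega> * Val s (\<omega> s) \<partial>P)"
      by (rule Bochner_Integration.integral_add[OF iA iV[OF s0(2)]])
    ultimately have "(\<integral>\<omega>. indicator A \<omega> * path_cost s (s + h n) \<omega> \<partial>P) + (\<integral>\<omega>. indicator A \<omega> * (h n * c) \<partial>P) \<le> 0"
      by linarith
    then have le: "(\<integral>\<omega>. indicator A \<omega> * path_cost s (s + h n) \<omega> + indicator A \<omega> * (h n * c) \<partial>P) \<le> 0"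
      using Bochner_Integration.integral_add[OF iC iA] by simp
    have "indicator A \<omega> * path_cost s (s + h n) \<omega> + indicator A \<omega> * (h n * c) =
        h n * (indicator A \<omega> * (path_cost s (s + h n) \<omega> / h n + c))" for \<omega>
      using h(1)[of n] by (simp add: field_simps)
    then have "h n * (\<integral>\<omega>. indicator A \<omega> * (path_cost s (s + h n) \<omega> / h n + c) \<partial>P) \<le> 0"
      using le by (simp only: Bochner_Integration.integral_mult_right_zero)
    then show ?thesis using h(1)[of n] by (simp add: mult_le_0_iff)
  qed
  have lim: "(\<lambda>n. \<integral>\<omega>. indicator A \<omega> * (path_cost s (s + h n) \<omega> / h n + c) \<partial>P)
      \<longlonglongrightarrow> (\<integral>\<omega>. indicator A \<omega> * (H s (\<omega> s) + c) \<partial>P)"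
  proof (rule integral_dominated_convergence[where w="\<lambda>_. C + \<bar>c\<bar>"])
    show "(\<lambda>\<omega>. indicator A \<omega> * (H s (\<omega> s) + c)) \<in> borel_measurable P"
      using AP by (intro borel_measurable_times borel_measurable_indicator borel_measurable_add borel_measurable_const
          coordinate_fun_P(1)[OF t0 P H_continuous_simplex[OF s0(2)]])
    show "(\<lambda>\<omega>. indicator A \<omega> * (path_cost s (s + h n) \<omega> / h n + c)) \<in> borel_measurable P" for n
      using AP h[of n] s0 by (intro borel_measurable_times borel_measurable_indicator borel_measurable_add borel_measurable_const
          borel_measurable_divide path_cost_P(1)[OF t0 P]) auto
    show "integrable P (\<lambda>_. C + \<bar>c\<bar>)" by simp
    show "AE \<omega> in P. norm (indicator A \<omega> * (path_cost s (s + h n) \<omega> / h n + c)) \<le> C + \<bar>c\<bar>" for n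
    proof (rule AE_I2)
      fix \<omega> assume w: "\<omega> \<in> space P"
      have "\<bar>path_cost s (s + h n) \<omega>\<bar> \<le> (s + h n - s) * C"
        using h[of n] s0 by (intro path_cost_P(2)[OF t0 P _ _ _ w]) auto
      then have "\<bar>path_cost s (s + h n) \<omega> / h n\<bar> \<le> C" using h(1)[of n] by (simp add: abs_divide divide_le_eq mult.commute)
      then have "\<bar>path_cost s (s + h n) \<omega> / h n + c\<bar> \<le> C + \<bar>c\<bar>" by linarith
      then show "norm (indicator A \<omega> * (path_cost s (s + h n) \<omega> / h n + c)) \<le> C + \<bar>c\<bar>"
        using C_pos by (simp add: indicator_def)
    qed
    show "AE \<omega> in P. (\<lambda>n. indicator A \<omega> * (path_cost s (s + h n) \<omega> / h n + c)) \<longlonglongrightarrow> indicator A \<omega> * (H s (\<omega> s) + c)"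
    proof (rule AE_I2)
      fix \<omega> assume w: "\<omega> \<in> space P"
      note cad = path_P[OF t0 P w]
      have "(\<lambda>n. path_cost s (s + h n) \<omega> / h n) \<longlonglongrightarrow> H s (\<omega> s)"
      proof (rule LIMSEQ_I)
        fix \<epsilon> :: real assume \<epsilon>: "0 < \<epsilon>"
        have right: "(\<omega> \<longlongrightarrow> \<omega> s) (at_right s)" using cad(1) by (simp add: cadlag_def)
        have "((\<lambda>r. (r, \<omega> r)) \<longlongrightarrow> (s, \<omega> s)) (at_right s)"
          by (intro tendsto_Pair tendsto_ident_at right)
        moreover have "\<forall>\<^sub>F r in at_right s. (r, \<omega> r) \<in> {0..T} \<times> prob_simplex"
        proof -
          have "\<forall>\<^sub>F r in at_right s. r \<in> {s<..<T}" using s by (intro eventually_at_right_real)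
          then show ?thesis by eventually_elim (use s0 cad(2) in auto)
        qed
        ultimately have "((\<lambda>r. (\<lambda>(t, p). H t p) (r, \<omega> r)) \<longlongrightarrow> (\<lambda>(t, p). H t p) (s, \<omega> s)) (at_right s)"
          using s0 cad(2) by (intro continuous_on_tendsto_compose[OF H_continuous]) auto
        then have "\<forall>\<^sub>F r in at_right s. dist (H r (\<omega> r)) (H s (\<omega> s)) < \<epsilon> / 2"
          using \<epsilon> by (intro tendstoD) auto
        then obtain b where b: "s < b" "\<And>r. s < r \<Longrightarrow> r < b \<Longrightarrow> dist (H r (\<omega> r)) (H s (\<omega> s)) < \<epsilon> / 2"
          by (auto simp: eventually_at_right_field)
        have "\<forall>\<^sub>F n in sequentially. h n < b - s" using h0 b(1) by (intro order_tendstoD(2)) auto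
        then obtain N where N: "\<And>n. N \<le> n \<Longrightarrow> h n < b - s" by (auto simp: eventually_sequentially)
        show "\<exists>no. \<forall>n\<ge>no. norm (path_cost s (s + h n) \<omega> / h n - H s (\<omega> s)) < \<epsilon>"
        proof (intro exI[of _ N] allI impI)
          fix n assume n: "N \<le> n"
          have "\<bar>path_cost s (s + h n) \<omega> - (s + h n - s) * H s (\<omega> s)\<bar> \<le> (s + h n - s) * (\<epsilon> / 2)"
          proof (rule path_cost_bound[OF cad])
            fix r assume r: "s \<le> r" "r < s + h n"
            show "\<bar>H r (\<omega> r) - H s (\<omega> s)\<bar> \<le> \<epsilon> / 2"
            proof (cases "r = s")
              case False
              then show ?thesis using b(2)[of r] r N[OF n] by (simp add: dist_real_def)
            qed (use \<epsilon> in simp)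
          qed (use h[of n] s0 in auto)
          then have "\<bar>path_cost s (s + h n) \<omega> - h n * H s (\<omega> s)\<bar> / h n \<le> \<epsilon> / 2"
            using h(1)[of n] by (simp add: divide_le_eq mult.commute)
          moreover have "path_cost s (s + h n) \<omega> / h n - H s (\<omega> s) = (path_cost s (s + h n) \<omega> - h n * H s (\<omega> s)) / h n"
            using h(1)[of n] by (simp add: field_simps)
          then have "norm (path_cost s (s + h n) \<omega> / h n - H s (\<omega> s)) = \<bar>path_cost s (s + h n) \<omega> - h n * H s (\<omega> s)\<bar> / h n"
            using h(1)[of n] by (simp add: abs_divide)
          ultimately show "norm (path_cost s (s + h n) \<omega> / h n - H s (\<omega> s)) < \<epsilon>"
            using \<epsilon> by linarith
        qed
      qed
      then show "(\<lambda>n. indicator A \<omega> * (path_cost s (s + h n) \<omega> / h n + c)) \<longlonglongrightarrow> indicator A \<omega> * (H s (\<omega> s) + c)"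
        by (intro tendsto_intros)
    qed
  qed
  have le0: "(\<integral>\<omega>. indicator A \<omega> * (H s (\<omega> s) + c) \<partial>P) \<le> 0"
    by (rule LIMSEQ_le_const2[OF lim]) (use neg in blast)
  have iA: "integrable P (\<lambda>\<omega>. indicator A \<omega> * (H s (\<omega> s) + c))"
    by (rule coordinate_fun_P(3)[OF t0 P continuous_on_add[OF H_continuous_simplex[OF s0(2)] continuous_on_const] AP])
  have nn: "AE \<omega> in P. 0 \<le> indicator A \<omega> * (H s (\<omega> s) + c)"
    by (intro AE_I2) (auto simp: indicator_def A_def)
  have "0 \<le> (\<integral>\<omega>. indicator A \<omega> * (H s (\<omega> s) + c) \<partial>P)" using nn by (rule integral_nonneg_AE)
  then have "AE \<omega> in P. indicator A \<omega> * (H s (\<omega> s) + c) = 0"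
    using le0 integral_nonneg_eq_0_iff_AE[OF iA nn] by simp
  then show ?thesis
    using AE_space
  proof eventually_elim
    case (elim \<omega>)
    then show ?case by (auto simp: A_def space_P[OF t0 P] indicator_def split: if_splits)
  qed
qed

end

end

section \<open>Paths stay in the non-revealing set\<close>

context random_game
begin

text \<open>\<open>Val_step\<close> bounds the difference quotient below by \<open>- H\<close> up to
  a small error, uniformly near \<open>p\<close>. A point therefore leaves the set only through
  quotients that are too large.\<close>

lemma nonrevealing_lower_bound:
  assumes t: "t \<in> {0..<T}" and p: "p \<in> prob_simplex"
  shows "ereal (- H t p) \<le> Liminf (at_right 0 \<times>\<^sub>F inf (nhds p) (principal prob_simplex))
       (\<lambda>(h, p'). ereal ((Val (t + h) p' - Val t p') / h))"
  unfolding le_Liminf_iff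
proof (intro allI impI)
  fix y assume y: "y < ereal (- H t p)"
  have tT: "t \<in> {0..T}" using t by simp
  obtain c where c: "y < ereal c" "c < - H t p" using ereal_dense2[OF y] by auto
  define \<epsilon> where "\<epsilon> = (- H t p - c) / 3"
  have \<epsilon>: "0 < \<epsilon>" "- H t p - 2 * \<epsilon> > c" using c(2) by (auto simp: \<epsilon>_def field_simps)
  obtain L where L: "0 \<le> L"
    "\<And>i s s' u u' v v'. s \<in> {0..T} \<Longrightarrow> s' \<in> {0..T} \<Longrightarrow> u \<in> U \<Longrightarrow> u' \<in> U \<Longrightarrow> v \<in> V \<Longrightarrow> v' \<in> V
      \<Longrightarrow> \<bar>l i s u v - l i s' u' v'\<bar> \<le> \<epsilon> / 2 + L * (\<bar>s - s'\<bar> + norm (u - u') + norm (v - v'))"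
    using l_modulus[of "\<epsilon> / 2"] \<epsilon>(1) by auto
  define \<eta> where "\<eta> = min (T - t) (\<epsilon> / (2 * (L + 1)))"
  have \<eta>: "0 < \<eta>" "\<eta> \<le> T - t" using t \<epsilon> L by (auto simp: \<eta>_def)
  have "L * \<eta> \<le> L * (\<epsilon> / (2 * (L + 1)))" using L(1) by (intro mult_left_mono) (simp_all add: \<eta>_def)
  also have "\<dots> \<le> \<epsilon> / 2" using L(1) \<epsilon>(1) by (simp add: field_simps)
  finally have L\<eta>: "L * \<eta> \<le> \<epsilon> / 2" .
  have cont: "\<forall>\<^sub>F p' in at p within prob_simplex. dist (H t p') (H t p) < \<epsilon>"
    using H_continuous_simplex[OF tT] p \<epsilon>(1) by (auto simp: continuous_on_def intro: tendstoD)
  have 1: "\<forall>\<^sub>F h in at_right 0. h \<in> {0<..<\<eta>}" using \<eta>(1) by (rule eventually_at_right_real)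
  have 2: "\<forall>\<^sub>F p' in inf (nhds p) (principal prob_simplex). p' \<in> prob_simplex \<and> H t p' < H t p + \<epsilon>"
    unfolding eventually_inf_principal
    using cont unfolding eventually_at_filter
  proof eventually_elim
    case (elim p')
    then show ?case using \<epsilon>(1) by (cases "p' = p") (auto simp: dist_real_def abs_less_iff)
  qed
  show "\<forall>\<^sub>F x in at_right 0 \<times>\<^sub>F inf (nhds p) (principal prob_simplex).
      y < (case x of (h, p') \<Rightarrow> ereal ((Val (t + h) p' - Val t p') / h))"
    unfolding eventually_prod_filter
  proof (intro exI conjI allI impI)
    show "\<forall>\<^sub>F h in at_right 0. h \<in> {0<..<\<eta>}" by (rule 1)
    show "\<forall>\<^sub>F p' in inf (nhds p) (principal prob_simplex). p' \<in> prob_simplex \<and> H t p' < H t p + \<epsilon>" by (rule 2)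
    fix h :: real and p' :: "real^'i"
    assume h: "h \<in> {0<..<\<eta>}" and p': "p' \<in> prob_simplex \<and> H t p' < H t p + \<epsilon>"
    have "Val t p' \<le> (t + h - t) * (H t p' + \<epsilon>) + Val (t + h) p'"
    proof (rule Val_step)
      fix s i u v assume s: "s \<in> {t..t + h}" and uv: "u \<in> U" "v \<in> V"
      have "\<bar>l i s u v - l i t u v\<bar> \<le> \<epsilon> / 2 + L * (\<bar>s - t\<bar> + norm (u - u) + norm (v - v))"
        using s uv t h \<eta>(2) by (intro L(2)) auto
      also have "L * (\<bar>s - t\<bar> + norm (u - u) + norm (v - v)) \<le> L * \<eta>"
        using s h L(1) by (intro mult_left_mono) auto
      finally show "\<bar>l i s u v - l i t u v\<bar> \<le> \<epsilon>" using L\<eta> by simp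
    qed (use t h \<eta> p' in auto)
    then have "- (H t p' + \<epsilon>) \<le> (Val (t + h) p' - Val t p') / h"
      using h by (simp add: field_simps)
    moreover have "c < - (H t p' + \<epsilon>)" using p' \<epsilon>(2) by simp
    ultimately have "ereal c < ereal ((Val (t + h) p' - Val t p') / h)" by simp
    then show "y < (case (h, p') of (h, p') \<Rightarrow> ereal ((Val (t + h) p' - Val t p') / h))"
      using c(1) by (simp only: case_prod_conv)
  qed
qed

text \<open>Failure of the non-revealing property with explicit parameters: a centre, a radius and a
  rate. Countably many triples will cover all failures, while for each triple the set of times is
  arbitrary.\<close>

definition fast_times :: "real \<Rightarrow> real^'i \<Rightarrow> real \<Rightarrow> real \<Rightarrow> real set" where
  "fast_times t0 q e c = {s\<in>{t0..<T}. \<forall>h p. 0 < h \<longrightarrow> h < e \<longrightarrow> s + h \<le> T \<longrightarrow> p \<in> ball q e \<longrightarrow>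
     p \<in> prob_simplex \<longrightarrow> h * c \<le> Val (s + h) p - Val s p}"

text \<open>If the lower limit exceeds \<open>- H\<close>, a rational rate \<open>c\<close> fits
  strictly between, and the quotients exceed it on a whole neighbourhood; this is recorded by a
  centre in the dense set \<open>D\<close> and a radius \<open>1 / Suc n\<close>.\<close>

lemma nonrevealing_or_fast:
  assumes t: "t \<in> {t0..<T}" "0 \<le> t0" and p: "p \<in> prob_simplex"
    and D: "\<And>X :: (real^'i) set. open X \<Longrightarrow> X \<noteq> {} \<Longrightarrow> \<exists>q\<in>D. q \<in> X"
    and nf: "\<And>q n c. q \<in> D \<Longrightarrow> c \<in> \<rat> \<Longrightarrow> t \<in> fast_times t0 q (1 / real (Suc n)) c \<Longrightarrow> p \<in> ball q (1 / real (Suc n)) \<Longrightarrow> c \<le> - H t p"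
  shows "(t, p) \<in> nonrevealing_set \<E> T U V l"
proof -
  define F where "F = at_right (0::real) \<times>\<^sub>F inf (nhds p) (principal prob_simplex)"
  define f where "f = (\<lambda>(h, p'). ereal ((Val (t + h) p' - Val t p') / h))"
  have tT: "t \<in> {0..<T}" using t by simp
  have "Liminf F f \<le> ereal (- H t p)"
  proof (rule ccontr)
    assume "\<not> Liminf F f \<le> ereal (- H t p)"
    then have "ereal (- H t p) < Liminf F f" by simp
    from ereal_dense3[OF this] obtain x :: rat
      where x: "ereal (- H t p) < ereal (real_of_rat x)" "ereal (real_of_rat x) < Liminf F f" by (elim exE conjE)
    define c where "c = real_of_rat x"
    have c: "c \<in> \<rat>" "- H t p < c" "ereal c < Liminf F f" using x by (simp_all add: c_def)
    from less_LiminfD[OF c(3)] have "\<forall>\<^sub>F x in F. ereal c < f x" .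
    then obtain Q1 Q2 where Q: "eventually Q1 (at_right 0)" "eventually Q2 (inf (nhds p) (principal prob_simplex))"
      "\<And>h p'. Q1 h \<Longrightarrow> Q2 p' \<Longrightarrow> ereal c < f (h, p')"
      unfolding F_def eventually_prod_filter by blast
    obtain b where b: "0 < b" "\<And>h. 0 < h \<Longrightarrow> h < b \<Longrightarrow> Q1 h" using Q(1) by (auto simp: eventually_at_right_field)
    obtain d where d: "0 < d" "\<And>p'. dist p' p < d \<Longrightarrow> p' \<in> prob_simplex \<Longrightarrow> Q2 p'"
      using Q(2) unfolding eventually_inf_principal eventually_nhds_metric by blast
    \<comment> \<open>Half of \<open>d\<close>, because the centre moves from \<open>p\<close> to a
      nearby \<open>q\<close> and the ball around \<open>q\<close> must stay in the neighbourhood of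
      \<open>p\<close>.\<close>
    obtain n where n: "1 / real (Suc n) < min b (d / 2)" using b(1) d(1) nat_approx_posE[of "min b (d / 2)"] by auto
    define e where "e = 1 / real (Suc n)"
    have e: "0 < e" "e < b" "2 * e < d" using n by (auto simp: e_def)
    obtain q where q: "q \<in> D" "q \<in> ball p e" using D[of "ball p e"] e(1) by auto
    have "t \<in> fast_times t0 q e c"
      unfolding fast_times_def
    proof (intro CollectI conjI allI impI t(1))
      fix h p' assume h: "0 < h" "h < e" and p': "p' \<in> ball q e" "p' \<in> prob_simplex"
      have "dist p' p < d" using dist_triangle[of p' p q] p'(1) q(2) e(3) by (simp add: dist_commute)
      then have "ereal c < f (h, p')" using Q(3) b(2) d(2) h e(2) p'(2) by simp
      then have "c < (Val (t + h) p' - Val t p') / h" by (simp add: f_def)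
      then show "h * c \<le> Val (t + h) p' - Val t p'" using h(1) by (simp add: field_simps)
    qed
    then have "c \<le> - H t p" using nf[OF q(1) c(1), of n] q(2) by (simp add: e_def dist_commute)
    then show False using c(2) by simp
  qed
  moreover have "ereal (- H t p) \<le> Liminf F f"
    unfolding F_def f_def by (rule nonrevealing_lower_bound[OF tT p])
  ultimately have "Liminf F f = ereal (- H t p)" by simp
  then show ?thesis using tT p by (simp add: nonrevealing_set_def F_def f_def)
qed

context
  fixes t0 :: real and p0 :: "real^'i" and P :: "(real \<Rightarrow> real^'i) measure"
  assumes t0: "0 \<le> t0" "t0 < T" and P: "P \<in> martingale_measures T t0 p0"
    and opt: "(\<integral>\<omega>. path_cost t0 T \<omega> \<partial>P) \<le> Val t0 p0"
begin

interpretation P: prob_space P by (rule P_prob[OF t0 P])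

text \<open>Null sets are excluded at countably many times, right-dense in each set of fast times.
  If a path were at a bad point at a fast time \<open>t\<close>, right-continuity would keep it near
  the same centre, with \<open>- H\<close> below \<open>c\<close>, for a while, and one of the
  selected fast times would fall into this period.\<close>

theorem optimal_nonrevealing: "AE \<omega> in P. \<forall>s\<in>{t0..<T}. (s, \<omega> s) \<in> nonrevealing_set \<E> T U V l"
proof -
  obtain D :: "(real^'i) set" where D: "countable D" "\<And>X. open X \<Longrightarrow> X \<noteq> {} \<Longrightarrow> \<exists>q\<in>D. q \<in> X"
    using countable_dense_setE by blast
  have "\<exists>S. countable S \<and> S \<subseteq> A \<and> (\<forall>s\<in>A. \<forall>e>0. \<exists>d\<in>S. s \<le> d \<and> d < s + e)" for A :: "real set"
    by (rule right_dense_countable_subset[of A]) blast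
  then obtain S where S: "\<And>A. countable (S A)" "\<And>A. S A \<subseteq> A"
    "\<And>A s e. s \<in> A \<Longrightarrow> 0 < e \<Longrightarrow> \<exists>d\<in>S A. s \<le> d \<and> d < s + (e::real)"
    by metis
  have "AE \<omega> in P. \<forall>q\<in>D. \<forall>n::nat. \<forall>c\<in>\<rat>. \<forall>s\<in>S (fast_times t0 q (1 / real (Suc n)) c).
      \<not> (\<omega> s \<in> ball q (1 / real (Suc n)) \<and> - H s (\<omega> s) < c)"
  proof (intro AE_ball_countable[THEN iffD2] AE_all_countable[THEN iffD2] D(1) countable_rat S(1) ballI allI)
    fix q n c s assume "s \<in> S (fast_times t0 q (1 / real (Suc n)) c)"
    then have "s \<in> fast_times t0 q (1 / real (Suc n)) c" using S(2) by blast
    then show "AE \<omega> in P. \<not> (\<omega> s \<in> ball q (1 / real (Suc n)) \<and> - H s (\<omega> s) < c)"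
      unfolding fast_times_def by (intro no_fast_growth_at_fixed_time[OF t0 P opt]) auto
  qed
  then show ?thesis
    using AE_space
  proof eventually_elim
    case (elim \<omega>)
    note cad = path_P[OF t0 P elim(2)]
    show ?case
    proof
      fix t assume t: "t \<in> {t0..<T}"
      show "(t, \<omega> t) \<in> nonrevealing_set \<E> T U V l"
      proof (rule nonrevealing_or_fast[OF t t0(1) cad(2) D(2)])
        fix q n c
        assume q: "q \<in> D" and c: "c \<in> \<rat>" and fast: "t \<in> fast_times t0 q (1 / real (Suc n)) c"
          and ball: "\<omega> t \<in> ball q (1 / real (Suc n))"
        show "c \<le> - H t (\<omega> t)"
        proof (rule ccontr)
          assume "\<not> c \<le> - H t (\<omega> t)"
          then have lt: "- H t (\<omega> t) < c" by simp
          have right: "(\<omega> \<longlongrightarrow> \<omega> t) (at_right t)" using cad(1) by (simp add: cadlag_def)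
          have tT: "t \<in> {0..T}" using t t0 by auto
          have "((\<lambda>r. (r, \<omega> r)) \<longlongrightarrow> (t, \<omega> t)) (at_right t)" by (intro tendsto_Pair tendsto_ident_at right)
          moreover have "\<forall>\<^sub>F r in at_right t. (r, \<omega> r) \<in> {0..T} \<times> prob_simplex"
          proof -
            have "\<forall>\<^sub>F r in at_right t. r \<in> {t<..<T}" using t by (intro eventually_at_right_real) auto
            then show ?thesis by eventually_elim (use tT cad(2) in auto)
          qed
          ultimately have "((\<lambda>r. (\<lambda>(t, p). H t p) (r, \<omega> r)) \<longlongrightarrow> (\<lambda>(t, p). H t p) (t, \<omega> t)) (at_right t)"
            using tT cad(2) by (intro continuous_on_tendsto_compose[OF H_continuous]) auto
          then have "((\<lambda>r. - H r (\<omega> r)) \<longlongrightarrow> - H t (\<omega> t)) (at_right t)" by (intro tendsto_minus) simp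
          then have "\<forall>\<^sub>F r in at_right t. - H r (\<omega> r) < c" using lt by (rule order_tendstoD(2))
          moreover have "\<forall>\<^sub>F r in at_right t. \<omega> r \<in> ball q (1 / real (Suc n))"
            by (rule topological_tendstoD[OF right open_ball ball])
          ultimately have "\<forall>\<^sub>F r in at_right t. \<omega> r \<in> ball q (1 / real (Suc n)) \<and> - H r (\<omega> r) < c"
            by eventually_elim blast
          then obtain b where b: "t < b" "\<And>r. t < r \<Longrightarrow> r < b \<Longrightarrow> \<omega> r \<in> ball q (1 / real (Suc n)) \<and> - H r (\<omega> r) < c"
            by (auto simp: eventually_at_right_field)
          obtain d where d: "d \<in> S (fast_times t0 q (1 / real (Suc n)) c)" "t \<le> d" "d < t + (b - t)"
            using S(3)[OF fast, of "b - t"] b(1) by auto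
          have "\<omega> d \<in> ball q (1 / real (Suc n)) \<and> - H d (\<omega> d) < c"
          proof (cases "d = t")
            case False
            then show ?thesis using b(2)[of d] d by simp
          qed (use ball lt in simp)
          then show False using elim(1) q c d(1) by blast
        qed
      qed
    qed
  qed
qed

end

end

section \<open>Left limits and the jump relation\<close>

context random_game
begin

context
  fixes t0 :: real and p0 :: "real^'i" and P :: "(real \<Rightarrow> real^'i) measure" and s :: real
  assumes t0: "0 \<le> t0" "t0 < T" and P: "P \<in> martingale_measures T t0 p0"
    and s: "t0 < s" "s \<le> T"
begin

interpretation P: prob_space P by (rule P_prob[OF t0 P])

text \<open>Denominators from 2 on keep all these times strictly between \<open>t0\<close> and
  \<open>s\<close>.\<close>

definition left_times :: "nat \<Rightarrow> real" where
  "left_times n = s - (s - t0) / real (Suc (Suc n))"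

definition left_state :: "(real \<Rightarrow> real^'i) \<Rightarrow> real^'i" where
  "left_state \<omega> = Lim (at_left s) \<omega>"

lemma left_times: "t0 < left_times n" "left_times n < s" "left_times \<longlonglongrightarrow> s"
proof -
  have "(s - t0) / real (Suc (Suc n)) < s - t0" "0 < (s - t0) / real (Suc (Suc n))"
    using s by (auto simp: divide_less_eq)
  then show "t0 < left_times n" "left_times n < s" by (auto simp: left_times_def)
  have "(\<lambda>n. s - (s - t0) / real (Suc (Suc n))) \<longlonglongrightarrow> s - 0"
    using LIMSEQ_Suc[OF LIMSEQ_Suc[OF lim_const_over_n[of "s - t0"]]] by (intro tendsto_diff tendsto_const) simp
  then show "left_times \<longlonglongrightarrow> s" by (simp add: left_times_def[abs_def])
qed

lemma left_state_tendsto: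
  assumes "\<omega> \<in> space P" shows "(\<lambda>n. \<omega> (left_times n)) \<longlonglongrightarrow> left_state \<omega>"
proof -
  obtain x where x: "(\<omega> \<longlongrightarrow> x) (at_left s)" using path_P(1)[OF t0 P assms] by (auto simp: cadlag_def)
  then have "left_state \<omega> = x"
    unfolding left_state_def by (intro tendsto_Lim) (auto simp: trivial_limit_at_left_real)
  moreover have "filterlim left_times (at_left s) sequentially"
    unfolding filterlim_at
  proof (intro conjI left_times(3) always_eventually allI)
    fix n show "left_times n \<in> {..<s}" "left_times n \<noteq> s" using left_times(2)[of n] by auto
  qed
  ultimately show ?thesis using filterlim_compose[OF x] by blast
qed

lemma left_state_measurable: "left_state \<in> borel_measurable P"
  by (rule borel_measurable_LIMSEQ_metric[OF coordinate_P[OF t0 P] left_state_tendsto])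

lemma left_state_simplex: "\<omega> \<in> space P \<Longrightarrow> left_state \<omega> \<in> prob_simplex"
  using closed_sequentially[OF compact_imp_closed[OF compact_prob_simplex] _ left_state_tendsto] path_P(2)[OF t0 P] by blast

lemma bounded_limit:
  fixes f :: "nat \<Rightarrow> (real \<Rightarrow> real^'i) \<Rightarrow> real"
  assumes "\<And>n. f n \<in> borel_measurable P" "\<And>n \<omega>. \<omega> \<in> space P \<Longrightarrow> \<bar>f n \<omega>\<bar> \<le> B"
    "\<And>\<omega>. \<omega> \<in> space P \<Longrightarrow> (\<lambda>n. f n \<omega>) \<longlonglongrightarrow> g \<omega>"
  shows "(\<lambda>n. \<integral>\<omega>. f n \<omega> \<partial>P) \<longlonglongrightarrow> (\<integral>\<omega>. g \<omega> \<partial>P)"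
proof (rule integral_dominated_convergence[where w="\<lambda>_. B"])
  show "g \<in> borel_measurable P" by (rule borel_measurable_LIMSEQ_real[OF assms(3,1)])
qed (use assms in \<open>auto intro!: AE_I2\<close>)

lemma component_bound:
  assumes "\<bar>x\<bar> \<le> 1" "p \<in> prob_simplex" shows "\<bar>x * p $ i\<bar> \<le> 1"
  using mult_mono[of "\<bar>x\<bar>" 1 "\<bar>p $ i\<bar>" 1] assms prob_simplex_component[of p i] by (auto simp: abs_mult)

lemma vec_component_measurable:
  fixes X :: "'a \<Rightarrow> real^'i"
  assumes "X \<in> borel_measurable M" shows "(\<lambda>\<omega>. X \<omega> $ i) \<in> borel_measurable M"
  by (rule measurable_compose[OF assms vec_nth_borel_measurable])

text \<open>The martingale property at times increasing to \<open>s\<close> passes to the limit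
  because both the state and a continuous function of it converge. Closed sets and then all Borel
  functions follow.\<close>

lemma left_state_martingale_continuous:
  fixes f :: "real^'i \<Rightarrow> real"
  assumes f: "continuous_on UNIV f" "\<And>x. \<bar>f x\<bar> \<le> 1"
  shows "(\<integral>\<omega>. f (left_state \<omega>) * \<omega> s $ i \<partial>P) = (\<integral>\<omega>. f (left_state \<omega>) * left_state \<omega> $ i \<partial>P)"
proof -
  have fm: "f \<in> borel_measurable borel" by (rule borel_measurable_continuous_onI[OF f(1)])
  have fl: "(\<lambda>n. f (\<omega> (left_times n))) \<longlonglongrightarrow> f (left_state \<omega>)" if "\<omega> \<in> space P" for \<omega>
    by (rule continuous_on_tendsto_compose[OF f(1) left_state_tendsto[OF that]]) auto
  have "(\<lambda>n. \<integral>\<omega>. f (\<omega> (left_times n)) * \<omega> s $ i \<partial>P) \<longlonglongrightarrow> (\<integral>\<omega>. f (left_state \<omega>) * \<omega> s $ i \<partial>P)"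
  proof (rule bounded_limit[where B=1])
    show "(\<lambda>\<omega>. f (\<omega> (left_times n)) * \<omega> s $ i) \<in> borel_measurable P" for n
      by (intro borel_measurable_times vec_component_measurable measurable_compose[OF _ fm] coordinate_P[OF t0 P])
    show "\<bar>f (\<omega> (left_times n)) * \<omega> s $ i\<bar> \<le> 1" if "\<omega> \<in> space P" for n \<omega>
      by (rule component_bound[OF f(2) path_P(2)[OF t0 P that]])
    show "(\<lambda>n. f (\<omega> (left_times n)) * \<omega> s $ i) \<longlonglongrightarrow> f (left_state \<omega>) * \<omega> s $ i" if "\<omega> \<in> space P" for \<omega>
      by (intro tendsto_mult_right fl that)
  qed
  moreover have "(\<integral>\<omega>. f (\<omega> (left_times n)) * \<omega> s $ i \<partial>P) = (\<integral>\<omega>. f (\<omega> (left_times n)) * \<omega> (left_times n) $ i \<partial>P)" for n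
    using left_times(2)[of n] f(2)
    by (intro martingale_mult[OF t0 P, where B=1] measurable_compose[OF coordinate_measurable_filtration[OF order_refl] fm]) auto
  moreover have "(\<lambda>n. \<integral>\<omega>. f (\<omega> (left_times n)) * \<omega> (left_times n) $ i \<partial>P) \<longlonglongrightarrow> (\<integral>\<omega>. f (left_state \<omega>) * left_state \<omega> $ i \<partial>P)"
  proof (rule bounded_limit[where B=1])
    show "(\<lambda>\<omega>. f (\<omega> (left_times n)) * \<omega> (left_times n) $ i) \<in> borel_measurable P" for n
      by (intro borel_measurable_times vec_component_measurable measurable_compose[OF _ fm] coordinate_P[OF t0 P])
    show "\<bar>f (\<omega> (left_times n)) * \<omega> (left_times n) $ i\<bar> \<le> 1" if "\<omega> \<in> space P" for n \<omega>
      by (rule component_bound[OF f(2) path_P(2)[OF t0 P that]])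
    show "(\<lambda>n. f (\<omega> (left_times n)) * \<omega> (left_times n) $ i) \<longlonglongrightarrow> f (left_state \<omega>) * left_state \<omega> $ i" if "\<omega> \<in> space P" for \<omega>
      by (intro tendsto_mult tendsto_vec_nth fl left_state_tendsto that)
  qed
  ultimately show ?thesis using LIMSEQ_unique by simp
qed

lemma left_state_martingale_closed:
  assumes Z: "closed Z"
  shows "(\<integral>\<omega>. indicator Z (left_state \<omega>) * \<omega> s $ i \<partial>P) = (\<integral>\<omega>. indicator Z (left_state \<omega>) * left_state \<omega> $ i \<partial>P)"
proof (cases "Z = {}")
  case False
  \<comment> \<open>Continuous functions decreasing to the indicator of \<open>Z\<close>. The empty
    set is treated apart, as \<open>infdist\<close> to it is 0 by convention.\<close>
  define f where "f n x = max 0 (1 - real n * infdist x Z)" for n and x :: "real^'i"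
  have f: "continuous_on UNIV (f n)" "\<And>x. \<bar>f n x\<bar> \<le> 1" for n
  proof -
    show "continuous_on UNIV (f n)" unfolding f_def[abs_def] by (intro continuous_intros)
    have "0 \<le> real n * infdist x Z" for x by (intro mult_nonneg_nonneg infdist_nonneg) simp
    then show "\<And>x. \<bar>f n x\<bar> \<le> 1" by (simp add: f_def max_def)
  qed
  have lim: "(\<lambda>n. f n x) \<longlonglongrightarrow> indicator Z x" for x
  proof (cases "x \<in> Z")
    case True
    then show ?thesis by (simp add: f_def)
  next
    case False
    then have pos: "0 < infdist x Z"
      using in_closed_iff_infdist_zero[OF Z \<open>Z \<noteq> {}\<close>, of x] infdist_nonneg[of x Z] by auto
    obtain N :: nat where N: "1 / infdist x Z < real N" using reals_Archimedean2 by blast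
    have "f n x = 0" if "N \<le> n" for n
    proof -
      have "1 \<le> real N * infdist x Z" using N pos by (simp add: divide_less_eq)
      also have "\<dots> \<le> real n * infdist x Z" using that pos by (intro mult_right_mono) auto
      finally show ?thesis by (simp add: f_def)
    qed
    then have "\<forall>\<^sub>F n in sequentially. f n x = 0" unfolding eventually_sequentially by blast
    then show ?thesis using False by (simp add: tendsto_eventually)
  qed
  have fm: "f n \<in> borel_measurable borel" for n by (rule borel_measurable_continuous_onI[OF f(1)])
  have "(\<lambda>n. \<integral>\<omega>. f n (left_state \<omega>) * \<omega> s $ i \<partial>P) \<longlonglongrightarrow> (\<integral>\<omega>. indicator Z (left_state \<omega>) * \<omega> s $ i \<partial>P)"
  proof (rule bounded_limit[where B=1])
    show "(\<lambda>\<omega>. f n (left_state \<omega>) * \<omega> s $ i) \<in> borel_measurable P" for n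
      by (intro borel_measurable_times vec_component_measurable measurable_compose[OF left_state_measurable fm] coordinate_P[OF t0 P])
    show "\<bar>f n (left_state \<omega>) * \<omega> s $ i\<bar> \<le> 1" if "\<omega> \<in> space P" for n \<omega>
      by (rule component_bound[OF f(2) path_P(2)[OF t0 P that]])
  qed (intro tendsto_mult_right lim)
  moreover have "(\<lambda>n. \<integral>\<omega>. f n (left_state \<omega>) * left_state \<omega> $ i \<partial>P) \<longlonglongrightarrow> (\<integral>\<omega>. indicator Z (left_state \<omega>) * left_state \<omega> $ i \<partial>P)"
  proof (rule bounded_limit[where B=1])
    show "(\<lambda>\<omega>. f n (left_state \<omega>) * left_state \<omega> $ i) \<in> borel_measurable P" for n
      by (intro borel_measurable_times vec_component_measurable measurable_compose[OF left_state_measurable fm] left_state_measurable)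
    show "\<bar>f n (left_state \<omega>) * left_state \<omega> $ i\<bar> \<le> 1" if "\<omega> \<in> space P" for n \<omega>
      by (rule component_bound[OF f(2) left_state_simplex[OF that]])
  qed (intro tendsto_mult_right lim)
  ultimately show ?thesis
    unfolding left_state_martingale_continuous[OF f] by (rule LIMSEQ_unique)
qed simp

text \<open>The conditional mean of the state given its left limit is the left limit. Components are
  nonnegative, so each side defines a finite measure on states; these agree on closed sets, a
  generator stable under intersection, and therefore integrate every Borel function alike.\<close>

lemma left_state_martingale:
  fixes g :: "real^'i \<Rightarrow> real"
  assumes g: "g \<in> borel_measurable borel"
  shows "(\<integral>\<omega>. g (left_state \<omega>) * \<omega> s $ i \<partial>P) = (\<integral>\<omega>. g (left_state \<omega>) * left_state \<omega> $ i \<partial>P)"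
proof -
  define \<mu> where "\<mu> a = distr (density P (\<lambda>\<omega>. ennreal (a \<omega>))) borel left_state" for a :: "(real \<Rightarrow> real^'i) \<Rightarrow> real"
  define a1 a2 where "a1 = (\<lambda>\<omega>::real \<Rightarrow> real^'i. \<omega> s $ i)" and "a2 = (\<lambda>\<omega>. left_state \<omega> $ i)"
  have am: "a1 \<in> borel_measurable P" "a2 \<in> borel_measurable P"
    unfolding a1_def a2_def by (intro vec_component_measurable coordinate_P[OF t0 P] left_state_measurable)+
  have a01: "0 \<le> a \<omega> \<and> a \<omega> \<le> 1" if "a = a1 \<or> a = a2" "\<omega> \<in> space P" for a \<omega>
    using prob_simplex_component[OF path_P(2)[OF t0 P that(2)]] prob_simplex_component[OF left_state_simplex[OF that(2)]] that(1)
    by (auto simp: a1_def a2_def)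
  have em: "emeasure (\<mu> a) Z = ennreal (\<integral>\<omega>. indicator Z (left_state \<omega>) * a \<omega> \<partial>P)"
    if a: "a = a1 \<or> a = a2" and Z: "Z \<in> sets borel" for a Z
  proof -
    have m: "a \<in> borel_measurable P" using am a by blast
    have pre: "left_state -` Z \<inter> space P \<in> sets P" by (rule measurable_sets[OF left_state_measurable Z])
    have im: "(\<lambda>\<omega>. indicator Z (left_state \<omega>) :: real) \<in> borel_measurable P"
      by (rule measurable_compose[OF left_state_measurable borel_measurable_indicator[OF Z]])
    have "emeasure (\<mu> a) Z = emeasure (density P (\<lambda>\<omega>. ennreal (a \<omega>))) (left_state -` Z \<inter> space P)"
      unfolding \<mu>_def using left_state_measurable Z by (subst emeasure_distr) auto
    also have "\<dots> = (\<integral>\<^sup>+\<omega>. ennreal (a \<omega>) * indicator (left_state -` Z \<inter> space P) \<omega> \<partial>P)"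
      using m pre by (intro emeasure_density) auto
    also have "\<dots> = (\<integral>\<^sup>+\<omega>. ennreal (indicator Z (left_state \<omega>) * a \<omega>) \<partial>P)"
      by (intro nn_integral_cong) (auto simp: indicator_def)
    also have "\<dots> = ennreal (\<integral>\<omega>. indicator Z (left_state \<omega>) * a \<omega> \<partial>P)"
    proof (rule nn_integral_eq_integral)
      show "integrable P (\<lambda>\<omega>. indicator Z (left_state \<omega>) * a \<omega>)"
        using a01[OF a] by (intro integrable_P[OF t0 P, where B=1] borel_measurable_times im m) (auto simp: indicator_def)
      show "AE \<omega> in P. 0 \<le> indicator Z (left_state \<omega>) * a \<omega>"
        using a01[OF a] by (intro AE_I2) (auto simp: indicator_def)
    qed
    finally show ?thesis .
  qed
  have "\<mu> a1 = \<mu> a2"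
  proof (rule measure_eqI_generator_eq[where E="{Z. closed Z}" and \<Omega>=UNIV and A="\<lambda>_. UNIV"])
    show "Int_stable {Z :: (real^'i) set. closed Z}" by (auto simp: Int_stable_def)
    show "sets (\<mu> a1) = sigma_sets UNIV {Z. closed Z}" "sets (\<mu> a2) = sigma_sets UNIV {Z. closed Z}"
      unfolding \<mu>_def by (simp_all add: borel_eq_closed)
    show "emeasure (\<mu> a1) Z = emeasure (\<mu> a2) Z" if "Z \<in> {Z. closed Z}" for Z
    proof -
      have Z: "closed Z" using that by simp
      have Zb: "Z \<in> sets borel" using Z by (rule borel_closed)
      have "(\<integral>\<omega>. indicator Z (left_state \<omega>) * a1 \<omega> \<partial>P) = (\<integral>\<omega>. indicator Z (left_state \<omega>) * a2 \<omega> \<partial>P)"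
        unfolding a1_def a2_def by (rule left_state_martingale_closed[OF Z])
      then show ?thesis using em[OF _ Zb, of a1] em[OF _ Zb, of a2] by simp
    qed
    show "emeasure (\<mu> a1) UNIV \<noteq> \<infinity>" using em[of a1 UNIV] by simp
  qed auto
  moreover have "integral\<^sup>L (\<mu> a) g = (\<integral>\<omega>. g (left_state \<omega>) * a \<omega> \<partial>P)" if a: "a = a1 \<or> a = a2" for a
  proof -
    have m: "a \<in> borel_measurable P" using am a by blast
    have "integral\<^sup>L (\<mu> a) g = (\<integral>\<omega>. g (left_state \<omega>) \<partial>density P (\<lambda>\<omega>. ennreal (a \<omega>)))"
      unfolding \<mu>_def using left_state_measurable g by (intro integral_distr) auto
    also have "\<dots> = (\<integral>\<omega>. a \<omega> *\<^sub>R g (left_state \<omega>) \<partial>P)"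
      using a01[OF a] by (intro integral_density measurable_compose[OF left_state_measurable g] m AE_I2) auto
    finally show ?thesis by (simp add: mult.commute)
  qed
  ultimately have "(\<integral>\<omega>. g (left_state \<omega>) * a1 \<omega> \<partial>P) = (\<integral>\<omega>. g (left_state \<omega>) * a2 \<omega> \<partial>P)" by metis
  then show ?thesis by (simp add: a1_def a2_def)
qed

lemma left_value_le:
  assumes opt: "(\<integral>\<omega>. path_cost t0 T \<omega> \<partial>P) \<le> Val t0 p0"
  shows "(\<integral>\<omega>. Val s (\<omega> s) \<partial>P) \<le> (\<integral>\<omega>. Val s (left_state \<omega>) \<partial>P)"
proof -
  have sT: "s \<in> {0..T}" using s t0 by simp
  have rT: "0 \<le> left_times n" "left_times n \<in> {0..T}" "t0 \<le> left_times n" for n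
    using left_times(1,2)[of n] s t0 by auto
  \<comment> \<open>In \<open>4 * C\<close>, one \<open>C\<close> bounds the running cost, one the
    Hamiltonian, and two the oscillation of the payoffs in \<open>Val_step\<close>.\<close>
  have key: "(\<integral>\<omega>. Val s (\<omega> s) \<partial>P) \<le> (\<integral>\<omega>. Val s (\<omega> (left_times n)) \<partial>P) + (s - left_times n) * (4 * C)" for n
  proof -
    define r where "r = left_times n"
    have r: "0 \<le> r" "r < s" "r \<in> {0..T}" "t0 \<le> r" using rT[of n] left_times(2)[of n] by (auto simp: r_def)
    have iV: "integrable P (\<lambda>\<omega>. Val u (\<omega> v))" if "u \<in> {0..T}" for u v
      by (rule coordinate_fun_P(2)[OF t0 P Val_continuous[OF that]])
    have "(\<integral>\<omega>. Val r (\<omega> r) \<partial>P) = (\<integral>\<omega>. path_cost r s \<omega> \<partial>P) + (\<integral>\<omega>. Val s (\<omega> s) \<partial>P)"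
      using value_martingale[OF t0 P opt r(4,2) s(2) whole_space_filtration[OF t0 P opt]]
      by (simp add: integral_space[OF t0 P opt])
    moreover have "(\<integral>\<omega>. Val r (\<omega> r) \<partial>P) \<le> (\<integral>\<omega>. (s - r) * (3 * C) + Val s (\<omega> r) \<partial>P)"
    proof (rule integral_mono)
      fix \<omega> assume w: "\<omega> \<in> space P"
      have "Val r (\<omega> r) \<le> (s - r) * (H r (\<omega> r) + 2 * C) + Val s (\<omega> r)"
      proof (rule Val_step[OF r(1,2) s(2) path_P(2)[OF t0 P w]])
        fix x i u v assume x: "x \<in> {r..s}" and uv: "u \<in> U" "v \<in> V"
        have "\<bar>l i x u v\<bar> \<le> C" "\<bar>l i r u v\<bar> \<le> C" using x r s uv by (auto intro!: l_bound)
        then show "\<bar>l i x u v - l i r u v\<bar> \<le> 2 * C" by linarith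
      qed
      also have "(s - r) * (H r (\<omega> r) + 2 * C) \<le> (s - r) * (3 * C)"
        using H_simplex_bound[OF r(3) path_P(2)[OF t0 P w], of r] r(2) by (intro mult_left_mono) (auto simp: abs_le_iff)
      finally show "Val r (\<omega> r) \<le> (s - r) * (3 * C) + Val s (\<omega> r)" by simp
    qed (use iV sT r in auto)
    moreover have "(\<integral>\<omega>. (s - r) * (3 * C) + Val s (\<omega> r) \<partial>P) = (s - r) * (3 * C) + (\<integral>\<omega>. Val s (\<omega> r) \<partial>P)"
      using iV[OF sT] by (simp add: P.prob_space)
    moreover have "\<bar>\<integral>\<omega>. path_cost r s \<omega> \<partial>P\<bar> \<le> (s - r) * C"
      using r C_pos by (intro prob_integral_abs_le P.prob_space_axioms path_cost_P(2)[OF t0 P r(1,2) s(2)]) auto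
    ultimately show ?thesis by (simp add: r_def[symmetric] abs_le_iff algebra_simps)
  qed
  have Vc: "continuous_on prob_simplex (Val s)" by (rule Val_continuous[OF sT])
  obtain B where B: "0 \<le> B" "\<And>p. p \<in> prob_simplex \<Longrightarrow> \<bar>Val s p\<bar> \<le> B" using continuous_simplex_bounded[OF Vc] by blast
  have "(\<lambda>n. \<integral>\<omega>. Val s (\<omega> (left_times n)) \<partial>P) \<longlonglongrightarrow> (\<integral>\<omega>. Val s (left_state \<omega>) \<partial>P)"
  proof (rule bounded_limit)
    show "(\<lambda>\<omega>. Val s (\<omega> (left_times n))) \<in> borel_measurable P" for n by (rule coordinate_fun_P(1)[OF t0 P Vc])
    show "\<bar>Val s (\<omega> (left_times n))\<bar> \<le> B" if "\<omega> \<in> space P" for n \<omega> by (rule B(2)[OF path_P(2)[OF t0 P that]])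
    show "(\<lambda>n. Val s (\<omega> (left_times n))) \<longlonglongrightarrow> Val s (left_state \<omega>)" if w: "\<omega> \<in> space P" for \<omega>
      using path_P(2)[OF t0 P w] left_state_simplex[OF w]
      by (intro continuous_on_tendsto_compose[OF Vc left_state_tendsto[OF w]]) auto
  qed
  then have "(\<lambda>n. (\<integral>\<omega>. Val s (\<omega> (left_times n)) \<partial>P) + (s - left_times n) * (4 * C))
      \<longlonglongrightarrow> (\<integral>\<omega>. Val s (left_state \<omega>) \<partial>P) + (s - s) * (4 * C)"
    by (intro tendsto_intros left_times(3))
  then have "(\<integral>\<omega>. Val s (\<omega> s) \<partial>P) \<le> (\<integral>\<omega>. Val s (left_state \<omega>) \<partial>P) + (s - s) * (4 * C)"
    by (rule LIMSEQ_le_const) (use key in blast)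
  then show ?thesis by simp
qed

theorem optimal_jumps:
  assumes opt: "(\<integral>\<omega>. path_cost t0 T \<omega> \<partial>P) \<le> Val t0 p0"
  shows "\<exists>\<xi>\<in>borel_measurable P.
       (AE \<omega> in P. \<xi> \<omega> \<in> simplex_subdifferential (Val s) (left_state \<omega>)) \<and>
       (AE \<omega> in P. Val s (\<omega> s) - Val s (left_state \<omega>) - \<xi> \<omega> \<bullet> (\<omega> s - left_state \<omega>) = 0)"
proof -
  have sT: "s \<in> {0..T}" using s t0 by simp
  note sel = Val_convex[OF sT] Val_Lipschitz[OF sT] Lipschitz_const_nonneg
  define \<zeta> where "\<zeta> = minimal_subgradient (Val s) (C * T * CARD('i))"
  have \<zeta>: "\<zeta> \<in> borel_measurable borel" "\<And>p. norm (\<zeta> p) \<le> C * T * CARD('i)"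
    "\<And>p. p \<in> prob_simplex \<Longrightarrow> \<zeta> p \<in> simplex_subdifferential (Val s) p"
    unfolding \<zeta>_def using minimal_subgradient_measurable[OF sel] minimal_subgradient_norm[OF sel]
      minimal_subgradient_subdifferential[OF sel] by blast+
  define \<xi> where "\<xi> \<omega> = \<zeta> (left_state \<omega>)" for \<omega>
  have \<xi>m: "\<xi> \<in> borel_measurable P"
    unfolding \<xi>_def[abs_def] by (rule measurable_compose[OF left_state_measurable \<zeta>(1)])
  have \<xi>s: "\<xi> \<omega> \<in> simplex_subdifferential (Val s) (left_state \<omega>)" if "\<omega> \<in> space P" for \<omega>
    unfolding \<xi>_def by (rule \<zeta>(3)[OF left_state_simplex[OF that]])
  have Vc: "continuous_on prob_simplex (Val s)" by (rule Val_continuous[OF sT])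
  obtain B where B: "0 \<le> B" "\<And>p. p \<in> prob_simplex \<Longrightarrow> \<bar>Val s p\<bar> \<le> B" using continuous_simplex_bounded[OF Vc] by blast
  have iV: "integrable P (\<lambda>\<omega>. Val s (\<omega> s))" by (rule coordinate_fun_P(2)[OF t0 P Vc])
  have iY: "integrable P (\<lambda>\<omega>. Val s (left_state \<omega>))"
    by (rule integrable_P[OF t0 P simplex_continuous_measurable[OF left_state_measurable left_state_simplex Vc], where B=B])
      (use B(2)[OF left_state_simplex] in auto)
  have iZ: "integrable P (\<lambda>\<omega>. \<zeta> (left_state \<omega>) $ i * X \<omega> $ i)"
    if X: "X \<in> borel_measurable P" "\<And>\<omega>. \<omega> \<in> space P \<Longrightarrow> X \<omega> \<in> prob_simplex" for X i
  proof (rule integrable_P[OF t0 P, where B="C * T * CARD('i)"])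
    show "(\<lambda>\<omega>. \<zeta> (left_state \<omega>) $ i * X \<omega> $ i) \<in> borel_measurable P"
      by (intro borel_measurable_times vec_component_measurable X(1) measurable_compose[OF left_state_measurable \<zeta>(1)])
    fix \<omega> assume w: "\<omega> \<in> space P"
    have "\<bar>\<zeta> (left_state \<omega>) $ i\<bar> * \<bar>X \<omega> $ i\<bar> \<le> C * T * CARD('i) * 1"
      using order_trans[OF component_le_norm_cart \<zeta>(2)] prob_simplex_component[OF X(2)[OF w], of i]
      by (intro mult_mono Lipschitz_const_nonneg) auto
    then show "\<bar>\<zeta> (left_state \<omega>) $ i * X \<omega> $ i\<bar> \<le> C * T * CARD('i)" by (simp add: abs_mult)
  qed
  define X where "X \<omega> = \<omega> s" for \<omega> :: "real \<Rightarrow> real^'i"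
  have X: "X \<in> borel_measurable P" "\<And>\<omega>. \<omega> \<in> space P \<Longrightarrow> X \<omega> \<in> prob_simplex"
    unfolding X_def[abs_def] by (rule coordinate_P[OF t0 P], rule path_P(2)[OF t0 P])
  have iZs: "integrable P (\<lambda>\<omega>. \<zeta> (left_state \<omega>) $ i * \<omega> s $ i)" for i
    using iZ[OF X] unfolding X_def .
  have iZl: "integrable P (\<lambda>\<omega>. \<zeta> (left_state \<omega>) $ i * left_state \<omega> $ i)" for i
    by (rule iZ[OF left_state_measurable left_state_simplex])
  \<comment> \<open>The gap in the subgradient inequality. Written in components, its linear part
    has mean zero by \<open>left_state_martingale\<close>, so this nonnegative function has
    nonpositive mean.\<close>
  define D where "D \<omega> = Val s (\<omega> s) - Val s (left_state \<omega>) -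
    (\<Sum>i\<in>UNIV. \<zeta> (left_state \<omega>) $ i * \<omega> s $ i - \<zeta> (left_state \<omega>) $ i * left_state \<omega> $ i)" for \<omega>
  have D_eq: "D \<omega> = Val s (\<omega> s) - Val s (left_state \<omega>) - \<xi> \<omega> \<bullet> (\<omega> s - left_state \<omega>)" for \<omega>
    by (simp add: D_def \<xi>_def inner_vec_def right_diff_distrib)
  have iD: "integrable P D"
    unfolding D_def[abs_def] using iV iY iZs iZl by auto
  have nn: "AE \<omega> in P. 0 \<le> D \<omega>"
  proof (rule AE_I2)
    fix \<omega> assume w: "\<omega> \<in> space P"
    have "\<forall>q\<in>prob_simplex. Val s (left_state \<omega>) + \<xi> \<omega> \<bullet> (q - left_state \<omega>) \<le> Val s q"
      using \<xi>s[OF w] by (simp add: simplex_subdifferential_def)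
    from bspec[OF this path_P(2)[OF t0 P w, of s]] show "0 \<le> D \<omega>" unfolding D_eq by simp
  qed
  have "(\<integral>\<omega>. D \<omega> \<partial>P) = (\<integral>\<omega>. Val s (\<omega> s) \<partial>P) - (\<integral>\<omega>. Val s (left_state \<omega>) \<partial>P) -
      (\<Sum>i\<in>UNIV. (\<integral>\<omega>. \<zeta> (left_state \<omega>) $ i * \<omega> s $ i \<partial>P) - (\<integral>\<omega>. \<zeta> (left_state \<omega>) $ i * left_state \<omega> $ i \<partial>P))"
    unfolding D_def using iV iY iZs iZl by simp
  also have "(\<Sum>i\<in>UNIV. (\<integral>\<omega>. \<zeta> (left_state \<omega>) $ i * \<omega> s $ i \<partial>P) - (\<integral>\<omega>. \<zeta> (left_state \<omega>) $ i * left_state \<omega> $ i \<partial>P)) = 0"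
    using left_state_martingale[OF measurable_compose[OF \<zeta>(1) vec_nth_borel_measurable]] by simp
  finally have "(\<integral>\<omega>. D \<omega> \<partial>P) \<le> 0" using left_value_le[OF opt] by simp
  moreover have "0 \<le> (\<integral>\<omega>. D \<omega> \<partial>P)" using nn by (rule integral_nonneg_AE)
  ultimately have "AE \<omega> in P. D \<omega> = 0" using integral_nonneg_eq_0_iff_AE[OF iD nn] by simp
  then have "AE \<omega> in P. Val s (\<omega> s) - Val s (left_state \<omega>) - \<xi> \<omega> \<bullet> (\<omega> s - left_state \<omega>) = 0"
    unfolding D_eq .
  moreover have "AE \<omega> in P. \<xi> \<omega> \<in> simplex_subdifferential (Val s) (left_state \<omega>)"
    by (rule AE_I2) (rule \<xi>s)
  ultimately show ?thesis using \<xi>m by blast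
qed

end

end

theorem theorem3p9:
  fixes T t0 :: real
    and U :: "'u::euclidean_space set" and V :: "'v::euclidean_space set"
    and l :: "'i::finite \<Rightarrow> real \<Rightarrow> 'u \<Rightarrow> 'v \<Rightarrow> real"
    and \<E> :: "'w measure set"
    and p0 :: "real^'i"
    and P :: "(real \<Rightarrow> real^'i) measure"
  assumes "CARD('i) \<ge> 2" and "T > 0"
    and "compact U" and "U \<noteq> {}" and "compact V" and "V \<noteq> {}"
    and "\<And>i. continuous_on ({0..T} \<times> U \<times> V) (\<lambda>(t, u, v). l i t u v)"
    and "isaacs T U V l"
    and "randomization_class \<E>"
    and "t0 \<in> {0..<T}" and "p0 \<in> prob_simplex"
    and "optimal_measure T U V l t0 p0 P"
  shows "(AE \<omega> in P. \<forall>s\<in>{t0..<T}. (s, \<omega> s) \<in> nonrevealing_set \<E> T U V l) \<and>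
    (\<forall>s\<in>{t0<..T}. \<exists>\<xi> \<in> borel_measurable P.
       (AE \<omega> in P. \<xi> \<omega> \<in> simplex_subdifferential (game_value \<E> T U V l s) (Lim (at_left s) \<omega>)) \<and>
       (AE \<omega> in P. game_value \<E> T U V l s (\<omega> s) - game_value \<E> T U V l s (Lim (at_left s) \<omega>)
          - \<xi> \<omega> \<bullet> (\<omega> s - Lim (at_left s) \<omega>) = 0))"
proof -
  interpret random_game T U V l \<E>
    by unfold_locales (fact assms)+
  have P: "P \<in> martingale_measures T t0 p0" and
    cost: "martingale_cost T U V l t0 P = (INF Q\<in>martingale_measures T t0 p0. martingale_cost T U V l t0 Q)"
    using assms(12) by (auto simp: optimal_measure_def)
  have t0: "0 \<le> t0" "t0 < T" using assms(10) by auto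
  \<comment> \<open>The form in which optimality enters both conclusions.\<close>
  have opt: "(\<integral>\<omega>. path_cost t0 T \<omega> \<partial>P) \<le> Val t0 p0"
    using INF_martingale_cost_le_Val[OF assms(10,11)] cost by (simp add: martingale_cost_def path_cost_def)
  have "\<exists>\<xi>\<in>borel_measurable P.
      (AE \<omega> in P. \<xi> \<omega> \<in> simplex_subdifferential (Val s) (Lim (at_left s) \<omega>)) \<and>
      (AE \<omega> in P. Val s (\<omega> s) - Val s (Lim (at_left s) \<omega>) - \<xi> \<omega> \<bullet> (\<omega> s - Lim (at_left s) \<omega>) = 0)"
    if "s \<in> {t0<..T}" for s
  proof -
    have s: "t0 < s" "s \<le> T" using that by auto
    show ?thesis using optimal_jumps[OF t0 P s opt] unfolding left_state_def[OF t0 P s] .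
  qed
  then show ?thesis using optimal_nonrevealing[OF t0 P opt] by simp
qed

end
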